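(* Suppose that $f,g$ satisfy the following conditions. 1. $g:K\to\mathbb{R}$ is $\mathcal{K}$-measurable and $\mathbb{E}^{t,x}|g(X_T)|^2<\infty$ for every $(t,x)\in[0,T]\times K$. 2. (i) For every $s\in[0,T]$, $x\in K$, $r\in\mathbb{R}$, $f(s,x,r,\cdot)$ is a mapping $L^2(K,\mathcal{K},\nu(s,x,dy))\to\mathbb{R}$; (ii) for every bounded $\mathcal{K}$-measurable $z:K\to\mathbb{R}$ the mapping $(s,x,r)\mapsto f(s,x,r,z(\cdot))$ is $\mathcal{B}([0,T])\otimes\mathcal{K}\otimes\mathcal{B}(\mathbb{R})$-measurable; (iii) there exist $L,L'\ge 0$ such that for all $s\in[0,T]$, $x\in K$, $r,r'\in\mathbb{R}$, $z,z'\in L^2(K,\mathcal{K},\nu(s,x,dy))$, $$|f(s,x,r,z(\cdot))-f(s,x,r',z'(\cdot))|\le L'|r-r'|+L\Big(\int_K|z(y)-z'(y)|^2\,\nu(s,x,dy)\Big)^{1/2};$$ (iv) $\mathbb{E}^{t,x}\int_t^T|f(s,X_s,0,0)|^2\,ds<\infty$ for every $(t,x)\in[0,T]\times K$. Then the nonlinear Kolmogorov equation $$v(t,x)=g(x)+\int_t^T\mathcal{L}_s v(s,x)\,ds+\int_t^T f\big(s,x,v(s,x),v(s,\cdot)-v(s,x)\big)\,ds,\qquad t\in[0,T],\ x\in K,$$ has a unique solution $v$ (in the sense defined in the context). Moreover, for every $(t,x)\in[0,T]\times K$, let $(Y^{t,x},Z^{t,x})$ be the unique solution in $\mathbb{M}^{t,x}$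 of the BSDE: $\mathbb{P}^{t,x}$-a.s., $$Y^{t,x}_s+\int_s^T\int_K Z^{t,x}_r(y)\,q^t(dr\,dy)=g(X_T)+\int_s^T f(r,X_r,Y^{t,x}_r,Z^{t,x}_r(\cdot))\,dr,\qquad s\in[t,T].$$ Then $$Y^{t,x}_s=v(s,X_s),\qquad Z^{t,x}_s(y)=v(s,y)-v(s,X_{s-}),$$ where the first equality means that, $\mathbb{P}^{t,x}$-a.s., it holds for all $s\in[t,T]$, and the second means that $\mathbb{E}^{t,x}\int_t^T\int_K|Z^{t,x}_s(y)-v(s,y)+v(s,X_{s-})|^2\,\nu(s,X_{s-},dy)\,ds=0$. In particular $v(t,x)=Y^{t,x}_t$.
   Context: Setting. $T>0$ is fixed. $(K,\mathcal{K})$ is a measurable space such that $\mathcal{K}$ contains all one-point sets. $\nu(t,x,A)$ ($t\in[0,\infty)$, $x\in K$, $A\in\mathcal{K}$) is a rate measure: $A\mapsto\nu(t,x,A)$ is a positive measure on $\mathcal{K}$, $(t,x)\mapsto\nu(t,x,A)$ is $\mathcal{B}([0,\infty))\otimes\mathcal{K}$-measurable, $\sup_{t\in[0,T],x\in K}\nu(t,x,K)<\infty$, and $\nu(t,x,\{x\})=0$ for all $t,x$. Put $\lambda(t,x)=\nu(t,x,K)$, and $\pi(t,x,A)=\nu(t,x,A)/\lambda(t,x)$ if $\lambda(t,x)>0$, $\pi(t,x,A)=1_A(x)$ if $\lambda(t,x)=0$. Markov process. $X:\Omega\times[0,\infty)\to K$ is a function on a set $\Omega$; for $I\subset[0,\infty)$,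 $\mathcal{F}_I=\sigma(X_t,\ t\in I)$; for each $(t,x)\in[0,\infty)\times K$ a probability $\mathbb{P}^{t,x}$ (expectation $\mathbb{E}^{t,x}$) is given on $(\Omega,\mathcal{F}_{[t,\infty)})$ such that: $\mathbb{P}^{t,x}(X_t=x)=1$; for $0\le t\le s$ and $A\in\mathcal{K}$ the map $x\mapsto\mathbb{P}^{t,x}(X_s\in A)$ is $\mathcal{K}$-measurable; for $0\le u\le t\le s$, $A\in\mathcal{K}$, $\mathbb{P}^{u,x}(X_s\in A\,|\,\mathcal{F}_{[u,t]})=\mathbb{P}^{t,X_t}(X_s\in A)$, $\mathbb{P}^{u,x}$-a.s.; for every $\omega$ and $t\ge0$ there is $\delta>0$ with $X_s(\omega)=X_t(\omega)$ for $s\in[t,t+\delta]$; every trajectory has finitely many jumps on every bounded interval. Moreover, with $T_1=\inf\{s>t: X_s\ne X_t\}$ ($\inf\emptyset=\infty$), for $0\le t\le a<b\le\infty$, $x\in K$, $A\in\mathcal{K}$, $$\mathbb{P}^{t,x}(T_1\in(a,b),\,X_{T_1}\in A)=\int_a^b\pi(s,x,A)\,\lambda(s,x)\exp\Big(-\int_t^s\lambda(r,x)\,dr\Big)ds.$$ Random measures. For fixed $t$: $\mathbb{F}^t=(\mathcal{F}_{[t,s]})_{s\ge t}$; $\mathcal{P}^t$ and $Prog^t$ are the $\mathbb{F}^t$-predictable and $\mathbb{F}^t$-progressive $\sigma$-algebras on $\Omega\times[t,T]$; $T_0^t=t$, $T_{n+1}^t=\inf\{s>T_n^t: X_s\neq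 X_{T_n^t}\}$ ($\inf\emptyset=\infty$); $p^t(ds\,dy)=\sum_{n\ge1,\,T_n^t<\infty}\delta_{(T_n^t,X_{T_n^t})}(ds\,dy)$ on $(t,\infty)\times K$. Its compensator under $\mathbb{P}^{t,x}$ is $\nu(s,X_{s-},dy)\,ds$, and $q^t(ds\,dy)=p^t(ds\,dy)-\nu(s,X_{s-},dy)\,ds$; integrals with respect to $q^t$ are differences of ordinary (pathwise) integrals, defined for $\mathcal{P}^t\otimes\mathcal{K}$-measurable $H$ with $\int_t^T\int_K|H_s(y)|\,\nu(s,X_s,dy)\,ds<\infty$ a.s.; $\int_a^b$ means integration over $(a,b]$. Space $\mathbb{M}^{t,x}$: pairs $(Y,Z)$ on $[t,T]$ with $Y$ real-valued and $Prog^t$-measurable, $Z:\Omega\times[t,T]\times K\to\mathbb{R}$ $\mathcal{P}^t\otimes\mathcal{K}$-measurable, and $$\|(Y,Z)\|^2_{\mathbb{M}^{t,x}}=\mathbb{E}^{t,x}\int_t^T|Y_s|^2ds+\mathbb{E}^{t,x}\int_t^T\int_K|Z_s(y)|^2\,\nu(s,X_s,dy)\,ds<\infty;$$ pairs whose difference has norm zero are identified. Under the stated conditions the BSDE has, for each $(t,x)$, a unique solution in $\mathbb{M}^{t,x}$. Generator of $X$: $\mathcal{L}_t\psi(x)=\int_K(\psi(y)-\psi(x))\,\nu(t,x,dy)$ for measurable $\psi:K\to\mathbb{R}$ for which the integral is well defined. Solution of the nonlinear Kolmogorov equation: a measurable function $v:[0,T]\times K\to\mathbb{R}$ such that for every $t\in[0,T]$,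 $x\in K$: (1) $\mathbb{E}^{t,x}\int_t^T\int_K|v(s,y)-v(s,X_s)|^2\,\nu(s,X_s,dy)\,ds<\infty$; (2) $\mathbb{E}^{t,x}\int_t^T|v(s,X_s)|^2\,ds<\infty$; (3) the equation is satisfied at $(t,x)$. (Conditions (1) and (2) imply that all terms of the equation are well defined.) *)

theory Defs
  imports "HOL-Probability.Probability"
begin

text \<open>
  The measurable space of states is given by a measure \<open>K\<close> of which only \<open>space K\<close> and \<open>sets K\<close>
  are used. Time is \<open>real\<close>, and only arguments \<open>t \<ge> 0\<close> matter.
\<close>

locale rate_measure =
  fixes T :: real and K :: "'k measure" and \<nu> :: "real \<Rightarrow> 'k \<Rightarrow> 'k measure"
  assumes T_pos: "0 < T"
    and singletons: "\<And>x. x \<in> space K \<Longrightarrow> {x} \<in> sets K"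
    and sets_rate: "\<And>t x. 0 \<le> t \<Longrightarrow> x \<in> space K \<Longrightarrow> sets (\<nu> t x) = sets K"
    and measurable_rate: "\<And>A. A \<in> sets K \<Longrightarrow>
      (\<lambda>(t, x). emeasure (\<nu> t x) A) \<in> borel_measurable (restrict_space borel {0..} \<Otimes>\<^sub>M K)"
    and bounded_rate:
      "(SUP (t, x) \<in> {0..T} \<times> space K. emeasure (\<nu> t x) (space K)) < \<infinity>"
    and no_self_jump: "\<And>t x. 0 \<le> t \<Longrightarrow> x \<in> space K \<Longrightarrow> emeasure (\<nu> t x) {x} = 0"

definition total_rate :: "'k measure \<Rightarrow> (real \<Rightarrow> 'k \<Rightarrow> 'k measure) \<Rightarrow> real \<Rightarrow> 'k \<Rightarrow> ennreal" where
  "total_rate K \<nu> t x = emeasure (\<nu> t x) (space K)"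

definition jump_kernel ::
    "'k measure \<Rightarrow> (real \<Rightarrow> 'k \<Rightarrow> 'k measure) \<Rightarrow> real \<Rightarrow> 'k \<Rightarrow> 'k set \<Rightarrow> ennreal" where
  "jump_kernel K \<nu> t x A =
    (if total_rate K \<nu> t x > 0 then emeasure (\<nu> t x) A / total_rate K \<nu> t x else indicator A x)"

text \<open>\<open>exp (- a)\<close> for \<open>a \<in> [0, \<infinity>]\<close>. The value \<open>\<infinity>\<close> may occur because the rates are only assumed
  to be bounded up to time \<open>T\<close>.\<close>

definition exp_minus :: "ennreal \<Rightarrow> ennreal" where
  "exp_minus a = (if a = \<infinity> then 0 else ennreal (exp (- enn2real a)))"

text \<open>\<open>T\<^sub>n\<^sup>t\<close>; recall that \<open>Inf {} = \<infinity>\<close> for extended reals.\<close>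

primrec jump_time :: "(real \<Rightarrow> 'w \<Rightarrow> 'k) \<Rightarrow> real \<Rightarrow> 'w \<Rightarrow> nat \<Rightarrow> ereal" where
  "jump_time X t \<omega> 0 = ereal t"
| "jump_time X t \<omega> (Suc n) =
    Inf {ereal s | s. jump_time X t \<omega> n < ereal s \<and>
                      X s \<omega> \<noteq> X (real_of_ereal (jump_time X t \<omega> n)) \<omega>}"

text \<open>The times \<open>s > 0\<close> at which the trajectory is not constant on a left neighbourhood of \<open>s\<close>
  including \<open>s\<close>; for the right-constant trajectories considered below these are the jump times.\<close>

definition jump_set :: "(real \<Rightarrow> 'w \<Rightarrow> 'k) \<Rightarrow> 'w \<Rightarrow> real set" where
  "jump_set X \<omega> = {s. 0 < s \<and> \<not> (\<forall>\<^sub>F r in at_left s. X r \<omega> = X s \<omega>)}"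

text \<open>\<open>X\<^sub>s\<^sub>-\<close>, the limit from the left in the discrete topology; meaningful for \<open>s > 0\<close>.\<close>

definition left_value :: "(real \<Rightarrow> 'w \<Rightarrow> 'k) \<Rightarrow> real \<Rightarrow> 'w \<Rightarrow> 'k" where
  "left_value X s \<omega> = (THE y. \<forall>\<^sub>F r in at_left s. X r \<omega> = y)"

definition path_algebra ::
    "'k measure \<Rightarrow> 'w set \<Rightarrow> (real \<Rightarrow> 'w \<Rightarrow> 'k) \<Rightarrow> real set \<Rightarrow> 'w measure" where
  "path_algebra K \<Omega> X I = sigma \<Omega> {X t -` A \<inter> \<Omega> | t A. t \<in> I \<and> A \<in> sets K}"

text \<open>
  Since \<open>P t x\<close> lives on the uncompleted \<open>\<sigma>\<close>-algebra \<open>path_algebra K \<Omega> X {t..}\<close>, prescribing the joint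
  law of the first jump time and position includes that the events involved belong to it.
  This is spelled out in \<open>first_jump_event\<close>, because \<open>emeasure\<close> is \<open>0\<close> outside the
  \<open>\<sigma>\<close>-algebra.
\<close>

locale markov_jump_process = rate_measure T K \<nu>
  for T :: real and K :: "'k measure" and \<nu> :: "real \<Rightarrow> 'k \<Rightarrow> 'k measure" +
  fixes \<Omega> :: "'w set" and X :: "real \<Rightarrow> 'w \<Rightarrow> 'k" and P :: "real \<Rightarrow> 'k \<Rightarrow> 'w measure"
  assumes state: "\<And>t \<omega>. 0 \<le> t \<Longrightarrow> \<omega> \<in> \<Omega> \<Longrightarrow> X t \<omega> \<in> space K"
    and prob: "\<And>t x. 0 \<le> t \<Longrightarrow> x \<in> space K \<Longrightarrow> prob_space (P t x)"
    and sets_prob: "\<And>t x. 0 \<le> t \<Longrightarrow> x \<in> space K \<Longrightarrow> sets (P t x) = sets (path_algebra K \<Omega> X {t..})"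
    and start: "\<And>t x. 0 \<le> t \<Longrightarrow> x \<in> space K \<Longrightarrow> measure (P t x) {\<omega> \<in> \<Omega>. X t \<omega> = x} = 1"
    and measurable_transition: "\<And>t s A. 0 \<le> t \<Longrightarrow> t \<le> s \<Longrightarrow> A \<in> sets K \<Longrightarrow>
      (\<lambda>x. measure (P t x) {\<omega> \<in> \<Omega>. X s \<omega> \<in> A}) \<in> borel_measurable K"
    and markov: "\<And>u t s x A. 0 \<le> u \<Longrightarrow> u \<le> t \<Longrightarrow> t \<le> s \<Longrightarrow> x \<in> space K \<Longrightarrow> A \<in> sets K \<Longrightarrow>
      AE \<omega> in P u x.
        real_cond_exp (P u x) (path_algebra K \<Omega> X {u..t}) (indicator {\<omega> \<in> \<Omega>. X s \<omega> \<in> A}) \<omega>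
          = measure (P t (X t \<omega>)) {\<omega>' \<in> \<Omega>. X s \<omega>' \<in> A}"
    and right_constant: "\<And>\<omega> t. \<omega> \<in> \<Omega> \<Longrightarrow> 0 \<le> t \<Longrightarrow> \<exists>\<delta>>0. \<forall>s\<in>{t..t + \<delta>}. X s \<omega> = X t \<omega>"
    and finitely_many_jumps: "\<And>\<omega> b. \<omega> \<in> \<Omega> \<Longrightarrow> finite (jump_set X \<omega> \<inter> {..b})"
    and first_jump_event:
      "\<And>t a x A (b :: ereal). 0 \<le> t \<Longrightarrow> t \<le> a \<Longrightarrow> ereal a < b \<Longrightarrow> x \<in> space K \<Longrightarrow> A \<in> sets K \<Longrightarrow>
        {\<omega> \<in> \<Omega>. ereal a < jump_time X t \<omega> 1 \<and> jump_time X t \<omega> 1 < b \<and>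
                X (real_of_ereal (jump_time X t \<omega> 1)) \<omega> \<in> A} \<in> sets (P t x)"
    and first_jump_law:
      "\<And>t a x A (b :: ereal). 0 \<le> t \<Longrightarrow> t \<le> a \<Longrightarrow> ereal a < b \<Longrightarrow> x \<in> space K \<Longrightarrow> A \<in> sets K \<Longrightarrow>
        emeasure (P t x)
          {\<omega> \<in> \<Omega>. ereal a < jump_time X t \<omega> 1 \<and> jump_time X t \<omega> 1 < b \<and>
                  X (real_of_ereal (jump_time X t \<omega> 1)) \<omega> \<in> A}
        = (\<integral>\<^sup>+ s \<in> {s. a < s \<and> ereal s < b}.
             jump_kernel K \<nu> s x A * total_rate K \<nu> s x *
             exp_minus (\<integral>\<^sup>+ r \<in> {t..s}. total_rate K \<nu> r x \<partial>lborel) \<partial>lborel)"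

definition predictable_algebra ::
    "real \<Rightarrow> 'k measure \<Rightarrow> 'w set \<Rightarrow> (real \<Rightarrow> 'w \<Rightarrow> 'k) \<Rightarrow> real \<Rightarrow> ('w \<times> real) measure" where
  "predictable_algebra T K \<Omega> X t = sigma (\<Omega> \<times> {t..T})
     ({A \<times> {t} | A. A \<in> sets (path_algebra K \<Omega> X {t..t})} \<union>
      {A \<times> {s<..u} | A s u. t \<le> s \<and> s \<le> u \<and> u \<le> T \<and> A \<in> sets (path_algebra K \<Omega> X {t..s})})"

definition progressive_algebra ::
    "real \<Rightarrow> 'k measure \<Rightarrow> 'w set \<Rightarrow> (real \<Rightarrow> 'w \<Rightarrow> 'k) \<Rightarrow> real \<Rightarrow> ('w \<times> real) measure" where
  "progressive_algebra T K \<Omega> X t = sigma (\<Omega> \<times> {t..T})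
     {B. B \<subseteq> \<Omega> \<times> {t..T} \<and>
         (\<forall>s\<in>{t..T}. B \<inter> (\<Omega> \<times> {t..s}) \<in>
            sets (path_algebra K \<Omega> X {t..s} \<Otimes>\<^sub>M restrict_space borel {t..s}))}"

text \<open>The sum of the Dirac measures at \<open>(T\<^sub>n\<^sup>t, X (T\<^sub>n\<^sup>t))\<close> over \<open>n \<ge> 1\<close> with \<open>T\<^sub>n\<^sup>t < \<infinity>\<close>, as
  the image of a counting measure.\<close>

definition jump_measure ::
    "'k measure \<Rightarrow> (real \<Rightarrow> 'w \<Rightarrow> 'k) \<Rightarrow> real \<Rightarrow> 'w \<Rightarrow> (real \<times> 'k) measure" where
  "jump_measure K X t \<omega> =
     distr (count_space {n. 1 \<le> n \<and> jump_time X t \<omega> n < \<infinity>})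
       (restrict_space borel {t<..} \<Otimes>\<^sub>M K)
       (\<lambda>n. (real_of_ereal (jump_time X t \<omega> n), X (real_of_ereal (jump_time X t \<omega> n)) \<omega>))"

text \<open>The pathwise integral of \<open>H\<close> over \<open>(a, b] \<times> K\<close> with respect to the compensated measure \<open>q\<^sup>t\<close>.\<close>

definition compensated_integral ::
    "'k measure \<Rightarrow> (real \<Rightarrow> 'k \<Rightarrow> 'k measure) \<Rightarrow> (real \<Rightarrow> 'w \<Rightarrow> 'k) \<Rightarrow>
     real \<Rightarrow> 'w \<Rightarrow> real \<Rightarrow> real \<Rightarrow> (real \<Rightarrow> 'k \<Rightarrow> real) \<Rightarrow> real" where
  "compensated_integral K \<nu> X t \<omega> a b H =
     (LINT z : {a<..b} \<times> space K | jump_measure K X t \<omega>. H (fst z) (snd z)) -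
     (LINT r : {a<..b} | lebesgue. LINT y | \<nu> r (left_value X r \<omega>). H r y)"

definition M_norm_sq ::
    "real \<Rightarrow> (real \<Rightarrow> 'k \<Rightarrow> 'k measure) \<Rightarrow> (real \<Rightarrow> 'w \<Rightarrow> 'k) \<Rightarrow> (real \<Rightarrow> 'k \<Rightarrow> 'w measure) \<Rightarrow>
     real \<Rightarrow> 'k \<Rightarrow> (real \<Rightarrow> 'w \<Rightarrow> real) \<Rightarrow> (real \<Rightarrow> 'w \<Rightarrow> 'k \<Rightarrow> real) \<Rightarrow> ennreal" where
  "M_norm_sq T \<nu> X P t x Y Z =
     (\<integral>\<^sup>+ \<omega>. (\<integral>\<^sup>+ s \<in> {t<..T}. ennreal (\<bar>Y s \<omega>\<bar>\<^sup>2) \<partial>lborel) \<partial>P t x) +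
     (\<integral>\<^sup>+ \<omega>. (\<integral>\<^sup>+ s \<in> {t<..T}. (\<integral>\<^sup>+ y. ennreal (\<bar>Z s \<omega> y\<bar>\<^sup>2) \<partial>\<nu> s (X s \<omega>)) \<partial>lborel) \<partial>P t x)"

definition in_M ::
    "real \<Rightarrow> 'k measure \<Rightarrow> (real \<Rightarrow> 'k \<Rightarrow> 'k measure) \<Rightarrow> 'w set \<Rightarrow> (real \<Rightarrow> 'w \<Rightarrow> 'k) \<Rightarrow>
     (real \<Rightarrow> 'k \<Rightarrow> 'w measure) \<Rightarrow> real \<Rightarrow> 'k \<Rightarrow>
     (real \<Rightarrow> 'w \<Rightarrow> real) \<Rightarrow> (real \<Rightarrow> 'w \<Rightarrow> 'k \<Rightarrow> real) \<Rightarrow> bool" where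
  "in_M T K \<nu> \<Omega> X P t x Y Z \<longleftrightarrow>
     (\<lambda>(\<omega>, s). Y s \<omega>) \<in> borel_measurable (progressive_algebra T K \<Omega> X t) \<and>
     (\<lambda>((\<omega>, s), y). Z s \<omega> y) \<in> borel_measurable (predictable_algebra T K \<Omega> X t \<Otimes>\<^sub>M K) \<and>
     M_norm_sq T \<nu> X P t x Y Z < \<infinity>"

text \<open>
  The driver \<open>f s x r z\<close> is only constrained for \<open>z\<close> square integrable with respect to \<open>\<nu> s x\<close>.
  Since this integrability of \<open>z = Z r \<omega>\<close> is known for almost every \<open>r\<close> only, integrals of the
  driver are taken with respect to the complete measure \<open>lebesgue\<close>, so that
  the remaining values are irrelevant.
\<close>

definition bsde_solution ::
    "real \<Rightarrow> 'k measure \<Rightarrow> (real \<Rightarrow> 'k \<Rightarrow> 'k measure) \<Rightarrow> 'w set \<Rightarrow> (real \<Rightarrow> 'w \<Rightarrow> 'k) \<Rightarrow>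
     (real \<Rightarrow> 'k \<Rightarrow> 'w measure) \<Rightarrow>
     (real \<Rightarrow> 'k \<Rightarrow> real \<Rightarrow> ('k \<Rightarrow> real) \<Rightarrow> real) \<Rightarrow> ('k \<Rightarrow> real) \<Rightarrow> real \<Rightarrow> 'k \<Rightarrow>
     (real \<Rightarrow> 'w \<Rightarrow> real) \<Rightarrow> (real \<Rightarrow> 'w \<Rightarrow> 'k \<Rightarrow> real) \<Rightarrow> bool" where
  "bsde_solution T K \<nu> \<Omega> X P f g t x Y Z \<longleftrightarrow>
     in_M T K \<nu> \<Omega> X P t x Y Z \<and>
     (AE \<omega> in P t x. \<forall>s\<in>{t..T}.
        Y s \<omega> + compensated_integral K \<nu> X t \<omega> s T (\<lambda>r. Z r \<omega>) =
        g (X T \<omega>) + (LINT r : {s<..T} | lebesgue. f r (X r \<omega>) (Y r \<omega>) (Z r \<omega>)))"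

definition generator ::
    "(real \<Rightarrow> 'k \<Rightarrow> 'k measure) \<Rightarrow> real \<Rightarrow> ('k \<Rightarrow> real) \<Rightarrow> 'k \<Rightarrow> real" where
  "generator \<nu> t \<psi> x = (LINT y | \<nu> t x. \<psi> y - \<psi> x)"

definition kolmogorov_solution ::
    "real \<Rightarrow> 'k measure \<Rightarrow> (real \<Rightarrow> 'k \<Rightarrow> 'k measure) \<Rightarrow> (real \<Rightarrow> 'w \<Rightarrow> 'k) \<Rightarrow>
     (real \<Rightarrow> 'k \<Rightarrow> 'w measure) \<Rightarrow>
     (real \<Rightarrow> 'k \<Rightarrow> real \<Rightarrow> ('k \<Rightarrow> real) \<Rightarrow> real) \<Rightarrow> ('k \<Rightarrow> real) \<Rightarrow>
     (real \<Rightarrow> 'k \<Rightarrow> real) \<Rightarrow> bool" where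
  "kolmogorov_solution T K \<nu> X P f g v \<longleftrightarrow>
     (\<lambda>(s, x). v s x) \<in> borel_measurable (restrict_space borel {0..T} \<Otimes>\<^sub>M K) \<and>
     (\<forall>t\<in>{0..T}. \<forall>x\<in>space K.
        (\<integral>\<^sup>+ \<omega>. (\<integral>\<^sup>+ s \<in> {t<..T}.
           (\<integral>\<^sup>+ y. ennreal (\<bar>v s y - v s (X s \<omega>)\<bar>\<^sup>2) \<partial>\<nu> s (X s \<omega>)) \<partial>lborel) \<partial>P t x) < \<infinity> \<and>
        (\<integral>\<^sup>+ \<omega>. (\<integral>\<^sup>+ s \<in> {t<..T}. ennreal (\<bar>v s (X s \<omega>)\<bar>\<^sup>2) \<partial>lborel) \<partial>P t x) < \<infinity> \<and>
        v t x = g x + (LINT s : {t<..T} | lebesgue. generator \<nu> s (v s) x)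
                    + (LINT s : {t<..T} | lebesgue. f s x (v s x) (\<lambda>y. v s y - v s x)))"

text \<open>Square integrable functions, as functions. The Lipschitz condition imposed on the driver makes
  it invariant under changes on null sets.\<close>

definition L2 :: "'k measure \<Rightarrow> ('k \<Rightarrow> real) set" where
  "L2 M = {z \<in> borel_measurable M. integrable M (\<lambda>y. \<bar>z y\<bar>\<^sup>2)}"

end

theory Submission
 imports Defs
begin

text \<open>A solution \<open>v\<close> of the Kolmogorov equation is absolutely continuous in time at every fixed state, so along
 a piecewise constant trajectory the process \<open>v(s, X\<^sub>s)\<close> changes by an absolutely continuous part and by
 the jumps \<open>v(s, X\<^sub>s) - v(s, X\<^sub>s\<^sub>-)\<close>: this is the backward equation. Because
 \<open>\<nu>(s, X\<^sub>s, dy) ds\<close> compensates the jump measure, squares of solutions of linear backward equations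
 satisfy an energy estimate in terms of the data, which yields uniqueness of both problems. For bounded
 data the Kolmogorov equation is an ordinary fixed point problem in the supremum norm. In general the
 data are truncated; the energy estimate makes the approximations converge at every point, and a
 process started at \<open>(t, x)\<close> stays at \<open>x\<close> for a short time with probability at least 1/2, which
 turns estimates in mean along trajectories into estimates in time at the fixed state \<open>x\<close>, so that the
 limit solves the equation.\<close>

text \<open>The compensator of the jump measure is not assumed: the locale gives only the law of the
  first jump and the Markov property at fixed times. It is derived without stopping times, by
  conditioning at the points of dyadic grids. The same grids stand in for regularity of the
  filtration and for a topology on the states: joint measurability, predictability of left limits
  and the left limits of solutions all come from sampling at grid points. Since the equation is
  claimed at every (t, x), no exceptional set of states may be discarded. At the starting time X t =
  x holds almost surely, so the mean square bounded by the energy estimate there is a bound at a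
  single point. Its constant depends only on T, t and the Lipschitz constants; truncation adds to
  the driver a term in (s, x) alone, which leaves those constants unchanged, so the estimate is
  uniform over the approximations. The driver is measurable for fixed bounded last arguments only
  and constrained on square integrable ones only. Hence the countable approximation in all L^2
  spaces at once, and the passage from integrals over \<open>lebesgue\<close> to Borel integrals of
  a cut-off driver.\<close>

abbreviation (input) sq :: "real \<Rightarrow> ennreal" where
 "sq a \<equiv> ennreal (a\<^sup>2)"

section \<open>Trajectories and their jumps\<close>

lemma sum_Un_jumps:
 fixes S :: "real set"
 assumes "finite (S \<inter> {a<..c})" "a \<le> b" "b \<le> c"
 shows "(\<Sum>j\<in>S \<inter> {a<..c}. f j) = (\<Sum>j\<in>S \<inter> {a<..b}. f j) + (\<Sum>j\<in>S \<inter> {b<..c}. f j)"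
proof -
 have "S \<inter> {a<..c} = (S \<inter> {a<..b}) \<union> (S \<inter> {b<..c})" using assms by auto
 moreover have "finite (S \<inter> {a<..b})" "finite (S \<inter> {b<..c})"
  using assms by (auto intro: finite_subset[OF _ assms(1)])
 ultimately show ?thesis by (simp only:) (rule sum.union_disjoint, auto)
qed

context markov_jump_process
begin

abbreviation "jumps w a b \<equiv> jump_set X w \<inter> {a<..b}"
abbreviation "PA t \<equiv> predictable_algebra T K \<Omega> X t"
abbreviation "GA t \<equiv> progressive_algebra T K \<Omega> X t"
abbreviation "nX p \<equiv> \<nu> (snd p) (X (snd p) (fst p))"
abbreviation "inM t x Y Z \<equiv> in_M T K \<nu> \<Omega> X P t x Y Z"
abbreviation "M_norm t x Y Z \<equiv> M_norm_sq T \<nu> X P t x Y Z"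

lemma finite_jumps: "w \<in> \<Omega> ==> finite (jumps w a b)"
 by (rule finite_subset[OF _ finitely_many_jumps[of w b]]) auto

text \<open>Let c be the infimum of the times in [a, s] at which the state differs from X a. If X c
  = X a, right-constancy keeps this value beyond c, against the choice of c. Otherwise c > a, and
  since c is not a jump, the value X c is already taken shortly before c, again against the choice
  of c.\<close>

lemma constant_without_jump:
 assumes w: "w \<in> \<Omega>" and a: "0 \<le> a" "a \<le> s" and J: "jumps w a s = {}"
 shows "X s w = X a w"
proof (rule ccontr)
 assume ne: "X s w \<noteq> X a w"
 define S where "S = {r\<in>{a..s}. X r w \<noteq> X a w}"
 define c where "c = Inf S"
 have sS: "s \<in> S" using ne a by (auto simp: S_def)
 have bdd: "bdd_below S" by (rule bdd_belowI[of _ a]) (auto simp: S_def)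
 have ca: "a \<le> c" unfolding c_def using sS by (intro cInf_greatest) (auto simp: S_def)
 have cs: "c \<le> s" unfolding c_def using sS bdd by (rule cInf_lower)
 have lower: "r \<in> S ==> c \<le> r" for r unfolding c_def using bdd by (rule cInf_lower[rotated])
 have "0 \<le> c" using a ca by simp
 from right_constant[OF w this]
 obtain d where d: "d > 0" "\<forall>r\<in>{c..c + d}. X r w = X c w"
  by blast
 show False
 proof (cases "X c w = X a w")
  case True
  have "c + d \<le> r" if r: "r \<in> S" for r
  proof (rule ccontr)
   assume "\<not> c + d \<le> r"
   hence "r \<in> {c..c + d}" using lower[OF r] by simp
   with d(2) have "X r w = X c w" by blast
   thus False using r True by (auto simp: S_def)
  qed
  hence "c + d \<le> c" unfolding c_def using sS by (intro cInf_greatest) auto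
  thus False using d(1) by simp
 next
  case False
  hence "a < c" using ca by (cases "a = c") auto
  hence "c \<notin> jump_set X w" using J cs by auto
  hence "\<forall>\<^sub>F r in at_left c. X r w = X c w" using \<open>a < c\<close> a by (auto simp: jump_set_def)
  then obtain b where b: "b < c" "\<And>r. b < r ==> r < c ==> X r w = X c w"
   unfolding eventually_at_left_field by auto
  define r where "r = (max a b + c) / 2"
  have r: "a < r" "b < r" "r < c" using b(1) \<open>a < c\<close> by (auto simp: r_def max_def)
  hence "r \<in> S" using b False cs by (auto simp: S_def)
  thus False using lower[of r] r by auto
 qed
qed

lemma left_value_eq:
 assumes "w \<in> \<Omega>" "0 \<le> a" "a < s" "jump_set X w \<inter> {a<..<s} = {}"
 shows "left_value X s w = X a w"
proof -
 have ev: "\<forall>\<^sub>F r in at_left s. X r w = X a w"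
  unfolding eventually_at_left_field
 proof (intro exI[of _ a] conjI allI impI)
  fix r assume "a < r" "r < s"
  thus "X r w = X a w"
   using assms by (intro constant_without_jump) auto
 qed (use assms in auto)
 show ?thesis unfolding left_value_def
 proof (rule the_equality)
  show "\<forall>\<^sub>F r in at_left s. X r w = X a w" by (rule ev)
  fix y assume "\<forall>\<^sub>F r in at_left s. X r w = y"
  with ev have "\<forall>\<^sub>F r in at_left s. y = X a w" by eventually_elim auto
  thus "y = X a w" by (simp add: trivial_limit_at_left_real)
 qed
qed

text \<open>Only finitely many jumps lie between b and s, so a point halfway between the last of
  them and s works. Inserting b keeps the maximum defined when there are none.\<close>

lemma ex_left_constant:
 assumes "w \<in> \<Omega>" "b < s"
 shows "\<exists>a. b < a \<and> a < s \<and> jump_set X w \<inter> {a<..<s} = {}"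
proof -
 let ?F = "insert b (jumps w b s - {s})"
 have fin: "finite ?F" using finite_jumps[OF assms(1)] by auto
 define m where "m = Max ?F"
 have m: "m < s" "b \<le> m" unfolding m_def using fin assms by (auto)
 have up: "r \<in> jump_set X w ==> b < r ==> r < s ==> r \<le> m" for r
  unfolding m_def using fin by (intro Max_ge) auto
 define c where "c = (m + s) / 2"
 have c: "m < c" "c < s" using m by (auto simp: c_def)
 have "r \<notin> jump_set X w" if "c < r" "r < s" for r
  using up[of r] m c that by linarith
 thus ?thesis using m c by (intro exI[of _ c]) auto
qed

lemma left_value_eq_self:
 assumes "w \<in> \<Omega>" "0 < s" "s \<notin> jump_set X w"
 shows "left_value X s w = X s w"
proof -
 obtain a where a: "0 < a" "a < s" "jump_set X w \<inter> {a<..<s} = {}"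
  using ex_left_constant[OF assms(1,2)] by auto
 have "{a<..s} = insert s {a<..<s}" using a by auto
 hence "jumps w a s = {}" using a assms(3) by auto
 hence "X s w = X a w" using a assms by (intro constant_without_jump) simp_all
 moreover have "left_value X s w = X a w" using a assms by (intro left_value_eq) simp_all
 ultimately show ?thesis by (rule trans[OF _ sym, rotated])
qed

text \<open>\<open>jump_time\<close> looks for a state different from the one at the previous jump
  time, \<open>jump_set\<close> for failure of local constancy. They agree because the path is
  constant strictly between consecutive elements of \<open>jump_set\<close>; a return at i to the
  state before i would make the path constant on a left neighbourhood of i.\<close>

lemma next_jump:
 assumes w: "w \<in> \<Omega>" and t: "0 \<le> t" and n: "jump_time X t w n = ereal j" "t \<le> j"
 shows "jump_set X w \<inter> {j<..} = {} ==> jump_time X t w (Suc n) = \<infinity>"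
  and "i \<in> jump_set X w ==> j < i ==> jump_set X w \<inter> {j<..<i} = {} ==>
   jump_time X t w (Suc n) = ereal i"
proof -
 have eq: "jump_time X t w (Suc n) = Inf {ereal s | s. j < s \<and> X s w \<noteq> X j w}"
  using n by simp
 {
  assume J: "jump_set X w \<inter> {j<..} = {}"
  have "X s w = X j w" if "j < s" for s
   by (rule constant_without_jump[OF w]) (use J that t n in auto)
  hence "{ereal s | s. j < s \<and> X s w \<noteq> X j w} = {}" by blast
  thus "jump_time X t w (Suc n) = \<infinity>"
   unfolding eq by (simp only: Inf_empty top_ereal_def)
 }
 {
  assume i: "i \<in> jump_set X w" "j < i" "jump_set X w \<inter> {j<..<i} = {}"
  have const: "X s w = X j w" if "j < s" "s < i" for s
   by (rule constant_without_jump[OF w]) (use i that t n in auto)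
  have "X i w \<noteq> X j w"
  proof
   assume "X i w = X j w"
   hence "\<forall>\<^sub>F r in at_left i. X r w = X i w"
    unfolding eventually_at_left_field using const i by auto
   thus False using i(1) by (auto simp: jump_set_def)
  qed
  show "jump_time X t w (Suc n) = ereal i"
   unfolding eq
  proof (rule antisym)
   show "Inf {ereal s | s. j < s \<and> X s w \<noteq> X j w} \<le> ereal i"
    using \<open>X i w \<noteq> X j w\<close> i by (intro Inf_lower) auto
   show "ereal i \<le> Inf {ereal s | s. j < s \<and> X s w \<noteq> X j w}"
    using const by (intro Inf_greatest) (force simp: not_less[symmetric])
  qed
 }
qed

lemma ex_next_jump:
 assumes w: "w \<in> \<Omega>" and "jump_set X w \<inter> {j<..} \<noteq> {}"
 shows "\<exists>i. i \<in> jump_set X w \<and> j < i \<and> jump_set X w \<inter> {j<..<i} = {}"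
proof -
 obtain s where s: "s \<in> jump_set X w" "j < s" using assms by auto
 let ?F = "jumps w j s"
 have fin: "finite ?F" and ne: "?F \<noteq> {}" using finite_jumps[OF w] s by auto
 define m where "m = Min ?F"
 have m: "m \<in> jump_set X w" "j < m" "m \<le> s"
  using Min_in[OF fin ne] by (simp_all add: m_def)
 have "m \<le> r" if "r \<in> jump_set X w" "j < r" "r < m" for r
  unfolding m_def using fin that m by (intro Min_le) auto
 hence "jump_set X w \<inter> {j<..<m} = {}" by fastforce
 with m show ?thesis by (intro exI[of _ m]) blast
qed

text \<open>The cardinality clause is the reason for this form: it makes the finite jump times
  injective in the index and prevents them from accumulating below a bound.\<close>

lemma jump_time_cases:
 assumes w: "w \<in> \<Omega>" and t: "0 \<le> t"
 shows "jump_time X t w n = \<infinity> \<or> (\<exists>j\<ge>t. jump_time X t w n = ereal j \<and>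
  card (jumps w t j) = n \<and> (1 \<le> n \<longrightarrow> t < j \<and> j \<in> jump_set X w))"
proof (induction n)
 case 0
 thus ?case by auto
next
 case (Suc n)
 from Suc show ?case
 proof
  assume "jump_time X t w n = \<infinity>"
  thus ?thesis by (simp add: top_ereal_def)
 next
  assume "\<exists>j\<ge>t. jump_time X t w n = ereal j \<and>
   card (jumps w t j) = n \<and> (1 \<le> n \<longrightarrow> t < j \<and> j \<in> jump_set X w)"
  then obtain j where j: "t \<le> j" "jump_time X t w n = ereal j"
   "card (jumps w t j) = n" by auto
  show ?thesis
  proof (cases "jump_set X w \<inter> {j<..} = {}")
   case True
   thus ?thesis using next_jump(1)[OF w t j(2,1)] by blast
  next
   case False
   then obtain i where i: "i \<in> jump_set X w" "j < i" "jump_set X w \<inter> {j<..<i} = {}"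
    using ex_next_jump[OF w] by blast
   have "{t<..i} = insert i ({t<..j} \<union> {j<..<i})" using i j by auto
   hence "jumps w t i = insert i (jumps w t j)"
    using i(1,3) by blast
   hence "card (jumps w t i) = Suc n"
    using j i finite_jumps[OF w, of t j] by auto
   moreover have "jump_time X t w (Suc n) = ereal i"
    by (rule next_jump(2)[OF w t j(2,1) i])
   ultimately show ?thesis
    using i(1,2) j(1) by (intro disjI2 exI[of _ i]) (simp del: jump_time.simps)
  qed
 qed
qed

text \<open>If i were skipped, every jump time would be finite and below i. The one whose index
  exceeds the number of jumps in (t, i] then has too many jumps before it.\<close>

lemma jump_time_surj:
 assumes w: "w \<in> \<Omega>" and t: "0 \<le> t" and i: "i \<in> jump_set X w" "t < i"
 shows "\<exists>n\<ge>1. jump_time X t w n = ereal i"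
proof (rule ccontr)
 assume contra: "\<not> (\<exists>n\<ge>1. jump_time X t w n = ereal i)"
 have below: "\<exists>j\<ge>t. jump_time X t w n = ereal j \<and> j < i" for n
 proof (induction n)
  case 0
  thus ?case using i by auto
 next
  case (Suc n)
  then obtain j where j: "t \<le> j" "jump_time X t w n = ereal j" "j < i" by auto
  then obtain r where r: "r \<in> jump_set X w" "j < r" "jump_set X w \<inter> {j<..<r} = {}"
   using ex_next_jump[OF w, of j] i by blast
  have "jump_time X t w (Suc n) = ereal r" by (rule next_jump(2)[OF w t j(2,1) r])
  moreover from this have "r \<noteq> i" using contra by (metis le_add1 plus_1_eq_Suc)
  moreover have "r \<le> i" using r(3) i j by (force simp: not_less[symmetric])
  ultimately show ?case using r j by auto
 qed
 define n where "n = Suc (card (jumps w t i))"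
 obtain j where j: "jump_time X t w n = ereal j" "j < i" using below by blast
 hence "card (jumps w t j) = n" using jump_time_cases[OF w t, of n] by auto
 moreover have "card (jumps w t j) \<le> card (jumps w t i)"
  using j finite_jumps[OF w] by (intro card_mono) auto
 ultimately show False by (simp add: n_def)
qed

lemma first_jump_iff:
 assumes w: "w \<in> \<Omega>" and t: "0 \<le> t"
 shows "jump_time X t w 1 = ereal j \<longleftrightarrow>
  t < j \<and> j \<in> jump_set X w \<and> jump_set X w \<inter> {t<..<j} = {}"
proof
 assume eq: "jump_time X t w 1 = ereal j"
 with jump_time_cases[OF w t, of 1]
 have *: "t < j" "j \<in> jump_set X w" by auto
 then obtain i where i: "i \<in> jump_set X w" "t < i" "jump_set X w \<inter> {t<..<i} = {}"
  using ex_next_jump[OF w, of t] by blast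
 have "jump_time X t w 1 = ereal i" using next_jump(2)[OF w t _ _ i, of 0] by simp
 thus "t < j \<and> j \<in> jump_set X w \<and> jump_set X w \<inter> {t<..<j} = {}"
  using * eq i by auto
next
 assume "t < j \<and> j \<in> jump_set X w \<and> jump_set X w \<inter> {t<..<j} = {}"
 thus "jump_time X t w 1 = ereal j" using next_jump(2)[OF w t, of 0 t j] by simp
qed

text \<open>An image of counting measure is integrated over the indices, where only finitely many
  terms are nonzero; the injective map from indices to jump times turns the result into a sum over
  the jumps in (a, b].\<close>

lemma jump_measure_integral:
 fixes H :: "real => 'k => real"
 assumes w: "w \<in> \<Omega>" and t: "0 \<le> t" "t \<le> a" "a \<le> b" "b \<le> T" "t < T"
  and H: "(\<lambda>(s, y). H s y) \<in> borel_measurable (restrict_space borel {t<..T} \<Otimes>\<^sub>M K)"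
 shows "(LINT z : {a<..b} \<times> space K | jump_measure K X t w. H (fst z) (snd z)) =
  (\<Sum>j\<in>jumps w a b. H j (X j w))"
proof -
 define N where "N = {n. 1 \<le> n \<and> jump_time X t w n < \<infinity>}"
 define d where "d n = real_of_ereal (jump_time X t w n)" for n
 define G where "G z = indicator ({a<..b} \<times> space K) z *\<^sub>R H (fst z) (snd z)" for z
 have d: "jump_time X t w n = ereal (d n)" "t < d n" "d n \<in> jump_set X w"
  "card (jump_set X w \<inter> {t<..d n}) = n" if "n \<in> N" for n
  using jump_time_cases[OF w t(1), of n] that by (auto simp: N_def d_def)
 have inj: "inj_on d N" by (rule inj_onI) (metis d(4))
 have surj: "\<exists>n\<in>N. d n = \<sigma>" if \<sigma>: "\<sigma> \<in> jump_set X w" "t < \<sigma>" for \<sigma>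
 proof -
  obtain n where n: "1 \<le> n" "jump_time X t w n = ereal \<sigma>"
   using jump_time_surj[OF w t(1) \<sigma>] by blast
  hence "n \<in> N" unfolding N_def by (simp only: mem_Collect_eq) simp
  thus ?thesis using n by (intro bexI[of _ n]) (simp_all add: d_def)
 qed
 have cs: "(\<lambda>n. (d n, X (d n) w)) \<in> count_space N \<rightarrow>\<^sub>M restrict_space borel {t<..} \<Otimes>\<^sub>M K"
  using d(2) state[OF less_imp_le w] order.strict_trans1[OF t(1) d(2)]
  by (subst measurable_count_space_eq1) (auto simp: space_pair_measure space_restrict_space)
 \<comment> \<open>H is measurable on (t, T] only, whereas the jump measure lives on (t,
   \<infinity>). Replacing the time by its minimum with T stays in (t, T] because t < T, and changes
   nothing inside (a, b].\<close>
 have clamp: "(\<lambda>z. (min (fst z) T, snd z)) \<in>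
   restrict_space borel {t<..} \<Otimes>\<^sub>M K \<rightarrow>\<^sub>M restrict_space borel {t<..T} \<Otimes>\<^sub>M K"
 proof (rule measurable_Pair)
  have "(\<lambda>s. min s T) \<in> restrict_space borel {t<..} \<rightarrow>\<^sub>M restrict_space borel {t<..T}"
   using t by (intro measurable_restrict_space2 measurable_restrict_space1) auto
  thus "(\<lambda>z. min (fst z) T) \<in> restrict_space borel {t<..} \<Otimes>\<^sub>M K \<rightarrow>\<^sub>M restrict_space borel {t<..T}"
   by (rule measurable_compose[OF measurable_fst])
 qed simp
 have G_meas: "G \<in> borel_measurable (restrict_space borel {t<..} \<Otimes>\<^sub>M K)"
 proof -
  have "(\<lambda>z. H (min (fst z) T) (snd z)) \<in> borel_measurable (restrict_space borel {t<..} \<Otimes>\<^sub>M K)"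
   using measurable_compose[OF clamp H] by simp
  moreover have "{a<..b} \<in> sets (restrict_space borel {t<..})"
   using t by (subst sets_restrict_space_iff) auto
  hence "{a<..b} \<times> space K \<in> sets (restrict_space borel {t<..} \<Otimes>\<^sub>M K)" by auto
  ultimately have "(\<lambda>z. indicator ({a<..b} \<times> space K) z *\<^sub>R H (min (fst z) T) (snd z))
    \<in> borel_measurable (restrict_space borel {t<..} \<Otimes>\<^sub>M K)" by (intro borel_measurable_scaleR) auto
  moreover have "G = (\<lambda>z. indicator ({a<..b} \<times> space K) z *\<^sub>R H (min (fst z) T) (snd z))"
   using t by (auto simp: G_def indicator_def fun_eq_iff min_def)
  ultimately show ?thesis by simp
 qed
 have "(LINT z : {a<..b} \<times> space K | jump_measure K X t w. H (fst z) (snd z)) =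
   integral\<^sup>L (jump_measure K X t w) G"
  by (simp add: set_lebesgue_integral_def G_def[abs_def])
 also have "\<dots> = (\<integral>n. G (d n, X (d n) w) \<partial>count_space N)"
  unfolding jump_measure_def N_def[symmetric] d_def[symmetric]
  by (rule integral_distr[OF cs G_meas])
 also have "\<dots> = (\<Sum>n | n \<in> N \<and> G (d n, X (d n) w) \<noteq> 0. G (d n, X (d n) w))"
 proof (rule lebesgue_integral_count_space_finite_support)
  have "d ` {n\<in>N. G (d n, X (d n) w) \<noteq> 0} \<subseteq> jumps w a b"
   using d by (auto simp: G_def indicator_def split: if_splits)
  hence "finite (d ` {n\<in>N. G (d n, X (d n) w) \<noteq> 0})"
   using finite_jumps[OF w] finite_subset by blast
  thus "finite {n\<in>N. G (d n, X (d n) w) \<noteq> 0}"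
   using inj by (elim finite_imageD) (auto simp: inj_on_def)
 qed
 also have "\<dots> = (\<Sum>j\<in>d ` {n. n \<in> N \<and> G (d n, X (d n) w) \<noteq> 0}. G (j, X j w))"
  using inj by (subst sum.reindex) (auto simp: inj_on_def)
 also have "\<dots> = (\<Sum>j\<in>jumps w a b. H j (X j w))"
 proof (rule sum.mono_neutral_cong_left)
  show "finite (jumps w a b)" by (rule finite_jumps[OF w])
  show "d ` {n. n \<in> N \<and> G (d n, X (d n) w) \<noteq> 0} \<subseteq> jumps w a b"
   using d by (auto simp: G_def indicator_def split: if_splits)
  have *: "G (\<sigma>, X \<sigma> w) = H \<sigma> (X \<sigma> w)" if "\<sigma> \<in> jumps w a b" for \<sigma>
   using that state[of \<sigma> w] w t by (auto simp: G_def)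
  show "\<forall>i\<in>jumps w a b - d ` {n. n \<in> N \<and> G (d n, X (d n) w) \<noteq> 0}. H i (X i w) = 0"
  proof
   fix \<sigma> assume \<sigma>: "\<sigma> \<in> jumps w a b - d ` {n. n \<in> N \<and> G (d n, X (d n) w) \<noteq> 0}"
   then obtain n where "n \<in> N" "d n = \<sigma>" using surj[of \<sigma>] t by auto
   thus "H \<sigma> (X \<sigma> w) = 0" using \<sigma> *[of \<sigma>] by auto
  qed
  show "G (x, X x w) = H x (X x w)"
   if "x \<in> d ` {n. n \<in> N \<and> G (d n, X (d n) w) \<noteq> 0}" for x
   using that * d by (auto simp: G_def indicator_def split: if_splits)
 qed
 finally show ?thesis .
qed

end

section \<open>The Markov property\<close>

lemma space_path_algebra [simp]: "space (path_algebra K \<Omega> X I) = \<Omega>"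
 unfolding path_algebra_def by (rule space_measure_of) auto

lemma sets_path_algebra:
 "sets (path_algebra K \<Omega> X I) = sigma_sets \<Omega> {X t -` A \<inter> \<Omega> | t A. t \<in> I \<and> A \<in> sets K}"
 unfolding path_algebra_def by (rule sets_measure_of) auto

lemma sets_path_algebra_mono:
 "I \<subseteq> I' ==> sets (path_algebra K \<Omega> X I) \<subseteq> sets (path_algebra K \<Omega> X I')"
 unfolding sets_path_algebra by (rule sigma_sets_mono') auto

context markov_jump_process
begin

abbreviation "FA \<equiv> path_algebra K \<Omega> X"

lemma measurable_X: "s \<in> I ==> 0 \<le> s ==> X s \<in> FA I \<rightarrow>\<^sub>M K"
 by (rule measurableI) (auto simp: state sets_path_algebra)

lemma measurable_FA_mono: "f \<in> FA I \<rightarrow>\<^sub>M N ==> I \<subseteq> I' ==> f \<in> FA I' \<rightarrow>\<^sub>M N"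
 unfolding measurable_def using sets_path_algebra_mono[of I I' K \<Omega> X] by auto

lemma space_P [simp]: "0 \<le> t ==> x \<in> space K ==> space (P t x) = \<Omega>"
 using sets_eq_imp_space_eq[OF sets_prob[of t x]] by simp

lemma measurable_P: "0 \<le> t ==> x \<in> space K ==> f \<in> FA {t..} \<rightarrow>\<^sub>M N ==> f \<in> P t x \<rightarrow>\<^sub>M N"
 using sets_prob[of t x] by (simp cong: measurable_cong_sets)

lemma sets_P: "0 \<le> t ==> x \<in> space K ==> I \<subseteq> {t..} ==> A \<in> sets (FA I) ==> A \<in> sets (P t x)"
 using sets_prob[of t x] sets_path_algebra_mono[of I "{t..}" K \<Omega> X] by auto

lemma emeasure_P_le_1: "0 \<le> t ==> x \<in> space K ==> emeasure (P t x) A \<le> 1"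
 using prob_space.measure_le_1[OF prob[of t x]] by simp

text \<open>Measurability of one-point sets makes {X t = x} an event, so that probability one
  becomes an almost sure statement.\<close>

lemma start_AE: "0 \<le> t ==> x \<in> space K ==> AE w in P t x. X t w = x"
proof -
 assume t: "0 \<le> t" "x \<in> space K"
 interpret prob_space "P t x" by (rule prob[OF t])
 have "X t \<in> P t x \<rightarrow>\<^sub>M K" using t by (intro measurable_P measurable_X) auto
 hence "X t -` {x} \<inter> space (P t x) \<in> sets (P t x)" using singletons t by (intro measurable_sets)
 hence "{w \<in> \<Omega>. X t w = x} \<in> sets (P t x)" using t by (simp add: vimage_def Int_def conj_commute)
 hence "AE w in P t x. w \<in> {w \<in> \<Omega>. X t w = x}"
  using start[OF t] by (intro prob_eq_1[THEN iffD1]) auto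
 thus ?thesis by (rule AE_mp) auto
qed

lemma X_event: "s \<in> I ==> 0 \<le> s ==> B \<in> sets K ==> {w \<in> \<Omega>. X s w \<in> B} \<in> sets (FA I)"
 using measurable_sets[OF measurable_X, of s I B] by (simp add: vimage_def Int_def conj_commute)

lemma measurable_transition_emeasure:
 assumes "0 \<le> t" "t \<le> s" "B \<in> sets K"
 shows "(\<lambda>y. emeasure (P t y) {w \<in> \<Omega>. X s w \<in> B}) \<in> borel_measurable K"
proof -
 have "(\<lambda>y. ennreal (measure (P t y) {w \<in> \<Omega>. X s w \<in> B})) \<in> borel_measurable K"
  using measurable_transition[OF assms] by measurable
 thus ?thesis
  by (rule measurable_cong[THEN iffD1, rotated])
    (simp add: finite_measure.emeasure_eq_measure[OF prob_space.finite_measure[OF prob[OF assms(1)]]])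
qed

text \<open>Integrating the assumed conditional expectation over an event of the past removes the
  conditioning; this form can be iterated and extended to other events.\<close>

lemma markov_one_time:
 assumes u: "0 \<le> u" "u \<le> t" "t \<le> s" "x \<in> space K" and A: "A \<in> sets (FA {u..t})"
  and B: "B \<in> sets K"
 shows "emeasure (P u x) (A \<inter> {w\<in>\<Omega>. X s w \<in> B}) =
  (\<integral>\<^sup>+ w \<in> A. emeasure (P t (X t w)) {w'\<in>\<Omega>. X s w' \<in> B} \<partial>P u x)"
proof -
 let ?D = "{w\<in>\<Omega>. X s w \<in> B}"
 interpret prob_space "P u x" by (rule prob) (use u in auto)
 have sub: "subalgebra (P u x) (FA {u..t})"
  using sets_P[of u x "{u..t}"] u by (auto simp: subalgebra_def)
 interpret finite_measure_subalgebra "P u x" "FA {u..t}"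
  by unfold_locales (rule sub)
 have D: "?D \<in> sets (P u x)" using u B by (intro sets_P[OF _ _ _ X_event[of s "{u..}"]]) auto
 have A': "A \<in> sets (P u x)" using sets_P[of u x "{u..t}"] u A by auto
 have int: "integrable (P u x) (indicator ?D :: _ => real)"
  using D by (intro integrable_real_indicator) (auto simp: emeasure_eq_measure)
 have AE: "AE w in P u x. real_cond_exp (P u x) (FA {u..t}) (indicator ?D) w =
   measure (P t (X t w)) ?D" by (rule markov[OF u B])
 have Xt: "X t \<in> P u x \<rightarrow>\<^sub>M K" using u by (intro measurable_P measurable_X) auto
 have m[measurable]: "(\<lambda>w. measure (P t (X t w)) ?D) \<in> borel_measurable (P u x)"
  by (rule measurable_compose[OF Xt measurable_transition]) (use u B in auto)
 have le1: "measure (P t (X t w)) ?D \<le> 1" if "w \<in> \<Omega>" for w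
  using prob_space.prob_le_1[OF prob[of t "X t w"]] u state[of t w] that by auto
 have "measure (P u x) (A \<inter> ?D) = (\<integral>w\<in>A. indicator ?D w \<partial>P u x)"
  using A' D by (simp add: set_lebesgue_integral_def indicator_inter_arith[symmetric] sets.Int_space_eq2)
 also have "\<dots> = (\<integral>w\<in>A. real_cond_exp (P u x) (FA {u..t}) (indicator ?D) w \<partial>P u x)"
  by (rule real_cond_exp_intA[OF int A])
 also have "\<dots> = (\<integral>w\<in>A. measure (P t (X t w)) ?D \<partial>P u x)"
  unfolding set_lebesgue_integral_def using AE A'
  by (intro integral_cong_AE) auto
 finally have "emeasure (P u x) (A \<inter> ?D) = ennreal (\<integral>w\<in>A. measure (P t (X t w)) ?D \<partial>P u x)"
  by (simp add: emeasure_eq_measure)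
 also have "\<dots> = (\<integral>\<^sup>+w. ennreal (indicator A w * measure (P t (X t w)) ?D) \<partial>P u x)"
  unfolding set_lebesgue_integral_def real_scaleR_def
 proof (rule nn_integral_eq_integral[symmetric])
  show "integrable (P u x) (\<lambda>w. indicator A w * measure (P t (X t w)) ?D)"
   using A' le1 u by (intro integrable_const_bound[where B=1]) (auto simp: indicator_def)
 qed auto
 also have "\<dots> = (\<integral>\<^sup>+ w \<in> A. emeasure (P t (X t w)) ?D \<partial>P u x)"
 proof (intro nn_integral_cong)
  fix w assume "w \<in> space (P u x)"
  hence "X t w \<in> space K" using u state by simp
  from finite_measure.emeasure_eq_measure[OF prob_space.finite_measure[OF prob[OF _ this]], of t] u
  show "ennreal (indicator A w * measure (P t (X t w)) ?D) = emeasure (P t (X t w)) ?D * indicator A w"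
   by (auto simp: indicator_def)
 qed
 finally show ?thesis .
qed

text \<open>The two sides of \<open>markov_one_time\<close> are the values at B of two measures on
  K: the law of X s restricted to A, and the mixture of the transition kernel over the law of X t
  restricted to A. As the measures coincide, so do their integrals of h.\<close>

lemma markov_function:
 assumes u: "0 \<le> t" "t \<le> s" and h: "h \<in> borel_measurable K"
 shows "(\<lambda>y. \<integral>\<^sup>+w'. h (X s w') \<partial>P t y) \<in> borel_measurable K" (is ?meas)
  and "\<And>u x A. 0 \<le> u ==> u \<le> t ==> x \<in> space K ==> A \<in> sets (FA {u..t}) ==>
   (\<integral>\<^sup>+ w \<in> A. h (X s w) \<partial>P u x) = (\<integral>\<^sup>+ w \<in> A. (\<integral>\<^sup>+w'. h (X s w') \<partial>P t (X t w)) \<partial>P u x)"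
   (is "PROP ?eq")
proof -
 define \<kappa> where "\<kappa> y = distr (P t y) K (X s)" for y
 have XsP: "X s \<in> P u x \<rightarrow>\<^sub>M K" if "0 \<le> u" "u \<le> s" "x \<in> space K" for u x
  using that by (intro measurable_P measurable_X) auto
 have \<kappa>_int: "(\<integral>\<^sup>+z. h z \<partial>\<kappa> y) = (\<integral>\<^sup>+w'. h (X s w') \<partial>P t y)" if "y \<in> space K" for y
  unfolding \<kappa>_def by (rule nn_integral_distr) (use XsP u that h in auto)
 have \<kappa>: "\<kappa> \<in> K \<rightarrow>\<^sub>M subprob_algebra K"
 proof (rule measurable_subprob_algebra)
  fix y assume y: "y \<in> space K"
  interpret prob_space "P t y" by (rule prob[OF u(1) y])
  have "prob_space (\<kappa> y)" unfolding \<kappa>_def by (rule prob_space_distr) (use XsP u y in auto)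
  thus "subprob_space (\<kappa> y)" by (rule prob_space_imp_subprob_space)
 next
  fix B assume B: "B \<in> sets K"
  show "(\<lambda>y. emeasure (\<kappa> y) B) \<in> borel_measurable K"
   by (rule measurable_cong[THEN iffD1, OF _ measurable_transition_emeasure[OF u B]])
     (use XsP u B in \<open>simp add: \<kappa>_def emeasure_distr vimage_def Int_def conj_commute\<close>)
 qed (simp add: \<kappa>_def)
 have "(\<lambda>y. \<integral>\<^sup>+z. h z \<partial>\<kappa> y) \<in> borel_measurable K"
  by (rule nn_integral_measurable_subprob_algebra2[OF _ \<kappa>]) (use h in measurable)
 thus ?meas by (rule measurable_cong[THEN iffD1, rotated]) (rule \<kappa>_int)
 fix v x A assume v: "0 \<le> v" "v \<le> t" "x \<in> space K" and A: "A \<in> sets (FA {v..t})"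
 have A': "A \<in> sets (P v x)" using sets_P[of v x "{v..t}"] v A by auto
 have XtP: "X t \<in> P v x \<rightarrow>\<^sub>M K" using v by (intro measurable_P measurable_X) auto
 \<comment> \<open>Multiplying by the density \<open>indicator A\<close> restricts the probability
   to A before the image under X is taken.\<close>
 define N1 where "N1 = distr (density (P v x) (indicator A)) K (X s)"
 define N2 where "N2 = distr (density (P v x) (indicator A)) K (X t)"
 have eq: "N1 = N2 \<bind> \<kappa>"
 proof (rule measure_eqI)
  have ne: "space N2 \<noteq> {}" using v by (auto simp: N2_def)
  show "sets N1 = sets (N2 \<bind> \<kappa>)"
   by (subst sets_bind[of _ _ K]) (use \<kappa> ne in \<open>auto simp: N1_def N2_def \<kappa>_def\<close>)
  fix B assume "B \<in> sets N1"
  hence B: "B \<in> sets K" by (simp add: N1_def)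
  have Bs: "{w\<in>\<Omega>. X s w \<in> B} \<in> sets (P v x)"
   using B u v by (intro sets_P[OF _ _ _ X_event[of s "{v..}"]]) auto
  have "emeasure N1 B = emeasure (density (P v x) (indicator A)) {w\<in>\<Omega>. X s w \<in> B}"
   unfolding N1_def using XsP u v B
   by (subst emeasure_distr) (auto simp: vimage_def Int_def conj_commute)
  also have "\<dots> = emeasure (P v x) (A \<inter> {w\<in>\<Omega>. X s w \<in> B})"
   using A' Bs by (subst emeasure_density)
    (auto simp: nn_integral_indicator[symmetric] indicator_inter_arith simp del: nn_integral_indicator)
  also have "\<dots> = (\<integral>\<^sup>+ w \<in> A. emeasure (P t (X t w)) {w'\<in>\<Omega>. X s w' \<in> B} \<partial>P v x)"
   by (rule markov_one_time) (use u v A B in auto)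
  also have "\<dots> = (\<integral>\<^sup>+ w \<in> A. emeasure (\<kappa> (X t w)) B \<partial>P v x)"
  proof (intro nn_integral_cong)
   fix w assume "w \<in> space (P v x)"
   hence "X t w \<in> space K" using v u state by simp
   thus "emeasure (P t (X t w)) {w'\<in>\<Omega>. X s w' \<in> B} * indicator A w =
     emeasure (\<kappa> (X t w)) B * indicator A w"
    unfolding \<kappa>_def using XsP u B
    by (subst emeasure_distr) (auto simp: vimage_def Int_def conj_commute)
  qed
  also have "\<dots> = (\<integral>\<^sup>+ y. emeasure (\<kappa> y) B \<partial>N2)"
   unfolding N2_def using XtP A' measurable_emeasure_kernel[OF \<kappa> B]
   by (subst nn_integral_distr) (auto simp: nn_integral_density mult.commute
     intro!: nn_integral_density[symmetric] measurable_compose[OF XtP])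
  also have "\<dots> = emeasure (N2 \<bind> \<kappa>) B"
   by (rule emeasure_bind[symmetric, where N=K]) (use \<kappa> ne B in \<open>auto simp: N2_def\<close>)
  finally show "emeasure N1 B = emeasure (N2 \<bind> \<kappa>) B" .
 qed
 have h\<kappa>: "(\<lambda>y. \<integral>\<^sup>+z. h z \<partial>\<kappa> y) \<in> borel_measurable K" by fact
 have "(\<integral>\<^sup>+ w \<in> A. h (X s w) \<partial>P v x) = (\<integral>\<^sup>+z. h z \<partial>N1)"
  unfolding N1_def using XsP[of v x] u v A' h
  by (subst nn_integral_distr) (auto simp: nn_integral_density mult.commute
     intro!: nn_integral_density[symmetric] measurable_compose[OF XsP[of v x]])
 also have "\<dots> = (\<integral>\<^sup>+y. (\<integral>\<^sup>+z. h z \<partial>\<kappa> y) \<partial>N2)"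
  unfolding eq by (rule nn_integral_bind[OF h]) (use \<kappa> in \<open>simp add: N2_def\<close>)
 also have "\<dots> = (\<integral>\<^sup>+ w \<in> A. (\<integral>\<^sup>+z. h z \<partial>\<kappa> (X t w)) \<partial>P v x)"
  unfolding N2_def using XtP A' h\<kappa>
  by (subst nn_integral_distr) (auto simp: nn_integral_density mult.commute
     intro!: nn_integral_density measurable_compose[OF XtP])
 also have "\<dots> = (\<integral>\<^sup>+ w \<in> A. (\<integral>\<^sup>+w'. h (X s w') \<partial>P t (X t w)) \<partial>P v x)"
 proof (intro nn_integral_cong)
  fix w assume "w \<in> space (P v x)"
  hence "X t w \<in> space K" using v u state by simp
  thus "(\<integral>\<^sup>+z. h z \<partial>\<kappa> (X t w)) * indicator A w =
    (\<integral>\<^sup>+w'. h (X s w') \<partial>P t (X t w)) * indicator A w" by (simp add: \<kappa>_int)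
 qed
 finally show "(\<integral>\<^sup>+ w \<in> A. h (X s w) \<partial>P v x) =
  (\<integral>\<^sup>+ w \<in> A. (\<integral>\<^sup>+w'. h (X s w') \<partial>P t (X t w)) \<partial>P v x)" .
qed

text \<open>Induction removes the smallest time b. The later times leave a function of X b;
  multiplied by the indicator of \<open>B b\<close> it is carried from b back to a by
  \<open>markov_function\<close>. The resulting function of X a is left unnamed, because it depends
  only on the event and is identified afterwards.\<close>

lemma markov_cylinder:
 assumes "finite I" "0 \<le> a" "\<And>i. i \<in> I ==> a \<le> i" "\<And>i. i \<in> I ==> B i \<in> sets K"
 shows "\<exists>v'\<in>borel_measurable K. \<forall>u x A. 0 \<le> u \<longrightarrow> u \<le> a \<longrightarrow> x \<in> space K \<longrightarrow> A \<in> sets (FA {u..a}) \<longrightarrow>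
  emeasure (P u x) (A \<inter> {w\<in>\<Omega>. \<forall>i\<in>I. X i w \<in> B i}) = (\<integral>\<^sup>+ w \<in> A. v' (X a w) \<partial>P u x)"
 using assms
proof (induction I arbitrary: a rule: finite_linorder_min_induct)
 case empty
 have "emeasure (P u x) (A \<inter> {w\<in>\<Omega>. \<forall>i\<in>{}. X i w \<in> B i}) = (\<integral>\<^sup>+ w \<in> A. 1 \<partial>P u x)"
  if "0 \<le> u" "u \<le> a" "x \<in> space K" "A \<in> sets (FA {u..a})" for u x A
 proof -
  have "A \<in> sets (P u x)" using sets_P[of u x "{u..a}"] that by auto
  moreover have "A \<subseteq> \<Omega>" using sets.sets_into_space[OF that(4)] by simp
  ultimately show ?thesis by (simp add: Int_absorb2)
 qed
 thus ?case by (intro bexI[of _ "\<lambda>_. 1"]) auto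
next
 case (insert b I)
 have "a \<le> b" "B b \<in> sets K" using insert.prems(2,3)[of b] by simp_all
 moreover from \<open>a \<le> b\<close> have "0 \<le> b" using insert.prems(1) by (rule order.trans[rotated])
 ultimately have b: "0 \<le> b" "a \<le> b" "B b \<in> sets K" by blast+
 have "\<exists>v'\<in>borel_measurable K. \<forall>u x A. 0 \<le> u \<longrightarrow> u \<le> b \<longrightarrow> x \<in> space K \<longrightarrow> A \<in> sets (FA {u..b}) \<longrightarrow>
  emeasure (P u x) (A \<inter> {w\<in>\<Omega>. \<forall>i\<in>I. X i w \<in> B i}) = (\<integral>\<^sup>+ w \<in> A. v' (X b w) \<partial>P u x)"
 proof (rule insert.IH)
  show "0 \<le> b" by (rule b(1))
  show "b \<le> i" if "i \<in> I" for i using insert.hyps(2) that by (auto intro: less_imp_le)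
  show "B i \<in> sets K" if "i \<in> I" for i using insert.prems(3)[of i] that by simp
 qed
 then obtain v' where v': "v' \<in> borel_measurable K"
  "\<And>u x A. 0 \<le> u ==> u \<le> b ==> x \<in> space K ==> A \<in> sets (FA {u..b}) ==>
  emeasure (P u x) (A \<inter> {w\<in>\<Omega>. \<forall>i\<in>I. X i w \<in> B i}) = (\<integral>\<^sup>+ w \<in> A. v' (X b w) \<partial>P u x)"
  by blast
 define h where "h y = indicator (B b) y * v' y" for y
 have h: "h \<in> borel_measurable K" unfolding h_def[abs_def] using v' b by measurable
 note mf = markov_function[OF insert.prems(1) b(2) h]
 show ?case
 proof (intro bexI[OF _ mf(1)] allI impI)
  fix u x A assume u: "0 \<le> u" "u \<le> a" "x \<in> space K" and A: "A \<in> sets (FA {u..a})"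
  have Ab: "A \<in> sets (FA {u..b})" using A sets_path_algebra_mono[of "{u..a}" "{u..b}" K \<Omega> X] b by auto
  have A': "A \<inter> {w\<in>\<Omega>. X b w \<in> B b} \<in> sets (FA {u..b})"
   using Ab X_event[of b "{u..b}" "B b"] b u by auto
  have "A \<inter> {w\<in>\<Omega>. \<forall>i\<in>insert b I. X i w \<in> B i} =
    A \<inter> {w\<in>\<Omega>. X b w \<in> B b} \<inter> {w\<in>\<Omega>. \<forall>i\<in>I. X i w \<in> B i}" by auto
  hence "emeasure (P u x) (A \<inter> {w\<in>\<Omega>. \<forall>i\<in>insert b I. X i w \<in> B i}) =
    (\<integral>\<^sup>+ w \<in> A \<inter> {w\<in>\<Omega>. X b w \<in> B b}. v' (X b w) \<partial>P u x)"
   using v'(2)[OF _ _ _ A'] u b by simp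
  also have "\<dots> = (\<integral>\<^sup>+ w \<in> A. h (X b w) \<partial>P u x)"
   using sets.sets_into_space[OF A] by (intro nn_integral_cong) (auto simp: h_def indicator_def)
  also have "\<dots> = (\<integral>\<^sup>+ w \<in> A. (\<integral>\<^sup>+ w'. h (X b w') \<partial>P a (X a w)) \<partial>P u x)"
   by (rule mf(2)) (use u A in auto)
  finally show "emeasure (P u x) (A \<inter> {w\<in>\<Omega>. \<forall>i\<in>insert b I. X i w \<in> B i}) =
   (\<integral>\<^sup>+ w \<in> A. (\<integral>\<^sup>+ w'. h (X b w') \<partial>P a (X a w)) \<partial>P u x)" .
 qed
qed

definition cylinders :: "real => 'w set set" where
 "cylinders a = {{w\<in>\<Omega>. \<forall>i\<in>I. X i w \<in> B i} | I B. finite I \<and> I \<subseteq> {a..} \<and> (\<forall>i\<in>I. B i \<in> sets K)}"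

lemma Int_stable_cylinders: "Int_stable (cylinders a)"
proof (rule Int_stableI)
 fix C D assume "C \<in> cylinders a" "D \<in> cylinders a"
 then obtain I B I' B' where C: "C = {w\<in>\<Omega>. \<forall>i\<in>I. X i w \<in> B i}" "finite I" "I \<subseteq> {a..}" "\<forall>i\<in>I. B i \<in> sets K"
  and D: "D = {w\<in>\<Omega>. \<forall>i\<in>I'. X i w \<in> B' i}" "finite I'" "I' \<subseteq> {a..}" "\<forall>i\<in>I'. B' i \<in> sets K"
  unfolding cylinders_def by blast
 define B'' where "B'' i = (if i \<in> I \<and> i \<in> I' then B i \<inter> B' i else if i \<in> I then B i else B' i)" for i
 have "C \<inter> D = {w\<in>\<Omega>. \<forall>i\<in>I \<union> I'. X i w \<in> B'' i}"
  unfolding C D B''_def by auto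
 moreover have "\<forall>i\<in>I \<union> I'. B'' i \<in> sets K" using C(4) D(4) by (auto simp: B''_def)
 moreover have "finite (I \<union> I')" "I \<union> I' \<subseteq> {a..}" using C(2,3) D(2,3) by auto
 ultimately show "C \<inter> D \<in> cylinders a" unfolding cylinders_def by blast
qed

lemma sigma_sets_cylinders: assumes "0 \<le> a" shows "sets (FA {a..}) = sigma_sets \<Omega> (cylinders a)"
 unfolding sets_path_algebra
proof (rule sigma_sets_eqI)
 fix C assume "C \<in> {X t -` A \<inter> \<Omega> |t A. t \<in> {a..} \<and> A \<in> sets K}"
 then obtain t A where "C = X t -` A \<inter> \<Omega>" "t \<in> {a..}" "A \<in> sets K" by blast
 hence "C \<in> cylinders a" unfolding cylinders_def
  by (intro CollectI exI[of _ "{t}"] exI[of _ "\<lambda>_. A"]) auto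
 thus "C \<in> sigma_sets \<Omega> (cylinders a)" by (rule sigma_sets.Basic)
next
 fix C assume "C \<in> cylinders a"
 then obtain I B where C: "C = {w\<in>\<Omega>. \<forall>i\<in>I. X i w \<in> B i}" "finite I" "I \<subseteq> {a..}" "\<forall>i\<in>I. B i \<in> sets K"
  unfolding cylinders_def by blast
 have "{w\<in>space (FA {a..}). \<forall>i\<in>I. X i w \<in> B i} \<in> sets (FA {a..})"
  using C assms by (intro sets.sets_Collect_finite_All) (auto intro!: X_event)
 thus "C \<in> sigma_sets \<Omega> {X t -` A \<inter> \<Omega> |t A. t \<in> {a..} \<and> A \<in> sets K}"
  using C by (simp add: sets_path_algebra)
qed

text \<open>A Dynkin argument starting from cylinders. Measurability of the probability of D in the
  starting state is part of the claim, so the class is formed with an unspecified measurable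
  function v'. Taking u = a and A = \<Omega>, where X a = y almost surely, then shows that v' y is
  that probability.\<close>

lemma markov_event:
 assumes a: "0 \<le> a" and D: "D \<in> sets (FA {a..})"
 shows "(\<lambda>y. emeasure (P a y) D) \<in> borel_measurable K"
  and "\<And>u x A. 0 \<le> u ==> u \<le> a ==> x \<in> space K ==> A \<in> sets (FA {u..a}) ==>
  emeasure (P u x) (A \<inter> D) = (\<integral>\<^sup>+ w \<in> A. emeasure (P a (X a w)) D \<partial>P u x)"
proof -
 define good where "good D \<longleftrightarrow> (\<exists>v'\<in>borel_measurable K. \<forall>u x A. 0 \<le> u \<longrightarrow> u \<le> a \<longrightarrow> x \<in> space K \<longrightarrow>
  A \<in> sets (FA {u..a}) \<longrightarrow> emeasure (P u x) (A \<inter> D) = (\<integral>\<^sup>+ w \<in> A. v' (X a w) \<partial>P u x))" for D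
 have goodI: "good D" if "v' \<in> borel_measurable K" "\<And>u x A. 0 \<le> u ==> u \<le> a ==> x \<in> space K ==>
  A \<in> sets (FA {u..a}) ==> emeasure (P u x) (A \<inter> D) = (\<integral>\<^sup>+ w \<in> A. v' (X a w) \<partial>P u x)" for D v'
  using that unfolding good_def by blast
 have goodD: "(\<lambda>y. emeasure (P a y) D) \<in> borel_measurable K \<and> (\<forall>u x A. 0 \<le> u \<longrightarrow> u \<le> a \<longrightarrow> x \<in> space K \<longrightarrow>
  A \<in> sets (FA {u..a}) \<longrightarrow> emeasure (P u x) (A \<inter> D) = (\<integral>\<^sup>+ w \<in> A. emeasure (P a (X a w)) D \<partial>P u x))"
  if "good D" and D: "D \<in> sets (FA {a..})" for D
 proof -
  from \<open>good D\<close> obtain v' where v': "v' \<in> borel_measurable K"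
   "\<And>u x A. 0 \<le> u ==> u \<le> a ==> x \<in> space K ==>
    A \<in> sets (FA {u..a}) ==> emeasure (P u x) (A \<inter> D) = (\<integral>\<^sup>+ w \<in> A. v' (X a w) \<partial>P u x)"
   unfolding good_def by blast
  have eq: "emeasure (P a y) D = v' y" if y: "y \<in> space K" for y
  proof -
   interpret prob_space "P a y" by (rule prob[OF a y])
   have D': "D \<subseteq> \<Omega>" using sets.sets_into_space[OF D] by simp
   have \<Omega>: "\<Omega> \<in> sets (FA {a..a})" using sets.top[of "FA {a..a}"] by simp
   have "emeasure (P a y) D = (\<integral>\<^sup>+ w \<in> \<Omega>. v' (X a w) \<partial>P a y)"
    using v'(2)[OF a order.refl y \<Omega>] D' by (simp add: Int_absorb1)
   also have "\<dots> = (\<integral>\<^sup>+ w. v' y \<partial>P a y)"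
    by (rule nn_integral_cong_AE) (use start_AE[OF a y] AE_space in eventually_elim, use a y in auto)
   finally show ?thesis by (simp add: emeasure_space_1)
  qed
  have "(\<lambda>y. emeasure (P a y) D) \<in> borel_measurable K"
   by (rule measurable_cong[THEN iffD2, OF eq v'(1)])
  moreover have "emeasure (P u x) (A \<inter> D) = (\<integral>\<^sup>+ w \<in> A. emeasure (P a (X a w)) D \<partial>P u x)"
   if u: "0 \<le> u" "u \<le> a" "x \<in> space K" "A \<in> sets (FA {u..a})" for u x A
   unfolding v'(2)[OF u] using u a
   by (intro nn_integral_cong) (simp add: eq state)
  ultimately show ?thesis by blast
 qed
 have "cylinders a \<subseteq> Pow \<Omega>" by (auto simp: cylinders_def)
 from Int_stable_cylinders this D[unfolded sigma_sets_cylinders[OF a]]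
 have "good D"
 proof (induction rule: sigma_sets_induct_disjoint)
  case (basic D)
  then obtain I B where "D = {w\<in>\<Omega>. \<forall>i\<in>I. X i w \<in> B i}" "finite I" "I \<subseteq> {a..}" "\<forall>i\<in>I. B i \<in> sets K"
   unfolding cylinders_def by blast
  thus ?case unfolding good_def using markov_cylinder[of I a B] a by auto
 next
  case empty
  show ?case by (rule goodI[of "\<lambda>_. 0"]) auto
 next
  case (compl D)
  have D: "D \<in> sets (FA {a..})" using compl(1) by (simp add: sigma_sets_cylinders[OF a])
  note gd = goodD[OF compl(2) D]
  show ?case
  proof (rule goodI[of "\<lambda>y. 1 - emeasure (P a y) D"])
   show "(\<lambda>y. 1 - emeasure (P a y) D) \<in> borel_measurable K"
    by (rule borel_measurable_minus_ennreal[OF borel_measurable_const conjunct1[OF gd]])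
   fix u x A assume u: "0 \<le> u" "u \<le> a" "x \<in> space K" and A: "A \<in> sets (FA {u..a})"
   have A': "A \<in> sets (P u x)" using sets_P[of u x "{u..a}"] u A by auto
   have D': "D \<in> sets (P u x)" using sets_P[of u x "{a..}"] u D by auto
   interpret prob_space "P u x" by (rule prob[OF u(1) u(3)])
   have Xa: "X a \<in> P u x \<rightarrow>\<^sub>M K" using u a by (intro measurable_P measurable_X) auto
   have m: "(\<lambda>w. emeasure (P a (X a w)) D) \<in> borel_measurable (P u x)"
    by (rule measurable_compose[OF Xa]) (use gd in auto)
   have "A \<inter> (\<Omega> - D) = A - A \<inter> D" using sets.sets_into_space[OF A] by auto
   hence "emeasure (P u x) (A \<inter> (\<Omega> - D)) = emeasure (P u x) A - emeasure (P u x) (A \<inter> D)"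
    using A' D' by (simp add: emeasure_Diff)
   also have "\<dots> = (\<integral>\<^sup>+ w. indicator A w \<partial>P u x) - (\<integral>\<^sup>+ w \<in> A. emeasure (P a (X a w)) D \<partial>P u x)"
    using gd u A A' by simp
   also have "\<dots> = (\<integral>\<^sup>+ w. indicator A w - emeasure (P a (X a w)) D * indicator A w \<partial>P u x)"
   proof (rule nn_integral_diff[symmetric])
    have "(\<integral>\<^sup>+ w \<in> A. emeasure (P a (X a w)) D \<partial>P u x) = emeasure (P u x) (A \<inter> D)"
     using gd u A by auto
    thus "(\<integral>\<^sup>+ w \<in> A. emeasure (P a (X a w)) D \<partial>P u x) \<noteq> \<infinity>" by simp
    show "AE w in P u x. emeasure (P a (X a w)) D * indicator A w \<le> indicator A w"
     using emeasure_P_le_1[OF a] state[OF a] u by (intro AE_I2) (auto simp: indicator_def)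
   qed (use A' m in auto)
   also have "\<dots> = (\<integral>\<^sup>+ w \<in> A. (1 - emeasure (P a (X a w)) D) \<partial>P u x)"
    by (intro nn_integral_cong) (auto simp: indicator_def)
   finally show "emeasure (P u x) (A \<inter> (\<Omega> - D)) = (\<integral>\<^sup>+ w \<in> A. (1 - emeasure (P a (X a w)) D) \<partial>P u x)" .
  qed
 next
  case (union D)
  have D: "D i \<in> sets (FA {a..})" for i using union(2) by (auto simp: sigma_sets_cylinders[OF a])
  note gd = goodD[OF union(3) D]
  show ?case
  proof (rule goodI[of "\<lambda>y. \<Sum>i. emeasure (P a y) (D i)"])
   show "(\<lambda>y. \<Sum>i. emeasure (P a y) (D i)) \<in> borel_measurable K"
    by (rule borel_measurable_suminf_order[OF conjunct1[OF gd]])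
   fix u x A assume u: "0 \<le> u" "u \<le> a" "x \<in> space K" and A: "A \<in> sets (FA {u..a})"
   have A': "A \<in> sets (P u x)" using sets_P[of u x "{u..a}"] u A by auto
   have D': "D i \<in> sets (P u x)" for i using sets_P[of u x "{a..}"] u D by auto
   have Xa: "X a \<in> P u x \<rightarrow>\<^sub>M K" using u a by (intro measurable_P measurable_X) auto
   have m: "(\<lambda>w. emeasure (P a (X a w)) (D i)) \<in> borel_measurable (P u x)" for i
    by (rule measurable_compose[OF Xa]) (use gd in auto)
   have "emeasure (P u x) (A \<inter> (\<Union>i. D i)) = emeasure (P u x) (\<Union>i. A \<inter> D i)" by simp
   also have "\<dots> = (\<Sum>i. emeasure (P u x) (A \<inter> D i))"
    using union(1) A' D' by (intro suminf_emeasure[symmetric]) (auto simp: disjoint_family_on_def)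
   also have "\<dots> = (\<Sum>i. \<integral>\<^sup>+ w \<in> A. emeasure (P a (X a w)) (D i) \<partial>P u x)"
    using gd u A by (intro suminf_cong) auto
   also have "\<dots> = (\<integral>\<^sup>+ w. (\<Sum>i. emeasure (P a (X a w)) (D i) * indicator A w) \<partial>P u x)"
    using m A' by (intro nn_integral_suminf[symmetric]) auto
   finally show "emeasure (P u x) (A \<inter> (\<Union>i. D i)) =
     (\<integral>\<^sup>+ w \<in> A. (\<Sum>i. emeasure (P a (X a w)) (D i)) \<partial>P u x)" by simp
  qed
 qed
 from goodD[OF this D]
 show "(\<lambda>y. emeasure (P a y) D) \<in> borel_measurable K"
  and "\<And>u x A. 0 \<le> u ==> u \<le> a ==> x \<in> space K ==> A \<in> sets (FA {u..a}) ==>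
  emeasure (P u x) (A \<inter> D) = (\<integral>\<^sup>+ w \<in> A. emeasure (P a (X a w)) D \<partial>P u x)" by auto
qed

end

section \<open>Measurability of processes\<close>

text \<open>A limit theorem for a target without topology: for a sequence that is eventually
  constant at each point, the preimage under the limit is the lower limit of the preimages.\<close>

lemma measurable_eventually_eq:
 assumes f: "\<And>n::nat. f n \<in> M \<rightarrow>\<^sub>M N" and ev: "\<And>x. x \<in> space M ==> \<forall>\<^sub>F n in sequentially. f n x = g x"
 shows "g \<in> M \<rightarrow>\<^sub>M N"
proof (rule measurableI)
 fix x assume "x \<in> space M"
 from eventually_happens[OF ev[OF this]] obtain n where "f n x = g x" by auto
 thus "g x \<in> space N" using measurable_space[OF f[of n] \<open>x \<in> space M\<close>] by simp
next
 fix A assume A: "A \<in> sets N"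
 have "g -` A \<inter> space M = (\<Union>n. \<Inter>m. f (n + m) -` A \<inter> space M)"
 proof (intro set_eqI iffI)
  fix x assume "x \<in> g -` A \<inter> space M"
  hence x: "x \<in> space M" "g x \<in> A" by auto
  then obtain n where "\<And>m. m \<ge> n ==> f m x = g x" using ev unfolding eventually_sequentially by blast
  thus "x \<in> (\<Union>n. \<Inter>m. f (n + m) -` A \<inter> space M)" using x by (intro UN_I[of n]) auto
 next
  fix x assume "x \<in> (\<Union>n. \<Inter>m. f (n + m) -` A \<inter> space M)"
  then obtain n where x: "x \<in> (\<Inter>m. f (n + m) -` A \<inter> space M)" by blast
  hence xM: "x \<in> space M" by auto
  then obtain N where "\<And>m. m \<ge> N ==> f m x = g x" using ev unfolding eventually_sequentially by blast
  from this[of "n + N"] have "f (n + N) x = g x" by simp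
  moreover have "f (n + N) x \<in> A" using x by auto
  ultimately show "x \<in> g -` A \<inter> space M" using xM by simp
 qed
 also have "\<dots> \<in> sets M"
  by (intro sets.countable_UN sets.countable_INT image_subsetI measurable_sets[OF f A]) simp
 finally show "g -` A \<inter> space M \<in> sets M" .
qed

definition grid_up :: "real => nat => real => real" where
 "grid_up t n s = t + (of_int \<lfloor>(s - t) * 2 ^ n\<rfloor> + 1) / 2 ^ n"

text \<open>The last point of the grid t + k / 2^n strictly before s, whereas \<open>grid_up\<close>
  is the first one strictly after s. Being strictly earlier matters twice: samples there reach the
  left limit even when s is a grid point carrying a jump, and they are known before s, as
  predictability requires.\<close>

definition grid_down :: "real => nat => real => real" where
 "grid_down t n s = t + (of_int \<lceil>(s - t) * 2 ^ n\<rceil> - 1) / 2 ^ n"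

lemma grid_up: fixes s t :: real shows "s < grid_up t n s" "grid_up t n s \<le> s + 1 / 2 ^ n"
proof -
 let ?y = "(s - t) * 2 ^ n"
 have "s - t = ?y / 2 ^ n" by simp
 moreover have "?y < of_int \<lfloor>?y\<rfloor> + 1" using floor_correct[of ?y] by simp
 hence "?y / 2 ^ n < (of_int \<lfloor>?y\<rfloor> + 1) / 2 ^ n" by (rule divide_strict_right_mono) simp
 moreover have "(of_int \<lfloor>?y\<rfloor> + 1) / 2 ^ n \<le> (?y + 1) / 2 ^ n" by (intro divide_right_mono) simp_all
 ultimately show "s < grid_up t n s" "grid_up t n s \<le> s + 1 / 2 ^ n"
  unfolding grid_up_def add_divide_distrib by linarith+
qed

lemma grid_down: "grid_down t n s < s" "s - 1 / 2 ^ n \<le> grid_down t n s"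
proof -
 let ?y = "(s - t) * 2 ^ n"
 have "s - t = ?y / 2 ^ n" by simp
 moreover have "(of_int \<lceil>?y\<rceil> - 1) / 2 ^ n < ?y / 2 ^ n"
  by (rule divide_strict_right_mono[OF ceiling_correct[THEN conjunct1]]) simp
 moreover have "(?y - 1) / 2 ^ n \<le> (of_int \<lceil>?y\<rceil> - 1) / 2 ^ n" by (intro divide_right_mono) simp_all
 ultimately show "grid_down t n s < s" "s - 1 / 2 ^ n \<le> grid_down t n s"
  unfolding grid_down_def diff_divide_distrib by linarith+
qed

lemma grid_down_ge: "t < s ==> t \<le> grid_down t n s"
proof -
 assume "t < s"
 hence "0 < (s - t) * 2 ^ n" by simp
 hence "1 \<le> \<lceil>(s - t) * 2 ^ n\<rceil>" by linarith
 hence "(1::real) \<le> of_int \<lceil>(s - t) * 2 ^ n\<rceil>" by linarith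
 thus ?thesis by (simp add: grid_down_def)
qed

lemma grid_down_eq:
 assumes "t + real k / 2 ^ n < s" "s \<le> t + real (Suc k) / 2 ^ n"
 shows "grid_down t n s = t + real k / 2 ^ n"
proof -
 have "real k < (s - t) * 2 ^ n" "(s - t) * 2 ^ n \<le> real k + 1"
  using assms by (auto simp: field_simps)
 hence "\<lceil>(s - t) * 2 ^ n\<rceil> = int k + 1" by linarith
 thus ?thesis by (simp add: grid_down_def)
qed

lemma ex_grid_down:
 assumes "t < s" shows "\<exists>k. t + real k / 2 ^ n < s \<and> s \<le> t + real (Suc k) / 2 ^ n"
proof -
 let ?y = "(s - t) * 2 ^ n"
 define k where "k = nat (\<lceil>?y\<rceil> - 1)"
 have "0 < ?y" using assms by simp
 hence "real k < ?y" "?y \<le> real k + 1" unfolding k_def by linarith+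
 thus ?thesis by (intro exI[of _ k]) (auto simp: field_simps)
qed

text \<open>Because each grid contains the coarser ones, the point below s can only move up. This
  later makes the number of first jumps per cell increase with n.\<close>

lemma grid_down_mono: "t < s ==> grid_down t n s \<le> grid_down t (Suc n) s"
proof -
 let ?y = "(s - t) * 2 ^ n"
 have "of_int (\<lceil>?y\<rceil> - 1) < ?y" using ceiling_correct[of ?y] by simp
 hence "of_int (2 * (\<lceil>?y\<rceil> - 1)) < 2 * ?y" by simp
 hence "2 * (\<lceil>?y\<rceil> - 1) < \<lceil>2 * ?y\<rceil>" by (simp only: less_ceiling_iff)
 hence "2 * (\<lceil>?y\<rceil> - 1) \<le> \<lceil>2 * ?y\<rceil> - 1" by linarith
 hence "of_int (2 * (\<lceil>?y\<rceil> - 1)) \<le> (of_int (\<lceil>2 * ?y\<rceil> - 1) :: real)" by (simp only: of_int_le_iff)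
 hence "2 * (of_int \<lceil>?y\<rceil> - 1) \<le> (of_int \<lceil>2 * ?y\<rceil> :: real) - 1" by simp
 hence "2 * (of_int \<lceil>?y\<rceil> - 1) / 2 ^ Suc n \<le> (of_int \<lceil>2 * ?y\<rceil> - 1 :: real) / 2 ^ Suc n"
  by (intro divide_right_mono) auto
 moreover have "2 * c / 2 ^ Suc n = c / 2 ^ n" for c :: real by simp
 moreover have "(s - t) * 2 ^ Suc n = 2 * ?y" by simp
 ultimately show ?thesis unfolding grid_down_def by (simp only: add_le_cancel_left)
qed

lemma tendsto_half_powers: "(\<lambda>n. 1 / 2 ^ n :: real) \<longlonglongrightarrow> 0"
 using LIMSEQ_power_zero[of "1 / 2 :: real"] by (simp add: power_one_over)

lemma grid_up_tendsto: "(\<lambda>n. grid_up t n s) \<longlonglongrightarrow> s"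
proof (rule tendsto_sandwich[where f="\<lambda>_. s" and h="\<lambda>n. s + 1 / 2 ^ n"])
 show "(\<lambda>n. s + 1 / 2 ^ n) \<longlonglongrightarrow> s" using tendsto_add[OF tendsto_const tendsto_half_powers, of s] by simp
 show "\<forall>\<^sub>F n in sequentially. s \<le> grid_up t n s" using grid_up(1)[THEN less_imp_le] by simp
 show "\<forall>\<^sub>F n in sequentially. grid_up t n s \<le> s + 1 / 2 ^ n" using grid_up(2) by simp
qed simp

lemma grid_down_tendsto: "(\<lambda>n. grid_down t n s) \<longlonglongrightarrow> s"
proof (rule tendsto_sandwich[where f="\<lambda>n. s - 1 / 2 ^ n" and h="\<lambda>_. s"])
 show "(\<lambda>n. s - 1 / 2 ^ n) \<longlonglongrightarrow> s" using tendsto_diff[OF tendsto_const tendsto_half_powers, of s] by simp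
 show "\<forall>\<^sub>F n in sequentially. grid_down t n s \<le> s" using grid_down(1)[THEN less_imp_le] by simp
 show "\<forall>\<^sub>F n in sequentially. s - 1 / 2 ^ n \<le> grid_down t n s" using grid_down(2) by simp
qed simp

context markov_jump_process
begin

lemma eventually_X_grid_up:
 assumes "w \<in> \<Omega>" "0 \<le> s" "s \<le> b"
 shows "\<forall>\<^sub>F n in sequentially. X (min b (grid_up t n s)) w = X s w"
proof -
 obtain d where d: "d > 0" "\<forall>r\<in>{s..s + d}. X r w = X s w"
  using right_constant[OF assms(1,2)] by blast
 have "\<forall>\<^sub>F n in sequentially. grid_up t n s < s + d"
  using order_tendstoD(2)[OF grid_up_tendsto, of s "s + d" t] d(1) by simp
 thus ?thesis
 proof eventually_elim
  case (elim n)
  hence "min b (grid_up t n s) \<in> {s..s + d}" using grid_up(1)[of s t n] assms(3) by auto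
  with d(2) show ?case by blast
 qed
qed

lemma eventually_X_grid_down:
 assumes "w \<in> \<Omega>" "0 \<le> t" "t < s"
 shows "\<forall>\<^sub>F n in sequentially. X (grid_down t n s) w = left_value X s w"
proof -
 obtain a where a: "t < a" "a < s" "jump_set X w \<inter> {a<..<s} = {}"
  using ex_left_constant[OF assms(1,3)] by blast
 have lv: "left_value X s w = X a w" by (rule left_value_eq) (use a assms in auto)
 have "\<forall>\<^sub>F n in sequentially. a < grid_down t n s"
  using order_tendstoD(1)[OF grid_down_tendsto a(2), of t] by simp
 thus ?thesis
 proof eventually_elim
  case (elim n)
  have "{a<..grid_down t n s} \<subseteq> {a<..<s}" using grid_down(1)[of t n s] by auto
  hence "X (grid_down t n s) w = X a w"
   using a elim assms by (intro constant_without_jump) auto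
  thus ?case using lv by simp
 qed
qed

text \<open>Sampling at the next grid point gives a map with countably many sampling times, hence
  jointly measurable, and right-constancy makes the samples eventually equal to X s. Capping the
  sampling time at b avoids looking beyond [t, b].\<close>

lemma X_joint:
 assumes t: "0 \<le> t" "t \<le> b"
 shows "(\<lambda>(w, s). X s w) \<in> FA {t..b} \<Otimes>\<^sub>M restrict_space borel {t..b} \<rightarrow>\<^sub>M K"
proof (rule measurable_eventually_eq)
 let ?M = "FA {t..b} \<Otimes>\<^sub>M restrict_space borel {t..b}"
 fix n :: nat
 define g where "g = (\<lambda>z :: 'w \<times> real. \<lfloor>(snd z - t) * 2 ^ n\<rfloor> :: int)"
 \<comment> \<open>With \<open>max 0\<close> and \<open>min b\<close> the sampling time lies in
   [t, b] for every integer i, including those that never arise from times in [t, b].\<close>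
 define f where "f i z = X (min b (t + (of_int (max 0 i) + 1) / 2 ^ n)) (fst z)" for i :: int and z :: "'w \<times> real"
 have "snd \<in> ?M \<rightarrow>\<^sub>M borel"
  by (rule measurable_compose[OF measurable_snd]) (rule measurable_restrict_space1, simp)
 hence g: "g \<in> ?M \<rightarrow>\<^sub>M count_space UNIV" unfolding g_def by measurable
 have f: "f i \<in> ?M \<rightarrow>\<^sub>M K" for i
  unfolding f_def using t
  by (intro measurable_compose[OF measurable_fst] measurable_X) (auto intro!: min.boundedI add_increasing2)
 have "(\<lambda>z. f (g z) z) \<in> ?M \<rightarrow>\<^sub>M K"
  by (rule measurable_compose_countable'[OF f g]) auto
 thus "(\<lambda>(w, s). X (min b (grid_up t n s)) w) \<in> ?M \<rightarrow>\<^sub>M K"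
  by (rule measurable_cong[THEN iffD1, rotated])
    (auto simp: f_def g_def grid_up_def space_pair_measure space_restrict_space max_def)
next
 fix z assume "z \<in> space (FA {t..b} \<Otimes>\<^sub>M restrict_space borel {t..b})"
 thus "\<forall>\<^sub>F n in sequentially. (case z of (w, s) => X (min b (grid_up t n s)) w) = (case z of (w, s) => X s w)"
  using eventually_X_grid_up t by (auto simp: space_pair_measure space_restrict_space)
qed

lemma FA_subset: "A \<in> sets (FA I) ==> A \<subseteq> \<Omega>"
 using sets.sets_into_space[of A "FA I"] by simp

lemma space_progressive [simp]: "space (GA t) = \<Omega> \<times> {t..T}"
 unfolding progressive_algebra_def by (rule space_measure_of) auto

lemma sets_progressive:
 "sets (GA t) = sigma_sets (\<Omega> \<times> {t..T}) {B. B \<subseteq> \<Omega> \<times> {t..T} \<and>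
  (\<forall>s\<in>{t..T}. B \<inter> (\<Omega> \<times> {t..s}) \<in> sets (FA {t..s} \<Otimes>\<^sub>M restrict_space borel {t..s}))}"
 unfolding progressive_algebra_def by (rule sets_measure_of) auto

definition pred_rects :: "real => ('w \<times> real) set set" where
 "pred_rects t = {A \<times> {t} | A. A \<in> sets (FA {t..t})} \<union>
   {A \<times> {s<..u} | A s u. t \<le> s \<and> s \<le> u \<and> u \<le> T \<and> A \<in> sets (FA {t..s})}"

lemma pred_rects_subset: "t \<le> T ==> pred_rects t \<subseteq> Pow (\<Omega> \<times> {t..T})"
 unfolding pred_rects_def by (fastforce dest: FA_subset)

lemma space_predictable: "t \<le> T ==> space (PA t) = \<Omega> \<times> {t..T}"
 unfolding predictable_algebra_def pred_rects_def[symmetric]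
 by (rule space_measure_of[OF pred_rects_subset])

lemma sets_predictable: "t \<le> T ==>
 sets (PA t) = sigma_sets (\<Omega> \<times> {t..T}) (pred_rects t)"
 unfolding predictable_algebra_def pred_rects_def[symmetric]
 by (rule sets_measure_of[OF pred_rects_subset])

lemma progressive_section:
 assumes s: "s \<in> {t..T}" and f: "f \<in> GA t \<rightarrow>\<^sub>M N"
 shows "(\<lambda>w. f (w, s)) \<in> FA {t..s} \<rightarrow>\<^sub>M N"
proof -
 have "(\<lambda>w. (w, s)) \<in> FA {t..s} \<rightarrow>\<^sub>M GA t"
  unfolding progressive_algebra_def
 proof (rule measurable_measure_of)
  fix B assume B: "B \<in> {B. B \<subseteq> \<Omega> \<times> {t..T} \<and> (\<forall>s\<in>{t..T}. B \<inter> (\<Omega> \<times> {t..s}) \<in>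
   sets (FA {t..s} \<Otimes>\<^sub>M restrict_space borel {t..s}))}"
  have "(\<lambda>w. (w, s)) -` (B \<inter> (\<Omega> \<times> {t..s})) \<in> sets (FA {t..s})"
   using B s by (intro sets_Pair2) auto
  moreover have "(\<lambda>w. (w, s)) -` B \<inter> space (FA {t..s}) = (\<lambda>w. (w, s)) -` (B \<inter> (\<Omega> \<times> {t..s}))"
   using s by (simp add: set_eq_iff)
  ultimately show "(\<lambda>w. (w, s)) -` B \<inter> space (FA {t..s}) \<in> sets (FA {t..s})" by (simp only:)
 qed (use s in auto)
 from measurable_compose[OF this f] show ?thesis .
qed

lemma measurable_progressive_product:
 assumes "t \<le> T" "f \<in> GA t \<rightarrow>\<^sub>M N"
 shows "f \<in> FA {t..T} \<Otimes>\<^sub>M restrict_space borel {t..T} \<rightarrow>\<^sub>M N"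
proof -
 have "(\<lambda>z. z) \<in> FA {t..T} \<Otimes>\<^sub>M restrict_space borel {t..T} \<rightarrow>\<^sub>M GA t"
  unfolding progressive_algebra_def
 proof (rule measurable_measure_of)
  fix B assume B: "B \<in> {B. B \<subseteq> \<Omega> \<times> {t..T} \<and> (\<forall>s\<in>{t..T}. B \<inter> (\<Omega> \<times> {t..s}) \<in>
   sets (FA {t..s} \<Otimes>\<^sub>M restrict_space borel {t..s}))}"
  have "B \<inter> (\<Omega> \<times> {t..T}) \<in> sets (FA {t..T} \<Otimes>\<^sub>M restrict_space borel {t..T})"
   using B assms(1) by simp
  thus "(\<lambda>z. z) -` B \<inter> space (FA {t..T} \<Otimes>\<^sub>M restrict_space borel {t..T}) \<in>
    sets (FA {t..T} \<Otimes>\<^sub>M restrict_space borel {t..T})"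
   by (simp add: space_pair_measure space_restrict_space)
 qed (auto simp: space_pair_measure space_restrict_space)
 from measurable_compose[OF this assms(2)] show ?thesis by simp
qed

lemma measurable_predictable_product:
 assumes "0 \<le> t" "t \<le> T" "f \<in> PA t \<rightarrow>\<^sub>M N"
 shows "f \<in> FA {t..T} \<Otimes>\<^sub>M restrict_space borel {t..T} \<rightarrow>\<^sub>M N"
proof -
 have "(\<lambda>z. z) \<in> FA {t..T} \<Otimes>\<^sub>M restrict_space borel {t..T} \<rightarrow>\<^sub>M PA t"
 proof (rule measurable_sigma_sets[OF sets_predictable[OF assms(2)] pred_rects_subset[OF assms(2)]])
  fix B assume B: "B \<in> pred_rects t"
  then obtain A S where AS: "B = A \<times> S" "A \<in> sets (FA {t..T})" "S \<in> sets borel" "S \<subseteq> {t..T}"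
  proof -
   from B consider A where "B = A \<times> {t}" "A \<in> sets (FA {t..t})"
    | A s u where "B = A \<times> {s<..u}" "t \<le> s" "s \<le> u" "u \<le> T" "A \<in> sets (FA {t..s})"
    unfolding pred_rects_def by blast
   thus thesis
   proof cases
    case 1
    hence "A \<in> sets (FA {t..T})"
     using sets_path_algebra_mono[of "{t..t}" "{t..T}" K \<Omega> X] assms by auto
    thus ?thesis using that[of A "{t}"] 1 assms by auto
   next
    case 2
    hence "A \<in> sets (FA {t..T})"
     using sets_path_algebra_mono[of "{t..s}" "{t..T}" K \<Omega> X] by auto
    moreover have "{s<..u} \<subseteq> {t..T}" using 2 by auto
    ultimately show ?thesis using that[of A "{s<..u}"] 2(1) by simp
   qed
  qed
  have "A \<times> S \<in> sets (FA {t..T} \<Otimes>\<^sub>M restrict_space borel {t..T})"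
   using AS by (intro pair_measureI) (auto simp: sets_restrict_space_iff)
  moreover have "(\<lambda>z. z) -` B \<inter> space (FA {t..T} \<Otimes>\<^sub>M restrict_space borel {t..T}) = A \<times> S"
   using AS FA_subset[of A] by (auto simp: space_pair_measure space_restrict_space)
  ultimately show "(\<lambda>z. z) -` B \<inter> space (FA {t..T} \<Otimes>\<^sub>M restrict_space borel {t..T}) \<in>
    sets (FA {t..T} \<Otimes>\<^sub>M restrict_space borel {t..T})" by (simp only:)
 qed (auto simp: space_pair_measure space_restrict_space)
 from measurable_compose[OF this assms(3)] show ?thesis by simp
qed

lemma X_progressive:
 assumes t: "0 \<le> t"
 shows "(\<lambda>(w, s). X s w) \<in> GA t \<rightarrow>\<^sub>M K"
proof (rule measurableI)
 fix A assume A: "A \<in> sets K"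
 let ?B = "(\<lambda>(w, s). X s w) -` A \<inter> (\<Omega> \<times> {t..T})"
 have "?B \<inter> (\<Omega> \<times> {t..s}) \<in> sets (FA {t..s} \<Otimes>\<^sub>M restrict_space borel {t..s})" if s: "s \<in> {t..T}" for s
 proof -
  have "t \<le> s" using s by simp
  from measurable_sets[OF X_joint[OF t this] A]
  have "(\<lambda>(w, s). X s w) -` A \<inter> (\<Omega> \<times> {t..s}) \<in> sets (FA {t..s} \<Otimes>\<^sub>M restrict_space borel {t..s})"
   by (simp add: space_pair_measure space_restrict_space)
  moreover have "?B \<inter> (\<Omega> \<times> {t..s}) = (\<lambda>(w, s). X s w) -` A \<inter> (\<Omega> \<times> {t..s})" using s by auto
  ultimately show ?thesis by (simp only:)
 qed
 thus "(\<lambda>(w, s). X s w) -` A \<inter> space (GA t) \<in> sets (GA t)"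
  unfolding sets_progressive space_progressive by (intro sigma_sets.Basic) blast
qed (use t state in auto)

lemma time_progressive: "0 \<le> t ==> snd \<in> GA t \<rightarrow>\<^sub>M restrict_space borel {0..T}"
proof (rule measurableI)
 fix A assume t: "0 \<le> t" and "A \<in> sets (restrict_space borel {0..T})"
 hence A: "A \<in> sets borel" by (auto simp: sets_restrict_space_iff)
 have "(\<Omega> \<times> (A \<inter> {t..T})) \<inter> (\<Omega> \<times> {t..s}) \<in> sets (FA {t..s} \<Otimes>\<^sub>M restrict_space borel {t..s})"
  if s: "s \<in> {t..T}" for s
 proof -
  have "\<Omega> \<in> sets (FA {t..s})" using sets.top[of "FA {t..s}"] by simp
  hence "\<Omega> \<times> (A \<inter> {t..s}) \<in> sets (FA {t..s} \<Otimes>\<^sub>M restrict_space borel {t..s})"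
   using A by (intro pair_measureI) (auto simp: sets_restrict_space_iff)
  moreover have "(\<Omega> \<times> (A \<inter> {t..T})) \<inter> (\<Omega> \<times> {t..s}) = \<Omega> \<times> (A \<inter> {t..s})" using s by auto
  ultimately show ?thesis by (simp only:)
 qed
 moreover have "snd -` A \<inter> (\<Omega> \<times> {t..T}) = \<Omega> \<times> (A \<inter> {t..T})" by auto
 ultimately show "snd -` A \<inter> space (GA t) \<in> sets (GA t)"
  unfolding sets_progressive space_progressive by (intro sigma_sets.Basic) auto
qed (auto simp: space_restrict_space)

text \<open>A process sampled at the preceding grid point is constant in time on each cell, with a
  value known at the left end of the cell. Preimages are therefore countable unions of generating
  rectangles, together with the slice at time t; \<open>max t\<close> covers that slice, where the
  preceding grid point lies before t.\<close>

lemma predictable_grid: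
 assumes t: "0 \<le> t" "t \<le> T" and h: "\<And>s. s \<in> {t..T} ==> h s \<in> FA {t..s} \<rightarrow>\<^sub>M N"
 shows "(\<lambda>(w, s). h (max t (grid_down t n s)) w) \<in> PA t \<rightarrow>\<^sub>M N"
proof (rule measurableI)
 fix z assume "z \<in> space (PA t)"
 then obtain w s where z: "z = (w, s)" "w \<in> \<Omega>" "s \<in> {t..T}" using t by (auto simp: space_predictable)
 hence "max t (grid_down t n s) \<in> {t..T}" using grid_down(1)[of t n s] t by auto
 from measurable_space[OF h[OF this], of w] z show "(case z of (w, s) => h (max t (grid_down t n s)) w) \<in> space N"
  by simp
next
 fix B assume B: "B \<in> sets N"
 define \<tau> where "\<tau> k = t + real k / 2 ^ n" for k
 define E where "E s = h s -` B \<inter> \<Omega>" for s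
 have E: "E s \<in> sets (FA {t..s})" if "s \<in> {t..T}" for s
  unfolding E_def using measurable_sets[OF h[OF that] B] by simp
 define R where "R k = (if \<tau> k \<le> T then E (\<tau> k) \<times> {\<tau> k<..min T (\<tau> (Suc k))} else {})" for k
 have \<tau>: "t \<le> \<tau> k" "\<tau> k \<le> \<tau> (Suc k)" for k by (auto simp: \<tau>_def divide_right_mono)
 have gt: "max t (grid_down t n t) = t" using grid_down(1)[of t n t] by simp
 have eq: "(\<lambda>(w, s). h (max t (grid_down t n s)) w) -` B \<inter> (\<Omega> \<times> {t..T}) = E t \<times> {t} \<union> (\<Union>k. R k)"
  (is "?L = ?R")
 proof (rule set_eqI)
  fix z :: "'w \<times> real"
  obtain w s where z: "z = (w, s)" by (cases z)
  consider "s = t" | "s < t \<or> T < s" | "t < s" "s \<le> T" by fastforce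
  thus "z \<in> ?L \<longleftrightarrow> z \<in> ?R"
  proof cases
   case 1
   hence "z \<notin> R k" for k using \<tau>(1)[of k] by (simp add: z R_def)
   hence "z \<notin> (\<Union>k. R k)" by blast
   thus ?thesis using 1 t by (auto simp: z E_def gt)
  next
   case 2
   have "z \<notin> R k" for k using 2 \<tau>(1)[of k] by (cases "s < t") (auto simp: z R_def)
   hence "z \<notin> (\<Union>k. R k)" by blast
   thus ?thesis using 2 t by (auto simp: z)
  next
   case 3
   obtain k where k: "\<tau> k < s" "s \<le> \<tau> (Suc k)" using ex_grid_down[OF 3(1), of n] by (auto simp: \<tau>_def)
   hence gd: "grid_down t n s = \<tau> k" using grid_down_eq[of t k n s] by (auto simp: \<tau>_def)
   have "z \<in> R j \<longleftrightarrow> j = k \<and> w \<in> E (\<tau> k)" for j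
   proof
    assume "z \<in> R j"
    hence j: "\<tau> j < s" "s \<le> \<tau> (Suc j)" "w \<in> E (\<tau> j)" by (auto simp: R_def z split: if_splits)
    hence "grid_down t n s = \<tau> j" using grid_down_eq[of t j n s] by (auto simp: \<tau>_def)
    with gd have "j = k" by (simp add: \<tau>_def)
    with j show "j = k \<and> w \<in> E (\<tau> k)" by simp
   next
    assume "j = k \<and> w \<in> E (\<tau> k)"
    thus "z \<in> R j" using k 3 by (auto simp: R_def z)
   qed
   hence "z \<in> (\<Union>k. R k) \<longleftrightarrow> w \<in> E (\<tau> k)" by auto
   moreover have "max t (grid_down t n s) = \<tau> k" using gd \<tau>(1)[of k] by simp
   ultimately show ?thesis using 3 by (auto simp: z E_def)
  qed
 qed
 have "E t \<times> {t} \<in> pred_rects t"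
  unfolding pred_rects_def using E[of t] t by auto
 moreover have "R k \<in> sigma_sets (\<Omega> \<times> {t..T}) (pred_rects t)" for k
 proof (cases "\<tau> k \<le> T")
  case True
  have "E (\<tau> k) \<times> {\<tau> k<..min T (\<tau> (Suc k))} \<in> pred_rects t"
   unfolding pred_rects_def using True E[of "\<tau> k"] \<tau>[of k]
   by (intro UnI2 CollectI exI[of _ "E (\<tau> k)"] exI[of _ "\<tau> k"] exI[of _ "min T (\<tau> (Suc k))"] conjI) auto
  thus ?thesis unfolding R_def using True by (auto intro: sigma_sets.Basic)
 qed (auto simp: R_def sigma_sets.Empty)
 ultimately have "E t \<times> {t} \<union> (\<Union>k. R k) \<in> sets (PA t)"
  unfolding sets_predictable[OF t(2), symmetric]
  by (intro sets.Un sets.countable_UN) (auto simp: sets_predictable[OF t(2)] intro: sigma_sets.Basic)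
 thus "(\<lambda>(w, s). h (max t (grid_down t n s)) w) -` B \<inter> space (PA t) \<in>
   sets (PA t)"
  by (simp add: space_predictable[OF t(2)] eq)
qed

lemma time_predictable:
 assumes t: "0 \<le> t" "t \<le> T"
 shows "snd \<in> PA t \<rightarrow>\<^sub>M restrict_space borel {0..T}"
proof (rule measurable_restrict_space2)
 show "snd \<in> borel_measurable (PA t)"
 proof (rule borel_measurable_LIMSEQ_real)
  show "(\<lambda>(w, s). max t (grid_down t n s)) \<in> borel_measurable (PA t)" for n
   using predictable_grid[OF t, of "\<lambda>s _. s" borel n] by simp
  fix z assume "z \<in> space (PA t)"
  hence "t \<le> snd z" using t by (auto simp: space_predictable)
  hence "(\<lambda>n. max t (grid_down t n (snd z))) \<longlonglongrightarrow> snd z"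
   using tendsto_max[OF tendsto_const grid_down_tendsto, of t t "snd z"] by (simp add: max_def split: if_splits)
  thus "(\<lambda>n. case z of (w, s) => max t (grid_down t n s)) \<longlonglongrightarrow> snd z" by (simp add: case_prod_beta)
 qed
qed (use t in \<open>auto simp: space_predictable\<close>)

text \<open>At time t itself the left limit would refer to times before t, which the filtration
  started at t does not see; there the value X t is used instead.\<close>

definition X_minus :: "real => real => 'w => 'k" where
 "X_minus t s w = (if s \<le> t then X t w else left_value X s w)"

lemma X_minus_predictable:
 assumes t: "0 \<le> t" "t \<le> T"
 shows "(\<lambda>(w, s). X_minus t s w) \<in> PA t \<rightarrow>\<^sub>M K"
proof (rule measurable_eventually_eq)
 show "(\<lambda>(w, s). X (max t (grid_down t n s)) w) \<in> PA t \<rightarrow>\<^sub>M K" for n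
  using t by (intro predictable_grid measurable_X) auto
 fix z assume "z \<in> space (PA t)"
 then obtain w s where z: "z = (w, s)" "w \<in> \<Omega>" "s \<in> {t..T}" using t by (auto simp: space_predictable)
 show "\<forall>\<^sub>F n in sequentially. (case z of (w, s) => X (max t (grid_down t n s)) w) =
   (case z of (w, s) => X_minus t s w)"
 proof (cases "s = t")
  case True
  moreover have "max t (grid_down t n t) = t" for n using grid_down(1)[of t n t] by simp
  ultimately show ?thesis by (simp add: z X_minus_def)
 next
  case False
  hence s: "t < s" using z by auto
  have "max t (grid_down t n s) = grid_down t n s" for n using grid_down_ge[OF s, of n] by simp
  thus ?thesis
   using eventually_X_grid_down[OF z(2) t(1) s] s by (simp add: z(1) X_minus_def)
 qed
qed

end

section \<open>Measurable dependence of integrals against the rates\<close>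

context rate_measure
begin

text \<open>Adding 1 makes the bound positive, so that one can divide by it even if all rates
  vanish.\<close>

definition rate_bound :: real where
 "rate_bound = enn2real (SUP (t, x) \<in> {0..T} \<times> space K. emeasure (\<nu> t x) (space K)) + 1"

lemma rate_bound_pos: "0 < rate_bound"
 by (simp add: rate_bound_def add_nonneg_pos)

lemma rate_le: "t \<in> {0..T} ==> x \<in> space K ==> emeasure (\<nu> t x) (space K) \<le> ennreal rate_bound"
proof -
 let ?S = "SUP (t, x) \<in> {0..T} \<times> space K. emeasure (\<nu> t x) (space K)"
 assume "t \<in> {0..T}" "x \<in> space K"
 hence "emeasure (\<nu> t x) (space K) \<le> ?S" by (intro SUP_upper2[of "(t, x)"]) auto
 also have "?S = ennreal (enn2real ?S)" using bounded_rate by simp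
 also have "\<dots> \<le> ennreal rate_bound" unfolding rate_bound_def by (intro ennreal_leI) simp
 finally show ?thesis .
qed

lemma space_rate: "0 \<le> t ==> x \<in> space K ==> space (\<nu> t x) = space K"
 using sets_eq_imp_space_eq[OF sets_rate] .

lemma finite_rate: "t \<in> {0..T} ==> x \<in> space K ==> finite_measure (\<nu> t x)"
 using rate_le[of t x] space_rate[of t x]
 by (intro finite_measureI) (auto simp: top_unique)

lemma measurable_rate_iff: "0 \<le> t ==> x \<in> space K ==> f \<in> \<nu> t x \<rightarrow>\<^sub>M N \<longleftrightarrow> f \<in> K \<rightarrow>\<^sub>M N"
 using sets_rate[of t x] by (simp cong: measurable_cong_sets)

text \<open>Divided by \<open>rate_bound\<close>, the rates become a measurable kernel of
  subprobabilities, whose integrals depend measurably on the parameter; the constant is restored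
  afterwards.\<close>

lemma kernel_nn_measurable:
 assumes i: "i \<in> S \<rightarrow>\<^sub>M restrict_space borel {0..T}" and \<xi>: "\<xi> \<in> S \<rightarrow>\<^sub>M K"
  and h: "(\<lambda>(w, y). h w y) \<in> borel_measurable (S \<Otimes>\<^sub>M K)"
 shows "(\<lambda>w. \<integral>\<^sup>+y. h w y \<partial>\<nu> (i w) (\<xi> w)) \<in> borel_measurable S"
proof -
 define c where "c = ennreal (1 / rate_bound)"
 define \<kappa> where "\<kappa> w = scale_measure c (\<nu> (i w) (\<xi> w))" for w
 have dom: "i w \<in> {0..T}" "\<xi> w \<in> space K" if "w \<in> space S" for w
  using measurable_space[OF i that] measurable_space[OF \<xi> that] by (auto simp: space_restrict_space)
 have ib: "i \<in> borel_measurable S" using i by (simp add: measurable_restrict_space2_iff)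
 have "(\<lambda>w. (i w, \<xi> w)) \<in> S \<rightarrow>\<^sub>M restrict_space borel {0..} \<Otimes>\<^sub>M K"
  using dom by (intro measurable_Pair measurable_restrict_space2 ib \<xi>) auto
 from measurable_compose[OF this measurable_rate]
 have em: "(\<lambda>w. emeasure (\<nu> (i w) (\<xi> w)) A) \<in> borel_measurable S" if "A \<in> sets K" for A
  using that by simp
 have \<kappa>: "\<kappa> \<in> S \<rightarrow>\<^sub>M subprob_algebra K"
 proof (rule measurable_subprob_algebra)
  fix w assume w: "w \<in> space S"
  show "sets (\<kappa> w) = sets K" using dom[OF w] by (simp add: \<kappa>_def sets_rate)
  show "subprob_space (\<kappa> w)"
  proof (rule subprob_spaceI)
   have "emeasure (\<kappa> w) (space (\<kappa> w)) = c * emeasure (\<nu> (i w) (\<xi> w)) (space K)"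
    using dom[OF w] by (simp add: \<kappa>_def space_scale_measure space_rate)
   also have "\<dots> \<le> c * ennreal rate_bound" using rate_le[OF dom[OF w]] by (rule mult_left_mono) simp
   also have "\<dots> = 1" using rate_bound_pos by (simp add: c_def ennreal_mult[symmetric])
   finally show "emeasure (\<kappa> w) (space (\<kappa> w)) \<le> 1" .
   show "space (\<kappa> w) \<noteq> {}" using dom[OF w] by (auto simp: \<kappa>_def space_scale_measure space_rate)
  qed
 next
  fix A assume "A \<in> sets K"
  from em[OF this] show "(\<lambda>w. emeasure (\<kappa> w) A) \<in> borel_measurable S"
   unfolding \<kappa>_def by simp
 qed
 have "(\<lambda>w. ennreal rate_bound * (\<integral>\<^sup>+y. h w y \<partial>\<kappa> w)) \<in> borel_measurable S"
  by (intro borel_measurable_times_ennreal borel_measurable_const nn_integral_measurable_subprob_algebra2[OF h \<kappa>])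
 moreover have "ennreal rate_bound * (\<integral>\<^sup>+y. h w y \<partial>\<kappa> w) = (\<integral>\<^sup>+y. h w y \<partial>\<nu> (i w) (\<xi> w))"
  if w: "w \<in> space S" for w
 proof -
  have "h w \<in> borel_measurable (\<nu> (i w) (\<xi> w))"
   using dom[OF w] measurable_compose[OF measurable_Pair1'[OF w] h] by (simp add: measurable_rate_iff)
  hence "(\<integral>\<^sup>+y. h w y \<partial>\<kappa> w) = c * (\<integral>\<^sup>+y. h w y \<partial>\<nu> (i w) (\<xi> w))"
   unfolding \<kappa>_def by (rule nn_integral_scale_measure)
  thus ?thesis using rate_bound_pos
   by (simp add: c_def mult.assoc[symmetric] ennreal_mult[symmetric])
 qed
 ultimately show ?thesis by (rule measurable_cong[THEN iffD1, rotated])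
qed

text \<open>Where the integral of the absolute value is finite, the integral is a difference of two
  nonnegative ones; the other branch reproduces the default value 0 of a non-integrable
  function.\<close>

lemma kernel_integral_measurable:
 fixes h :: "'s => 'k => real"
 assumes i: "i \<in> S \<rightarrow>\<^sub>M restrict_space borel {0..T}" and \<xi>: "\<xi> \<in> S \<rightarrow>\<^sub>M K"
  and h: "(\<lambda>(w, y). h w y) \<in> borel_measurable (S \<Otimes>\<^sub>M K)"
 shows "(\<lambda>w. \<integral>y. h w y \<partial>\<nu> (i w) (\<xi> w)) \<in> borel_measurable S"
proof -
 have dom: "i w \<in> {0..T}" "\<xi> w \<in> space K" if "w \<in> space S" for w
  using measurable_space[OF i that] measurable_space[OF \<xi> that] by (auto simp: space_restrict_space)
 have n: "(\<lambda>w. \<integral>\<^sup>+y. ennreal (norm (h w y)) \<partial>\<nu> (i w) (\<xi> w)) \<in> borel_measurable S"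
  "(\<lambda>w. \<integral>\<^sup>+y. ennreal (h w y) \<partial>\<nu> (i w) (\<xi> w)) \<in> borel_measurable S"
  "(\<lambda>w. \<integral>\<^sup>+y. ennreal (- h w y) \<partial>\<nu> (i w) (\<xi> w)) \<in> borel_measurable S"
  using h by (intro kernel_nn_measurable[OF i \<xi>]; simp add: case_prod_beta')+
 have "(\<lambda>w. if (\<integral>\<^sup>+y. ennreal (norm (h w y)) \<partial>\<nu> (i w) (\<xi> w)) < \<infinity> then
   enn2real (\<integral>\<^sup>+y. ennreal (h w y) \<partial>\<nu> (i w) (\<xi> w)) - enn2real (\<integral>\<^sup>+y. ennreal (- h w y) \<partial>\<nu> (i w) (\<xi> w))
   else 0) \<in> borel_measurable S"
  using n by measurable
 moreover have "(if (\<integral>\<^sup>+y. ennreal (norm (h w y)) \<partial>\<nu> (i w) (\<xi> w)) < \<infinity> then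
   enn2real (\<integral>\<^sup>+y. ennreal (h w y) \<partial>\<nu> (i w) (\<xi> w)) - enn2real (\<integral>\<^sup>+y. ennreal (- h w y) \<partial>\<nu> (i w) (\<xi> w))
   else 0) = (\<integral>y. h w y \<partial>\<nu> (i w) (\<xi> w))" if w: "w \<in> space S" for w
 proof -
  have m: "h w \<in> borel_measurable (\<nu> (i w) (\<xi> w))"
   using dom[OF w] measurable_compose[OF measurable_Pair1'[OF w] h] by (simp add: measurable_rate_iff)
  show ?thesis
  proof (cases "integrable (\<nu> (i w) (\<xi> w)) (h w)")
   case True
   thus ?thesis using real_lebesgue_integral_def[OF True] by (auto simp: integrable_iff_bounded)
  next
   case False
   thus ?thesis using m by (simp add: not_integrable_integral_eq integrable_iff_bounded)
  qed
 qed
 ultimately show ?thesis by (rule measurable_cong[THEN iffD1, rotated])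
qed

end

section \<open>The compensator of the jump measure\<close>

lemma nn_integral_split_Ioc:
 fixes f :: "real => ennreal" and a b :: real
 assumes [measurable]: "f \<in> borel_measurable borel" and "a \<le> b"
 shows "(\<integral>\<^sup>+s\<in>{s. a < s}. f s \<partial>lborel) = (\<integral>\<^sup>+s\<in>{a<..b}. f s \<partial>lborel) + (\<integral>\<^sup>+s\<in>{s. b < s}. f s \<partial>lborel)"
proof -
 have "(\<integral>\<^sup>+s\<in>{s. a < s}. f s \<partial>lborel) = (\<integral>\<^sup>+s. f s * indicator {a<..b} s + f s * indicator {s. b < s} s \<partial>lborel)"
 proof (rule nn_integral_cong)
  fix s
  show "f s * indicator {s. a < s} s = f s * indicator {a<..b} s + f s * indicator {s. b < s} s"
   using assms(2) by (cases "a < s"; cases "s \<le> b") (auto simp: indicator_def not_le)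
 qed
 also have "\<dots> = (\<integral>\<^sup>+s\<in>{a<..b}. f s \<partial>lborel) + (\<integral>\<^sup>+s\<in>{s. b < s}. f s \<partial>lborel)"
  by (rule nn_integral_add) auto
 finally show ?thesis .
qed

lemma exp_minus_le_1: "exp_minus a \<le> 1"
 by (auto simp: exp_minus_def ennreal_le_1)

lemma mult_exp_minus_le: "c * exp_minus a \<le> c"
 using mult_left_mono[OF exp_minus_le_1, of c a] by simp

lemma exp_minus_ge: "a \<le> ennreal c ==> 0 \<le> c ==> ennreal (exp (- c)) \<le> exp_minus a"
proof -
 assume a: "a \<le> ennreal c" "0 \<le> c"
 hence "a \<noteq> \<infinity>" by (auto simp: top_unique)
 moreover have "enn2real a \<le> c" using a by (intro enn2real_leI) auto
 ultimately show ?thesis by (auto simp: exp_minus_def intro!: ennreal_leI)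
qed

lemma measurable_exp_minus [measurable]: "exp_minus \<in> borel_measurable borel"
 unfolding exp_minus_def[abs_def] by measurable

context markov_jump_process
begin

text \<open>The first jump after a occurs by time b and leads into B. Half-open intervals are used
  because the cells (a, b] of a grid tile without overlap.\<close>

definition first_in :: "real => real => 'k set => 'w set" where
 "first_in a b B = {w\<in>\<Omega>. \<exists>j\<in>jump_set X w. a < j \<and> j \<le> b \<and> jump_set X w \<inter> {a<..<j} = {} \<and> X j w \<in> B}"

lemma first_jump_after_eq:
 assumes "0 \<le> a"
 shows "{w \<in> \<Omega>. ereal c < jump_time X a w 1 \<and> jump_time X a w 1 < \<infinity> \<and>
   X (real_of_ereal (jump_time X a w 1)) w \<in> B} =
  {w \<in> \<Omega>. \<exists>j. jump_time X a w 1 = ereal j \<and> c < j \<and> X j w \<in> B}" (is "?L = ?R")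
proof (rule set_eqI)
 fix w
 show "w \<in> ?L \<longleftrightarrow> w \<in> ?R"
 proof (cases "w \<in> \<Omega>")
  case True
  from jump_time_cases[OF True assms, of 1]
  consider "jump_time X a w 1 = \<infinity>" | j where "jump_time X a w 1 = ereal j" by blast
  thus ?thesis
  proof cases
   case 1
   thus ?thesis unfolding mem_Collect_eq by (simp del: jump_time.simps One_nat_def)
  next
   case 2
   thus ?thesis unfolding mem_Collect_eq by (simp del: jump_time.simps One_nat_def)
  qed
 qed simp
qed

text \<open>The prescribed law speaks of open intervals; (a, b] is the difference of (a,
  \<infinity>) and (b, \<infinity>), both for the first jump after a.\<close>

lemma first_in_eq:
 assumes "0 \<le> a" "a \<le> b"
 shows "first_in a b B =
  {w \<in> \<Omega>. \<exists>j. jump_time X a w 1 = ereal j \<and> a < j \<and> X j w \<in> B} -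
  {w \<in> \<Omega>. \<exists>j. jump_time X a w 1 = ereal j \<and> b < j \<and> X j w \<in> B}" (is "_ = ?S a - ?S b")
proof -
 have "first_in a b B = {w \<in> \<Omega>. \<exists>j. jump_time X a w 1 = ereal j \<and> a < j \<and> j \<le> b \<and> X j w \<in> B}"
  unfolding first_in_def using first_jump_iff[OF _ assms(1)] by (intro Collect_cong) blast
 also have "\<dots> = ?S a - ?S b"
 proof (rule set_eqI)
  fix w
  show "w \<in> {w \<in> \<Omega>. \<exists>j. jump_time X a w 1 = ereal j \<and> a < j \<and> j \<le> b \<and> X j w \<in> B} \<longleftrightarrow> w \<in> ?S a - ?S b"
  proof (cases "\<exists>j. jump_time X a w 1 = ereal j")
   case True
   then obtain j where "jump_time X a w 1 = ereal j" by blast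
   thus ?thesis unfolding Diff_iff mem_Collect_eq by (auto simp del: jump_time.simps One_nat_def)
  qed (simp del: jump_time.simps One_nat_def)
 qed
 finally show ?thesis .
qed

text \<open>\<open>max 0\<close> extends the rates to the whole line, since nothing is assumed about
  negative times.\<close>

lemma total_rate_measurable: "x \<in> space K ==> A \<in> sets K ==> (\<lambda>s. emeasure (\<nu> (max 0 s) x) A) \<in> borel_measurable borel"
proof -
 assume x: "x \<in> space K" and A: "A \<in> sets K"
 have "(\<lambda>s :: real. (max 0 s, x)) \<in> borel \<rightarrow>\<^sub>M restrict_space borel {0..} \<Otimes>\<^sub>M K"
 proof (rule measurable_Pair)
  have "(\<lambda>s :: real. max 0 s) \<in> borel_measurable borel" by measurable
  thus "(\<lambda>s :: real. max 0 s) \<in> borel \<rightarrow>\<^sub>M restrict_space borel {0..}"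
   by (rule measurable_restrict_space2[rotated]) simp
  show "(\<lambda>s. x) \<in> borel \<rightarrow>\<^sub>M K" using x by (rule measurable_const)
 qed
 from measurable_compose[OF this measurable_rate[OF A]] show ?thesis by simp
qed

text \<open>Subtracting the masses beyond b from those beyond a leaves the density on (a, b] only.
  There the total rate is finite, so the normalisation in \<open>jump_kernel\<close> cancels against
  the total rate.\<close>

lemma first_in_law:
 assumes a: "0 \<le> a" "a \<le> b" "b \<le> T" and x: "x \<in> space K" and B: "B \<in> sets K"
 shows "first_in a b B \<in> sets (FA {a..})"
  and "emeasure (P a x) (first_in a b B) =
   (\<integral>\<^sup>+ s\<in>{a<..b}. emeasure (\<nu> s x) B * exp_minus (\<integral>\<^sup>+ r \<in> {a..s}. total_rate K \<nu> r x \<partial>lborel) \<partial>lborel)"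
proof -
 define S where "S c = {w \<in> \<Omega>. \<exists>j. jump_time X a w 1 = ereal j \<and> c < j \<and> X j w \<in> B}" for c
 define E where "E s = exp_minus (\<integral>\<^sup>+ r. indicator {a..s} r * emeasure (\<nu> (max 0 r) x) (space K) \<partial>lborel)" for s
 define l where "l s = emeasure (\<nu> (max 0 s) x) (space K)" for s
 \<comment> \<open>The density of the prescribed law, with the rates extended to negative times so
   that it is Borel on the line.\<close>
 define D where "D s = (if 0 < l s then emeasure (\<nu> (max 0 s) x) B / l s else indicator B x) * l s * E s" for s
 have S_sets: "S c \<in> sets (P a x)" if "a \<le> c" for c
  using first_jump_event[OF a(1) that _ x B, of \<infinity>] unfolding first_jump_after_eq[OF a(1)] S_def by simp
 have l: "l \<in> borel_measurable borel" unfolding l_def by (rule total_rate_measurable[OF x sets.top])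
 have "(\<lambda>(s, r). indicator {a..s} r * l r) \<in> borel_measurable (borel \<Otimes>\<^sub>M borel)"
 proof -
  have "(\<lambda>(s, r). indicator {z. a \<le> snd z \<and> snd z \<le> fst z} (s, r) * l r) \<in> borel_measurable (borel \<Otimes>\<^sub>M borel)"
   using l by measurable
  thus ?thesis by (rule measurable_cong[THEN iffD1, rotated]) (auto simp: indicator_def)
 qed
 hence "(\<lambda>s. \<integral>\<^sup>+ r. indicator {a..s} r * l r \<partial>lborel) \<in> borel_measurable borel"
  using lborel.borel_measurable_nn_integral[of "\<lambda>s r. indicator {a..s} r * l r" borel] by simp
 hence E: "E \<in> borel_measurable borel" unfolding E_def l_def by measurable
 have D[measurable]: "D \<in> borel_measurable borel"
  unfolding D_def[abs_def] using E l total_rate_measurable[OF x B] by measurable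
 have law: "emeasure (P a x) (S c) = (\<integral>\<^sup>+ s\<in>{s. c < s}. D s \<partial>lborel)" if c: "a \<le> c" for c
 proof -
  have "emeasure (P a x) (S c) = (\<integral>\<^sup>+ s \<in> {s. c < s \<and> ereal s < \<infinity>}.
       jump_kernel K \<nu> s x B * total_rate K \<nu> s x *
       exp_minus (\<integral>\<^sup>+ r \<in> {a..s}. total_rate K \<nu> r x \<partial>lborel) \<partial>lborel)"
   using first_jump_law[OF a(1) c _ x B, of \<infinity>] unfolding first_jump_after_eq[OF a(1)] S_def by simp
  also have "\<dots> = (\<integral>\<^sup>+ s\<in>{s. c < s}. D s \<partial>lborel)"
  proof (rule nn_integral_cong)
   fix s :: real
   have "(\<integral>\<^sup>+ r \<in> {a..s}. total_rate K \<nu> r x \<partial>lborel) =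
     (\<integral>\<^sup>+ r. indicator {a..s} r * emeasure (\<nu> (max 0 r) x) (space K) \<partial>lborel)"
    using a(1) by (intro nn_integral_cong) (auto simp: indicator_def total_rate_def max_def)
   thus "jump_kernel K \<nu> s x B * total_rate K \<nu> s x *
       exp_minus (\<integral>\<^sup>+ r \<in> {a..s}. total_rate K \<nu> r x \<partial>lborel) * indicator {s. c < s \<and> ereal s < \<infinity>} s =
     D s * indicator {s. c < s} s"
    using a c by (auto simp: D_def E_def l_def jump_kernel_def total_rate_def indicator_def max_def)
  qed
  finally show ?thesis .
 qed
 interpret prob_space "P a x" by (rule prob[OF a(1) x])
 have fi: "first_in a b B = S a - S b" unfolding S_def by (rule first_in_eq[OF a(1,2)])
 have "first_in a b B \<in> sets (P a x)" unfolding fi using S_sets a by auto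
 thus "first_in a b B \<in> sets (FA {a..})" using sets_prob[OF a(1) x] by simp
 have sub: "S b \<subseteq> S a" unfolding S_def using a by (auto simp del: jump_time.simps)
 have "emeasure (P a x) (S a) = (\<integral>\<^sup>+ s\<in>{a<..b}. D s \<partial>lborel) + emeasure (P a x) (S b)"
  using law[of a] law[of b] nn_integral_split_Ioc[OF D a(2)] a by simp
 hence "emeasure (P a x) (first_in a b B) = (\<integral>\<^sup>+ s\<in>{a<..b}. D s \<partial>lborel)"
  unfolding fi using S_sets a sub by (subst emeasure_Diff) (auto simp: ennreal_add_diff_cancel_right)
 also have "\<dots> = (\<integral>\<^sup>+ s\<in>{a<..b}. emeasure (\<nu> s x) B * exp_minus (\<integral>\<^sup>+ r \<in> {a..s}. total_rate K \<nu> r x \<partial>lborel) \<partial>lborel)"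
 proof (rule nn_integral_cong)
  fix s :: real
  show "D s * indicator {a<..b} s =
   emeasure (\<nu> s x) B * exp_minus (\<integral>\<^sup>+ r \<in> {a..s}. total_rate K \<nu> r x \<partial>lborel) * indicator {a<..b} s"
  proof (cases "s \<in> {a<..b}")
   case True
   hence s: "s \<in> {0..T}" "max 0 s = s" using a by auto
   have "(\<integral>\<^sup>+ r \<in> {a..s}. total_rate K \<nu> r x \<partial>lborel) =
     (\<integral>\<^sup>+ r. indicator {a..s} r * emeasure (\<nu> (max 0 r) x) (space K) \<partial>lborel)"
    using a(1) by (intro nn_integral_cong) (auto simp: indicator_def total_rate_def max_def)
   \<comment> \<open>If the total rate is positive it cancels, being finite up to time T. If it is
     0, the rate of B is 0 as well and the value of the quotient is irrelevant.\<close>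
   moreover have "(if 0 < l s then emeasure (\<nu> s x) B / l s else indicator B x) * l s = emeasure (\<nu> s x) B"
   proof (cases "0 < l s")
    case True
    moreover have "l s < top" using rate_le[OF s(1) x] unfolding l_def s(2) by (rule le_less_trans) simp
    ultimately have "l s / l s = 1" by (intro ennreal_divide_self) auto
    thus ?thesis using True by (simp add: ennreal_divide_times)
   next
    case False
    hence "l s = 0" by (simp add: not_gr_zero)
    moreover have "emeasure (\<nu> s x) B \<le> l s" unfolding l_def s(2)
     using B s sets_rate[of s x] x sets.sets_into_space[OF B] by (intro emeasure_mono) auto
    ultimately show ?thesis by simp
   qed
   ultimately show ?thesis unfolding D_def E_def s(2) by (simp only:)
  qed simp
 qed
 finally show "emeasure (P a x) (first_in a b B) =
   (\<integral>\<^sup>+ s\<in>{a<..b}. emeasure (\<nu> s x) B * exp_minus (\<integral>\<^sup>+ r \<in> {a..s}. total_rate K \<nu> r x \<partial>lborel) \<partial>lborel)" .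
qed

text \<open>The survival factor in the density is at most 1 and, by the bound on the rates, at least
  \<open>exp (- rate_bound * (b - a))\<close>. The two bounds merge as the cell shrinks, so no exact
  computation of the survival factor is needed.\<close>

lemma first_in_bounds:
 assumes a: "0 \<le> a" "a \<le> b" "b \<le> T" and x: "x \<in> space K" and B: "B \<in> sets K"
 shows "emeasure (P a x) (first_in a b B) \<le> (\<integral>\<^sup>+ s\<in>{a<..b}. emeasure (\<nu> s x) B \<partial>lborel)"
  and "ennreal (exp (- rate_bound * (b - a))) * (\<integral>\<^sup>+ s\<in>{a<..b}. emeasure (\<nu> s x) B \<partial>lborel) \<le>
   emeasure (P a x) (first_in a b B)"
proof -
 let ?E = "\<lambda>s. exp_minus (\<integral>\<^sup>+ r \<in> {a..s}. total_rate K \<nu> r x \<partial>lborel)"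
 show "emeasure (P a x) (first_in a b B) \<le> (\<integral>\<^sup>+ s\<in>{a<..b}. emeasure (\<nu> s x) B \<partial>lborel)"
  unfolding first_in_law(2)[OF a x B]
  by (intro nn_integral_mono mult_right_mono mult_exp_minus_le) simp
 have E: "ennreal (exp (- rate_bound * (b - a))) \<le> ?E s" if s: "s \<in> {a<..b}" for s
 proof -
  have "(\<integral>\<^sup>+ r \<in> {a..s}. total_rate K \<nu> r x \<partial>lborel) \<le> (\<integral>\<^sup>+ r. ennreal rate_bound * indicator {a..s} r \<partial>lborel)"
   using rate_le[OF _ x] s a by (intro nn_integral_mono) (auto simp: indicator_def total_rate_def)
  also have "\<dots> = ennreal (rate_bound * (s - a))"
   using s rate_bound_pos by (simp add: nn_integral_cmult_indicator ennreal_mult)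
  also have "\<dots> \<le> ennreal (rate_bound * (b - a))"
   using s rate_bound_pos by (intro ennreal_leI mult_left_mono) auto
  finally show ?thesis using exp_minus_ge[of _ "rate_bound * (b - a)"] rate_bound_pos a by simp
 qed
 have m: "(\<lambda>s. emeasure (\<nu> s x) B * indicator {a<..b} s) \<in> borel_measurable lborel"
 proof -
  have "(\<lambda>s. emeasure (\<nu> (max 0 s) x) B * indicator {a<..b} s) \<in> borel_measurable lborel"
   using total_rate_measurable[OF x B] by measurable
  thus ?thesis using a by (elim measurable_cong[THEN iffD1, rotated]) (auto simp: indicator_def)
 qed
 have "ennreal (exp (- rate_bound * (b - a))) * (\<integral>\<^sup>+ s\<in>{a<..b}. emeasure (\<nu> s x) B \<partial>lborel) =
   (\<integral>\<^sup>+ s. ennreal (exp (- rate_bound * (b - a))) * (emeasure (\<nu> s x) B * indicator {a<..b} s) \<partial>lborel)"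
  using m by (rule nn_integral_cmult[symmetric])
 also have "\<dots> \<le> emeasure (P a x) (first_in a b B)"
  unfolding first_in_law(2)[OF a x B]
 proof (rule nn_integral_mono)
  fix s
  show "ennreal (exp (- rate_bound * (b - a))) * (emeasure (\<nu> s x) B * indicator {a<..b} s) \<le>
    emeasure (\<nu> s x) B * ?E s * indicator {a<..b} s"
   using mult_left_mono[OF E, of s "emeasure (\<nu> s x) B"] by (auto simp: indicator_def mult.commute)
 qed
 finally show "ennreal (exp (- rate_bound * (b - a))) * (\<integral>\<^sup>+ s\<in>{a<..b}. emeasure (\<nu> s x) B \<partial>lborel) \<le>
   emeasure (P a x) (first_in a b B)" .
qed

text \<open>Counting only the first jump in each cell of a dyadic partition gives, as the mesh shrinks,
 the number of all jumps; each such first jump is governed by the Markov property at the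
 deterministic left end point of the cell.\<close>

lemma compensator_rectangle:
 assumes t: "0 \<le> t" "t \<le> s" "s \<le> u" "u \<le> T" and x: "x \<in> space K"
  and A: "A \<in> sets (FA {t..s})" and B: "B \<in> sets K"
 shows "(\<lambda>w. \<Sum>\<tau>\<in>jumps w s u. indicator B (X \<tau> w) :: ennreal) \<in> borel_measurable (P t x)"
  and "(\<integral>\<^sup>+w\<in>A. (\<Sum>\<tau>\<in>jumps w s u. indicator B (X \<tau> w)) \<partial>P t x) =
   (\<integral>\<^sup>+w\<in>A. (\<integral>\<^sup>+r\<in>{s<..u}. emeasure (\<nu> r (X r w)) B \<partial>lborel) \<partial>P t x)"
proof -
 interpret prob_space "P t x" by (rule prob[OF t(1) x])
 have A': "A \<in> sets (P t x)" using sets_P[OF t(1) x _ A] by auto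
 define \<tau> where "\<tau> n k = s + real k / 2 ^ n" for n k
 let ?F = "\<lambda>n k. first_in (\<tau> n k) (min u (\<tau> n (Suc k))) B" and ?e = "\<lambda>n. ennreal (exp (- rate_bound * (1 / 2 ^ n)))"
 define Kn where "Kn n = {k. \<tau> n k < u}" for n
 define C where "C n k = {\<tau> n k<..min u (\<tau> n (Suc k))}" for n k
 define N where "N n w = (\<Sum>k\<in>Kn n. indicator (?F n k) w :: ennreal)" for n w
 \<comment> \<open>A jump belongs to \<open>ok n w\<close> when it leads into B and no jump precedes
   it in its cell of the n-th grid.\<close>
 define ok where "ok n w = {\<sigma>. X \<sigma> w \<in> B \<and> jump_set X w \<inter> {grid_down s n \<sigma><..<\<sigma>} = {}}" for n w
 define Nlim where "Nlim w = (\<Sum>\<tau>\<in>jumps w s u. indicator B (X \<tau> w) :: ennreal)" for w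
 have \<tau>: "s \<le> \<tau> n k" "\<tau> n k \<le> \<tau> n (Suc k)" "\<tau> n (Suc k) = \<tau> n k + 1 / 2 ^ n" for n k
  by (auto simp: \<tau>_def divide_right_mono add_divide_distrib)
 have fin: "finite (Kn n)" for n
 proof (rule finite_subset)
  show "Kn n \<subseteq> {..nat \<lceil>(u - s) * 2 ^ n\<rceil>}"
  proof
   fix k assume "k \<in> Kn n"
   hence "real k < (u - s) * 2 ^ n" by (simp add: Kn_def \<tau>_def field_simps)
   thus "k \<in> {..nat \<lceil>(u - s) * 2 ^ n\<rceil>}" by simp linarith
  qed
 qed simp
 have C_gd: "grid_down s n r = \<tau> n k" if "r \<in> C n k" for n k r
  using that grid_down_eq[of s k n r] by (auto simp: C_def \<tau>_def)
 have C_disj: "j = k" if "r \<in> C n k" "r \<in> C n j" for n k j r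
 proof -
  have "\<tau> n k = \<tau> n j" using C_gd that by metis
  thus "j = k" by (simp add: \<tau>_def)
 qed
 have C_cover: "\<exists>k\<in>Kn n. r \<in> C n k" if r: "r \<in> {s<..u}" for n r
 proof -
  obtain k where k: "\<tau> n k < r" "r \<le> \<tau> n (Suc k)" using ex_grid_down[of s r n] r by (auto simp: \<tau>_def)
  thus ?thesis using r by (intro bexI[of _ k]) (auto simp: C_def Kn_def)
 qed
 have C_sub: "C n k \<subseteq> {s<..u}" for n k using \<tau>(1)[of n k] by (auto simp: C_def)
 have C_Un: "(\<Union>k\<in>Kn n. C n k) = {s<..u}" for n using C_cover C_sub by blast
 \<comment> \<open>Each cell contributes 1 exactly when its first jump leads into B. Writing the
   count as a sum over the jumps of the path, instead of over the cells, makes different n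
   comparable.\<close>
 have N_eq: "N n w = (\<Sum>\<sigma>\<in>jumps w s u. indicator (ok n w) \<sigma>)" if w: "w \<in> \<Omega>" for n w
 proof -
  let ?J = "jump_set X w"
  have cell: "(indicator (?F n k) w :: ennreal) = (\<Sum>\<sigma>\<in>?J \<inter> C n k. indicator (ok n w) \<sigma>)" for k
  proof -
   have finC: "finite (?J \<inter> C n k)" unfolding C_def by (rule finite_jumps[OF w])
   have ok_iff: "\<sigma> \<in> ok n w \<longleftrightarrow> X \<sigma> w \<in> B \<and> ?J \<inter> {\<tau> n k<..<\<sigma>} = {}" if "\<sigma> \<in> C n k" for \<sigma>
    unfolding ok_def using C_gd[OF that] by simp
   show ?thesis
   proof (cases "w \<in> ?F n k")
    case True
    then obtain \<sigma> where \<sigma>: "\<sigma> \<in> ?J \<inter> C n k" "?J \<inter> {\<tau> n k<..<\<sigma>} = {}" "X \<sigma> w \<in> B"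
     unfolding first_in_def C_def by auto
    have uniq: "\<rho> = \<sigma>" if \<rho>: "\<rho> \<in> ?J \<inter> C n k" "\<rho> \<in> ok n w" for \<rho>
    proof -
     have "?J \<inter> {\<tau> n k<..<\<rho>} = {}" using ok_iff[of \<rho>] \<rho> by blast
     hence "\<not> \<sigma> < \<rho>" using \<sigma>(1) unfolding C_def by auto
     moreover have "\<not> \<rho> < \<sigma>" using \<sigma>(2) \<rho>(1) unfolding C_def by auto
     ultimately show ?thesis by simp
    qed
    have "\<sigma> \<in> ok n w" using \<sigma> ok_iff[of \<sigma>] by blast
    hence "\<rho> \<in> ok n w \<longleftrightarrow> \<rho> = \<sigma>" if "\<rho> \<in> ?J \<inter> C n k" for \<rho> using uniq[OF that] by blast
    hence "(\<Sum>\<rho>\<in>?J \<inter> C n k. indicator (ok n w) \<rho> :: ennreal) = (\<Sum>\<rho>\<in>?J \<inter> C n k. if \<rho> = \<sigma> then 1 else 0)"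
     unfolding indicator_def by (intro sum.cong refl) simp
    also have "\<dots> = 1" using \<sigma> finC by simp
    finally show ?thesis using True by simp
   next
    case False
    have "\<rho> \<notin> ok n w" if "\<rho> \<in> ?J \<inter> C n k" for \<rho>
    proof
     assume "\<rho> \<in> ok n w"
     hence "X \<rho> w \<in> B" "?J \<inter> {\<tau> n k<..<\<rho>} = {}" using ok_iff[of \<rho>] that by auto
     hence "w \<in> ?F n k"
      unfolding first_in_def using that w by (auto simp: C_def)
     with False show False by contradiction
    qed
    thus ?thesis using False by simp
   qed
  qed
  have "N n w = (\<Sum>k\<in>Kn n. \<Sum>\<sigma>\<in>?J \<inter> C n k. indicator (ok n w) \<sigma>)"
   unfolding N_def cell ..
  also have "\<dots> = (\<Sum>\<sigma>\<in>(\<Union>k\<in>Kn n. ?J \<inter> C n k). indicator (ok n w) \<sigma>)"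
  proof (rule sum.UNION_disjoint[symmetric, OF fin])
   show "\<forall>i\<in>Kn n. finite (?J \<inter> C n i)" unfolding C_def using finite_jumps[OF w] by blast
   show "\<forall>i\<in>Kn n. \<forall>j\<in>Kn n. i \<noteq> j \<longrightarrow> ?J \<inter> C n i \<inter> (?J \<inter> C n j) = {}" using C_disj by blast
  qed
  also have "(\<Union>k\<in>Kn n. ?J \<inter> C n k) = ?J \<inter> {s<..u}" using C_Un by blast
  finally show ?thesis .
 qed
 have fi_sets: "?F n k \<in> sets (FA {\<tau> n k..})" if "k \<in> Kn n" for n k
  by (rule first_in_law(1)[OF _ _ _ x B]) (use that \<tau>[of n k] t in \<open>auto simp: Kn_def\<close>)
 have fi_P: "?F n k \<in> sets (P t x)" if "k \<in> Kn n" for n k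
  using sets_P[OF t(1) x _ fi_sets[OF that]] \<tau>(1)[of n k] t by auto
 have N_meas[measurable]: "N n \<in> borel_measurable (P t x)" for n
  unfolding N_def[abs_def] using fi_P by (intro borel_measurable_sum) auto
 have mono: "N m w \<le> N n w" if w: "w \<in> \<Omega>" and "m \<le> n" for m n w
 proof -
  have "indicator (ok m w) \<sigma> \<le> (indicator (ok n w) \<sigma> :: ennreal)" if \<sigma>: "\<sigma> \<in> jumps w s u" for \<sigma>
  proof -
   have "grid_down s m \<sigma> \<le> grid_down s n \<sigma>"
    using \<open>m \<le> n\<close> by (rule lift_Suc_mono_le[of "\<lambda>n. grid_down s n \<sigma>", rotated]) (use grid_down_mono \<sigma> in auto)
   hence "{grid_down s n \<sigma><..<\<sigma>} \<subseteq> {grid_down s m \<sigma><..<\<sigma>}" by auto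
   hence "\<sigma> \<in> ok m w ==> \<sigma> \<in> ok n w" unfolding ok_def by blast
   thus ?thesis by (auto simp: indicator_def)
  qed
  thus ?thesis unfolding N_eq[OF w] by (rule sum_mono)
 qed
 \<comment> \<open>The path has finitely many jumps in (s, u], so on a fine enough grid each of them
   is the first one of its cell.\<close>
 have ev: "\<forall>\<^sub>F n in sequentially. N n w = Nlim w" if w: "w \<in> \<Omega>" for w
 proof -
  have "\<forall>\<^sub>F n in sequentially. indicator (ok n w) \<sigma> = (indicator B (X \<sigma> w) :: ennreal)"
   if \<sigma>: "\<sigma> \<in> jumps w s u" for \<sigma>
  proof -
   obtain a where a: "s < a" "a < \<sigma>" "jump_set X w \<inter> {a<..<\<sigma>} = {}"
    using ex_left_constant[OF w, of s \<sigma>] \<sigma> by auto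
   have "\<forall>\<^sub>F n in sequentially. a < grid_down s n \<sigma>"
    using order_tendstoD(1)[OF grid_down_tendsto a(2), of s] .
   thus ?thesis
   proof eventually_elim
    case (elim n)
    hence "{grid_down s n \<sigma><..<\<sigma>} \<subseteq> {a<..<\<sigma>}" by auto
    hence "jump_set X w \<inter> {grid_down s n \<sigma><..<\<sigma>} = {}" using a(3) by blast
    hence "\<sigma> \<in> ok n w \<longleftrightarrow> X \<sigma> w \<in> B" unfolding ok_def by simp
    thus ?case by (auto simp: indicator_def)
   qed
  qed
  hence "\<forall>\<^sub>F n in sequentially. \<forall>\<sigma>\<in>jumps w s u. indicator (ok n w) \<sigma> = (indicator B (X \<sigma> w) :: ennreal)"
   using finite_jumps[OF w, of s u] by (simp add: eventually_ball_finite_distrib)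
  thus ?thesis
   unfolding N_eq[OF w] Nlim_def by eventually_elim (rule sum.cong, auto)
 qed
 show Nlim_meas: "Nlim \<in> borel_measurable (P t x)"
  by (rule measurable_eventually_eq[OF N_meas]) (use ev t x in auto)
 have lim1: "(\<lambda>n. \<integral>\<^sup>+w\<in>A. N n w \<partial>P t x) \<longlonglongrightarrow> (\<integral>\<^sup>+w\<in>A. Nlim w \<partial>P t x)"
 proof -
  define N' where "N' n w = (if w \<in> \<Omega> then N n w * indicator A w else 0)" for n w
  define L' where "L' w = (if w \<in> \<Omega> then Nlim w * indicator A w else 0)" for w
  have "(\<lambda>n. \<integral>\<^sup>+w. N' n w \<partial>P t x) \<longlonglongrightarrow> (\<integral>\<^sup>+w. L' w \<partial>P t x)"
  proof (rule nn_integral_LIMSEQ)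
   show "incseq N'"
    unfolding N'_def using mono by (auto simp: incseq_def le_fun_def intro!: mult_right_mono)
   have "(\<lambda>w. N n w * indicator A w) \<in> borel_measurable (P t x)" for n using A' by measurable
   thus "N' n \<in> borel_measurable (P t x)" for n
    by (rule measurable_cong[THEN iffD1, rotated]) (use t x in \<open>auto simp: N'_def\<close>)
   show "(\<lambda>n. N' n w) \<longlonglongrightarrow> L' w" for w
   proof (cases "w \<in> \<Omega>")
    case True
    from ev[OF True] have "\<forall>\<^sub>F n in sequentially. N' n w = L' w"
     by eventually_elim (simp add: N'_def L'_def)
    thus ?thesis by (rule tendsto_eventually)
   qed (simp add: N'_def L'_def)
  qed
  moreover have "(\<integral>\<^sup>+w. N' n w \<partial>P t x) = (\<integral>\<^sup>+w\<in>A. N n w \<partial>P t x)" for n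
   using t x by (intro nn_integral_cong) (simp add: N'_def)
  moreover have "(\<integral>\<^sup>+w. L' w \<partial>P t x) = (\<integral>\<^sup>+w\<in>A. Nlim w \<partial>P t x)"
   using t x by (intro nn_integral_cong) (simp add: L'_def)
  ultimately show ?thesis by simp
 qed
 define m where "m n k y = (\<integral>\<^sup>+r\<in>C n k. emeasure (\<nu> r y) B \<partial>lborel)" for n k y
 \<comment> \<open>The expected intensity with the state frozen at the left end point of the cell
   containing the current time.\<close>
 define I where "I n = (\<Sum>k\<in>Kn n. \<integral>\<^sup>+w\<in>A. m n k (X (\<tau> n k) w) \<partial>P t x)" for n
 have markov_cell: "(\<integral>\<^sup>+w\<in>A. N n w \<partial>P t x) =
   (\<Sum>k\<in>Kn n. \<integral>\<^sup>+w\<in>A. emeasure (P (\<tau> n k) (X (\<tau> n k) w)) (?F n k) \<partial>P t x)" for n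
 proof -
  have "(\<integral>\<^sup>+w\<in>A. N n w \<partial>P t x) =
    (\<integral>\<^sup>+w. (\<Sum>k\<in>Kn n. indicator (A \<inter> ?F n k) w) \<partial>P t x)"
   unfolding N_def by (intro nn_integral_cong) (simp add: sum_distrib_left indicator_inter_arith mult.commute)
  also have "\<dots> = (\<Sum>k\<in>Kn n. \<integral>\<^sup>+w. indicator (A \<inter> ?F n k) w \<partial>P t x)"
   using fi_P A' by (intro nn_integral_sum) auto
  also have "\<dots> = (\<Sum>k\<in>Kn n. emeasure (P t x) (A \<inter> ?F n k))"
   using fi_P A' by (intro sum.cong nn_integral_indicator) auto
  also have "\<dots> = (\<Sum>k\<in>Kn n. \<integral>\<^sup>+w\<in>A. emeasure (P (\<tau> n k) (X (\<tau> n k) w)) (?F n k) \<partial>P t x)"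
  proof (rule sum.cong[OF refl])
   fix k assume k: "k \<in> Kn n"
   have "A \<in> sets (FA {t..\<tau> n k})"
    using A sets_path_algebra_mono[of "{t..s}" "{t..\<tau> n k}" K \<Omega> X] \<tau>(1)[of n k] by auto
   thus "emeasure (P t x) (A \<inter> ?F n k) =
     (\<integral>\<^sup>+w\<in>A. emeasure (P (\<tau> n k) (X (\<tau> n k) w)) (?F n k) \<partial>P t x)"
    using t x \<tau>(1)[of n k] by (intro markov_event(2) fi_sets[OF k]) auto
  qed
  finally show ?thesis .
 qed
 have Xst: "X (\<tau> n k) w \<in> space K" if "w \<in> space (P t x)" for n k w
  using that t x \<tau>(1)[of n k] by (intro state) auto
 \<comment> \<open>Together with \<open>low\<close>, this squeezes the expected count between
   \<open>I n\<close> and \<open>I n\<close> times a factor tending to 1, because the cells have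
   length at most 1 / 2^n.\<close>
 have up: "(\<integral>\<^sup>+w\<in>A. N n w \<partial>P t x) \<le> I n" for n
  unfolding markov_cell I_def
 proof (intro sum_mono nn_integral_mono mult_right_mono)
  fix k w assume "k \<in> Kn n" "w \<in> space (P t x)"
  thus "emeasure (P (\<tau> n k) (X (\<tau> n k) w)) (?F n k) \<le> m n k (X (\<tau> n k) w)"
   unfolding m_def C_def using \<tau>[of n k] t by (intro first_in_bounds Xst B) (auto simp: Kn_def)
 qed simp
 define RI where "RI = restrict_space lborel {s<..u}"
 let ?Q = "P t x \<Otimes>\<^sub>M RI"
 define G where "G \<phi> w r = emeasure (\<nu> r (\<phi> r w)) B" for \<phi> :: "real => 'w => 'k" and w r
 have RI_int: "(\<integral>\<^sup>+r. h r \<partial>RI) = (\<integral>\<^sup>+r\<in>{s<..u}. h r \<partial>lborel)" for h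
  unfolding RI_def by (rule nn_integral_restrict_space) simp
 interpret RI: finite_measure RI
  by (rule finite_measureI) (use t in \<open>simp add: RI_def space_restrict_space emeasure_restrict_space\<close>)
 interpret pair_sigma_finite "P t x" RI ..
 have pair_meas: "(\<lambda>(w, r). \<phi> r w) \<in> ?Q \<rightarrow>\<^sub>M K ==>
   (\<lambda>(w, r). G \<phi> w r) \<in> borel_measurable (?Q)" for \<phi>
 proof -
  assume \<phi>: "(\<lambda>(w, r). \<phi> r w) \<in> ?Q \<rightarrow>\<^sub>M K"
  have snd: "snd \<in> ?Q \<rightarrow>\<^sub>M restrict_space borel {0..T}"
   by (rule measurable_compose[OF measurable_snd], unfold RI_def)
     (use t in \<open>auto intro!: measurable_restrict_space1 measurable_restrict_space2 simp: space_restrict_space measurable_restrict_space2_iff\<close>)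
  have "(\<lambda>z. \<integral>\<^sup>+y. indicator B y \<partial>\<nu> (snd z) ((\<lambda>(w, r). \<phi> r w) z)) \<in> borel_measurable (?Q)"
   by (rule kernel_nn_measurable[OF snd \<phi>]) (use B in measurable)
  moreover have "(\<integral>\<^sup>+y. indicator B y \<partial>\<nu> (snd z) ((\<lambda>(w, r). \<phi> r w) z)) = (\<lambda>(w, r). G \<phi> w r) z"
   if z: "z \<in> space (?Q)" for z
   using measurable_space[OF \<phi> z] measurable_space[OF snd z] B
   by (auto simp: G_def case_prod_beta sets_rate space_restrict_space intro!: nn_integral_indicator)
  ultimately show ?thesis by (rule measurable_cong[THEN iffD1, rotated])
 qed
 have Xj: "(\<lambda>(w, r). X r w) \<in> ?Q \<rightarrow>\<^sub>M K"
 proof -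
  have "(\<lambda>w. w) \<in> P t x \<rightarrow>\<^sub>M FA {t..T}"
   using sets_P[OF t(1) x, of "{t..T}"] t x FA_subset by (intro measurableI) (auto simp: Int_absorb2)
  moreover have "(\<lambda>r. r) \<in> RI \<rightarrow>\<^sub>M restrict_space borel {t..T}"
   unfolding RI_def using t
   by (auto intro!: measurable_restrict_space1 measurable_restrict_space2 simp: space_restrict_space measurable_restrict_space2_iff)
  ultimately have "(\<lambda>z. (fst z, snd z)) \<in> ?Q \<rightarrow>\<^sub>M FA {t..T} \<Otimes>\<^sub>M restrict_space borel {t..T}"
   by (intro measurable_Pair measurable_compose[OF measurable_fst] measurable_compose[OF measurable_snd])
  from measurable_compose[OF this X_joint[OF t(1)]] t show ?thesis by (simp add: case_prod_beta')
 qed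
 define Xg where "Xg n r w = X (max s (grid_down s n r)) w" for n r w
 have Xgj: "(\<lambda>(w, r). Xg n r w) \<in> ?Q \<rightarrow>\<^sub>M K" for n
 proof -
  define g where "g = (\<lambda>z :: 'w \<times> real. \<lceil>(snd z - s) * 2 ^ n\<rceil> :: int)"
  define f where "f i z = X (max s (s + (of_int i - 1) / 2 ^ n)) (fst z)" for i :: int and z :: "'w \<times> real"
  have "snd \<in> ?Q \<rightarrow>\<^sub>M borel" unfolding RI_def
   by (rule measurable_compose[OF measurable_snd]) (rule measurable_restrict_space1, simp)
  hence g: "g \<in> ?Q \<rightarrow>\<^sub>M count_space UNIV" unfolding g_def by measurable
  have f: "f i \<in> ?Q \<rightarrow>\<^sub>M K" for i
   unfolding f_def using t x
   by (intro measurable_compose[OF measurable_fst] measurable_P measurable_X) auto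
  have "(\<lambda>z. f (g z) z) \<in> ?Q \<rightarrow>\<^sub>M K"
   by (rule measurable_compose_countable'[OF f g]) auto
  thus ?thesis by (simp add: f_def g_def Xg_def grid_down_def case_prod_beta')
 qed
 have m_meas: "(\<lambda>w. m n k (X (\<tau> n k) w)) \<in> borel_measurable (P t x)" for n k
 proof -
  have c: "(\<lambda>(w, r). X (\<tau> n k) w) \<in> ?Q \<rightarrow>\<^sub>M K"
   using t x \<tau>(1)[of n k] unfolding case_prod_beta
   by (intro measurable_compose[OF measurable_fst] measurable_P measurable_X) auto
  have Cm: "C n k \<in> sets RI"
   unfolding RI_def using C_sub by (subst sets_restrict_space_iff) (auto simp: C_def)
  hence "(\<lambda>(w, r). indicator (C n k) r * G (\<lambda>_. X (\<tau> n k)) w r) \<in> borel_measurable (?Q)"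
   using pair_meas[OF c] by (auto simp: case_prod_beta' intro!: borel_measurable_times_ennreal)
  hence "(\<lambda>w. \<integral>\<^sup>+r. indicator (C n k) r * G (\<lambda>_. X (\<tau> n k)) w r \<partial>RI) \<in> borel_measurable (P t x)"
   by (rule RI.borel_measurable_nn_integral)
  moreover have "(\<integral>\<^sup>+r. indicator (C n k) r * G (\<lambda>_. X (\<tau> n k)) w r \<partial>RI) = m n k (X (\<tau> n k) w)" for w
   unfolding RI_int m_def G_def using C_sub[of n k] by (intro nn_integral_cong) (auto simp: indicator_def)
  ultimately show ?thesis by simp
 qed
 have I_eq: "I n = (\<integral>\<^sup>+w\<in>A. (\<integral>\<^sup>+r. G (Xg n) w r \<partial>RI) \<partial>P t x)" for n
 proof -
  have cellm: "(\<lambda>r. emeasure (\<nu> r y) B * indicator (C n k) r) \<in> borel_measurable lborel" if "y \<in> space K" for k y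
  proof -
   have "(\<lambda>r. emeasure (\<nu> (max 0 r) y) B * indicator (C n k) r) \<in> borel_measurable lborel"
    using total_rate_measurable[OF that B] unfolding C_def by measurable
   thus ?thesis using t \<tau>(1)[of n k]
    by (elim measurable_cong[THEN iffD1, rotated]) (auto simp: indicator_def C_def)
  qed
  have inner: "(\<Sum>k\<in>Kn n. m n k (X (\<tau> n k) w)) = (\<integral>\<^sup>+r. G (Xg n) w r \<partial>RI)" if w: "w \<in> space (P t x)" for w
  proof -
   have "(\<Sum>k\<in>Kn n. m n k (X (\<tau> n k) w)) =
     (\<integral>\<^sup>+r. (\<Sum>k\<in>Kn n. emeasure (\<nu> r (X (\<tau> n k) w)) B * indicator (C n k) r) \<partial>lborel)"
    unfolding m_def using cellm Xst[OF w] by (intro nn_integral_sum[symmetric]) auto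
   also have "\<dots> = (\<integral>\<^sup>+r\<in>{s<..u}. G (Xg n) w r \<partial>lborel)"
   proof (rule nn_integral_cong)
    fix r :: real
    show "(\<Sum>k\<in>Kn n. emeasure (\<nu> r (X (\<tau> n k) w)) B * indicator (C n k) r) = G (Xg n) w r * indicator {s<..u} r"
    proof (cases "r \<in> {s<..u}")
     case True
     then obtain k where k: "k \<in> Kn n" "r \<in> C n k" using C_cover by blast
     have "(\<Sum>j\<in>Kn n. emeasure (\<nu> r (X (\<tau> n j) w)) B * indicator (C n j) r) =
       (\<Sum>j\<in>Kn n. if j = k then emeasure (\<nu> r (X (\<tau> n k) w)) B else 0)"
      using k C_disj by (intro sum.cong) (auto simp: indicator_def)
     also have "\<dots> = emeasure (\<nu> r (X (\<tau> n k) w)) B" using k fin by simp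
     also have "\<tau> n k = max s (grid_down s n r)" using C_gd[OF k(2)] \<tau>(1)[of n k] by simp
     finally show ?thesis using True by (simp add: G_def Xg_def)
    next
     case False
     hence "r \<notin> C n k" for k using C_sub by blast
     thus ?thesis using False by simp
    qed
   qed
   finally show ?thesis unfolding RI_int .
  qed
  have "I n = (\<integral>\<^sup>+w. (\<Sum>k\<in>Kn n. m n k (X (\<tau> n k) w) * indicator A w) \<partial>P t x)"
   unfolding I_def using m_meas A' by (intro nn_integral_sum[symmetric]) auto
  also have "\<dots> = (\<integral>\<^sup>+w\<in>A. (\<integral>\<^sup>+r. G (Xg n) w r \<partial>RI) \<partial>P t x)"
   by (rule nn_integral_cong) (simp add: sum_distrib_right[symmetric] inner)
  finally show ?thesis .
 qed
 have Gbound: "G \<phi> w r \<le> ennreal rate_bound" if "r \<in> {s<..u}" "\<phi> r w \<in> space K" for \<phi> w r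
 proof -
  have "G \<phi> w r \<le> emeasure (\<nu> r (\<phi> r w)) (space K)"
   unfolding G_def using that t sets.sets_into_space[OF B] sets_rate[of r "\<phi> r w"] by (intro emeasure_mono) auto
  also have "\<dots> \<le> ennreal rate_bound" using that t by (intro rate_le) auto
  finally show ?thesis .
 qed
 have RI_space: "space RI = {s<..u}" by (simp add: RI_def space_restrict_space)
 have Xg_st: "Xg n r w \<in> space K" if "w \<in> \<Omega>" for n r w unfolding Xg_def using that t by (intro state) auto
 have lim2: "I \<longlonglongrightarrow> (\<integral>\<^sup>+w\<in>A. (\<integral>\<^sup>+r. G X w r \<partial>RI) \<partial>P t x)"
  unfolding I_eq
 proof (rule nn_integral_dominated_convergence[where w="\<lambda>_. ennreal (rate_bound * (u - s))"])
  show "(\<lambda>w. (\<integral>\<^sup>+r. G (Xg n) w r \<partial>RI) * indicator A w) \<in> borel_measurable (P t x)" for n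
   using RI.borel_measurable_nn_integral[OF pair_meas[OF Xgj[of n]]] A' by measurable
  show "(\<lambda>w. (\<integral>\<^sup>+r. G X w r \<partial>RI) * indicator A w) \<in> borel_measurable (P t x)"
   using RI.borel_measurable_nn_integral[OF pair_meas[OF Xj]] A' by measurable
  have RIc: "(\<integral>\<^sup>+r. ennreal rate_bound \<partial>RI) = ennreal (rate_bound * (u - s))"
   unfolding RI_int using t rate_bound_pos by (simp add: nn_integral_cmult_indicator ennreal_mult)
  show "AE w in P t x. (\<integral>\<^sup>+r. G (Xg n) w r \<partial>RI) * indicator A w \<le> ennreal (rate_bound * (u - s))" for n
  proof (rule AE_I2)
   fix w assume "w \<in> space (P t x)"
   hence "w \<in> \<Omega>" using t x by simp
   hence "(\<integral>\<^sup>+r. G (Xg n) w r \<partial>RI) \<le> (\<integral>\<^sup>+r. ennreal rate_bound \<partial>RI)"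
    using Gbound Xg_st by (intro nn_integral_mono) (simp add: RI_space)
   thus "(\<integral>\<^sup>+r. G (Xg n) w r \<partial>RI) * indicator A w \<le> ennreal (rate_bound * (u - s))"
    unfolding RIc by (auto simp: indicator_def)
  qed
  show "(\<integral>\<^sup>+ w. ennreal (rate_bound * (u - s)) \<partial>P t x) < \<infinity>"
   by (simp add: emeasure_space_1)
  show "AE w in P t x. (\<lambda>n. (\<integral>\<^sup>+r. G (Xg n) w r \<partial>RI) * indicator A w) \<longlonglongrightarrow> (\<integral>\<^sup>+r. G X w r \<partial>RI) * indicator A w"
  proof (rule AE_I2)
   fix w assume wP: "w \<in> space (P t x)"
   hence w: "w \<in> \<Omega>" using t x by simp
   have "(\<lambda>n. \<integral>\<^sup>+r. G (Xg n) w r \<partial>RI) \<longlonglongrightarrow> (\<integral>\<^sup>+r. G X w r \<partial>RI)"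
   proof (rule nn_integral_dominated_convergence[where w="\<lambda>_. ennreal rate_bound"])
    show "G (Xg n) w \<in> borel_measurable RI" for n
     using measurable_compose[OF measurable_Pair1'[OF wP] pair_meas[OF Xgj[of n]]] by simp
    show "G X w \<in> borel_measurable RI"
     using measurable_compose[OF measurable_Pair1'[OF wP] pair_meas[OF Xj]] by simp
    show "AE r in RI. G (Xg n) w r \<le> ennreal rate_bound" for n
     using Gbound Xg_st[OF w] by (intro AE_I2) (simp add: RI_space)
    show "(\<integral>\<^sup>+r. ennreal rate_bound \<partial>RI) < \<infinity>" unfolding RIc by simp
    have "AE r in lborel. r \<notin> jumps w s u"
     by (rule AE_not_in[OF finite_imp_null_set_lborel[OF finite_jumps[OF w]]])
    hence "AE r in RI. r \<notin> jumps w s u"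
     unfolding RI_def by (subst AE_restrict_space_iff) auto
    moreover have "AE r in RI. r \<in> {s<..u}" by (rule AE_I2) (simp add: RI_space)
    ultimately show "AE r in RI. (\<lambda>n. G (Xg n) w r) \<longlonglongrightarrow> G X w r"
    proof eventually_elim
     case (elim r)
     hence r: "s < r" "r \<notin> jump_set X w" by auto
     have "left_value X r w = X r w" using r t by (intro left_value_eq_self w) auto
     moreover have "\<forall>\<^sub>F n in sequentially. X (grid_down s n r) w = left_value X r w"
      using t r by (intro eventually_X_grid_down w) auto
     moreover have "max s (grid_down s n r) = grid_down s n r" for n
      using grid_down_ge[OF r(1), of n] by simp
     ultimately have "\<forall>\<^sub>F n in sequentially. Xg n r w = X r w" unfolding Xg_def by simp
     hence "\<forall>\<^sub>F n in sequentially. G (Xg n) w r = G X w r"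
      by eventually_elim (simp add: G_def)
     thus ?case by (rule tendsto_eventually)
    qed
   qed simp
   thus "(\<lambda>n. (\<integral>\<^sup>+r. G (Xg n) w r \<partial>RI) * indicator A w) \<longlonglongrightarrow> (\<integral>\<^sup>+r. G X w r \<partial>RI) * indicator A w"
    by (auto simp: indicator_def)
  qed
 qed simp
 have low: "?e n * I n \<le> (\<integral>\<^sup>+w\<in>A. N n w \<partial>P t x)" for n
 proof -
  have mono_c: "?e n * m n k (X (\<tau> n k) w) \<le>
    emeasure (P (\<tau> n k) (X (\<tau> n k) w)) (?F n k)"
   if "k \<in> Kn n" "w \<in> space (P t x)" for k w
  proof -
   have "min u (\<tau> n (Suc k)) - \<tau> n k \<le> 1 / 2 ^ n" using \<tau>(3)[of n k] by simp
   hence "rate_bound * (min u (\<tau> n (Suc k)) - \<tau> n k) \<le> rate_bound * (1 / 2 ^ n)"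
    using rate_bound_pos by (intro mult_left_mono) auto
   hence "?e n * m n k (X (\<tau> n k) w) \<le>
     ennreal (exp (- rate_bound * (min u (\<tau> n (Suc k)) - \<tau> n k))) * m n k (X (\<tau> n k) w)"
    by (intro mult_right_mono ennreal_leI) auto
   also have "\<dots> \<le> emeasure (P (\<tau> n k) (X (\<tau> n k) w)) (?F n k)"
    unfolding m_def C_def using that \<tau>[of n k] t by (intro first_in_bounds Xst B) (auto simp: Kn_def)
   finally show ?thesis .
  qed
  have "?e n * I n \<le>
   (\<Sum>k\<in>Kn n. \<integral>\<^sup>+w. ?e n * (m n k (X (\<tau> n k) w) * indicator A w) \<partial>P t x)"
   unfolding I_def sum_distrib_left
   using m_meas A' by (intro sum_mono) (simp add: nn_integral_cmult)
  also have "\<dots> \<le> (\<integral>\<^sup>+w\<in>A. N n w \<partial>P t x)"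
   unfolding markov_cell
  proof (intro sum_mono nn_integral_mono)
   fix k w assume "k \<in> Kn n" "w \<in> space (P t x)"
   from mono_c[OF this]
   show "?e n * (m n k (X (\<tau> n k) w) * indicator A w) \<le>
     emeasure (P (\<tau> n k) (X (\<tau> n k) w)) (?F n k) * indicator A w"
    by (auto simp: indicator_def)
  qed
  finally show ?thesis .
 qed
 have "(\<lambda>n. ?e n * I n) \<longlonglongrightarrow> 1 * (\<integral>\<^sup>+w\<in>A. (\<integral>\<^sup>+r. G X w r \<partial>RI) \<partial>P t x)"
 proof (rule tendsto_mult_ennreal[OF _ lim2])
  have "(\<lambda>n. exp (- rate_bound * (1 / 2 ^ n))) \<longlonglongrightarrow> exp (- rate_bound * 0)"
   by (intro tendsto_intros tendsto_half_powers)
  hence "(\<lambda>n. ?e n) \<longlonglongrightarrow> ennreal (exp (- rate_bound * 0))"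
   by (rule tendsto_ennrealI)
  thus "(\<lambda>n. ?e n) \<longlonglongrightarrow> 1" by simp
 qed auto
 from tendsto_sandwich[OF always_eventually[OF allI[OF low]] always_eventually[OF allI[OF up]] this[unfolded mult_1] lim2]
 have lim3: "(\<lambda>n. \<integral>\<^sup>+w\<in>A. N n w \<partial>P t x) \<longlonglongrightarrow> (\<integral>\<^sup>+w\<in>A. (\<integral>\<^sup>+r. G X w r \<partial>RI) \<partial>P t x)" .
 from LIMSEQ_unique[OF lim1 lim3]
 show "(\<integral>\<^sup>+w\<in>A. (\<Sum>\<tau>\<in>jumps w s u. indicator B (X \<tau> w)) \<partial>P t x) =
   (\<integral>\<^sup>+w\<in>A. (\<integral>\<^sup>+r\<in>{s<..u}. emeasure (\<nu> r (X r w)) B \<partial>lborel) \<partial>P t x)"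
  unfolding Nlim_def RI_int G_def .
qed

section \<open>Predictable integrands: from rectangles to nonnegative functions\<close>

abbreviation "RS t \<equiv> restrict_space lborel {t<..T}"
abbreviation "PR t x \<equiv> P t x \<Otimes>\<^sub>M RS t"

lemma RS_nn_integral: "(\<integral>\<^sup>+r. h r \<partial>RS t) = (\<integral>\<^sup>+r\<in>{t<..T}. h r \<partial>lborel)"
 by (rule nn_integral_restrict_space) simp

lemma space_RS [simp]: "space (RS t) = {t<..T}"
 by (simp add: space_restrict_space)

lemma finite_measure_RS: "t \<le> T ==> finite_measure (RS t)"
 by (rule finite_measureI) (simp add: space_restrict_space emeasure_restrict_space)

lemma product_inclusion:
 assumes t: "0 \<le> t" "x \<in> space K"
 shows "(\<lambda>z. z) \<in> PR t x \<rightarrow>\<^sub>M FA {t..T} \<Otimes>\<^sub>M restrict_space borel {t..T}"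
proof -
 have "(\<lambda>w. w) \<in> P t x \<rightarrow>\<^sub>M FA {t..T}"
  using sets_P[OF t, of "{t..T}"] t FA_subset by (intro measurableI) (auto simp: Int_absorb2)
 moreover have "(\<lambda>r. r) \<in> RS t \<rightarrow>\<^sub>M restrict_space borel {t..T}"
  by (auto intro!: measurable_restrict_space1 measurable_restrict_space2 simp: space_restrict_space measurable_restrict_space2_iff)
 ultimately have "(\<lambda>z. (fst z, snd z)) \<in> PR t x \<rightarrow>\<^sub>M FA {t..T} \<Otimes>\<^sub>M restrict_space borel {t..T}"
  by (intro measurable_Pair measurable_compose[OF measurable_fst] measurable_compose[OF measurable_snd])
 thus ?thesis by simp
qed

lemma product_progressive:
 assumes "0 \<le> t" "t \<le> T" "x \<in> space K" "f \<in> GA t \<rightarrow>\<^sub>M N"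
 shows "f \<in> PR t x \<rightarrow>\<^sub>M N"
 using measurable_compose[OF product_inclusion measurable_progressive_product, of t x] assms by simp

lemma product_predictable:
 assumes "0 \<le> t" "t \<le> T" "x \<in> space K" "f \<in> PA t \<rightarrow>\<^sub>M N"
 shows "f \<in> PR t x \<rightarrow>\<^sub>M N"
 using measurable_compose[OF product_inclusion measurable_predictable_product, of t x] assms by simp

lemma product_X:
 assumes "0 \<le> t" "t \<le> T" "x \<in> space K"
 shows "(\<lambda>(w, r). X r w) \<in> PR t x \<rightarrow>\<^sub>M K"
 by (rule product_progressive[OF assms X_progressive[OF assms(1)]])

lemma product_time:
 assumes "0 \<le> t" "t \<le> T" "x \<in> space K"
 shows "snd \<in> PR t x \<rightarrow>\<^sub>M restrict_space borel {0..T}"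
 by (rule product_progressive[OF assms time_progressive[OF assms(1)]])

lemma product_predictable2:
 assumes "0 \<le> t" "t \<le> T" "x \<in> space K"
  and H: "H \<in> PA t \<Otimes>\<^sub>M K \<rightarrow>\<^sub>M N"
 shows "H \<in> (PR t x) \<Otimes>\<^sub>M K \<rightarrow>\<^sub>M N"
proof -
 have "(\<lambda>z. z) \<in> PR t x \<rightarrow>\<^sub>M PA t"
  by (rule product_predictable[OF assms(1-3)]) simp
 hence "(\<lambda>w. (fst w, snd w)) \<in> (PR t x) \<Otimes>\<^sub>M K \<rightarrow>\<^sub>M PA t \<Otimes>\<^sub>M K"
  by (intro measurable_Pair measurable_compose[OF measurable_fst]) auto
 from measurable_compose[OF this H] show ?thesis by simp
qed

lemma product_rate_nn_integral:
 assumes t: "0 \<le> t" "t \<le> T" "x \<in> space K"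
  and H: "H \<in> borel_measurable (PA t \<Otimes>\<^sub>M K)"
 shows "(\<lambda>(w, r). \<integral>\<^sup>+y. H ((w, r), y) \<partial>\<nu> r (X r w)) \<in> borel_measurable (PR t x)"
 using kernel_nn_measurable[OF product_time[OF t] product_X[OF t], of "\<lambda>v' y. H (v', y)"]
  product_predictable2[OF t H] by (simp add: case_prod_beta')

lemma Int_stable_rectangles: assumes "t \<le> T"
 shows "Int_stable {R \<times> B | R B. R \<in> pred_rects t \<and> B \<in> sets K}"
proof -
 have *: "R \<inter> S \<in> pred_rects t" if RS: "R \<in> pred_rects t" "S \<in> pred_rects t" for R S
 proof -
  have empty: "{} \<in> pred_rects t"
   unfolding pred_rects_def by (intro UnI1 CollectI exI[of _ "{}"]) auto
  have mix: "A \<times> {t} \<inter> A' \<times> {s<..u} = {}" if "t \<le> s" for A A' :: "'w set" and s u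
   using that by auto
  from RS(1) consider (a) A where "R = A \<times> {t}" "A \<in> sets (FA {t..t})"
   | (b) A s u where "R = A \<times> {s<..u}" "t \<le> s" "s \<le> u" "u \<le> T" "A \<in> sets (FA {t..s})"
   unfolding pred_rects_def by blast
  thus ?thesis
  proof cases
   case a
   from RS(2) consider A' where "S = A' \<times> {t}" "A' \<in> sets (FA {t..t})"
    | A' s u where "S = A' \<times> {s<..u}" "t \<le> s"
    unfolding pred_rects_def by blast
   thus ?thesis
   proof cases
    case 1
    have "R \<inter> S = (A \<inter> A') \<times> {t}" using a 1 by auto
    thus ?thesis using a 1 unfolding pred_rects_def by auto
   next
    case 2
    thus ?thesis using mix a empty by metis
   qed
  next
   case b
   from RS(2) consider A' where "S = A' \<times> {t}" "A' \<in> sets (FA {t..t})"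
    | A' s' u' where "S = A' \<times> {s'<..u'}" "t \<le> s'" "s' \<le> u'" "u' \<le> T" "A' \<in> sets (FA {t..s'})"
    unfolding pred_rects_def by blast
   thus ?thesis
   proof cases
    case 1
    thus ?thesis using mix[OF b(2)] b(1) empty by (metis Int_commute)
   next
    case 2
    have eq: "R \<inter> S = (A \<inter> A') \<times> {max s s'<..min u u'}" using b 2 by auto
    have "A \<in> sets (FA {t..max s s'})" "A' \<in> sets (FA {t..max s s'})"
     using b 2 sets_path_algebra_mono[of "{t..s}" "{t..max s s'}" K \<Omega> X]
      sets_path_algebra_mono[of "{t..s'}" "{t..max s s'}" K \<Omega> X] by auto
    hence AA: "A \<inter> A' \<in> sets (FA {t..max s s'})" by auto
    show ?thesis
    proof (cases "max s s' \<le> min u u'")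
     case True
     hence "(A \<inter> A') \<times> {max s s'<..min u u'} \<in> pred_rects t"
      unfolding pred_rects_def using AA b 2
      by (intro UnI2 CollectI exI[of _ "A \<inter> A'"] exI[of _ "max s s'"] exI[of _ "min u u'"] conjI) auto
     thus ?thesis using eq by simp
    next
     case False
     hence "R \<inter> S = {}" unfolding eq by auto
     thus ?thesis using empty by simp
    qed
   qed
  qed
 qed
 show ?thesis
 proof (rule Int_stableI)
  fix C D assume "C \<in> {R \<times> B | R B. R \<in> pred_rects t \<and> B \<in> sets K}"
   "D \<in> {R \<times> B | R B. R \<in> pred_rects t \<and> B \<in> sets K}"
  then obtain R B R' B' where C: "C = R \<times> B" "R \<in> pred_rects t" "B \<in> sets K"
   and D: "D = R' \<times> B'" "R' \<in> pred_rects t" "B' \<in> sets K" by blast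
  have "C \<inter> D = (R \<inter> R') \<times> (B \<inter> B')" unfolding C(1) D(1) by blast
  moreover have "R \<inter> R' \<in> pred_rects t" "B \<inter> B' \<in> sets K" using * C D by auto
  ultimately show "C \<inter> D \<in> {R \<times> B | R B. R \<in> pred_rects t \<and> B \<in> sets K}" by blast
 qed
qed

lemma sets_predictable_product:
 assumes t: "t \<le> T"
 shows "sets (PA t \<Otimes>\<^sub>M K) = sigma_sets ((\<Omega> \<times> {t..T}) \<times> space K)
  {R \<times> B | R B. R \<in> pred_rects t \<and> B \<in> sets K}"
proof -
 have \<Omega>: "\<Omega> \<in> sets (FA {t..t})" using sets.top[of "FA {t..t}"] by simp
 have 1: "\<Omega> \<times> {t} \<in> pred_rects t"
  unfolding pred_rects_def using \<Omega> by blast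
 have 2: "\<Omega> \<times> {t<..T} \<in> pred_rects t"
  unfolding pred_rects_def using \<Omega> t by blast
 have "sets (PA t \<Otimes>\<^sub>M K) =
  sets (sigma (space (PA t) \<times> space K) {a \<times> b | a b. a \<in> pred_rects t \<and> b \<in> sets K})"
 \<comment> \<open>The strip \<Omega> \<times> [t, T] need not be a generator; it is covered by the
   slice at t and the part after t.\<close>
 proof (rule sets_pair_eq[where Ca="{\<Omega> \<times> {t}, \<Omega> \<times> {t<..T}}" and Cb="{space K}"])
  show "pred_rects t \<subseteq> Pow (space (PA t))"
   using pred_rects_subset[OF t] by (simp add: space_predictable[OF t])
  show "sets (PA t) = sigma_sets (space (PA t)) (pred_rects t)"
   using sets_predictable[OF t] by (simp add: space_predictable[OF t])
  show "\<Union>{\<Omega> \<times> {t}, \<Omega> \<times> {t<..T}} = space (PA t)"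
   using t by (auto simp: space_predictable[OF t])
  show "sets K = sigma_sets (space K) (sets K)" by (simp add: sets.sigma_sets_eq)
  show "sets K \<subseteq> Pow (space K)" by (rule sets.space_closed)
 qed (use 1 2 in auto)
 also have "\<dots> = sigma_sets ((\<Omega> \<times> {t..T}) \<times> space K) {a \<times> b | a b. a \<in> pred_rects t \<and> b \<in> sets K}"
  unfolding space_predictable[OF t] using pred_rects_subset[OF t] sets.sets_into_space[of _ K]
  by (intro sets_measure_of) blast
 finally show ?thesis .
qed

text \<open>A Dynkin argument on products of predictable rectangles with sets of states. Rectangles
  over the single time t contribute 0 to both sides, since jumps and intensities are taken after t
  only; the others are covered by \<open>compensator_rectangle\<close>.\<close>

lemma compensator_set:
 assumes t: "0 \<le> t" "t \<le> T" "x \<in> space K" and C: "C \<in> sets (PA t \<Otimes>\<^sub>M K)"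
 shows "(\<lambda>w. \<Sum>j\<in>jumps w t T. indicator C ((w, j), X j w) :: ennreal) \<in> borel_measurable (P t x) \<and>
  (\<integral>\<^sup>+w. (\<Sum>j\<in>jumps w t T. indicator C ((w, j), X j w)) \<partial>P t x) =
  (\<integral>\<^sup>+w. (\<integral>\<^sup>+r. (\<integral>\<^sup>+y. indicator C ((w, r), y) \<partial>\<nu> r (X r w)) \<partial>RS t) \<partial>P t x)"
proof -
 interpret prob_space "P t x" by (rule prob[OF t(1,3)])
 interpret RI: finite_measure "RS t" by (rule finite_measure_RS[OF t(2)])
 let ?S = "(\<Omega> \<times> {t..T}) \<times> space K"
 let ?E = "{R \<times> B | R B. R \<in> pred_rects t \<and> B \<in> sets K}"
 have sE: "sets (PA t \<Otimes>\<^sub>M K) = sigma_sets ?S ?E" by (rule sets_predictable_product[OF t(2)])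
 have subE: "?E \<subseteq> Pow ?S"
  using pred_rects_subset[OF t(2)] sets.sets_into_space[of _ K] by blast
 define N where "N C w = (\<Sum>j\<in>jumps w t T. indicator C ((w, j), X j w) :: ennreal)" for C w
 define G where "G C w r = (\<integral>\<^sup>+y. indicator C ((w, r), y) \<partial>\<nu> r (X r w))" for C w r
 define R where "R C = (\<integral>\<^sup>+w. (\<integral>\<^sup>+r. G C w r \<partial>RS t) \<partial>P t x)" for C
 have inS: "((w, j), X j w) \<in> ?S" if "w \<in> \<Omega>" "j \<in> {t<..T}" for w j
  using that t state[of j w] by auto
 have G_meas: "(\<lambda>(w, r). G C w r) \<in> borel_measurable (PR t x)" if "C \<in> sigma_sets ?S ?E" for C
  unfolding G_def by (rule product_rate_nn_integral[OF t borel_measurable_indicator]) (use that sE in simp)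
 have G_sec: "G C w \<in> borel_measurable (RS t)" if "C \<in> sigma_sets ?S ?E" "w \<in> space (P t x)" for C w
  using measurable_compose[OF measurable_Pair1'[OF that(2)] G_meas[OF that(1)]] by simp
 have G_int: "(\<lambda>w. \<integral>\<^sup>+r. G C w r \<partial>RS t) \<in> borel_measurable (P t x)" if "C \<in> sigma_sets ?S ?E" for C
  by (rule RI.borel_measurable_nn_integral[OF G_meas[OF that]])
 have C_sec: "(\<lambda>y. indicator C ((w, r), y) :: ennreal) \<in> borel_measurable (\<nu> r (X r w))"
  if C: "C \<in> sigma_sets ?S ?E" and "w \<in> \<Omega>" "r \<in> {t<..T}" for C w r
 proof -
  have "(w, r) \<in> space (PA t)" using that t by (auto simp: space_predictable)
  hence "(\<lambda>y. ((w, r), y)) \<in> K \<rightarrow>\<^sub>M PA t \<Otimes>\<^sub>M K" by (rule measurable_Pair1')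
  from measurable_compose[OF this borel_measurable_indicator[of C]] C sE
  show ?thesis using that t state[of r w] by (simp add: measurable_rate_iff)
 qed
 define good where "good C \<longleftrightarrow> N C \<in> borel_measurable (P t x) \<and> (\<integral>\<^sup>+w. N C w \<partial>P t x) = R C" for C
 have rect: "good (Q \<times> B)" if RB: "Q \<in> pred_rects t" "B \<in> sets K" for Q B
 proof -
  from RB(1) consider (a) A where "Q = A \<times> {t}" "A \<in> sets (FA {t..t})"
   | (b) A s u where "Q = A \<times> {s<..u}" "t \<le> s" "s \<le> u" "u \<le> T" "A \<in> sets (FA {t..s})"
   unfolding pred_rects_def by blast
  thus ?thesis
  proof cases
   case a
   have "N (Q \<times> B) = (\<lambda>_. 0)" unfolding N_def a(1) by (intro ext sum.neutral) auto
   moreover have "G (Q \<times> B) w r = 0" if "r \<in> {t<..T}" for w r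
    unfolding G_def a(1) using that by (auto simp: indicator_def)
   hence "(\<integral>\<^sup>+r. G (Q \<times> B) w r \<partial>RS t) = (\<integral>\<^sup>+r. 0 \<partial>RS t)" for w
    by (intro nn_integral_cong) simp
   ultimately show ?thesis by (simp add: good_def R_def)
  next
   case b
   note cr = compensator_rectangle[OF t(1) b(2,3,4) t(3) b(5) RB(2)]
   have A: "A \<in> sets (P t x)" using sets_P[OF t(1,3) _ b(5)] by auto
   have N_eq: "N (Q \<times> B) w = (\<Sum>j\<in>jumps w s u. indicator B (X j w)) * indicator A w"
    if w: "w \<in> \<Omega>" for w
   proof -
    have "N (Q \<times> B) w = (\<Sum>j\<in>jumps w s u. indicator (Q \<times> B) ((w, j), X j w))"
     unfolding N_def using b finite_jumps[OF w]
     by (intro sum.mono_neutral_right) (auto simp: indicator_def)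
    also have "\<dots> = (\<Sum>j\<in>jumps w s u. indicator B (X j w) * indicator A w)"
     unfolding b(1) by (intro sum.cong) (auto simp: indicator_def)
    finally show ?thesis by (simp add: sum_distrib_right)
   qed
   have G_eq: "(\<integral>\<^sup>+r. G (Q \<times> B) w r \<partial>RS t) = (\<integral>\<^sup>+r\<in>{s<..u}. emeasure (\<nu> r (X r w)) B \<partial>lborel) * indicator A w"
    if w: "w \<in> \<Omega>" for w
   proof -
    have "G (Q \<times> B) w r = emeasure (\<nu> r (X r w)) B * indicator {s<..u} r * indicator A w" if r: "r \<in> {t<..T}" for r
    proof -
     have "G (Q \<times> B) w r = (\<integral>\<^sup>+y. (indicator {s<..u} r * indicator A w) * indicator B y \<partial>\<nu> r (X r w))"
      unfolding G_def b(1) by (intro nn_integral_cong) (auto simp: indicator_def)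
     also have "\<dots> = (indicator {s<..u} r * indicator A w) * emeasure (\<nu> r (X r w)) B"
      using RB(2) sets_rate[of r "X r w"] r t state[of r w] w by (intro nn_integral_cmult_indicator) auto
     finally show ?thesis by (simp add: ac_simps)
    qed
    hence "(\<integral>\<^sup>+r. G (Q \<times> B) w r \<partial>RS t) =
      (\<integral>\<^sup>+r. emeasure (\<nu> r (X r w)) B * indicator {s<..u} r * indicator A w * indicator {t<..T} r \<partial>lborel)"
     unfolding RS_nn_integral by (intro nn_integral_cong) (auto simp: indicator_def)
    also have "\<dots> = (\<integral>\<^sup>+r. emeasure (\<nu> r (X r w)) B * indicator {s<..u} r * indicator A w \<partial>lborel)"
     using b by (intro nn_integral_cong) (auto simp: indicator_def)
    also have "\<dots> = (\<integral>\<^sup>+r\<in>{s<..u}. emeasure (\<nu> r (X r w)) B \<partial>lborel) * indicator A w"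
     by (cases "w \<in> A") auto
    finally show ?thesis .
   qed
   have "(\<lambda>w. (\<Sum>j\<in>jumps w s u. indicator B (X j w)) * indicator A w :: ennreal) \<in> borel_measurable (P t x)"
    using cr(1) A by measurable
   hence "N (Q \<times> B) \<in> borel_measurable (P t x)"
    by (rule measurable_cong[THEN iffD2, rotated]) (use N_eq t in auto)
   moreover have "(\<integral>\<^sup>+w. N (Q \<times> B) w \<partial>P t x) = (\<integral>\<^sup>+w\<in>A. (\<Sum>j\<in>jumps w s u. indicator B (X j w)) \<partial>P t x)"
    by (rule nn_integral_cong) (use N_eq t in auto)
   moreover have "R (Q \<times> B) = (\<integral>\<^sup>+w\<in>A. (\<integral>\<^sup>+r\<in>{s<..u}. emeasure (\<nu> r (X r w)) B \<partial>lborel) \<partial>P t x)"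
    unfolding R_def by (rule nn_integral_cong) (use G_eq t in auto)
   ultimately show ?thesis unfolding good_def using cr(2) by (simp only:)
  qed
 qed
 have full: "good ?S"
 proof -
  have 1: "good ((\<Omega> \<times> {t<..T}) \<times> space K)"
  proof (rule rect)
   have "\<Omega> \<in> sets (FA {t..t})" using sets.top[of "FA {t..t}"] by simp
   thus "\<Omega> \<times> {t<..T} \<in> pred_rects t"
    unfolding pred_rects_def using t by blast
  qed simp
  have "N ?S = N ((\<Omega> \<times> {t<..T}) \<times> space K)"
   unfolding N_def by (intro ext sum.cong) (auto simp: indicator_def)
  moreover have "G ?S w r = G ((\<Omega> \<times> {t<..T}) \<times> space K) w r" if "r \<in> {t<..T}" for w r
   unfolding G_def using that by (intro nn_integral_cong) (auto simp: indicator_def)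
  hence "R ?S = R ((\<Omega> \<times> {t<..T}) \<times> space K)"
   unfolding R_def by (intro nn_integral_cong) simp
  ultimately show ?thesis using 1 unfolding good_def by (simp only:)
 qed
 \<comment> \<open>Passing to complements subtracts intensities, which is legitimate because the
   total one is at most the rate bound times the length of the interval.\<close>
 have full_fin: "R ?S < \<infinity>"
 proof -
  have "R ?S \<le> (\<integral>\<^sup>+w. (\<integral>\<^sup>+r. ennreal rate_bound \<partial>RS t) \<partial>P t x)"
   unfolding R_def
  proof (intro nn_integral_mono)
   fix w r assume "w \<in> space (P t x)" "r \<in> space (RS t)"
   hence r: "r \<in> {0..T}" "X r w \<in> space K" using t state[of r w] by auto
   have "G ?S w r \<le> (\<integral>\<^sup>+y. indicator (space (\<nu> r (X r w))) y \<partial>\<nu> r (X r w))"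
    unfolding G_def by (intro nn_integral_mono) (auto simp: indicator_def)
   also have "\<dots> = emeasure (\<nu> r (X r w)) (space (\<nu> r (X r w)))"
    by (rule nn_integral_indicator) (rule sets.top)
   also have "\<dots> \<le> ennreal rate_bound" using rate_le[OF r] r by (simp add: space_rate)
   finally show "G ?S w r \<le> ennreal rate_bound" .
  qed
  moreover have "emeasure (RS t) {t<..T} < top"
   using RI.emeasure_finite[of "{t<..T}"] unfolding less_top .
  hence "(\<integral>\<^sup>+w. (\<integral>\<^sup>+r. ennreal rate_bound \<partial>RS t) \<partial>P t x) < \<infinity>"
   by (simp add: emeasure_space_1 ennreal_mult_less_top)
  ultimately show ?thesis by (rule le_less_trans)
 qed
 have "good C"
  using Int_stable_rectangles[OF t(2)] subE C[unfolded sE]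
 proof (induction rule: sigma_sets_induct_disjoint)
  case (basic C)
  thus ?case using rect by blast
 next
  case empty
  have "N {} = (\<lambda>_. 0)" "G {} = (\<lambda>_ _. 0)" by (simp_all add: N_def G_def fun_eq_iff)
  thus ?case by (simp add: good_def R_def)
 next
  case (compl C)
  have Cc: "?S - C \<in> sigma_sets ?S ?E" using compl(1) by (rule sigma_sets.Compl)
  have N_add: "N ?S w = N (?S - C) w + N C w" if "w \<in> \<Omega>" for w
   unfolding N_def sum.distrib[symmetric] using inS[OF that]
   by (intro sum.cong refl) (auto simp: indicator_def)
  have G_add: "G ?S w r = G (?S - C) w r + G C w r" if "w \<in> \<Omega>" "r \<in> {t<..T}" for w r
  proof -
   have "G ?S w r = (\<integral>\<^sup>+y. indicator (?S - C) ((w, r), y) + indicator C ((w, r), y) \<partial>\<nu> r (X r w))"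
    unfolding G_def using sigma_sets_into_sp[OF subE compl(1)]
    by (intro nn_integral_cong) (auto simp: indicator_def)
   also have "\<dots> = G (?S - C) w r + G C w r"
    unfolding G_def using C_sec[OF Cc that] C_sec[OF compl(1) that] by (rule nn_integral_add)
   finally show ?thesis .
  qed
  have N_fin: "N C w \<noteq> \<infinity>" if "w \<in> \<Omega>" for w
   unfolding N_def using finite_jumps[OF that] by (simp add: indicator_def)
  have "N (?S - C) w = N ?S w - N C w" if "w \<in> \<Omega>" for w
   using N_add[OF that] N_fin[OF that] by (simp add: ennreal_add_diff_cancel_right)
  moreover have "(\<lambda>w. N ?S w - N C w) \<in> borel_measurable (P t x)"
   using full compl(2) unfolding good_def by (intro borel_measurable_minus_ennreal) auto
  ultimately have N_meas: "N (?S - C) \<in> borel_measurable (P t x)"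
   using t by (subst measurable_cong[where g="\<lambda>w. N ?S w - N C w"]) auto
  have "R ?S = (\<integral>\<^sup>+w. (\<integral>\<^sup>+r. G (?S - C) w r \<partial>RS t) + (\<integral>\<^sup>+r. G C w r \<partial>RS t) \<partial>P t x)"
   unfolding R_def
  proof (rule nn_integral_cong)
   fix w assume w: "w \<in> space (P t x)"
   have "(\<integral>\<^sup>+r. G ?S w r \<partial>RS t) = (\<integral>\<^sup>+r. G (?S - C) w r + G C w r \<partial>RS t)"
    using G_add w t by (intro nn_integral_cong) simp
   also have "\<dots> = (\<integral>\<^sup>+r. G (?S - C) w r \<partial>RS t) + (\<integral>\<^sup>+r. G C w r \<partial>RS t)"
    by (rule nn_integral_add[OF G_sec[OF Cc w] G_sec[OF compl(1) w]])
   finally show "(\<integral>\<^sup>+r. G ?S w r \<partial>RS t) = (\<integral>\<^sup>+r. G (?S - C) w r \<partial>RS t) + (\<integral>\<^sup>+r. G C w r \<partial>RS t)" .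
  qed
  also have "\<dots> = R (?S - C) + R C"
   unfolding R_def by (rule nn_integral_add[OF G_int[OF Cc] G_int[OF compl(1)]])
  finally have R_add: "R ?S = R (?S - C) + R C" .
  have NC_meas: "N C \<in> borel_measurable (P t x)" using compl(2) by (simp add: good_def)
  have "(\<integral>\<^sup>+w. N ?S w \<partial>P t x) = (\<integral>\<^sup>+w. N (?S - C) w + N C w \<partial>P t x)"
   using N_add t by (intro nn_integral_cong) simp
  also have "\<dots> = (\<integral>\<^sup>+w. N (?S - C) w \<partial>P t x) + (\<integral>\<^sup>+w. N C w \<partial>P t x)"
   by (rule nn_integral_add[OF N_meas NC_meas])
  finally have "R (?S - C) + R C = (\<integral>\<^sup>+w. N (?S - C) w \<partial>P t x) + R C"
   using full compl(2) R_add unfolding good_def by (simp only:)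
  moreover have "R C \<noteq> top" using full_fin R_add by (auto simp: top_unique)
  ultimately have "(\<integral>\<^sup>+w. N (?S - C) w \<partial>P t x) = R (?S - C)"
   by (metis ennreal_add_diff_cancel_right infinity_ennreal_def)
  thus ?case using N_meas by (simp add: good_def)
 next
  case (union C)
  have C: "C i \<in> sigma_sets ?S ?E" for i using union(2) by auto
  have ind: "indicator (\<Union>i. C i) z = (\<Sum>i. indicator (C i) z :: ennreal)" for z
   using suminf_indicator[OF union(1), of z] by simp
  have N_eq: "N (\<Union>i. C i) = (\<lambda>w. \<Sum>i. N (C i) w)"
   unfolding N_def ind by (intro ext suminf_sum[symmetric]) simp
  have G_eq: "G (\<Union>i. C i) w r = (\<Sum>i. G (C i) w r)" if "w \<in> \<Omega>" "r \<in> {t<..T}" for w r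
   unfolding G_def ind using C_sec[OF C that] by (intro nn_integral_suminf)
  have "(\<integral>\<^sup>+w. N (\<Union>i. C i) w \<partial>P t x) = (\<Sum>i. \<integral>\<^sup>+w. N (C i) w \<partial>P t x)"
   unfolding N_eq using union(3) by (intro nn_integral_suminf) (simp add: good_def)
  also have "\<dots> = (\<Sum>i. R (C i))" using union(3) by (simp add: good_def)
  also have "\<dots> = (\<integral>\<^sup>+w. (\<Sum>i. \<integral>\<^sup>+r. G (C i) w r \<partial>RS t) \<partial>P t x)"
   unfolding R_def using G_int[OF C] by (intro nn_integral_suminf[symmetric])
  also have "\<dots> = R (\<Union>i. C i)"
   unfolding R_def
  proof (rule nn_integral_cong)
   fix w assume w: "w \<in> space (P t x)"
   have "(\<Sum>i. \<integral>\<^sup>+r. G (C i) w r \<partial>RS t) = (\<integral>\<^sup>+r. (\<Sum>i. G (C i) w r) \<partial>RS t)"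
    using G_sec[OF C w] by (intro nn_integral_suminf[symmetric])
   also have "\<dots> = (\<integral>\<^sup>+r. G (\<Union>i. C i) w r \<partial>RS t)"
    using G_eq w t by (intro nn_integral_cong) simp
   finally show "(\<Sum>i. \<integral>\<^sup>+r. G (C i) w r \<partial>RS t) = (\<integral>\<^sup>+r. G (\<Union>i. C i) w r \<partial>RS t)" .
  qed
  finally have "(\<integral>\<^sup>+w. N (\<Union>i. C i) w \<partial>P t x) = R (\<Union>i. C i)" .
  moreover have "N (\<Union>i. C i) \<in> borel_measurable (P t x)"
   unfolding N_eq using union(3) by (intro borel_measurable_suminf_order) (simp add: good_def)
  ultimately show ?case by (simp add: good_def)
 qed
 thus ?thesis unfolding good_def N_def R_def G_def by blast
qed

text \<open>The usual extension from indicators by linearity and monotone limits; both sides may be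
  infinite. The kernel is taken at X r instead of the left limit, since on each path the two differ
  at finitely many r only.\<close>

theorem compensator:
 fixes H :: "('w \<times> real) \<times> 'k => ennreal"
 assumes t: "0 \<le> t" "t \<le> T" "x \<in> space K" and H: "H \<in> borel_measurable (PA t \<Otimes>\<^sub>M K)"
 shows "(\<lambda>w. \<Sum>j\<in>jumps w t T. H ((w, j), X j w)) \<in> borel_measurable (P t x) \<and>
  (\<integral>\<^sup>+w. (\<Sum>j\<in>jumps w t T. H ((w, j), X j w)) \<partial>P t x) =
  (\<integral>\<^sup>+w. (\<integral>\<^sup>+r. (\<integral>\<^sup>+y. H ((w, r), y) \<partial>\<nu> r (X r w)) \<partial>RS t) \<partial>P t x)"
 using H
proof (induction H)
 let ?M = "PA t \<Otimes>\<^sub>M K"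
 interpret prob_space "P t x" by (rule prob[OF t(1,3)])
 interpret RI: finite_measure "RS t" by (rule finite_measure_RS[OF t(2)])
 define N where "N H w = (\<Sum>j\<in>jumps w t T. H ((w, j), X j w) :: ennreal)" for H w
 define G where "G H w r = (\<integral>\<^sup>+y. H ((w, r), y) \<partial>\<nu> r (X r w))" for H w r
 define R where "R H = (\<integral>\<^sup>+w. (\<integral>\<^sup>+r. G H w r \<partial>RS t) \<partial>P t x)" for H
 have inS: "((w, j), y) \<in> space ?M" if "w \<in> \<Omega>" "j \<in> {t<..T}" "y \<in> space K" for w j y
  using that t by (auto simp: space_pair_measure space_predictable)
 have st: "X j w \<in> space K" if "w \<in> \<Omega>" "j \<in> {t<..T}" for w j using that t state by auto
 have G_meas: "(\<lambda>(w, r). G H w r) \<in> borel_measurable (PR t x)" if "H \<in> borel_measurable ?M" for H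
  unfolding G_def by (rule product_rate_nn_integral[OF t that])
 have G_sec: "G H w \<in> borel_measurable (RS t)" if "H \<in> borel_measurable ?M" "w \<in> space (P t x)" for H w
  using measurable_compose[OF measurable_Pair1'[OF that(2)] G_meas[OF that(1)]] by simp
 have G_int: "(\<lambda>w. \<integral>\<^sup>+r. G H w r \<partial>RS t) \<in> borel_measurable (P t x)" if "H \<in> borel_measurable ?M" for H
  by (rule RI.borel_measurable_nn_integral[OF G_meas[OF that]])
 have sec: "(\<lambda>y. H ((w, r), y)) \<in> borel_measurable (\<nu> r (X r w))"
  if "H \<in> borel_measurable ?M" "w \<in> \<Omega>" "r \<in> {t<..T}" for H :: "_ => ennreal" and w r
 proof -
  have "(w, r) \<in> space (PA t)" using that t by (auto simp: space_predictable)
  from measurable_compose[OF measurable_Pair1'[OF this] that(1)]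
  show ?thesis using that t state[of r w] by (simp add: measurable_rate_iff)
 qed
 {
  case (cong f g)
  have "N f w = N g w" if "w \<in> \<Omega>" for w
   unfolding N_def using cong(3) inS st that by (intro sum.cong) auto
  moreover have "G f w r = G g w r" if "w \<in> \<Omega>" "r \<in> {t<..T}" for w r
   unfolding G_def using cong(3) inS that t st[OF that]
   by (intro nn_integral_cong) (auto simp: space_rate)
  hence "R f = R g" unfolding R_def using t by (intro nn_integral_cong) simp
  ultimately have "N f \<in> borel_measurable (P t x) \<longleftrightarrow> N g \<in> borel_measurable (P t x)"
   "(\<integral>\<^sup>+w. N f w \<partial>P t x) = (\<integral>\<^sup>+w. N g w \<partial>P t x)" "R f = R g"
   using t by (auto intro!: nn_integral_cong measurable_cong)
  moreover have "N g \<in> borel_measurable (P t x) \<and> (\<integral>\<^sup>+w. N g w \<partial>P t x) = R g"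
   using cong(4) unfolding N_def R_def G_def .
  ultimately have "N f \<in> borel_measurable (P t x) \<and> (\<integral>\<^sup>+w. N f w \<partial>P t x) = R f" by simp
  thus ?case unfolding N_def R_def G_def .
 next
  case (set A)
  thus ?case by (rule compensator_set[OF t])
 next
  case (mult u c)
  have "N (\<lambda>z. c * u z) = (\<lambda>w. c * N u w)" by (simp add: N_def sum_distrib_left fun_eq_iff)
  moreover have "G (\<lambda>z. c * u z) w r = c * G u w r" if "w \<in> \<Omega>" "r \<in> {t<..T}" for w r
   unfolding G_def using sec[OF mult(2) that] by (rule nn_integral_cmult)
  hence "(\<integral>\<^sup>+r. G (\<lambda>z. c * u z) w r \<partial>RS t) = c * (\<integral>\<^sup>+r. G u w r \<partial>RS t)" if "w \<in> space (P t x)" for w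
   using G_sec[OF mult(2) that] that t by (subst nn_integral_cmult[symmetric]) (auto intro!: nn_integral_cong)
  hence "R (\<lambda>z. c * u z) = c * R u"
   unfolding R_def using G_int[OF mult(2)] by (subst nn_integral_cmult[symmetric]) (auto intro!: nn_integral_cong)
  moreover have "N u \<in> borel_measurable (P t x) \<and> (\<integral>\<^sup>+w. N u w \<partial>P t x) = R u"
   using mult(4) unfolding N_def R_def G_def .
  ultimately have "N (\<lambda>z. c * u z) \<in> borel_measurable (P t x) \<and> (\<integral>\<^sup>+w. N (\<lambda>z. c * u z) w \<partial>P t x) = R (\<lambda>z. c * u z)"
   by (simp add: nn_integral_cmult borel_measurable_times_ennreal)
  thus ?case unfolding N_def R_def G_def .
 next
  case (add u v)
  have "N (\<lambda>z. v z + u z) = (\<lambda>w. N v w + N u w)" by (simp add: N_def sum.distrib fun_eq_iff)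
  moreover have "G (\<lambda>z. v z + u z) w r = G v w r + G u w r" if "w \<in> \<Omega>" "r \<in> {t<..T}" for w r
   unfolding G_def using sec[OF add(3) that] sec[OF add(1) that] by (rule nn_integral_add)
  hence "(\<integral>\<^sup>+r. G (\<lambda>z. v z + u z) w r \<partial>RS t) = (\<integral>\<^sup>+r. G v w r \<partial>RS t) + (\<integral>\<^sup>+r. G u w r \<partial>RS t)"
   if "w \<in> space (P t x)" for w
   using G_sec[OF add(3) that] G_sec[OF add(1) that] that t
   by (subst nn_integral_add[symmetric]) (auto intro!: nn_integral_cong)
  hence "R (\<lambda>z. v z + u z) = R v + R u"
   unfolding R_def using G_int[OF add(3)] G_int[OF add(1)]
   by (subst nn_integral_add[symmetric]) (auto intro!: nn_integral_cong)
  moreover have "N u \<in> borel_measurable (P t x) \<and> (\<integral>\<^sup>+w. N u w \<partial>P t x) = R u"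
   "N v \<in> borel_measurable (P t x) \<and> (\<integral>\<^sup>+w. N v w \<partial>P t x) = R v"
   using add(6,7) unfolding N_def R_def G_def by blast+
  ultimately have "N (\<lambda>z. v z + u z) \<in> borel_measurable (P t x) \<and>
    (\<integral>\<^sup>+w. N (\<lambda>z. v z + u z) w \<partial>P t x) = R (\<lambda>z. v z + u z)"
   by (simp add: nn_integral_add borel_measurable_add)
  thus ?case unfolding N_def R_def G_def .
 next
  case (seq U)
  have inc: "incseq (\<lambda>i. U i z)" for z
   using seq(3) unfolding incseq_def le_fun_def by blast
  have Sup: "(SUP i. U i) z = (SUP i. U i z)" for z by (simp add: image_comp)
  have N_inc: "incseq (\<lambda>i. N (U i))"
   unfolding N_def using inc by (auto simp: incseq_def le_fun_def intro!: sum_mono)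
  have N_eq: "N (SUP i. U i) = (\<lambda>w. SUP i. N (U i) w)"
   unfolding N_def Sup using inc by (intro ext ennreal_SUP_sum[symmetric])
  have G_inc: "incseq (\<lambda>i. G (U i) w)" for w
   unfolding G_def using inc by (auto simp: incseq_def le_fun_def intro!: nn_integral_mono)
  have G_eq: "G (SUP i. U i) w r = (SUP i. G (U i) w r)" if "w \<in> \<Omega>" "r \<in> {t<..T}" for w r
   unfolding G_def Sup using sec[OF seq(1) that] inc
   by (intro nn_integral_monotone_convergence_SUP) (auto simp: incseq_def le_fun_def)
  have GI: "(\<integral>\<^sup>+r. G (SUP i. U i) w r \<partial>RS t) = (SUP i. \<integral>\<^sup>+r. G (U i) w r \<partial>RS t)"
   if w: "w \<in> space (P t x)" for w
  proof -
   have "(\<integral>\<^sup>+r. G (SUP i. U i) w r \<partial>RS t) = (\<integral>\<^sup>+r. (SUP i. G (U i) w r) \<partial>RS t)"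
    using G_eq w t by (intro nn_integral_cong) simp
   also have "\<dots> = (SUP i. \<integral>\<^sup>+r. G (U i) w r \<partial>RS t)"
    using G_inc G_sec[OF seq(1) w] by (rule nn_integral_monotone_convergence_SUP)
   finally show ?thesis .
  qed
  have "R (SUP i. U i) = (\<integral>\<^sup>+w. (SUP i. \<integral>\<^sup>+r. G (U i) w r \<partial>RS t) \<partial>P t x)"
   unfolding R_def using GI by (rule nn_integral_cong)
  also have "\<dots> = (SUP i. R (U i))"
   unfolding R_def using G_inc G_int[OF seq(1)]
   by (intro nn_integral_monotone_convergence_SUP) (auto simp: incseq_def le_fun_def intro!: nn_integral_mono)
  finally have R_eq: "R (SUP i. U i) = (SUP i. R (U i))" .
  have NU: "N (U i) \<in> borel_measurable (P t x)" "(\<integral>\<^sup>+w. N (U i) w \<partial>P t x) = R (U i)" for i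
   using seq(5)[of i] unfolding N_def R_def G_def by blast+
  have "(\<integral>\<^sup>+w. N (SUP i. U i) w \<partial>P t x) = (SUP i. \<integral>\<^sup>+w. N (U i) w \<partial>P t x)"
   unfolding N_eq using N_inc NU(1) by (rule nn_integral_monotone_convergence_SUP)
  moreover have "N (SUP i. U i) \<in> borel_measurable (P t x)" unfolding N_eq using NU(1) by measurable
  ultimately have "N (SUP i. U i) \<in> borel_measurable (P t x) \<and> (\<integral>\<^sup>+w. N (SUP i. U i) w \<partial>P t x) = R (SUP i. U i)"
   unfolding R_eq by (simp add: NU(2))
  thus ?case unfolding N_def R_def G_def .
 }
qed

end

section \<open>Squares of absolutely continuous paths with finitely many jumps\<close>

lemma integral_triangle:
 fixes E :: "real => real"
 assumes E: "integrable lborel E"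
 shows "integrable lborel (\<lambda>s. E s * (\<integral>r. indicator {..s} r * E r \<partial>lborel))"
  and "(\<integral>s. E s * (\<integral>r. indicator {..s} r * E r \<partial>lborel) \<partial>lborel) = (\<integral>s. E s \<partial>lborel)\<^sup>2 / 2"
proof -
 have [measurable]: "E \<in> borel_measurable borel" using E by auto
 define f where "f = (\<lambda>(s, r). E s * (indicator {..s} r * E r))"
 have ind: "(\<lambda>(s :: real, r). indicator {..s} r :: real) \<in> borel_measurable (borel \<Otimes>\<^sub>M borel)"
 proof -
  have "(\<lambda>z. indicator {z :: real \<times> real. snd z \<le> fst z} z :: real) \<in> borel_measurable (borel \<Otimes>\<^sub>M borel)"
   by measurable
  moreover have "(\<lambda>z. indicator {z :: real \<times> real. snd z \<le> fst z} z :: real) = (\<lambda>(s, r). indicator {..s} r)"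
   by (auto simp: fun_eq_iff indicator_def)
  ultimately show ?thesis by (simp only:)
 qed
 hence f_meas: "f \<in> borel_measurable (lborel \<Otimes>\<^sub>M lborel)"
  unfolding f_def by (simp add: case_prod_beta') measurable
 have prod: "integrable (lborel \<Otimes>\<^sub>M lborel) (\<lambda>(s, r). E s * E r)"
 proof (rule lborel_pair.Fubini_integrable)
  show "(\<lambda>(s, r). E s * E r) \<in> borel_measurable (lborel \<Otimes>\<^sub>M lborel)" by measurable
  show "integrable lborel (\<lambda>s. \<integral>r. norm (case (s, r) of (s, r) => E s * E r) \<partial>lborel)"
   using E by (simp add: abs_mult)
  show "AE s in lborel. integrable lborel (\<lambda>r. case (s, r) of (s, r) => E s * E r)"
   using E by simp
 qed
 have f_int: "integrable (lborel \<Otimes>\<^sub>M lborel) f"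
  by (rule Bochner_Integration.integrable_bound[OF prod f_meas]) (auto simp: f_def indicator_def)
 define F where "F s = (\<integral>r. indicator {..s} r * E r \<partial>lborel)" for s
 define G where "G s = (\<integral>r. indicator {s..} r * E r \<partial>lborel)" for s
 have Ei: "integrable lborel (\<lambda>r. indicator A r * E r)" if "A \<in> sets borel" for A
  using integrable_mult_indicator[of A lborel E] E that by simp
 \<comment> \<open>The two half-lines overlap in the single point s, so the two partial integrals
   add up to the total.\<close>
 have FG: "F s + G s = (\<integral>r. E r \<partial>lborel)" for s
 proof -
  have "F s + G s = (\<integral>r. indicator {..s} r * E r + indicator {s..} r * E r \<partial>lborel)"
   unfolding F_def G_def by (rule Bochner_Integration.integral_add[symmetric]) (auto intro: Ei)
  also have "\<dots> = (\<integral>r. E r \<partial>lborel)"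
  proof (rule integral_cong_AE)
   have "AE r in lborel. r \<noteq> s" by (rule AE_lborel_singleton)
   thus "AE r in lborel. indicator {..s} r * E r + indicator {s..} r * E r = E r"
    by eventually_elim (auto simp: indicator_def)
  qed measurable
  finally show ?thesis .
 qed
 show i1: "integrable lborel (\<lambda>s. E s * (\<integral>r. indicator {..s} r * E r \<partial>lborel))"
  using lborel_pair.integrable_fst'[OF f_int] by (simp add: f_def)
 have swap: "f (s, r) = E r * (indicator {r..} s * E s)" for s r by (simp add: f_def indicator_def)
 have fG: "(\<integral>s. f (s, r) \<partial>lborel) = E r * G r" for r unfolding swap G_def by simp
 have i2: "integrable lborel (\<lambda>r. E r * G r)"
  using lborel_pair.integrable_snd[of "\<lambda>s r. f (s, r)"] f_int unfolding fG by simp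
 have "(\<integral>s. E s * F s \<partial>lborel) = (\<integral>s. (\<integral>r. f (s, r) \<partial>lborel) \<partial>lborel)"
  by (simp add: f_def F_def)
 also have "\<dots> = (\<integral>r. (\<integral>s. f (s, r) \<partial>lborel) \<partial>lborel)"
  by (rule lborel_pair.Fubini_integral[symmetric]) (use f_int in simp)
 also have "\<dots> = (\<integral>r. E r * G r \<partial>lborel)"
  unfolding fG ..
 \<comment> \<open>Fubini on the triangle r \<le> s shows that the integrals of \<open>E * F\<close>
   and \<open>E * G\<close> agree. As they add up to the square of the total integral, each is half
   of it.\<close>
 finally have eq: "(\<integral>s. E s * F s \<partial>lborel) = (\<integral>r. E r * G r \<partial>lborel)" .
 have "(\<integral>s. E s * F s \<partial>lborel) + (\<integral>s. E s * G s \<partial>lborel) = (\<integral>s. E s * F s + E s * G s \<partial>lborel)"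
  using i1 i2 unfolding F_def by (intro Bochner_Integration.integral_add[symmetric])
 also have "\<dots> = (\<integral>s. E s * (\<integral>r. E r \<partial>lborel) \<partial>lborel)" by (simp add: distrib_left[symmetric] FG)
 also have "\<dots> = (\<integral>s. E s \<partial>lborel)\<^sup>2" by (simp add: power2_eq_square)
 finally show "(\<integral>s. E s * (\<integral>r. indicator {..s} r * E r \<partial>lborel) \<partial>lborel) = (\<integral>s. E s \<partial>lborel)\<^sup>2 / 2"
  using eq by (simp add: F_def)
qed

abbreviation ioc :: "(real => real) => real => real => real" where
 "ioc D a b \<equiv> (LINT r:{a<..b}|lborel. D r)"

lemma set_integrable_ioc_subset:
 fixes D :: "real => real"
 shows "set_integrable lborel {a<..b} D ==> a \<le> c ==> d \<le> b ==> set_integrable lborel {c<..d} D"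
 by (rule set_integrable_subset) auto

lemma ioc_split:
 fixes D :: "real => real"
 assumes "set_integrable lborel {a<..c} D" "a \<le> b" "b \<le> c"
 shows "ioc D a c = ioc D a b + ioc D b c"
proof -
 have "{a<..c} = {a<..b} \<union> {b<..c}" using assms by auto
 thus ?thesis
  using set_integral_Un[of "{a<..b}" "{b<..c}" lborel D] set_integrable_ioc_subset[OF assms(1)] assms
  by simp
qed

text \<open>The identity F dF = d(F^2) / 2 for the primitive F of D. It comes from the symmetry of
  the double integral, so F need not be differentiated.\<close>

lemma ioc_square:
 fixes D :: "real => real"
 assumes D: "set_integrable lborel {a<..b} D"
 shows "set_integrable lborel {a<..b} (\<lambda>s. D s * ioc D a s)"
  and "ioc (\<lambda>s. D s * ioc D a s) a b = (ioc D a b)\<^sup>2 / 2"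
proof -
 define E where "E s = indicator {a<..b} s * D s" for s
 have E: "integrable lborel E" using D by (simp add: set_integrable_def E_def[abs_def])
 have eq: "E s * (\<integral>r. indicator {..s} r * E r \<partial>lborel) = indicator {a<..b} s *\<^sub>R (D s * ioc D a s)" for s
 proof (cases "s \<in> {a<..b}")
  case True
  hence "(\<integral>r. indicator {..s} r * E r \<partial>lborel) = ioc D a s"
   unfolding set_lebesgue_integral_def E_def
   by (intro Bochner_Integration.integral_cong) (auto simp: indicator_def)
  thus ?thesis using True by (simp add: E_def)
 qed (simp add: E_def)
 show "set_integrable lborel {a<..b} (\<lambda>s. D s * ioc D a s)"
  using integral_triangle(1)[OF E] unfolding eq set_integrable_def .
 show "ioc (\<lambda>s. D s * ioc D a s) a b = (ioc D a b)\<^sup>2 / 2"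
  using integral_triangle(2)[OF E] unfolding eq
  by (simp add: set_lebesgue_integral_def E_def[abs_def])
qed

text \<open>The change of variables formula for \<open>y\<^sup>2\<close> along a path \<open>y\<close> which is absolutely continuous
 apart from finitely many jumps \<open>c\<close>; note \<open>y\<^sub>j\<^sub>- = y\<^sub>j - c\<^sub>j\<close>.\<close>

lemma square_segment:
 fixes y c D :: "real => real"
 assumes st: "s \<le> j" "j \<le> b" and D: "set_integrable lborel {s<..b} D" and J: "J \<inter> {s<..<j} = {}"
  and y: "\<And>r. s \<le> r ==> r \<le> b ==> y r - y s = (\<Sum>i\<in>J \<inter> {s<..r}. c i) - ioc D s r"
 shows "set_integrable lborel {s<..j} (\<lambda>r. y r * D r)"
  and "(y s - ioc D s j)\<^sup>2 - (y s)\<^sup>2 = - 2 * ioc (\<lambda>r. y r * D r) s j"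
proof -
 define g where "g r = y s * D r - D r * ioc D s r" for r
 have D': "set_integrable lborel {s<..j} D" by (rule set_integrable_ioc_subset[OF D]) (use st in auto)
 note sq = ioc_square[OF D']
 have g_int: "set_integrable lborel {s<..j} g"
  unfolding g_def using D' sq(1) by (intro set_integral_diff(1)) auto
 have g_val: "ioc g s j = y s * ioc D s j - (ioc D s j)\<^sup>2 / 2"
  unfolding g_def using D' sq by (subst set_integral_diff(2)) auto
 have eq: "y r * D r = g r" if "r \<in> {s<..<j}" for r
 proof -
  have "J \<inter> {s<..r} = {}" using J that by fastforce
  hence e: "y r = y s - ioc D s r" using y[of r] that st by simp
  show ?thesis unfolding g_def e by (simp add: algebra_simps)
 qed
 \<comment> \<open>At r = j the path may already have jumped. The correction is supported at that
   one point and has integral 0.\<close>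
 have yD: "(\<lambda>r. indicator {s<..j} r *\<^sub>R (y r * D r)) = (\<lambda>r. indicator {s<..j} r *\<^sub>R g r + indicator {j} r * (indicator {s<..j} j * (y j * D j - g j)))"
 proof
  fix r
  show "indicator {s<..j} r *\<^sub>R (y r * D r) = indicator {s<..j} r *\<^sub>R g r + indicator {j} r * (indicator {s<..j} j * (y j * D j - g j))"
  proof (cases "r = j")
   case False
   thus ?thesis using eq[of r] by (cases "r \<in> {s<..<j}") (auto simp: indicator_def)
  qed (simp add: algebra_simps)
 qed
 have i0: "has_bochner_integral lborel (\<lambda>r. indicator {j} r * (indicator {s<..j} j * (y j * D j - g j))) 0"
 proof -
  have "integrable lborel (\<lambda>r. indicator {j} r * (indicator {s<..j} j * (y j * D j - g j)))"
   by (intro integrable_mult_left integrable_real_indicator) auto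
  thus ?thesis by (simp add: has_bochner_integral_iff)
 qed
 have hg: "has_bochner_integral lborel (\<lambda>r. indicator {s<..j} r *\<^sub>R g r) (ioc g s j)"
  using g_int by (simp add: has_bochner_integral_iff set_integrable_def set_lebesgue_integral_def)
 from has_bochner_integral_add[OF hg i0]
 have "has_bochner_integral lborel (\<lambda>r. indicator {s<..j} r *\<^sub>R (y r * D r)) (ioc g s j)"
  unfolding yD by simp
 thus "set_integrable lborel {s<..j} (\<lambda>r. y r * D r)"
  and "(y s - ioc D s j)\<^sup>2 - (y s)\<^sup>2 = - 2 * ioc (\<lambda>r. y r * D r) s j"
  using g_val by (auto simp: has_bochner_integral_iff set_integrable_def set_lebesgue_integral_def
    power2_eq_square algebra_simps)
qed

text \<open>Induction on the number of jumps in (s, b]. Up to the first jump j the path has no jump,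
  so \<open>square_segment\<close> gives the square of the left limit \<open>y j - c j\<close>; the
  difference to the square of \<open>y j\<close> is the summand for j.\<close>

lemma square_formula:
 fixes y c D :: "real => real" and J :: "real set"
 assumes st: "s \<le> b" and D: "set_integrable lborel {s<..b} D" and fin: "finite (J \<inter> {s<..b})"
  and y: "\<And>p r. s \<le> p ==> p \<le> r ==> r \<le> b ==> y r - y p = (\<Sum>i\<in>J \<inter> {p<..r}. c i) - ioc D p r"
 shows "set_integrable lborel {s<..b} (\<lambda>r. y r * D r) \<and>
  (y b)\<^sup>2 - (y s)\<^sup>2 = (\<Sum>j\<in>J \<inter> {s<..b}. 2 * (y j - c j) * c j + (c j)\<^sup>2) - 2 * ioc (\<lambda>r. y r * D r) s b"
 using assms
proof (induction "card (J \<inter> {s<..b})" arbitrary: s)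
 case 0
 hence J: "J \<inter> {s<..b} = {}" by simp
 hence "J \<inter> {s<..<b} = {}" by fastforce
 note seg = square_segment[OF 0(2) order.refl 0(3) this 0(5)[OF order.refl]]
 have "y b = y s - ioc D s b" using 0(5)[of s b] 0(2) J by simp
 thus ?case using seg J by simp
next
 case (Suc n)
 define j where "j = Min (J \<inter> {s<..b})"
 have ne: "J \<inter> {s<..b} \<noteq> {}" using Suc(2) by auto
 have j: "j \<in> J" "s < j" "j \<le> b" using Min_in[OF Suc(5) ne] by (auto simp: j_def)
 have min: "j \<le> r" if "r \<in> J" "s < r" "r \<le> b" for r
  unfolding j_def using Suc(5) that by (intro Min_le) auto
 hence J1: "J \<inter> {s<..<j} = {}" using j by fastforce
 have J2: "J \<inter> {s<..b} = insert j (J \<inter> {j<..b})" using j min by fastforce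
 have J3: "J \<inter> {s<..j} = {j}" using j min by force
 have fin2: "finite (J \<inter> {j<..b})" by (rule finite_subset[OF _ Suc(5)]) (use j in auto)
 have card: "n = card (J \<inter> {j<..b})" using Suc(2) fin2 by (simp add: J2)
 have D2: "set_integrable lborel {j<..b} D" by (rule set_integrable_ioc_subset[OF Suc(4)]) (use j in auto)
 have IH: "set_integrable lborel {j<..b} (\<lambda>r. y r * D r) \<and>
  (y b)\<^sup>2 - (y j)\<^sup>2 = (\<Sum>j\<in>J \<inter> {j<..b}. 2 * (y j - c j) * c j + (c j)\<^sup>2) - 2 * ioc (\<lambda>r. y r * D r) j b"
  by (rule Suc(1)[OF card j(3) D2 fin2]) (use Suc(6) j in auto)
 have sj: "s \<le> j" using j by simp
 have seg: "set_integrable lborel {s<..j} (\<lambda>r. y r * D r)"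
  "(y s - ioc D s j)\<^sup>2 - (y s)\<^sup>2 = - 2 * ioc (\<lambda>r. y r * D r) s j"
  by (rule square_segment[OF sj j(3) Suc(4) J1, of y c]; use Suc(6)[OF order.refl] in blast)+
 have yj: "y j - c j = y s - ioc D s j" using Suc(6)[of s j] j by (simp add: J3)
 have un: "{s<..b} = {s<..j} \<union> {j<..b}" using j by auto
 have int: "set_integrable lborel {s<..b} (\<lambda>r. y r * D r)"
  unfolding un using seg(1) IH by (intro set_integrable_Un) auto
 have split: "ioc (\<lambda>r. y r * D r) s b = ioc (\<lambda>r. y r * D r) s j + ioc (\<lambda>r. y r * D r) j b"
  by (rule ioc_split[OF int]) (use j in auto)
 have sum: "(\<Sum>j\<in>J \<inter> {s<..b}. 2 * (y j - c j) * c j + (c j)\<^sup>2) =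
   (2 * (y j - c j) * c j + (c j)\<^sup>2) + (\<Sum>j\<in>J \<inter> {j<..b}. 2 * (y j - c j) * c j + (c j)\<^sup>2)"
  unfolding J2 using fin2 by (subst sum.insert) auto
 have e: "(y j)\<^sup>2 - (y j - c j)\<^sup>2 = 2 * (y j - c j) * c j + (c j)\<^sup>2"
  by (simp add: power2_eq_square algebra_simps)
 have "p - q = (p - p1) + (p1 - p2) + (p2 - q)" for p p1 p2 q :: real by simp
 from this[of "(y b)\<^sup>2" "(y s)\<^sup>2" "(y j)\<^sup>2" "(y j - c j)\<^sup>2"]
 have "(y b)\<^sup>2 - (y s)\<^sup>2 = (\<Sum>j\<in>J \<inter> {s<..b}. 2 * (y j - c j) * c j + (c j)\<^sup>2) - 2 * ioc (\<lambda>r. y r * D r) s b"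
  unfolding sum split e conjunct2[OF IH] seg(2)[folded yj] by (simp only: ring_distribs)
 with int show ?case by blast
qed

text \<open>Completeness of \<open>lebesgue\<close> makes F measurable as soon as it agrees almost
  everywhere with the Borel function G. This is how integrals of the driver, known for almost every
  time only, become Borel integrals.\<close>

lemma lebesgue_ioc_eq:
 fixes F G :: "real => real"
 assumes G: "set_borel_measurable lborel {a<..b} G"
  and eq: "AE r in lborel. r \<in> {a<..b} \<longrightarrow> F r = G r"
 shows "(LINT r:{a<..b}|lebesgue. F r) = ioc G a b"
proof -
 let ?F = "\<lambda>r. indicator {a<..b} r *\<^sub>R F r" and ?G = "\<lambda>r. indicator {a<..b} r *\<^sub>R G r"
 have G': "?G \<in> borel_measurable lborel" using G by (simp add: set_borel_measurable_def)
 have ae: "AE r in lebesgue. ?F r = ?G r"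
  by (rule AE_completion, use eq in eventually_elim) (auto simp: indicator_def)
 have complete: "complete_measure (lebesgue :: real measure)" by unfold_locales
 have F': "?F \<in> borel_measurable lebesgue"
 proof (rule measurableI)
  fix A :: "real set" assume A: "A \<in> sets borel"
  have m1: "?G -` A \<inter> space lebesgue \<in> sets lebesgue"
   by (rule measurable_sets[OF measurable_completion[OF G'] A])
  have m2: "AE r in lebesgue. r \<in> ?G -` A \<inter> space lebesgue \<longleftrightarrow> r \<in> ?F -` A \<inter> space lebesgue"
   using ae by eventually_elim (simp only: vimage_eq Int_iff)
  show "?F -` A \<inter> space lebesgue \<in> sets lebesgue"
   by (rule complete_measure.in_sets_AE[OF complete m2 m1]) simp
 qed simp
 have "(LINT r:{a<..b}|lebesgue. F r) = integral\<^sup>L lebesgue ?G"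
  unfolding set_lebesgue_integral_def
  by (rule integral_cong_AE[OF F' measurable_completion[OF G'] ae])
 also have "\<dots> = ioc G a b" unfolding set_lebesgue_integral_def by (rule integral_completion[OF G'])
 finally show ?thesis .
qed

text \<open>The driver is only known to be measurable when its last argument is a fixed bounded function.
 Composition with a varying function works because countably many bounded functions
 approximate all sections in every \<open>L\<^sup>2\<close> space at once.\<close>

definition approximable :: "'s measure => 'k measure => ('s => 'k => real) => bool" where
 "approximable S K \<zeta> \<longleftrightarrow> (\<lambda>(w, y). \<zeta> w y) \<in> borel_measurable (S \<Otimes>\<^sub>M K) \<and>
  (\<exists>D. countable D \<and> (\<forall>z\<in>D. z \<in> borel_measurable K \<and> (\<exists>C. \<forall>y\<in>space K. \<bar>z y\<bar> \<le> C)) \<and>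
   (\<forall>w\<in>space S. \<forall>m. sets m = sets K \<longrightarrow> finite_measure m \<longrightarrow> (\<integral>\<^sup>+y. sq (\<zeta> w y) \<partial>m) < \<infinity> \<longrightarrow>
    (\<forall>e>0. \<exists>z\<in>D. (\<integral>\<^sup>+y. sq (\<zeta> w y - z y) \<partial>m) < ennreal e)))"

lemma approximableI:
 assumes "(\<lambda>(w, y). \<zeta> w y) \<in> borel_measurable (S \<Otimes>\<^sub>M K)" "countable D"
  "\<And>z. z \<in> D ==> z \<in> borel_measurable K" "\<And>z. z \<in> D ==> \<exists>C. \<forall>y\<in>space K. \<bar>z y\<bar> \<le> C"
  "\<And>w m e. w \<in> space S ==> sets m = sets K ==> finite_measure m ==> (\<integral>\<^sup>+y. sq (\<zeta> w y) \<partial>m) < \<infinity> ==>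
   e > 0 ==> \<exists>z\<in>D. (\<integral>\<^sup>+y. sq (\<zeta> w y - z y) \<partial>m) < ennreal e"
 shows "approximable S K \<zeta>"
 using assms unfolding approximable_def by (intro conjI exI[of _ D]) auto

lemma nn_integral_square_sum_le:
 fixes u v :: "'a => real"
 assumes [measurable]: "u \<in> borel_measurable M" "v \<in> borel_measurable M"
 shows "(\<integral>\<^sup>+y. sq (a * u y + b * v y) \<partial>M) \<le>
  ennreal (2 * a\<^sup>2) * (\<integral>\<^sup>+y. sq (u y) \<partial>M) + ennreal (2 * b\<^sup>2) * (\<integral>\<^sup>+y. sq (v y) \<partial>M)"
proof -
 have "(a * p + b * q)\<^sup>2 \<le> 2 * a\<^sup>2 * p\<^sup>2 + 2 * b\<^sup>2 * q\<^sup>2" for p q :: real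
  using zero_le_power2[of "a * p - b * q"] by (simp add: power2_eq_square algebra_simps)
 hence "(\<integral>\<^sup>+y. sq (a * u y + b * v y) \<partial>M) \<le>
   (\<integral>\<^sup>+y. ennreal (2 * a\<^sup>2) * sq (u y) + ennreal (2 * b\<^sup>2) * sq (v y) \<partial>M)"
  by (intro nn_integral_mono) (simp add: ennreal_mult[symmetric] ennreal_plus[symmetric] del: ennreal_plus)
 also have "\<dots> = ennreal (2 * a\<^sup>2) * (\<integral>\<^sup>+y. sq (u y) \<partial>M) + ennreal (2 * b\<^sup>2) * (\<integral>\<^sup>+y. sq (v y) \<partial>M)"
  by (simp add: nn_integral_add nn_integral_cmult)
 finally show ?thesis .
qed

lemma section_measurable:
 fixes z :: "'s => 'k => 'b"
 assumes "(\<lambda>(w, y). z w y) \<in> S \<Otimes>\<^sub>M K \<rightarrow>\<^sub>M N" "w \<in> space S" "sets m = sets K"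
 shows "z w \<in> m \<rightarrow>\<^sub>M N"
 using measurable_compose[OF measurable_Pair1'[OF assms(2)] assms(1)] assms(3) by (simp cong: measurable_cong_sets)

lemma approximable_linear:
 assumes u: "approximable S K u" and v: "approximable S K v"
  and \<zeta>: "\<And>w y. \<zeta> w y = a * u w y + b * v w y"
  and bd: "\<And>w y. \<bar>u w y\<bar> \<le> B * (\<bar>\<zeta> w y\<bar> + 1)" "\<And>w y. \<bar>v w y\<bar> \<le> B * (\<bar>\<zeta> w y\<bar> + 1)"
 shows "approximable S K \<zeta>"
proof -
 obtain D where D0: "countable D" "\<forall>z\<in>D. z \<in> borel_measurable K \<and> (\<exists>C. \<forall>y\<in>space K. \<bar>z y\<bar> \<le> C)"
  "\<forall>w\<in>space S. \<forall>\<mu>. sets \<mu> = sets K \<longrightarrow> finite_measure \<mu> \<longrightarrow> (\<integral>\<^sup>+y. sq (u w y) \<partial>\<mu>) < \<infinity> \<longrightarrow>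
    (\<forall>e>0. \<exists>z\<in>D. (\<integral>\<^sup>+y. sq (u w y - z y) \<partial>\<mu>) < ennreal e)"
  using u unfolding approximable_def by blast
 have D1: "(\<lambda>(w, y). u w y) \<in> borel_measurable (S \<Otimes>\<^sub>M K)" using u unfolding approximable_def by blast
 have D5: "\<exists>z\<in>D. (\<integral>\<^sup>+y. sq (u w y - z y) \<partial>\<mu>) < ennreal e"
  if "w \<in> space S" "sets \<mu> = sets K" "finite_measure \<mu>" "(\<integral>\<^sup>+y. sq (u w y) \<partial>\<mu>) < \<infinity>" "e > 0" for w \<mu> e
  using D0(3) that by blast
 obtain E where E0: "countable E" "\<forall>z\<in>E. z \<in> borel_measurable K \<and> (\<exists>C. \<forall>y\<in>space K. \<bar>z y\<bar> \<le> C)"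
  "\<forall>w\<in>space S. \<forall>\<mu>. sets \<mu> = sets K \<longrightarrow> finite_measure \<mu> \<longrightarrow> (\<integral>\<^sup>+y. sq (v w y) \<partial>\<mu>) < \<infinity> \<longrightarrow>
    (\<forall>e>0. \<exists>z\<in>E. (\<integral>\<^sup>+y. sq (v w y - z y) \<partial>\<mu>) < ennreal e)"
  using v unfolding approximable_def by blast
 have E1: "(\<lambda>(w, y). v w y) \<in> borel_measurable (S \<Otimes>\<^sub>M K)" using v unfolding approximable_def by blast
 have E5: "\<exists>z\<in>E. (\<integral>\<^sup>+y. sq (v w y - z y) \<partial>\<mu>) < ennreal e"
  if "w \<in> space S" "sets \<mu> = sets K" "finite_measure \<mu>" "(\<integral>\<^sup>+y. sq (v w y) \<partial>\<mu>) < \<infinity>" "e > 0" for w \<mu> e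
  using E0(3) that by blast
 let ?F = "(\<lambda>(z, z') y. a * z y + b * z' y) ` (D \<times> E)"
 show ?thesis
 proof (rule approximableI[where D = ?F])
  show \<zeta>m: "(\<lambda>(w, y). \<zeta> w y) \<in> borel_measurable (S \<Otimes>\<^sub>M K)"
   unfolding \<zeta> using D1 E1 by (simp add: case_prod_beta')
  show "countable ?F" using D0(1) E0(1) by auto
  show "z \<in> borel_measurable K" if z: "z \<in> ?F" for z
  proof -
   obtain z1 z2 where z12: "z1 \<in> D" "z2 \<in> E" "z = (\<lambda>y. a * z1 y + b * z2 y)" using z by auto
   hence "z1 \<in> borel_measurable K" "z2 \<in> borel_measurable K" using D0(2) E0(2) by blast+
   thus ?thesis unfolding z12(3) by measurable
  qed
  show "\<exists>C. \<forall>y\<in>space K. \<bar>z y\<bar> \<le> C" if z: "z \<in> ?F" for z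
  proof -
   obtain z1 z2 where z12: "z1 \<in> D" "z2 \<in> E" "z = (\<lambda>y. a * z1 y + b * z2 y)" using z by auto
   obtain C1 C2 where C: "\<forall>y\<in>space K. \<bar>z1 y\<bar> \<le> C1" "\<forall>y\<in>space K. \<bar>z2 y\<bar> \<le> C2"
    using D0(2) E0(2) z12(1,2) by blast
   have "\<bar>z y\<bar> \<le> \<bar>a\<bar> * C1 + \<bar>b\<bar> * C2" if "y \<in> space K" for y
   proof -
    have "\<bar>z y\<bar> \<le> \<bar>a\<bar> * \<bar>z1 y\<bar> + \<bar>b\<bar> * \<bar>z2 y\<bar>"
     unfolding z12 using abs_triangle_ineq[of "a * z1 y" "b * z2 y"] by (simp add: abs_mult)
    also have "\<dots> \<le> \<bar>a\<bar> * C1 + \<bar>b\<bar> * C2" using C that by (intro add_mono mult_left_mono) auto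
    finally show ?thesis .
   qed
   thus ?thesis by blast
  qed
  fix w \<mu> and e :: real
  assume w: "w \<in> space S" and \<mu>: "sets \<mu> = sets K" "finite_measure \<mu>"
   and fin: "(\<integral>\<^sup>+y. sq (\<zeta> w y) \<partial>\<mu>) < \<infinity>" and e: "0 < e"
  interpret finite_measure \<mu> by fact
  have [measurable]: "\<zeta> w \<in> borel_measurable \<mu>" "u w \<in> borel_measurable \<mu>" "v w \<in> borel_measurable \<mu>"
   using section_measurable[OF \<zeta>m w \<mu>(1)] section_measurable[OF D1 w \<mu>(1)] section_measurable[OF E1 w \<mu>(1)] by auto
  have fin': "(\<integral>\<^sup>+y. sq (h y) \<partial>\<mu>) < \<infinity>" if h: "\<And>y. \<bar>h y\<bar> \<le> B * (\<bar>\<zeta> w y\<bar> + 1)" for h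
  proof -
   have "(h y)\<^sup>2 \<le> (B * \<bar>\<zeta> w y\<bar> + B * 1)\<^sup>2" for y
    using power_mono[OF h[of y], of 2] by (simp add: distrib_left)
   hence "(\<integral>\<^sup>+y. sq (h y) \<partial>\<mu>) \<le> (\<integral>\<^sup>+y. sq (B * \<bar>\<zeta> w y\<bar> + B * 1) \<partial>\<mu>)"
    by (intro nn_integral_mono ennreal_leI)
   also have "\<dots> \<le> ennreal (2 * B\<^sup>2) * (\<integral>\<^sup>+y. ennreal (\<bar>\<zeta> w y\<bar>\<^sup>2) \<partial>\<mu>) + ennreal (2 * B\<^sup>2) * (\<integral>\<^sup>+y. sq 1 \<partial>\<mu>)"
    by (rule nn_integral_square_sum_le) auto
   also have "\<dots> < \<infinity>" using fin
    by (auto simp: ennreal_mult_less_top emeasure_eq_measure)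
   finally show ?thesis .
  qed
  \<comment> \<open>If both approximation errors are below e / c, the combined one is at most
    \<open>(2 * a\<^sup>2 + 2 * b\<^sup>2) * (e / c)\<close>, which is less than e.\<close>
  define c where "c = 2 * a\<^sup>2 + 2 * b\<^sup>2 + 1"
  have c: "c > 0" "2 * a\<^sup>2 + 2 * b\<^sup>2 < c" by (auto simp: c_def add_nonneg_pos)
  obtain z1 where z1: "z1 \<in> D" "(\<integral>\<^sup>+y. sq (u w y - z1 y) \<partial>\<mu>) < ennreal (e / c)"
   using D5[OF w \<mu> fin'[OF bd(1)], of "e / c"] e c by auto
  obtain z2 where z2: "z2 \<in> E" "(\<integral>\<^sup>+y. sq (v w y - z2 y) \<partial>\<mu>) < ennreal (e / c)"
   using E5[OF w \<mu> fin'[OF bd(2)], of "e / c"] e c by auto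
  have [measurable]: "z1 \<in> borel_measurable \<mu>" "z2 \<in> borel_measurable \<mu>"
   using D0(2) E0(2) z1(1) z2(1) \<mu>(1) by (auto cong: measurable_cong_sets)
  have "(\<integral>\<^sup>+y. sq (\<zeta> w y - (a * z1 y + b * z2 y)) \<partial>\<mu>) =
    (\<integral>\<^sup>+y. sq (a * (u w y - z1 y) + b * (v w y - z2 y)) \<partial>\<mu>)"
   by (simp add: \<zeta> algebra_simps)
  also have "\<dots> \<le> ennreal (2 * a\<^sup>2) * (\<integral>\<^sup>+y. sq (u w y - z1 y) \<partial>\<mu>) + ennreal (2 * b\<^sup>2) * (\<integral>\<^sup>+y. sq (v w y - z2 y) \<partial>\<mu>)"
   by (rule nn_integral_square_sum_le) auto
  also have "\<dots> \<le> ennreal (2 * a\<^sup>2) * ennreal (e / c) + ennreal (2 * b\<^sup>2) * ennreal (e / c)"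
   using z1 z2 by (intro add_mono mult_left_mono) auto
  also have "\<dots> = ennreal ((2 * a\<^sup>2 + 2 * b\<^sup>2) * (e / c))"
   using e c by (simp add: ennreal_mult[symmetric] ennreal_plus[symmetric] distrib_right add_divide_distrib del: ennreal_plus)
  also have "\<dots> < ennreal e"
  proof -
   have "(2 * a\<^sup>2 + 2 * b\<^sup>2) * (e / c) < c * (e / c)" using c e by (intro mult_strict_right_mono) auto
   thus ?thesis using c e by (intro ennreal_lessI) auto
  qed
  finally show "\<exists>z\<in>?F. (\<integral>\<^sup>+y. sq (\<zeta> w y - z y) \<partial>\<mu>) < ennreal e"
   using z1(1) z2(1) by (intro bexI[of _ "\<lambda>y. a * z1 y + b * z2 y"]) auto
 qed
qed

text \<open>The union of the countable families serves. Domination by \<zeta> makes the functions U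
  i converge in every L^2 space containing \<zeta>, with one and the same family for all
  measures.\<close>

lemma approximable_limit:
 assumes U: "\<And>i::nat. approximable S K (U i)"
  and lim: "\<And>w y. w \<in> space S ==> y \<in> space K ==> (\<lambda>i. U i w y) \<longlonglongrightarrow> \<zeta> w y"
  and bd: "\<And>i w y. w \<in> space S ==> y \<in> space K ==> \<bar>U i w y\<bar> \<le> \<bar>\<zeta> w y\<bar>"
 shows "approximable S K \<zeta>"
proof -
 define good where "good D i \<longleftrightarrow> countable D \<and> (\<forall>z\<in>D. z \<in> borel_measurable K \<and> (\<exists>C. \<forall>y\<in>space K. \<bar>z y\<bar> \<le> C)) \<and>
   (\<forall>w\<in>space S. \<forall>\<mu>. sets \<mu> = sets K \<longrightarrow> finite_measure \<mu> \<longrightarrow> (\<integral>\<^sup>+y. sq (U i w y) \<partial>\<mu>) < \<infinity> \<longrightarrow>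
    (\<forall>e>0. \<exists>z\<in>D. (\<integral>\<^sup>+y. sq (U i w y - z y) \<partial>\<mu>) < ennreal e))" for D i
 have "\<forall>i. \<exists>D. good D i" using U unfolding approximable_def good_def by blast
 then obtain D where good: "good (D i) i" for i by metis
 have D: "countable (D i)" "z \<in> D i ==> z \<in> borel_measurable K" "z \<in> D i ==> \<exists>C. \<forall>y\<in>space K. \<bar>z y\<bar> \<le> C"
  "w \<in> space S ==> sets \<mu> = sets K ==> finite_measure \<mu> ==> (\<integral>\<^sup>+y. sq (U i w y) \<partial>\<mu>) < \<infinity> ==>
    e > 0 ==> \<exists>z\<in>D i. (\<integral>\<^sup>+y. sq (U i w y - z y) \<partial>\<mu>) < ennreal e" for i z w \<mu> e
  using good[of i] unfolding good_def by blast+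
 have Um: "(\<lambda>(w, y). U i w y) \<in> borel_measurable (S \<Otimes>\<^sub>M K)" for i
  using U unfolding approximable_def by blast
 show ?thesis
 proof (rule approximableI[where D="\<Union>i. D i"])
  show \<zeta>m: "(\<lambda>(w, y). \<zeta> w y) \<in> borel_measurable (S \<Otimes>\<^sub>M K)"
   by (rule borel_measurable_LIMSEQ_real[OF _ Um]) (use lim in \<open>auto simp: space_pair_measure\<close>)
  show "countable (\<Union>i. D i)" using D(1) by simp
  show "z \<in> borel_measurable K" if "z \<in> (\<Union>i. D i)" for z using that D(2) by blast
  show "\<exists>C. \<forall>y\<in>space K. \<bar>z y\<bar> \<le> C" if "z \<in> (\<Union>i. D i)" for z using that D(3) by blast
  fix w \<mu> and e :: real
  assume w: "w \<in> space S" and \<mu>: "sets \<mu> = sets K" "finite_measure \<mu>"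
   and fin: "(\<integral>\<^sup>+y. sq (\<zeta> w y) \<partial>\<mu>) < \<infinity>" and e: "0 < e"
  have sp: "space \<mu> = space K" using sets_eq_imp_space_eq[OF \<mu>(1)] .
  have [measurable]: "\<zeta> w \<in> borel_measurable \<mu>" "U i w \<in> borel_measurable \<mu>" for i
   using section_measurable[OF \<zeta>m w \<mu>(1)] section_measurable[OF Um w \<mu>(1)] by auto
  have Ufin: "(\<integral>\<^sup>+y. sq (U i w y) \<partial>\<mu>) < \<infinity>" for i
  proof (rule le_less_trans[OF _ fin], intro nn_integral_mono ennreal_leI)
   fix y assume "y \<in> space \<mu>"
   thus "(U i w y)\<^sup>2 \<le> (\<zeta> w y)\<^sup>2" using bd[OF w, of y i] sp by (simp add: abs_le_square_iff)
  qed
  have "(\<lambda>i. \<integral>\<^sup>+y. sq (\<zeta> w y - U i w y) \<partial>\<mu>) \<longlonglongrightarrow> (\<integral>\<^sup>+y. 0 \<partial>\<mu>)"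
  proof (rule nn_integral_dominated_convergence[where w="\<lambda>y. ennreal (4 * (\<zeta> w y)\<^sup>2)"])
   show "AE y in \<mu>. sq (\<zeta> w y - U i w y) \<le> ennreal (4 * (\<zeta> w y)\<^sup>2)" for i
   proof (intro AE_I2 ennreal_leI)
    fix y assume "y \<in> space \<mu>"
    hence "\<bar>\<zeta> w y - U i w y\<bar> \<le> \<bar>2 * \<zeta> w y\<bar>" using bd[OF w, of y i] sp by auto
    hence "(\<zeta> w y - U i w y)\<^sup>2 \<le> (2 * \<zeta> w y)\<^sup>2" by (simp add: abs_le_square_iff)
    thus "(\<zeta> w y - U i w y)\<^sup>2 \<le> 4 * (\<zeta> w y)\<^sup>2" by (simp add: power_mult_distrib)
   qed
   show "(\<integral>\<^sup>+y. ennreal (4 * (\<zeta> w y)\<^sup>2) \<partial>\<mu>) < \<infinity>"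
    using fin by (simp add: ennreal_mult nn_integral_cmult ennreal_mult_less_top)
   show "AE y in \<mu>. (\<lambda>i. sq (\<zeta> w y - U i w y)) \<longlonglongrightarrow> 0"
   proof (rule AE_I2)
    fix y assume "y \<in> space \<mu>"
    hence "(\<lambda>i. (\<zeta> w y - U i w y)\<^sup>2) \<longlonglongrightarrow> (\<zeta> w y - \<zeta> w y)\<^sup>2"
     using lim[OF w, of y] sp by (intro tendsto_intros) auto
    hence "(\<lambda>i. sq (\<zeta> w y - U i w y)) \<longlonglongrightarrow> sq (\<zeta> w y - \<zeta> w y)"
     by (rule tendsto_ennrealI)
    thus "(\<lambda>i. sq (\<zeta> w y - U i w y)) \<longlonglongrightarrow> 0" by simp
   qed
  qed auto
  hence "\<forall>\<^sub>F i in sequentially. (\<integral>\<^sup>+y. sq (\<zeta> w y - U i w y) \<partial>\<mu>) < ennreal (e / 4)"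
   using e by (intro order_tendstoD) auto
  from eventually_happens[OF this] obtain i where i: "(\<integral>\<^sup>+y. sq (\<zeta> w y - U i w y) \<partial>\<mu>) < ennreal (e / 4)"
   by auto
  obtain z where z: "z \<in> D i" "(\<integral>\<^sup>+y. sq (U i w y - z y) \<partial>\<mu>) < ennreal (e / 4)"
   using D(4)[OF w \<mu> Ufin[of i], of "e / 4"] e by auto
  have [measurable]: "z \<in> borel_measurable \<mu>" using D(2)[OF z(1)] \<mu>(1) by (simp cong: measurable_cong_sets)
  have "(\<integral>\<^sup>+y. sq (\<zeta> w y - z y) \<partial>\<mu>) =
    (\<integral>\<^sup>+y. sq (1 * (\<zeta> w y - U i w y) + 1 * (U i w y - z y)) \<partial>\<mu>)" by simp
  also have "\<dots> \<le> ennreal (2 * 1\<^sup>2) * (\<integral>\<^sup>+y. sq (\<zeta> w y - U i w y) \<partial>\<mu>) + ennreal (2 * 1\<^sup>2) * (\<integral>\<^sup>+y. sq (U i w y - z y) \<partial>\<mu>)"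
   by (rule nn_integral_square_sum_le) auto
  also have "\<dots> < ennreal e"
  proof -
   have *: "ennreal (2 * 1\<^sup>2) * p + ennreal (2 * 1\<^sup>2) * q < ennreal e"
    if pq: "p < ennreal (e / 4)" "q < ennreal (e / 4)" for p q
   proof -
    have "p < top" "q < top" using pq by (auto intro: less_trans)
    then obtain p' q' where "p = ennreal p'" "0 \<le> p'" "q = ennreal q'" "0 \<le> q'" by (cases p; cases q) auto
    moreover from this have e1: "ennreal (2 * 1\<^sup>2) * p + ennreal (2 * 1\<^sup>2) * q = ennreal (2 * p' + 2 * q')"
     by (simp add: ennreal_mult)
    have "2 * p' + 2 * q' < e" using pq calculation by (simp add: ennreal_less_iff)
    hence "ennreal (2 * p' + 2 * q') < ennreal e" using e by (intro ennreal_lessI)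
    thus ?thesis unfolding e1 .
   qed
   show ?thesis by (rule *[OF i z(2)])
  qed
  finally show "\<exists>z\<in>(\<Union>i. D i). (\<integral>\<^sup>+y. sq (\<zeta> w y - z y) \<partial>\<mu>) < ennreal e" using z(1) by blast
 qed
qed

lemma approximable_fixed:
 assumes "(\<lambda>(w, y). \<zeta> w y) \<in> borel_measurable (S \<Otimes>\<^sub>M K)" "countable D"
  "\<And>z. z \<in> D ==> z \<in> borel_measurable K" "\<And>z. z \<in> D ==> \<exists>C. \<forall>y\<in>space K. \<bar>z y\<bar> \<le> C"
  "\<And>w. w \<in> space S ==> \<exists>z\<in>D. \<forall>y\<in>space K. \<zeta> w y = z y"
 shows "approximable S K \<zeta>"
proof (rule approximableI[OF assms(1-4)])
 fix w m and e :: real assume w: "w \<in> space S" "sets m = sets K" "0 < e"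
 from assms(5)[OF w(1)] obtain z where z: "z \<in> D" "\<forall>y\<in>space K. \<zeta> w y = z y" by blast
 have "(\<integral>\<^sup>+y. sq (\<zeta> w y - z y) \<partial>m) = (\<integral>\<^sup>+y. 0 \<partial>m)"
  using z(2) sets_eq_imp_space_eq[OF w(2)] by (intro nn_integral_cong) auto
 thus "\<exists>z\<in>D. (\<integral>\<^sup>+y. sq (\<zeta> w y - z y) \<partial>m) < ennreal e"
  using w(3) z(1) by (intro bexI[of _ z]) auto
qed

lemma approximable_const: "approximable S K (\<lambda>w y. c)"
 by (rule approximable_fixed[where D="{\<lambda>y. c}"]) auto

text \<open>A rectangle has only two sections, 0 and \<open>indicator B\<close>, so a two-element
  family suffices; complements and disjoint unions follow by linear combinations and dominated
  limits.\<close>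

lemma approximable_indicator:
 assumes "C \<in> sets (S \<Otimes>\<^sub>M K)"
 shows "approximable S K (\<lambda>w y. indicator C (w, y))"
proof -
 from Int_stable_pair_measure_generator pair_measure_closed assms[unfolded sets_pair_measure]
 show ?thesis
 proof (induction rule: sigma_sets_induct_disjoint)
  case (basic C)
  then obtain A B where C: "C = A \<times> B" "A \<in> sets S" "B \<in> sets K" by blast
  show ?case
  proof (rule approximable_fixed[where D="{\<lambda>y. 0, indicator B}"])
   have "A \<times> B \<in> sets (S \<Otimes>\<^sub>M K)" using C by auto
   thus "(\<lambda>(w, y). indicator C (w, y)) \<in> borel_measurable (S \<Otimes>\<^sub>M K)" by (simp add: C(1) case_prod_beta' borel_measurable_indicator)
   show "\<exists>z\<in>{\<lambda>y. 0, indicator B}. \<forall>y\<in>space K. indicator C (w, y) = z y" for w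
    by (cases "w \<in> A") (auto simp: C indicator_def)
  qed (use C in \<open>auto intro!: exI[of _ 1] simp: indicator_def\<close>)
 next
  case empty
  show ?case using approximable_const[of S K 0] by simp
 next
  case (compl C)
  have 1: "approximable S K (\<lambda>w y. 1 - indicator C (w, y))"
   by (rule approximable_linear[OF approximable_const[of S K 1] compl(2), of _ 1 "-1" 1]) (auto simp: indicator_def)
  \<comment> \<open>The two functions agree on the space only. Applying
    \<open>approximable_limit\<close> to a constant sequence replaces one by the other.\<close>
  have 2: "1 - indicator C (w, y) = (indicator (space S \<times> space K - C) (w, y) :: real)"
   if "w \<in> space S" "y \<in> space K" for w y using that by (auto simp: indicator_def)
  show ?case
  proof (rule approximable_limit[OF 1])
   fix w y assume wy: "w \<in> space S" "y \<in> space K"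
   show "(\<lambda>i. 1 - indicator C (w, y)) \<longlonglongrightarrow> (indicator (space S \<times> space K - C) (w, y) :: real)"
    unfolding 2[OF wy] by (rule tendsto_const)
   show "\<bar>1 - indicator C (w, y)\<bar> \<le> \<bar>indicator (space S \<times> space K - C) (w, y) :: real\<bar>"
    unfolding 2[OF wy] by (rule order.refl)
  qed
 next
  case (union C)
  have part: "approximable S K (\<lambda>w y. \<Sum>i<n. indicator (C i) (w, y))" for n
  proof (induction n)
   case 0
   show ?case using approximable_const[of S K 0] by simp
  next
   case (Suc n)
   show ?case
    by (rule approximable_linear[OF Suc union(3)[of n], of _ 1 1 1])
      (auto intro!: sum_nonneg add_nonneg_nonneg simp: abs_of_nonneg sum_nonneg)
  qed
  have fin: "(\<Sum>i<n. indicator (C i) z) = (if \<exists>i<n. z \<in> C i then 1 else (0::real))" for n z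
  proof (cases "\<exists>i<n. z \<in> C i")
   case True
   then obtain i where i: "i < n" "z \<in> C i" by blast
   have "z \<in> C j \<longleftrightarrow> j = i" for j using i union(1) by (auto simp: disjoint_family_on_def)
   hence "(\<Sum>i<n. indicator (C i) z) = (\<Sum>j<n. if j = i then 1 else (0::real))"
    by (intro sum.cong) (auto simp: indicator_def)
   thus ?thesis using i True by auto
  qed (auto intro!: sum.neutral)
  show ?case
  proof (rule approximable_limit[OF part])
   fix w y
   show "(\<lambda>n. \<Sum>i<n. indicator (C i) (w, y)) \<longlonglongrightarrow> (indicator (\<Union>i. C i) (w, y) :: real)"
   proof (cases "\<exists>i. (w, y) \<in> C i")
    case True
    then obtain i where i: "(w, y) \<in> C i" by blast
    have "\<forall>\<^sub>F n in sequentially. (\<Sum>i<n. indicator (C i) (w, y)) = (indicator (\<Union>i. C i) (w, y) :: real)"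
     using eventually_gt_at_top[of i]
    proof eventually_elim
     case (elim n)
     moreover have "(w, y) \<in> (\<Union>i. C i)" using i by blast
     ultimately show ?case unfolding fin using i by auto
    qed
    thus ?thesis by (rule tendsto_eventually)
   qed (simp add: fin)
   show "\<bar>\<Sum>i<n. indicator (C i) (w, y)\<bar> \<le> \<bar>indicator (\<Union>i. C i) (w, y) :: real\<bar>" for n
    unfolding fin by (auto simp: indicator_def)
  qed
 qed
qed

text \<open>For nonnegative functions there is no cancellation, so every step of the induction
  satisfies the required bounds. A general \<zeta> is split into its positive and negative part,
  each bounded by its absolute value.\<close>

lemma approximable_measurable:
 assumes \<zeta>: "(\<lambda>(w, y). \<zeta> w y) \<in> borel_measurable (S \<Otimes>\<^sub>M K)"
 shows "approximable S K \<zeta>"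
proof -
 have pos: "approximable S K (\<lambda>w y. u (w, y))" if "u \<in> borel_measurable (S \<Otimes>\<^sub>M K)" "\<And>z. 0 \<le> u z" for u
  using that
 proof (induction u rule: borel_measurable_induct_real)
  case (set A)
  thus ?case by (rule approximable_indicator)
 next
  case (mult u c)
  show ?case
  proof (cases "c = 0")
   case True
   thus ?thesis using approximable_const[of S K 0] by simp
  next
   case False
   hence c: "c > 0" using mult by simp
   show ?thesis
   proof (rule approximable_linear[OF mult(4) approximable_const[of S K 0], of _ c 0 "1 / c"])
    show "\<bar>u (w, y)\<bar> \<le> 1 / c * (\<bar>c * u (w, y)\<bar> + 1)" for w y
     using c mult(3)[of "(w, y)"] by (simp add: abs_mult distrib_left)
    show "\<bar>0\<bar> \<le> 1 / c * (\<bar>c * u (w, y)\<bar> + 1)" for w y using c by simp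
   qed simp
  qed
 next
  case (add u v)
  show ?case
  proof (rule approximable_linear[OF add(7) add(6), of _ 1 1 1])
   fix w y
   show "\<bar>v (w, y)\<bar> \<le> 1 * (\<bar>v (w, y) + u (w, y)\<bar> + 1)" "\<bar>u (w, y)\<bar> \<le> 1 * (\<bar>v (w, y) + u (w, y)\<bar> + 1)"
    using add(2)[of "(w, y)"] add(4)[of "(w, y)"] by auto
  qed simp
 next
  case (seq U)
  show ?case
  proof (rule approximable_limit[OF seq(5)])
   fix w y i assume wy: "w \<in> space S" "y \<in> space K"
   hence z: "(w, y) \<in> space (S \<Otimes>\<^sub>M K)" by (simp add: space_pair_measure)
   show lim: "(\<lambda>i. U i (w, y)) \<longlonglongrightarrow> u (w, y)" by (rule seq(4)[OF z])
   have "U i (w, y) \<le> u (w, y)"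
    by (rule incseq_le[OF _ lim]) (use seq(3) in \<open>simp add: incseq_def le_fun_def\<close>)
   thus "\<bar>U i (w, y)\<bar> \<le> \<bar>u (w, y)\<bar>" using seq(2)[of i "(w, y)"] by simp
  qed
 qed
 have m: "(\<lambda>z. \<zeta> (fst z) (snd z)) \<in> borel_measurable (S \<Otimes>\<^sub>M K)" using \<zeta> by (simp add: case_prod_beta')
 have "approximable S K (\<lambda>w y. max 0 (\<zeta> (fst (w, y)) (snd (w, y))))"
  by (rule pos[OF borel_measurable_max[OF m borel_measurable_const]]) simp
 hence p: "approximable S K (\<lambda>w y. max 0 (\<zeta> w y))" by (simp only: fst_conv snd_conv)
 have "approximable S K (\<lambda>w y. max 0 (- \<zeta> (fst (w, y)) (snd (w, y))))"
  by (rule pos[OF borel_measurable_max[OF borel_measurable_uminus[OF m] borel_measurable_const]]) simp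
 hence n: "approximable S K (\<lambda>w y. max 0 (- \<zeta> w y))" by (simp only: fst_conv snd_conv)
 show ?thesis
 proof (rule approximable_linear[OF p n])
  fix w y
  show "\<zeta> w y = 1 * max 0 (\<zeta> w y) + (- 1) * max 0 (- \<zeta> w y)" by (simp add: max_def)
  show "\<bar>max 0 (\<zeta> w y)\<bar> \<le> 1 * (\<bar>\<zeta> w y\<bar> + 1)" "\<bar>max 0 (- \<zeta> w y)\<bar> \<le> 1 * (\<bar>\<zeta> w y\<bar> + 1)"
   by (simp_all add: max_def)
 qed
qed

section \<open>The Lipschitz driver and its measurability along processes\<close>

locale lipschitz_driver = markov_jump_process T K \<nu> \<Omega> X P
 for T :: real and K :: "'k measure" and \<nu> :: "real => 'k => 'k measure"
  and \<Omega> :: "'w set" and X :: "real => 'w => 'k" and P :: "real => 'k => 'w measure" +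
 fixes f :: "real => 'k => real => ('k => real) => real" and L L' :: real
 assumes driver_measurable: "\<And>z C. z \<in> borel_measurable K ==> (\<And>y. y \<in> space K ==> \<bar>z y\<bar> \<le> C) ==>
   (\<lambda>(s, x, r). f s x r z) \<in>
    borel_measurable (restrict_space borel {0..T} \<Otimes>\<^sub>M K \<Otimes>\<^sub>M (borel :: real measure))"
  and L_nonneg: "0 \<le> L" "0 \<le> L'"
  and lipschitz: "\<And>s x r r' z z'. s \<in> {0..T} ==> x \<in> space K ==> z \<in> L2 (\<nu> s x) ==> z' \<in> L2 (\<nu> s x) ==>
    \<bar>f s x r z - f s x r' z'\<bar> \<le> L' * \<bar>r - r'\<bar> + L * sqrt (LINT y | \<nu> s x. \<bar>z y - z' y\<bar>\<^sup>2)"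
begin

abbreviation "bsde g t x Y Z \<equiv> bsde_solution T K \<nu> \<Omega> X P f g t x Y Z"
abbreviation "kolmogorov g v \<equiv> kolmogorov_solution T K \<nu> X P f g v"

lemma bounded_in_L2:
 assumes "s \<in> {0..T}" "x \<in> space K" "z \<in> borel_measurable K" "\<And>y. y \<in> space K ==> \<bar>z y\<bar> \<le> C"
 shows "z \<in> L2 (\<nu> s x)"
proof -
 interpret finite_measure "\<nu> s x" by (rule finite_rate[OF assms(1,2)])
 have m: "z \<in> borel_measurable (\<nu> s x)" using assms by (simp add: measurable_rate_iff)
 have "integrable (\<nu> s x) (\<lambda>y. \<bar>z y\<bar>\<^sup>2)"
 proof (rule integrable_const_bound[where B="C\<^sup>2"])
  show "AE y in \<nu> s x. norm (\<bar>z y\<bar>\<^sup>2) \<le> C\<^sup>2"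
   using assms by (intro AE_I2) (auto simp: space_rate intro!: power_mono[where n=2, of "\<bar>z _\<bar>", simplified])
 qed (use m in measurable)
 thus ?thesis using m by (simp add: L2_def)
qed

text \<open>For each w take the first function of a countable approximating family whose squared
  distance to \<open>\<zeta> w\<close> in the L^2 space of \<open>\<nu> (i w) (\<xi> w)\<close> is
  below 1 / (n + 1). The choice is measurable with countably many values, so the driver evaluated
  there is measurable; by the Lipschitz condition its error is at most L times the square root of 1
  / (n + 1).\<close>

lemma driver_composition_measurable:
 assumes i: "i \<in> S \<rightarrow>\<^sub>M restrict_space borel {0..T}" and \<xi>: "\<xi> \<in> S \<rightarrow>\<^sub>M K"
  and \<rho>: "\<rho> \<in> borel_measurable S" and \<zeta>: "(\<lambda>(w, y). \<zeta> w y) \<in> borel_measurable (S \<Otimes>\<^sub>M K)"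
  and L2: "\<And>w. w \<in> space S ==> \<zeta> w \<in> L2 (\<nu> (i w) (\<xi> w))"
 shows "(\<lambda>w. f (i w) (\<xi> w) (\<rho> w) (\<zeta> w)) \<in> borel_measurable S"
proof (cases "space S = {}")
 case True
 thus ?thesis by (simp add: measurable_def)
next
 case False
 have dom: "i w \<in> {0..T}" "\<xi> w \<in> space K" if "w \<in> space S" for w
  using measurable_space[OF i that] measurable_space[OF \<xi> that] by (auto simp: space_restrict_space)
 obtain D where D: "countable D" "\<forall>z\<in>D. z \<in> borel_measurable K \<and> (\<exists>C. \<forall>y\<in>space K. \<bar>z y\<bar> \<le> C)"
  "\<forall>w\<in>space S. \<forall>m. sets m = sets K \<longrightarrow> finite_measure m \<longrightarrow> (\<integral>\<^sup>+y. sq (\<zeta> w y) \<partial>m) < \<infinity> \<longrightarrow>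
    (\<forall>e>0. \<exists>z\<in>D. (\<integral>\<^sup>+y. sq (\<zeta> w y - z y) \<partial>m) < ennreal e)"
  using approximable_measurable[OF \<zeta>] unfolding approximable_def by blast
 have approx: "\<exists>z\<in>D. (\<integral>\<^sup>+y. sq (\<zeta> w y - z y) \<partial>\<nu> (i w) (\<xi> w)) < ennreal e"
  if w: "w \<in> space S" and e: "e > 0" for w e
 proof -
  have "(\<integral>\<^sup>+y. sq (\<zeta> w y) \<partial>\<nu> (i w) (\<xi> w)) < \<infinity>"
   using L2[OF w] by (auto simp: L2_def integrable_iff_bounded)
  moreover have "sets (\<nu> (i w) (\<xi> w)) = sets K" "finite_measure (\<nu> (i w) (\<xi> w))"
   using sets_rate finite_rate dom[OF w] by auto
  ultimately show ?thesis using D(3) w e by blast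
 qed
 from False obtain w0 where "w0 \<in> space S" by blast
 from approx[OF this, of 1] have ne: "D \<noteq> {}" by auto
 define z where "z = from_nat_into D"
 have zD: "z k \<in> D" for k unfolding z_def by (rule from_nat_into[OF ne])
 hence zm: "z k \<in> borel_measurable K" for k using D(2) by blast
 have zb: "\<exists>C. \<forall>y\<in>space K. \<bar>z k y\<bar> \<le> C" for k using zD D(2) by blast
 define d where "d k w = (\<integral>\<^sup>+y. sq (\<zeta> w y - z k y) \<partial>\<nu> (i w) (\<xi> w))" for k w
 have d_meas[measurable]: "d k \<in> borel_measurable S" for k
  unfolding d_def[abs_def]
 proof (rule kernel_nn_measurable[OF i \<xi>])
  have "(\<lambda>p. z k (snd p)) \<in> borel_measurable (S \<Otimes>\<^sub>M K)" by (rule measurable_compose[OF measurable_snd zm])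
  thus "(\<lambda>(w, y). sq (\<zeta> w y - z k y)) \<in> borel_measurable (S \<Otimes>\<^sub>M K)"
   using \<zeta> by (simp add: case_prod_beta')
 qed
 define k where "k n w = (LEAST j. d j w < ennreal (1 / real (Suc n)))" for n w
 have k: "d (k n w) w < ennreal (1 / real (Suc n))" if w: "w \<in> space S" for n w
 proof -
  obtain z' where "z' \<in> D" "(\<integral>\<^sup>+y. sq (\<zeta> w y - z' y) \<partial>\<nu> (i w) (\<xi> w)) < ennreal (1 / real (Suc n))"
   using approx[OF w, of "1 / real (Suc n)"] by auto
  moreover obtain j where "z j = z'" using \<open>z' \<in> D\<close> D(1) ne unfolding z_def by (metis from_nat_into_surj)
  ultimately have "d j w < ennreal (1 / real (Suc n))" by (simp add: d_def)
  thus ?thesis unfolding k_def by (rule LeastI)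
 qed
 have k_meas: "k n \<in> S \<rightarrow>\<^sub>M count_space UNIV" for n
  unfolding k_def[abs_def] by measurable
 have fz: "(\<lambda>w. f (i w) (\<xi> w) (\<rho> w) (z j)) \<in> borel_measurable S" for j
 proof -
  obtain C where "\<And>y. y \<in> space K ==> \<bar>z j y\<bar> \<le> C" using zb[of j] by blast
  from driver_measurable[OF zm this]
  have "(\<lambda>(s, x, r). f s x r (z j)) \<in> borel_measurable (restrict_space borel {0..T} \<Otimes>\<^sub>M K \<Otimes>\<^sub>M borel)" .
  moreover have "(\<lambda>w. (i w, \<xi> w, \<rho> w)) \<in> S \<rightarrow>\<^sub>M restrict_space borel {0..T} \<Otimes>\<^sub>M K \<Otimes>\<^sub>M borel"
   using i \<xi> \<rho> by (intro measurable_Pair)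
  ultimately show ?thesis by (auto dest: measurable_compose[rotated])
 qed
 show ?thesis
 proof (rule borel_measurable_LIMSEQ_real)
  show "(\<lambda>w. f (i w) (\<xi> w) (\<rho> w) (z (k n w))) \<in> borel_measurable S" for n
   by (rule measurable_compose_countable'[OF fz k_meas]) auto
  fix w assume w: "w \<in> space S"
  have L2z: "z j \<in> L2 (\<nu> (i w) (\<xi> w))" for j
   using zb[of j] by (auto intro: bounded_in_L2[OF dom[OF w] zm])
  have bound: "\<bar>f (i w) (\<xi> w) (\<rho> w) (z (k n w)) - f (i w) (\<xi> w) (\<rho> w) (\<zeta> w)\<bar> \<le> L * sqrt (1 / real (Suc n))" for n
  proof -
   have "\<bar>f (i w) (\<xi> w) (\<rho> w) (z (k n w)) - f (i w) (\<xi> w) (\<rho> w) (\<zeta> w)\<bar> \<le>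
     L * sqrt (LINT y | \<nu> (i w) (\<xi> w). \<bar>z (k n w) y - \<zeta> w y\<bar>\<^sup>2)"
    using lipschitz[OF dom[OF w] L2z L2[OF w], of "\<rho> w" "k n w" "\<rho> w"] by simp
   also have "(LINT y | \<nu> (i w) (\<xi> w). \<bar>z (k n w) y - \<zeta> w y\<bar>\<^sup>2) = enn2real (d (k n w) w)"
   proof (subst integral_eq_nn_integral)
    show "(\<lambda>y. \<bar>z (k n w) y - \<zeta> w y\<bar>\<^sup>2) \<in> borel_measurable (\<nu> (i w) (\<xi> w))"
     using L2z[of "k n w"] L2[OF w] by (auto simp: L2_def)
    show "enn2real (\<integral>\<^sup>+y. ennreal (\<bar>z (k n w) y - \<zeta> w y\<bar>\<^sup>2) \<partial>\<nu> (i w) (\<xi> w)) = enn2real (d (k n w) w)"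
     unfolding d_def by (simp add: power2_commute)
   qed simp
   also have "enn2real (d (k n w) w) \<le> 1 / real (Suc n)"
    using k[OF w, of n] by (intro enn2real_leI) (auto simp: less_imp_le)
   finally show ?thesis using L_nonneg by (simp add: mult_left_mono)
  qed
  have "(\<lambda>n. L * sqrt (1 / real (Suc n))) \<longlonglongrightarrow> L * sqrt 0"
   by (intro tendsto_intros LIMSEQ_Suc[OF lim_1_over_n])
  hence lim: "(\<lambda>n. L * sqrt (1 / real (Suc n))) \<longlonglongrightarrow> 0" by simp
  show "(\<lambda>n. f (i w) (\<xi> w) (\<rho> w) (z (k n w))) \<longlonglongrightarrow> f (i w) (\<xi> w) (\<rho> w) (\<zeta> w)"
   unfolding LIM_zero_iff[symmetric, of _ "f (i w) (\<xi> w) (\<rho> w) (\<zeta> w)"]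
   by (rule Lim_null_comparison[OF _ lim]) (use bound in auto)
 qed
qed

end

section \<open>The energy estimate for linear backward equations\<close>

lemma integral_enn2real:
 assumes [measurable]: "g \<in> borel_measurable M" and fin: "(\<integral>\<^sup>+x. g x \<partial>M) < \<infinity>"
 shows "integrable M (\<lambda>x. enn2real (g x))" and "(\<integral>x. enn2real (g x) \<partial>M) = enn2real (\<integral>\<^sup>+x. g x \<partial>M)"
proof -
 have "AE x in M. g x \<noteq> \<infinity>" by (rule nn_integral_PInf_AE) (use fin in auto)
 hence eq: "(\<integral>\<^sup>+x. ennreal (enn2real (g x)) \<partial>M) = (\<integral>\<^sup>+x. g x \<partial>M)"
  by (intro nn_integral_cong_AE) (auto simp: less_top)
 show "integrable M (\<lambda>x. enn2real (g x))" using fin eq by (intro integrableI_nonneg) auto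
 show "(\<integral>x. enn2real (g x) \<partial>M) = enn2real (\<integral>\<^sup>+x. g x \<partial>M)"
  by (subst integral_eq_nn_integral) (auto simp: eq)
qed

lemma ioc_exp:
 fixes a b c :: real
 assumes "a \<le> b" "c \<noteq> 0"
 shows "set_integrable lborel {a<..b} (\<lambda>s. exp (c * s))" "ioc (\<lambda>s. exp (c * s)) a b = (exp (c * b) - exp (c * a)) / c"
proof -
 have "has_bochner_integral lborel (\<lambda>s. exp (c * s) * indicator {a..b} s) (exp (c * b) / c - exp (c * a) / c)"
  using assms by (intro has_bochner_integral_FTC_Icc_real[where F="\<lambda>s. exp (c * s) / c"])
   (auto intro!: derivative_eq_intros continuous_intros)
 moreover have "AE s in lborel. exp (c * s) * indicator {a..b} s = indicator {a<..b} s *\<^sub>R exp (c * s)"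
  using AE_lborel_singleton[of a] by eventually_elim (auto simp: indicator_def)
 ultimately have "has_bochner_integral lborel (\<lambda>s. indicator {a<..b} s *\<^sub>R exp (c * s)) (exp (c * b) / c - exp (c * a) / c)"
  by (subst (asm) has_bochner_integral_cong_AE[where g="\<lambda>s. indicator {a<..b} s *\<^sub>R exp (c * s)"]) auto
 thus "set_integrable lborel {a<..b} (\<lambda>s. exp (c * s))" "ioc (\<lambda>s. exp (c * s)) a b = (exp (c * b) - exp (c * a)) / c"
  by (auto simp: has_bochner_integral_iff set_integrable_def set_lebesgue_integral_def diff_divide_distrib)
qed

text \<open>Integrate the hypothesis against the weight exp (2 C (r - t)). After exchanging the
  integrals, the integral of the weight up to q is at most its value at q divided by 2 C, so the
  weighted integral G satisfies G \<le> B times the integral of the weight, plus G / 2. Finiteness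
  of G allows absorbing the last term.\<close>

lemma gronwall:
 fixes h :: "real => ennreal" and B :: ennreal and C t T :: real
 assumes tT: "t \<le> T" and C: "C > 0" and h[measurable]: "h \<in> borel_measurable borel"
  and fin: "(\<integral>\<^sup>+r\<in>{t<..T}. h r \<partial>lborel) < \<infinity>"
  and le: "\<And>r. r \<in> {t<..T} ==> h r \<le> B + ennreal C * (\<integral>\<^sup>+q\<in>{r<..T}. h q \<partial>lborel)"
 shows "(\<integral>\<^sup>+r\<in>{t<..T}. h r \<partial>lborel) \<le> ennreal (2 * (T - t) * exp (2 * C * (T - t))) * B"
proof -
 define w where "w r = ennreal (exp (2 * C * (r - t)))" for r
 define W where "W = exp (2 * C * (T - t))"
 have [measurable]: "w \<in> borel_measurable borel" unfolding w_def[abs_def] by measurable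
 have w1: "1 \<le> w r" "w r \<le> ennreal W" if "r \<in> {t<..T}" for r
  using that C unfolding w_def W_def by (auto intro!: ennreal_leI simp: one_le_exp_iff)
 define G where "G = (\<integral>\<^sup>+r\<in>{t<..T}. w r * h r \<partial>lborel)"
 have "G \<le> (\<integral>\<^sup>+r. ennreal W * (h r * indicator {t<..T} r) \<partial>lborel)"
  unfolding G_def using w1(2) by (intro nn_integral_mono) (auto simp: indicator_def intro!: mult_right_mono)
 also have "\<dots> = ennreal W * (\<integral>\<^sup>+r\<in>{t<..T}. h r \<partial>lborel)" by (rule nn_integral_cmult) measurable
 also have "\<dots> < \<infinity>" using fin by (simp add: ennreal_mult_less_top)
 finally have Gfin: "G < \<infinity>" .
 have inner: "(\<integral>\<^sup>+r. w r * indicator {t<..T} r * indicator {r<..T} q \<partial>lborel) \<le> w q / ennreal (2 * C)" if q: "q \<in> {t<..T}" for q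
 proof -
  have "(\<integral>\<^sup>+r. w r * indicator {t<..T} r * indicator {r<..T} q \<partial>lborel) \<le>
    (\<integral>\<^sup>+r. ennreal (exp (- 2 * C * t)) * ennreal (indicator {t<..q} r *\<^sub>R exp (2 * C * r)) \<partial>lborel)"
   unfolding w_def using q
   by (intro nn_integral_mono) (auto simp: indicator_def ennreal_mult[symmetric] exp_add[symmetric] algebra_simps)
  also have "\<dots> = ennreal (exp (- 2 * C * t)) * (\<integral>\<^sup>+r. ennreal (indicator {t<..q} r *\<^sub>R exp (2 * C * r)) \<partial>lborel)"
   by (rule nn_integral_cmult) measurable
  also have "(\<integral>\<^sup>+r. ennreal (indicator {t<..q} r *\<^sub>R exp (2 * C * r)) \<partial>lborel) = ennreal (ioc (\<lambda>s. exp (2 * C * s)) t q)"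
   unfolding set_lebesgue_integral_def using ioc_exp(1)[of t q "2 * C"] q C
   by (intro nn_integral_eq_integral) (auto simp: set_integrable_def)
  also have "ennreal (exp (- 2 * C * t)) * ennreal (ioc (\<lambda>s. exp (2 * C * s)) t q) \<le>
    ennreal (exp (- 2 * C * t)) * ennreal (exp (2 * C * q) / (2 * C))"
   using ioc_exp(2)[of t q "2 * C"] q C by (intro mult_left_mono ennreal_leI) (auto simp: divide_right_mono)
  also have "\<dots> = w q / ennreal (2 * C)"
   using C unfolding w_def by (simp add: ennreal_mult[symmetric] divide_ennreal exp_add[symmetric] algebra_simps)
  finally show ?thesis .
 qed
 have pairm: "(\<lambda>(r, q). w r * indicator {t<..T} r * (h q * indicator {r<..T} q)) \<in> borel_measurable (borel \<Otimes>\<^sub>M borel)"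
 proof -
  have "(\<lambda>z. w (fst z) * indicator {t<..T} (fst z) * (h (snd z) * indicator {z :: real \<times> real. fst z < snd z \<and> snd z \<le> T} z))
    \<in> borel_measurable (borel \<Otimes>\<^sub>M borel)" by measurable
  moreover have "(\<lambda>z. w (fst z) * indicator {t<..T} (fst z) * (h (snd z) * indicator {z :: real \<times> real. fst z < snd z \<and> snd z \<le> T} z)) =
    (\<lambda>(r, q). w r * indicator {t<..T} r * (h q * indicator {r<..T} q))"
   by (auto simp: fun_eq_iff indicator_def)
  ultimately show ?thesis by (simp only:)
 qed
 have pairm1: "(\<lambda>r. \<integral>\<^sup>+q. w r * indicator {t<..T} r * (h q * indicator {r<..T} q) \<partial>lborel) \<in> borel_measurable borel"
  using lborel.borel_measurable_nn_integral[of "\<lambda>r q. w r * indicator {t<..T} r * (h q * indicator {r<..T} q)" borel] pairm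
  by simp
 have "G \<le> (\<integral>\<^sup>+r. B * (w r * indicator {t<..T} r) +
   ennreal C * (\<integral>\<^sup>+q. w r * indicator {t<..T} r * (h q * indicator {r<..T} q) \<partial>lborel) \<partial>lborel)"
  unfolding G_def
 proof (rule nn_integral_mono)
  fix r
  have "(\<integral>\<^sup>+q. w r * indicator {t<..T} r * (h q * indicator {r<..T} q) \<partial>lborel) =
    w r * indicator {t<..T} r * (\<integral>\<^sup>+q\<in>{r<..T}. h q \<partial>lborel)" by (rule nn_integral_cmult) measurable
  moreover have "w r * h r \<le> w r * (B + ennreal C * (\<integral>\<^sup>+q\<in>{r<..T}. h q \<partial>lborel))" if "r \<in> {t<..T}"
   using le[OF that] by (rule mult_left_mono) simp
  ultimately show "w r * h r * indicator {t<..T} r \<le> B * (w r * indicator {t<..T} r) +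
   ennreal C * (\<integral>\<^sup>+q. w r * indicator {t<..T} r * (h q * indicator {r<..T} q) \<partial>lborel)"
   by (auto simp: indicator_def distrib_left ac_simps)
 qed
 also have "\<dots> = B * (\<integral>\<^sup>+r\<in>{t<..T}. w r \<partial>lborel) +
   ennreal C * (\<integral>\<^sup>+r. (\<integral>\<^sup>+q. w r * indicator {t<..T} r * (h q * indicator {r<..T} q) \<partial>lborel) \<partial>lborel)"
  using pairm1 by (simp add: nn_integral_add nn_integral_cmult)
 also have "(\<integral>\<^sup>+r. (\<integral>\<^sup>+q. w r * indicator {t<..T} r * (h q * indicator {r<..T} q) \<partial>lborel) \<partial>lborel) =
   (\<integral>\<^sup>+q. (\<integral>\<^sup>+r. w r * indicator {t<..T} r * (h q * indicator {r<..T} q) \<partial>lborel) \<partial>lborel)"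
  by (rule lborel_pair.Fubini') (use pairm in simp)
 also have "\<dots> \<le> (\<integral>\<^sup>+q. (w q * h q * indicator {t<..T} q) / ennreal (2 * C) \<partial>lborel)"
 proof (rule nn_integral_mono)
  fix q :: real
  show "(\<integral>\<^sup>+r. w r * indicator {t<..T} r * (h q * indicator {r<..T} q) \<partial>lborel) \<le> (w q * h q * indicator {t<..T} q) / ennreal (2 * C)"
  proof (cases "q \<in> {t<..T}")
   case True
   have m: "(\<lambda>r. w r * indicator {t<..T} r * indicator {r<..T} q) \<in> borel_measurable lborel"
   proof -
    have "(\<lambda>r. w r * indicator {t<..T} r * indicator {..<q} r) \<in> borel_measurable lborel" by measurable
    moreover have "(\<lambda>r. w r * indicator {t<..T} r * indicator {..<q} r) = (\<lambda>r. w r * indicator {t<..T} r * indicator {r<..T} q)"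
     using True by (auto simp: fun_eq_iff indicator_def)
    ultimately show ?thesis by (simp only:)
   qed
   have "(\<integral>\<^sup>+r. w r * indicator {t<..T} r * (h q * indicator {r<..T} q) \<partial>lborel) =
     (\<integral>\<^sup>+r. h q * (w r * indicator {t<..T} r * indicator {r<..T} q) \<partial>lborel)" by (simp add: ac_simps)
   also have "\<dots> = h q * (\<integral>\<^sup>+r. w r * indicator {t<..T} r * indicator {r<..T} q \<partial>lborel)"
    using m by (rule nn_integral_cmult)
   also have "\<dots> \<le> h q * (w q / ennreal (2 * C))" using inner[OF True] by (rule mult_left_mono) simp
   finally show ?thesis using True by (simp add: ennreal_times_divide mult.commute)
  next
   case False
   hence z: "(\<lambda>r. w r * indicator {t<..T} r * (h q * indicator {r<..T} q)) = (\<lambda>_. 0)"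
    by (auto simp: fun_eq_iff indicator_def)
   show ?thesis unfolding z by simp
  qed
 qed
 also have "\<dots> = G / ennreal (2 * C)" unfolding G_def by (rule nn_integral_divide) measurable
 finally have le1: "G \<le> B * (\<integral>\<^sup>+r\<in>{t<..T}. w r \<partial>lborel) + ennreal C * (G / ennreal (2 * C))"
  by (simp add: mult_left_mono add_left_mono)
 have wint: "(\<integral>\<^sup>+r\<in>{t<..T}. w r \<partial>lborel) \<le> ennreal (W * (T - t))"
 proof -
  have "(\<integral>\<^sup>+r\<in>{t<..T}. w r \<partial>lborel) \<le> (\<integral>\<^sup>+r. ennreal W * indicator {t<..T} r \<partial>lborel)"
   using w1(2) by (intro nn_integral_mono) (auto simp: indicator_def)
  also have "\<dots> = ennreal (W * (T - t))"
   using tT by (simp add: nn_integral_cmult_indicator ennreal_mult W_def)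
  finally show ?thesis .
 qed
 have "G \<le> 2 * (ennreal (W * (T - t)) * B)"
 proof -
  have "B * (\<integral>\<^sup>+r\<in>{t<..T}. w r \<partial>lborel) \<le> ennreal (W * (T - t)) * B"
   using mult_left_mono[OF wint, of B] by (simp add: mult.commute)
  hence le2: "G \<le> ennreal (W * (T - t)) * B + ennreal C * (G / ennreal (2 * C))"
   using le1 by (meson add_right_mono order.trans)
  obtain g where g: "G = ennreal g" "0 \<le> g" using Gfin by (cases G) auto
  have half: "ennreal C * (G / ennreal (2 * C)) = ennreal (g / 2)"
   using C g by (simp add: divide_ennreal ennreal_mult[symmetric])
  show ?thesis
  proof (cases "ennreal (W * (T - t)) * B")
   case (real b)
   hence "ennreal g \<le> ennreal (b + g / 2)" using le2 half g by simp
   hence "g \<le> b + g / 2" using real g by (subst (asm) ennreal_le_iff) auto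
   hence "g \<le> 2 * b" by simp
   thus ?thesis using real g by (simp add: ennreal_mult[symmetric] ennreal_leI flip: ennreal_numeral)
  qed (simp add: ennreal_mult_top)
 qed
 moreover have "(\<integral>\<^sup>+r\<in>{t<..T}. h r \<partial>lborel) \<le> G"
  unfolding G_def
 proof (rule nn_integral_mono)
  fix r
  show "h r * indicator {t<..T} r \<le> w r * h r * indicator {t<..T} r"
   using mult_right_mono[OF w1(1), of r "h r"] by (auto simp: indicator_def)
 qed
 ultimately have "(\<integral>\<^sup>+r\<in>{t<..T}. h r \<partial>lborel) \<le> 2 * (ennreal (W * (T - t)) * B)" by (rule order.trans[rotated])
 moreover have "ennreal 2 * ennreal (W * (T - t)) = ennreal (2 * (W * (T - t)))"
  by (rule ennreal_mult[symmetric]) (use tT in \<open>auto simp: W_def\<close>)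
 hence "2 * (ennreal (W * (T - t)) * B) = ennreal (2 * (W * (T - t))) * B"
  by (simp only: mult.assoc[symmetric] ennreal_numeral)
 moreover have "2 * (W * (T - t)) = 2 * (T - t) * exp (2 * C * (T - t))" by (simp add: W_def)
 ultimately show ?thesis by (simp only:)
qed

context markov_jump_process
begin

text \<open>By \<open>first_in_bounds\<close> a jump in (t, b] has probability at most
  \<open>rate_bound * (b - t)\<close>, hence at most 1 / 2. On the complementary event the path
  stays at x on (t, b], so the expectation contains at least half of the integral at x.\<close>

lemma sojourn:
 fixes h :: "real => 'k => ennreal"
 assumes t: "0 \<le> t" "t \<le> b" "b \<le> T" "rate_bound * (b - t) \<le> 1 / 2" and x: "x \<in> space K"
 shows "(\<integral>\<^sup>+s\<in>{t<..b}. h s x \<partial>lborel) \<le> 2 * (\<integral>\<^sup>+w. (\<integral>\<^sup>+s\<in>{t<..T}. h s (X s w) \<partial>lborel) \<partial>P t x)"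
proof -
 interpret prob_space "P t x" by (rule prob[OF t(1) x])
 let ?F = "first_in t b (space K)" and ?c = "(\<integral>\<^sup>+s\<in>{t<..b}. h s x \<partial>lborel)"
 have F: "?F \<in> sets (P t x)"
  using first_in_law(1)[OF t(1-3) x sets.top] sets_prob[OF t(1) x] by simp
 have "emeasure (P t x) ?F \<le> (\<integral>\<^sup>+ s\<in>{t<..b}. emeasure (\<nu> s x) (space K) \<partial>lborel)"
  by (rule first_in_bounds(1)[OF t(1-3) x sets.top])
 also have "\<dots> \<le> (\<integral>\<^sup>+s. ennreal rate_bound * indicator {t<..b} s \<partial>lborel)"
  using rate_le[OF _ x] t by (intro nn_integral_mono) (auto simp: indicator_def)
 also have "\<dots> = ennreal (rate_bound * (b - t))"
  using t rate_bound_pos by (simp add: nn_integral_cmult_indicator ennreal_mult)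
 also have "\<dots> \<le> ennreal (1 / 2)" using t by (intro ennreal_leI)
 finally have "ennreal (prob ?F) \<le> ennreal (1 / 2)" unfolding emeasure_eq_measure .
 hence "prob ?F \<le> 1 / 2" by (subst (asm) ennreal_le_iff) auto
 hence half: "1 / 2 \<le> prob (\<Omega> - ?F)" using prob_compl[OF F] t x by simp
 have const: "X s w = x" if w: "w \<in> \<Omega> - ?F" "X t w = x" and s: "s \<in> {t<..b}" for s w
 proof -
  have "jumps w t b = {}"
  proof (rule ccontr)
   assume ne: "jumps w t b \<noteq> {}"
   hence "jump_set X w \<inter> {t<..} \<noteq> {}" by auto
   then obtain i where i: "i \<in> jump_set X w" "t < i" "jump_set X w \<inter> {t<..<i} = {}"
    using ex_next_jump[of w t] w(1) by blast
   have "i \<le> b"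
   proof (rule ccontr)
    assume "\<not> i \<le> b"
    hence "{t<..b} \<subseteq> {t<..<i}" by auto
    thus False using ne i(3) by blast
   qed
   hence "w \<in> ?F" unfolding first_in_def using i w(1) state[of i w] t by auto
   thus False using w by simp
  qed
  hence "jumps w t s = {}" using s by fastforce
  hence "X s w = X t w" using w s t by (intro constant_without_jump) auto
  thus ?thesis using w(2) by simp
 qed
 have "?c * ennreal (prob (\<Omega> - ?F)) = (\<integral>\<^sup>+w. ?c * indicator (\<Omega> - ?F) w \<partial>P t x)"
 proof -
  have "\<Omega> - ?F \<in> sets (P t x)" using F sets.top[of "P t x"] t x by auto
  thus ?thesis by (simp add: nn_integral_cmult_indicator emeasure_eq_measure)
 qed
 also have "\<dots> \<le> (\<integral>\<^sup>+w. (\<integral>\<^sup>+s\<in>{t<..T}. h s (X s w) \<partial>lborel) \<partial>P t x)"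
 proof (rule nn_integral_mono_AE)
  show "AE w in P t x. ?c * indicator (\<Omega> - ?F) w \<le> (\<integral>\<^sup>+s\<in>{t<..T}. h s (X s w) \<partial>lborel)"
   using start_AE[OF t(1) x]
  proof eventually_elim
   case (elim w)
   have "?c \<le> (\<integral>\<^sup>+s\<in>{t<..T}. h s (X s w) \<partial>lborel)" if "w \<in> \<Omega> - ?F"
    using const[OF that elim] t by (intro nn_integral_mono) (auto simp: indicator_def)
   thus ?case by (auto simp: indicator_def)
  qed
 qed
 finally have le: "?c * ennreal (prob (\<Omega> - ?F)) \<le> (\<integral>\<^sup>+w. (\<integral>\<^sup>+s\<in>{t<..T}. h s (X s w) \<partial>lborel) \<partial>P t x)" .
 have "ennreal 2 * ennreal (1 / 2) = ennreal (2 * (1 / 2))" by (rule ennreal_mult[symmetric]) auto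
 hence "(2 :: ennreal) * ennreal (1 / 2) = 1" by simp
 hence "?c = ?c * (2 * ennreal (1 / 2))" by (simp only: mult_1_right)
 hence "?c = 2 * (?c * ennreal (1 / 2))" by (simp only: ac_simps)
 also have "2 * (?c * ennreal (1 / 2)) \<le> 2 * (?c * ennreal (prob (\<Omega> - ?F)))"
  using half by (intro mult_left_mono ennreal_leI) auto
 also have "\<dots> \<le> 2 * (\<integral>\<^sup>+w. (\<integral>\<^sup>+s\<in>{t<..T}. h s (X s w) \<partial>lborel) \<partial>P t x)"
  using le by (rule mult_left_mono) simp
 finally show ?thesis .
qed

text \<open>The interval is cut into pieces of length at most \<open>1 / (2 * rate_bound)\<close>,
  and on each the process is started afresh at x from the left end point. The list of starting times
  does not depend on \<phi>; hence smallness in mean for each starting time passes to the fixed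
  state along a whole sequence of functions.\<close>

lemma sojourn_cover:
 assumes t: "0 \<le> t" "t \<le> T" and x: "x \<in> space K"
 shows "\<exists>ts. set ts \<subseteq> {t..T} \<and> (\<forall>\<phi> :: real => 'k => ennreal.
  (\<lambda>s. \<phi> s x * indicator {0<..T} s) \<in> borel_measurable borel \<longrightarrow>
  (\<integral>\<^sup>+s\<in>{t<..T}. \<phi> s x \<partial>lborel) \<le>
   (\<Sum>a\<leftarrow>ts. 2 * (\<integral>\<^sup>+w. (\<integral>\<^sup>+s\<in>{a<..T}. \<phi> s (X s w) \<partial>lborel) \<partial>P a x)))"
proof -
 define h where "h = 1 / (2 * rate_bound)"
 have h: "h > 0" "rate_bound * h = 1 / 2" using rate_bound_pos by (auto simp: h_def)
 have ex: "\<exists>ts. set ts \<subseteq> {t..T} \<and> (\<forall>\<phi> :: real => 'k => ennreal.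
  (\<lambda>s. \<phi> s x * indicator {0<..T} s) \<in> borel_measurable borel \<longrightarrow>
  (\<integral>\<^sup>+s\<in>{t<..T}. \<phi> s x \<partial>lborel) \<le>
   (\<Sum>a\<leftarrow>ts. 2 * (\<integral>\<^sup>+w. (\<integral>\<^sup>+s\<in>{a<..T}. \<phi> s (X s w) \<partial>lborel) \<partial>P a x)))"
  if "0 \<le> t" "t \<le> T" "T - t \<le> real n * h" for n t
  using that
 proof (induction n arbitrary: t)
  case 0
  hence "t = T" by simp
  thus ?case by (intro exI[of _ "[]"]) simp
 next
  case (Suc n)
  define b where "b = min T (t + h)"
  have b: "t \<le> b" "b \<le> T" "b - t \<le> h" using Suc.prems h by (auto simp: b_def)
  have "T - b \<le> real n * h" using Suc.prems(3) h by (auto simp: b_def distrib_right min_def)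
  from Suc.IH[OF _ b(2) this] b Suc.prems obtain ts where ts: "set ts \<subseteq> {b..T}"
   "\<And>\<phi> :: real => 'k => ennreal. (\<lambda>s. \<phi> s x * indicator {0<..T} s) \<in> borel_measurable borel ==>
    (\<integral>\<^sup>+s\<in>{b<..T}. \<phi> s x \<partial>lborel) \<le>
   (\<Sum>a\<leftarrow>ts. 2 * (\<integral>\<^sup>+w. (\<integral>\<^sup>+s\<in>{a<..T}. \<phi> s (X s w) \<partial>lborel) \<partial>P a x))" by auto
  have "rate_bound * (b - t) \<le> rate_bound * h" using b rate_bound_pos by (intro mult_left_mono) auto
  hence rb: "rate_bound * (b - t) \<le> 1 / 2" using h by simp
  show ?case
  proof (intro exI[of _ "t # ts"] conjI allI impI)
   show "set (t # ts) \<subseteq> {t..T}" using ts(1) b Suc.prems by auto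
   fix \<phi> :: "real => 'k => ennreal"
   assume m[measurable]: "(\<lambda>s. \<phi> s x * indicator {0<..T} s) \<in> borel_measurable borel"
   have "(\<integral>\<^sup>+s\<in>{t<..T}. \<phi> s x \<partial>lborel) =
     (\<integral>\<^sup>+s. (\<phi> s x * indicator {0<..T} s) * indicator {t<..b} s + (\<phi> s x * indicator {0<..T} s) * indicator {b<..T} s \<partial>lborel)"
    using b Suc.prems by (intro nn_integral_cong) (auto simp: indicator_def)
   also have "\<dots> = (\<integral>\<^sup>+s. (\<phi> s x * indicator {0<..T} s) * indicator {t<..b} s \<partial>lborel) +
     (\<integral>\<^sup>+s. (\<phi> s x * indicator {0<..T} s) * indicator {b<..T} s \<partial>lborel)"
    by (rule nn_integral_add) measurable
   also have "\<dots> \<le> (\<integral>\<^sup>+s\<in>{t<..b}. \<phi> s x \<partial>lborel) + (\<integral>\<^sup>+s\<in>{b<..T}. \<phi> s x \<partial>lborel)"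
    by (intro add_mono nn_integral_mono) (auto simp: indicator_def)
   also have "\<dots> \<le> 2 * (\<integral>\<^sup>+w. (\<integral>\<^sup>+s\<in>{t<..T}. \<phi> s (X s w) \<partial>lborel) \<partial>P t x) +
     (\<Sum>a\<leftarrow>ts. 2 * (\<integral>\<^sup>+w. (\<integral>\<^sup>+s\<in>{a<..T}. \<phi> s (X s w) \<partial>lborel) \<partial>P a x))"
    by (rule add_mono[OF sojourn[OF Suc.prems(1) b(1,2) rb x] ts(2)[of \<phi>, OF m]])
   finally show "(\<integral>\<^sup>+s\<in>{t<..T}. \<phi> s x \<partial>lborel) \<le>
    (\<Sum>a\<leftarrow>t # ts. 2 * (\<integral>\<^sup>+w. (\<integral>\<^sup>+s\<in>{a<..T}. \<phi> s (X s w) \<partial>lborel) \<partial>P a x))" by simp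
  qed
 qed
 obtain n :: nat where "(T - t) / h \<le> real n" using real_arch_simple by blast
 hence "T - t \<le> real n * h" using h by (simp add: divide_le_eq)
 from ex[OF t this] show ?thesis .
qed

text \<open>The compensator identity for integrands of both signs, from positive and negative parts
  whose expectations are finite. The inner integral is the difference of the two parts only where
  both are finite, which is almost everywhere.\<close>

lemma compensator_integral:
 fixes H :: "('w \<times> real) \<times> 'k => real"
 assumes t: "0 \<le> t" "t \<le> T" "x \<in> space K"
  and H: "H \<in> borel_measurable (PA t \<Otimes>\<^sub>M K)"
  and fin: "(\<integral>\<^sup>+p. (\<integral>\<^sup>+u. ennreal \<bar>H (p, u)\<bar> \<partial>nX p) \<partial>PR t x) < \<infinity>"
 shows "integrable (P t x) (\<lambda>w. \<Sum>j\<in>jumps w t T. H ((w, j), X j w))"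
  and "integrable (PR t x) (\<lambda>p. \<integral>u. H (p, u) \<partial>nX p)"
  and "(\<integral>w. (\<Sum>j\<in>jumps w t T. H ((w, j), X j w)) \<partial>P t x) =
   (\<integral>p. (\<integral>u. H (p, u) \<partial>nX p) \<partial>PR t x)"
proof -
 interpret prob_space "P t x" by (rule prob[OF t(1,3)])
 interpret RI: finite_measure "RS t" by (rule finite_measure_RS[OF t(2)])
 interpret pair_sigma_finite "P t x" "RS t" ..
 let ?M = "PR t x"
 define n where "n p = nX p" for p
 define N where "N h w = (\<Sum>j\<in>jumps w t T. h ((w, j), X j w))" for h :: "('w \<times> real) \<times> 'k => ennreal" and w
 define G where "G h p = (\<integral>\<^sup>+u. h (p, u) \<partial>n p)" for h :: "('w \<times> real) \<times> 'k => ennreal" and p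
 have dom: "fst p \<in> \<Omega>" "snd p \<in> {0..T}" "X (snd p) (fst p) \<in> space K" if "p \<in> space ?M" for p
  using that t state by (auto simp: space_pair_measure)
 have G_meas: "G h \<in> borel_measurable ?M" if "h \<in> borel_measurable (PA t \<Otimes>\<^sub>M K)" for h
  using product_rate_nn_integral[OF t that] unfolding G_def[abs_def] n_def by (simp add: case_prod_beta')
 have comp: "N h \<in> borel_measurable (P t x)" "(\<integral>\<^sup>+w. N h w \<partial>P t x) = (\<integral>\<^sup>+p. G h p \<partial>?M)"
  if h: "h \<in> borel_measurable (PA t \<Otimes>\<^sub>M K)" for h
 proof -
  note c = compensator[OF t h]
  show "N h \<in> borel_measurable (P t x)" using c unfolding N_def[abs_def] by blast
  have "(\<integral>\<^sup>+p. G h p \<partial>?M) = (\<integral>\<^sup>+w. (\<integral>\<^sup>+r. G h (w, r) \<partial>RS t) \<partial>P t x)"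
   using G_meas[OF h] by (rule RI.nn_integral_fst[symmetric])
  thus "(\<integral>\<^sup>+w. N h w \<partial>P t x) = (\<integral>\<^sup>+p. G h p \<partial>?M)"
   using c unfolding N_def G_def n_def by simp
 qed
 define hp where "hp z = ennreal (H z)" for z
 define hn where "hn z = ennreal (- H z)" for z
 have hm: "hp \<in> borel_measurable (PA t \<Otimes>\<^sub>M K)" "hn \<in> borel_measurable (PA t \<Otimes>\<^sub>M K)"
  unfolding hp_def[abs_def] hn_def[abs_def] using H by measurable
 have Gle: "G hp p \<le> (\<integral>\<^sup>+u. ennreal \<bar>H (p, u)\<bar> \<partial>n p)" "G hn p \<le> (\<integral>\<^sup>+u. ennreal \<bar>H (p, u)\<bar> \<partial>n p)" for p
  unfolding G_def hp_def hn_def by (intro nn_integral_mono ennreal_leI; simp)+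
 have G_fin: "(\<integral>\<^sup>+p. G hp p \<partial>?M) < \<infinity>" "(\<integral>\<^sup>+p. G hn p \<partial>?M) < \<infinity>"
  by (rule le_less_trans[OF nn_integral_mono[OF Gle(1)] fin[folded n_def]],
    rule le_less_trans[OF nn_integral_mono[OF Gle(2)] fin[folded n_def]])
 have H_sec: "(\<lambda>u. H (p, u)) \<in> borel_measurable (n p)" if p: "p \<in> space ?M" for p
 proof -
  have "p \<in> space (PA t)"
   using p t by (auto simp: space_predictable space_pair_measure)
  from measurable_compose[OF measurable_Pair1'[OF this] H]
  show ?thesis using dom[OF p] unfolding n_def by (simp add: measurable_rate_iff)
 qed
 have "AE p in ?M. G hp p \<noteq> \<infinity>" "AE p in ?M. G hn p \<noteq> \<infinity>"
  using nn_integral_PInf_AE[OF G_meas[OF hm(1)]] nn_integral_PInf_AE[OF G_meas[OF hm(2)]] G_fin by simp_all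
 hence AEH: "AE p in ?M. (\<integral>u. H (p, u) \<partial>n p) = enn2real (G hp p) - enn2real (G hn p)"
  using AE_space
 proof eventually_elim
  case (elim p)
  have "(\<integral>\<^sup>+u. ennreal (norm (H (p, u))) \<partial>n p) = (\<integral>\<^sup>+u. hp (p, u) + hn (p, u) \<partial>n p)"
   by (intro nn_integral_cong) (auto simp: hp_def hn_def abs_if ennreal_neg)
  also have "\<dots> = G hp p + G hn p"
   unfolding G_def hp_def hn_def using H_sec[OF elim(3)]
   by (intro nn_integral_add measurable_compose[OF _ measurable_ennreal] borel_measurable_uminus) auto
  also have "\<dots> < \<infinity>" using elim by (simp add: less_top)
  finally have "integrable (n p) (\<lambda>u. H (p, u))" using H_sec[OF elim(3)] by (simp add: integrable_iff_bounded)
  from real_lebesgue_integral_def[OF this] show ?case by (simp add: G_def hp_def hn_def)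
 qed
 have H_int_meas: "(\<lambda>p. \<integral>u. H (p, u) \<partial>n p) \<in> borel_measurable ?M"
  using kernel_integral_measurable[OF product_time[OF t] product_X[OF t], of "\<lambda>p u. H (p, u)"]
   product_predictable2[OF t H] unfolding n_def by (simp add: case_prod_beta')
 note ip = integral_enn2real[OF G_meas[OF hm(1)] G_fin(1)] and inn = integral_enn2real[OF G_meas[OF hm(2)] G_fin(2)]
 have R: "has_bochner_integral ?M (\<lambda>p. \<integral>u. H (p, u) \<partial>n p)
   (enn2real (\<integral>\<^sup>+p. G hp p \<partial>?M) - enn2real (\<integral>\<^sup>+p. G hn p \<partial>?M))"
 proof (subst has_bochner_integral_cong_AE[OF H_int_meas _ AEH])
  show "(\<lambda>p. enn2real (G hp p) - enn2real (G hn p)) \<in> borel_measurable ?M"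
   using G_meas[OF hm(1)] G_meas[OF hm(2)] by measurable
  show "has_bochner_integral ?M (\<lambda>p. enn2real (G hp p) - enn2real (G hn p))
   (enn2real (\<integral>\<^sup>+p. G hp p \<partial>?M) - enn2real (\<integral>\<^sup>+p. G hn p \<partial>?M))"
   using ip inn by (intro has_bochner_integral_diff) (auto simp: has_bochner_integral_iff)
 qed
 note cp = comp[OF hm(1)] and cn = comp[OF hm(2)]
 have N_fin: "(\<integral>\<^sup>+w. N hp w \<partial>P t x) < \<infinity>" "(\<integral>\<^sup>+w. N hn w \<partial>P t x) < \<infinity>" using G_fin cp cn by auto
 have N_eq: "(\<Sum>j\<in>jumps w t T. H ((w, j), X j w)) = enn2real (N hp w) - enn2real (N hn w)" for w
 proof -
  have e: "enn2real (\<Sum>i\<in>I. ennreal (a i)) = (\<Sum>i\<in>I. max 0 (a i))" for a :: "real => real" and I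
   by (subst sum.cong[OF refl, of _ _ "\<lambda>i. ennreal (max 0 (a i))"])
     (auto simp: max_def ennreal_neg sum_nonneg intro!: sum.cong)
  show ?thesis unfolding N_def hp_def hn_def e sum_subtractf[symmetric]
   by (intro sum.cong) auto
 qed
 have L: "has_bochner_integral (P t x) (\<lambda>w. \<Sum>j\<in>jumps w t T. H ((w, j), X j w))
   (enn2real (\<integral>\<^sup>+p. G hp p \<partial>?M) - enn2real (\<integral>\<^sup>+p. G hn p \<partial>?M))"
  unfolding N_eq using integral_enn2real[OF cp(1) N_fin(1)] integral_enn2real[OF cn(1) N_fin(2)] cp(2) cn(2)
  by (intro has_bochner_integral_diff) (auto simp: has_bochner_integral_iff)
 show "integrable (P t x) (\<lambda>w. \<Sum>j\<in>jumps w t T. H ((w, j), X j w))"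
  and "integrable ?M (\<lambda>p. \<integral>u. H (p, u) \<partial>nX p)"
  and "(\<integral>w. (\<Sum>j\<in>jumps w t T. H ((w, j), X j w)) \<partial>P t x) =
   (\<integral>p. (\<integral>u. H (p, u) \<partial>nX p) \<partial>?M)"
  using L R unfolding n_def by (auto simp: has_bochner_integral_iff)
qed

text \<open>\<open>C'\<close> comes from Young's inequality for the term with the driver, W from
  Gronwall's inequality. W bounds the contribution of y in the interior;
  \<open>2 * (1 + C' * W)\<close> bounds that of z, with factor 2 because half of the z-term was
  spent in Young's inequality, and also the value at time t.\<close>

definition energy_const :: "real => real => real" where
 "energy_const C t = (let C' = 2 * C + 2 * C\<^sup>2 + 1; W = 2 * (T - t) * exp (2 * C' * (T - t)) in W + 2 * (1 + C' * W))"

text \<open>Energy estimate for the linear backward equation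
 \<open>y\<^sub>s + \<integral>\<^sub>s\<^sup>T \<integral> z dq = \<xi> + \<integral>\<^sub>s\<^sup>T h dr\<close>. The left limits \<open>y\<^sub>j - z\<^sub>j\<close> occurring in the change of variables
 formula have a predictable version, obtained from the values of \<open>y\<close> on dyadic grids, so that the
 cross terms of jumps and compensator cancel in expectation.\<close>

lemma energy_estimate:
 fixes y h \<kappa> :: "real => 'w => real" and z :: "real => 'w => 'k => real" and \<xi> :: "'w => real"
 assumes t: "0 \<le> t" "t \<le> T" "x \<in> space K" and C: "0 \<le> C"
  and ys: "\<And>s. s \<in> {t..T} ==> y s \<in> borel_measurable (FA {t..s})"
  and ym: "(\<lambda>p. y (snd p) (fst p)) \<in> borel_measurable (PR t x)"
  and zm: "(\<lambda>((w, s), u). z s w u) \<in> borel_measurable (PA t \<Otimes>\<^sub>M K)"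
  and hm: "(\<lambda>p. h (snd p) (fst p)) \<in> borel_measurable (PR t x)"
  and km: "(\<lambda>p. \<kappa> (snd p) (fst p)) \<in> borel_measurable (PR t x)"
  and xm: "\<xi> \<in> borel_measurable (P t x)"
  and yfin: "(\<integral>\<^sup>+p. sq (y (snd p) (fst p)) \<partial>PR t x) < \<infinity>"
  and zfin: "(\<integral>\<^sup>+p. (\<integral>\<^sup>+u. sq (z (snd p) (fst p) u) \<partial>nX p) \<partial>PR t x) < \<infinity>"
  and kfin: "(\<integral>\<^sup>+p. sq (\<kappa> (snd p) (fst p)) \<partial>PR t x) < \<infinity>"
  and xfin: "(\<integral>\<^sup>+w. sq (\<xi> w) \<partial>P t x) < \<infinity>"
  and hb: "AE p in PR t x. \<bar>h (snd p) (fst p)\<bar> \<le> C * \<bar>y (snd p) (fst p)\<bar> +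
    C * sqrt (enn2real (\<integral>\<^sup>+u. sq (z (snd p) (fst p) u) \<partial>nX p)) + \<bar>\<kappa> (snd p) (fst p)\<bar>"
  and eq: "AE w in P t x. set_integrable lborel {t<..T} (\<lambda>r. h r w + (\<integral>u. z r w u \<partial>\<nu> r (X r w))) \<and>
    (\<forall>s\<in>{t..T}. y s w = \<xi> w + ioc (\<lambda>r. h r w + (\<integral>u. z r w u \<partial>\<nu> r (X r w))) s T -
     (\<Sum>j\<in>jumps w s T. z j w (X j w)))"
 defines "B \<equiv> (\<integral>\<^sup>+w. sq (\<xi> w) \<partial>P t x) + (\<integral>\<^sup>+p. sq (\<kappa> (snd p) (fst p)) \<partial>PR t x)"
 shows "(\<integral>\<^sup>+w. sq (y t w) \<partial>P t x) \<le> ennreal (energy_const C t) * B" (is ?g1)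
  and "(\<integral>\<^sup>+p. sq (y (snd p) (fst p)) \<partial>PR t x) \<le> ennreal (energy_const C t) * B" (is ?g2)
  and "(\<integral>\<^sup>+p. (\<integral>\<^sup>+u. sq (z (snd p) (fst p) u) \<partial>nX p) \<partial>PR t x)
   \<le> ennreal (energy_const C t) * B" (is ?g3)
proof -
 interpret prob_space "P t x" by (rule prob[OF t(1,3)])
 interpret RI: finite_measure "RS t" by (rule finite_measure_RS[OF t(2)])
 interpret pair_sigma_finite "P t x" "RS t" ..
 let ?M = "PR t x"
 define n where "n p = nX p" for p
 define Y where "Y p = y (snd p) (fst p)" for p
 define h' where "h' p = h (snd p) (fst p)" for p
 define k' where "k' p = \<kappa> (snd p) (fst p)" for p
 define Z where "Z p u = z (snd p) (fst p) u" for p u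
 define Z2 where "Z2 p = (\<integral>\<^sup>+u. sq (Z p u) \<partial>n p)" for p
 define zq where "zq p = enn2real (Z2 p)" for p
 define zi where "zi p = (\<integral>u. Z p u \<partial>n p)" for p
 define ind where "ind s p = (indicator {s<..T} (snd p) :: real)" for s and p :: "'w \<times> real"
 have dom: "fst p \<in> \<Omega>" "snd p \<in> {t<..T}" "snd p \<in> {0..T}" "X (snd p) (fst p) \<in> space K" if "p \<in> space ?M" for p
  using that t state by (auto simp: space_pair_measure)
 have [measurable]: "Y \<in> borel_measurable ?M" "h' \<in> borel_measurable ?M" "k' \<in> borel_measurable ?M" "\<xi> \<in> borel_measurable (P t x)"
  using ym hm km xm unfolding Y_def[abs_def] h'_def[abs_def] k'_def[abs_def] by auto
 have snd_m: "snd \<in> borel_measurable ?M" by (rule measurable_compose[OF measurable_snd]) (rule measurable_restrict_space1, simp)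
 have ind_m[measurable]: "ind s \<in> borel_measurable ?M" for s unfolding ind_def[abs_def] using snd_m by measurable
 have ZPm: "(\<lambda>(p, u). Z p u) \<in> borel_measurable (PA t \<Otimes>\<^sub>M K)"
  using zm unfolding Z_def by (simp add: case_prod_beta')
 have Zm: "(\<lambda>(p, u). Z p u) \<in> borel_measurable (?M \<Otimes>\<^sub>M K)"
  by (rule product_predictable2[OF t ZPm])
 have Zsec: "Z p \<in> borel_measurable (n p)" if p: "p \<in> space ?M" for p
  using section_measurable[OF Zm p] dom[OF p] sets_rate[of "snd p" "X (snd p) (fst p)"] unfolding n_def by auto
 have X'm: "(\<lambda>p. X (snd p) (fst p)) \<in> ?M \<rightarrow>\<^sub>M K" using product_X[OF t] by (simp add: case_prod_beta')
 have Z2m[measurable]: "Z2 \<in> borel_measurable ?M"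
  unfolding Z2_def[abs_def] n_def
  by (rule kernel_nn_measurable[OF product_time[OF t] X'm]) (use Zm in \<open>simp add: case_prod_beta'\<close>)
 have zqm[measurable]: "zq \<in> borel_measurable ?M" unfolding zq_def[abs_def] by measurable
 have zim[measurable]: "zi \<in> borel_measurable ?M"
  unfolding zi_def[abs_def] n_def
  by (rule kernel_integral_measurable[OF product_time[OF t] X'm Zm])
 have Yfin: "(\<integral>\<^sup>+p. sq (Y p) \<partial>?M) < \<infinity>" using yfin by (simp add: Y_def)
 have Z2fin: "(\<integral>\<^sup>+p. Z2 p \<partial>?M) < \<infinity>" using zfin by (simp add: Z2_def Z_def n_def)
 have kfin': "(\<integral>\<^sup>+p. sq (k' p) \<partial>?M) < \<infinity>" using kfin by (simp add: k'_def)
 have Y2: "integrable ?M (\<lambda>p. (Y p)\<^sup>2)" using Yfin by (intro integrableI_nonneg) auto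
 have k2: "integrable ?M (\<lambda>p. (k' p)\<^sup>2)" using kfin' by (intro integrableI_nonneg) auto
 have xi2: "integrable (P t x) (\<lambda>w. (\<xi> w)\<^sup>2)" using xfin by (intro integrableI_nonneg) auto
 have zq_int: "integrable ?M zq" using integral_enn2real(1)[OF Z2m Z2fin] by (simp add: zq_def[abs_def])
 have Z2AE: "AE p in ?M. Z2 p \<noteq> \<infinity>" by (rule nn_integral_PInf_AE) (use Z2fin in auto)
 have hb': "AE p in ?M. \<bar>h' p\<bar> \<le> C * \<bar>Y p\<bar> + C * sqrt (zq p) + \<bar>k' p\<bar>"
  using hb by (simp add: h'_def Y_def zq_def Z2_def Z_def n_def k'_def)
 have zq0: "0 \<le> zq p" for p by (simp add: zq_def)
 \<comment> \<open>Chosen so that C' a^2 + b^2 / 2 + c^2 exceeds 2 a (C a + C b + c) by exactly (2 C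
   a - b)^2 / 2 + (a - c)^2. The coefficient 1 / 2 of b^2 leaves half of the z-energy on the left of
   the final inequality.\<close>
 define C' where "C' = 2 * C + 2 * C\<^sup>2 + 1"
 have C'0: "0 < C'" using C by (simp add: C'_def add_nonneg_pos)
 have young: "2 * (\<bar>Y p\<bar> * \<bar>h' p\<bar>) \<le> C' * (Y p)\<^sup>2 + zq p / 2 + (k' p)\<^sup>2"
  if "\<bar>h' p\<bar> \<le> C * \<bar>Y p\<bar> + C * sqrt (zq p) + \<bar>k' p\<bar>" for p
 proof -
  define a b c where "a = \<bar>Y p\<bar>" "b = sqrt (zq p)" "c = \<bar>k' p\<bar>"
  have sq: "(Y p)\<^sup>2 = a\<^sup>2" "zq p = b\<^sup>2" "(k' p)\<^sup>2 = c\<^sup>2" using zq0[of p] by (auto simp: a_b_c_def)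
  have "2 * (a * \<bar>h' p\<bar>) \<le> 2 * (a * (C * a + C * b + c))"
   using that by (intro mult_left_mono) (auto simp: a_b_c_def)
  also have "\<dots> \<le> C' * a\<^sup>2 + b\<^sup>2 / 2 + c\<^sup>2"
  proof -
   have "C' * a\<^sup>2 + b\<^sup>2 / 2 + c\<^sup>2 - 2 * (a * (C * a + C * b + c)) = (2 * C * a - b)\<^sup>2 / 2 + (a - c)\<^sup>2"
    by (simp add: C'_def power2_eq_square field_simps)
   moreover have "0 \<le> (2 * C * a - b)\<^sup>2 / 2 + (a - c)\<^sup>2" by simp
   ultimately show ?thesis by linarith
  qed
  finally show ?thesis by (simp only: sq a_b_c_def(1)[symmetric])
 qed
 have Yh: "integrable ?M (\<lambda>p. Y p * h' p)"
 proof (rule Bochner_Integration.integrable_bound)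
  show "integrable ?M (\<lambda>p. C' * (Y p)\<^sup>2 + zq p / 2 + (k' p)\<^sup>2)" using Y2 zq_int k2 by auto
  show "AE p in ?M. norm (Y p * h' p) \<le> norm (C' * (Y p)\<^sup>2 + zq p / 2 + (k' p)\<^sup>2)"
   using hb'
  proof eventually_elim
   case (elim p)
   from young[OF this] show ?case using zq0[of p] C'0
    by (simp add: abs_mult) (smt (verit) mult_nonneg_nonneg abs_ge_zero)
  qed
 qed measurable
 \<comment> \<open>\<open>lim\<close> is total, so this process is predictable without exception;
   that it is the left limit of y is known only on trajectories satisfying the equation.\<close>
 define yl where "yl p = lim (\<lambda>m. y (max t (grid_down t m (snd p))) (fst p))" for p
 have yl_pred: "yl \<in> borel_measurable (PA t)"
  unfolding yl_def[abs_def]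
 proof (rule borel_measurable_lim_metric)
  show "(\<lambda>p. y (max t (grid_down t m (snd p))) (fst p)) \<in> borel_measurable (PA t)" for m
   using predictable_grid[OF t(1,2) ys, of m] by (simp add: case_prod_beta')
 qed
 have yl_m[measurable]: "yl \<in> borel_measurable ?M" by (rule product_predictable[OF t yl_pred])
 define D where "D w r = h r w + (\<integral>u. z r w u \<partial>\<nu> r (X r w))" for w r
 define c where "c w r = z r w (X r w)" for w r
 define good where "good w \<longleftrightarrow> set_integrable lborel {t<..T} (D w) \<and>
  (\<forall>s\<in>{t..T}. y s w = \<xi> w + ioc (D w) s T - (\<Sum>j\<in>jumps w s T. c w j))" for w
 have AEgood: "AE w in P t x. w \<in> \<Omega> \<and> good w"
  using eq AE_space by eventually_elim (use t in \<open>auto simp: good_def D_def[abs_def] c_def\<close>)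
 have incr: "y r w - y p w = (\<Sum>\<sigma>\<in>jumps w p r. c w \<sigma>) - ioc (D w) p r"
  if g: "w \<in> \<Omega>" "good w" and pr: "t \<le> p" "p \<le> r" "r \<le> T" for w p r
 proof -
  have "set_integrable lborel {p<..T} (D w)"
   using g(2) pr by (auto simp: good_def intro: set_integrable_ioc_subset)
  from ioc_split[OF this pr(2,3)] sum_Un_jumps[OF finite_jumps[OF g(1)] pr(2,3), of "c w"]
  show ?thesis using g(2) pr by (auto simp: good_def)
 qed
 have yl_eq: "yl (w, j) = y j w - (if j \<in> jump_set X w then c w j else 0)"
  if g: "w \<in> \<Omega>" "good w" and j: "j \<in> {t<..T}" for w j
 proof -
  define p where "p m = max t (grid_down t m j)" for m
  have p: "p m = grid_down t m j" "t \<le> p m" "p m < j" for m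
   using grid_down_ge[of t j m] grid_down(1)[of t m j] j by (auto simp: p_def)
  have plim: "p \<longlonglongrightarrow> j" using grid_down_tendsto[of t j] unfolding p(1)[abs_def] .
  have Dint: "set_integrable lborel {t<..T} (D w)" using g(2) by (simp add: good_def)
  have "(\<lambda>m. ioc (D w) (p m) j) \<longlonglongrightarrow> integral\<^sup>L (lborel :: real measure) (\<lambda>_. 0)"
   unfolding set_lebesgue_integral_def
  proof (rule integral_dominated_convergence[where w="\<lambda>r. norm (indicator {t<..T} r *\<^sub>R D w r)"])
   show "integrable lborel (\<lambda>r. norm (indicator {t<..T} r *\<^sub>R D w r))"
    using Dint unfolding set_integrable_def by (rule integrable_norm)
   show "(\<lambda>r. indicator {p m<..j} r *\<^sub>R D w r) \<in> borel_measurable lborel" for m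
    using set_integrable_ioc_subset[OF Dint p(2)[of m], of j] j by (auto simp: set_integrable_def)
   show "AE r in lborel. norm (indicator {p m<..j} r *\<^sub>R D w r) \<le> norm (indicator {t<..T} r *\<^sub>R D w r)" for m
    using p(2)[of m] j by (intro AE_I2) (auto simp: indicator_def)
   show "AE r in lborel. (\<lambda>m. indicator {p m<..j} r *\<^sub>R D w r) \<longlonglongrightarrow> 0"
    using AE_lborel_singleton[of j]
   proof eventually_elim
    case (elim r)
    have "\<forall>\<^sub>F m in sequentially. indicator {p m<..j} r *\<^sub>R D w r = 0"
    proof (cases "r < j")
     case True
     from order_tendstoD(1)[OF plim this] show ?thesis
      by eventually_elim (auto simp: indicator_def)
    qed (use elim in \<open>auto simp: indicator_def\<close>)
    thus ?case by (rule tendsto_eventually)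
   qed
  qed simp
  hence lim0: "(\<lambda>m. ioc (D w) (p m) j) \<longlonglongrightarrow> 0" by simp
  obtain a where a: "t < a" "a < j" "jump_set X w \<inter> {a<..<j} = {}"
   using ex_left_constant[OF g(1), of t j] j by auto
  have "\<forall>\<^sub>F m in sequentially. y (p m) w = y j w - (if j \<in> jump_set X w then c w j else 0) + ioc (D w) (p m) j"
   using order_tendstoD(1)[OF plim a(2)]
  proof eventually_elim
   case (elim m)
   have "{p m<..j} \<subseteq> insert j {a<..<j}" "j \<in> {p m<..j}" using elim p(3)[of m] by auto
   hence "jump_set X w \<inter> {p m<..j} = (if j \<in> jump_set X w then {j} else {})" using a(3) by auto
   hence "(\<Sum>\<sigma>\<in>jump_set X w \<inter> {p m<..j}. c w \<sigma>) = (if j \<in> jump_set X w then c w j else 0)" by simp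
   thus ?case using incr[OF g p(2)[of m], of j] p(3)[of m] j by simp
  qed
  moreover have "(\<lambda>m. y j w - (if j \<in> jump_set X w then c w j else 0) + ioc (D w) (p m) j) \<longlonglongrightarrow>
    y j w - (if j \<in> jump_set X w then c w j else 0) + 0" by (intro tendsto_intros lim0)
  ultimately have "(\<lambda>m. y (p m) w) \<longlonglongrightarrow> y j w - (if j \<in> jump_set X w then c w j else 0) + 0"
   by (subst tendsto_cong) auto
  thus ?thesis unfolding yl_def p_def by (simp add: limI)
 qed
 \<comment> \<open>On each good trajectory the left limit differs from y at jumps only, a finite
   set. In time integrals \<open>yl\<close> may thus be replaced by Y, while in sums over jumps it
   may not.\<close>
 have yl_AE: "AE p in ?M. yl p = Y p"
 proof (rule AE_pair_measure)
  show "{p \<in> space ?M. yl p = Y p} \<in> sets ?M" by measurable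
  show "AE w in P t x. AE r in RS t. yl (w, r) = Y (w, r)"
   using AEgood
  proof eventually_elim
   case (elim w)
   have "AE r in lborel. r \<notin> jumps w t T"
    by (rule AE_not_in[OF finite_imp_null_set_lborel[OF finite_jumps]]) (use elim in simp)
   hence "AE r in RS t. r \<notin> jumps w t T"
    by (subst AE_restrict_space_iff) auto
   thus ?case
    using AE_space
   proof eventually_elim
    case (elim r)
    thus ?case using yl_eq[of w r] \<open>w \<in> \<Omega> \<and> good w\<close> by (simp add: Y_def)
   qed
  qed
 qed
 have RSint: "ioc g s T = (\<integral>r. indicator {s<..T} r * g r \<partial>RS t)" if "t \<le> s" for g s
 proof -
  have "(\<integral>r. indicator {s<..T} r * g r \<partial>RS t) = (\<integral>r. indicator {t<..T} r *\<^sub>R (indicator {s<..T} r * g r) \<partial>lborel)"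
   by (rule integral_restrict_space) simp
  also have "\<dots> = ioc g s T" unfolding set_lebesgue_integral_def
   using that by (intro Bochner_Integration.integral_cong) (auto simp: indicator_def)
  finally show ?thesis ..
 qed
 \<comment> \<open>Squares of the jumps, and in \<open>H2\<close> their products with the left
   limits. Jumps after s are selected by a factor depending on time alone, so both integrands remain
   predictable on the whole interval.\<close>
 define H1 where "H1 s = (\<lambda>(p, u). ind s p * (Z p u)\<^sup>2)" for s
 define H2 where "H2 s = (\<lambda>(p, u). ind s p * (yl p * Z p u))" for s
 have ind_pred: "ind s \<in> borel_measurable (PA t)" for s
 proof -
  have "snd \<in> borel_measurable (PA t)"
   using time_predictable[OF t(1,2)] by (simp add: measurable_restrict_space2_iff)
  thus ?thesis unfolding ind_def[abs_def] by measurable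
 qed
 have H1m: "H1 s \<in> borel_measurable (PA t \<Otimes>\<^sub>M K)"
  and H2m: "H2 s \<in> borel_measurable (PA t \<Otimes>\<^sub>M K)" for s
 proof -
  have [measurable]: "(\<lambda>v'. Z (fst v') (snd v')) \<in> borel_measurable (PA t \<Otimes>\<^sub>M K)"
   using ZPm by (simp add: case_prod_beta')
  have [measurable]: "(\<lambda>v'. ind s (fst v')) \<in> borel_measurable (PA t \<Otimes>\<^sub>M K)"
   by (rule measurable_compose[OF measurable_fst ind_pred])
  have [measurable]: "(\<lambda>v'. yl (fst v')) \<in> borel_measurable (PA t \<Otimes>\<^sub>M K)"
   by (rule measurable_compose[OF measurable_fst yl_pred])
  show "H1 s \<in> borel_measurable (PA t \<Otimes>\<^sub>M K)"
   "H2 s \<in> borel_measurable (PA t \<Otimes>\<^sub>M K)"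
   unfolding H1_def H2_def case_prod_beta' by measurable
 qed
 have ind01: "0 \<le> ind s p" "ind s p \<le> 1" for s p by (auto simp: ind_def)
 have H1fin: "(\<integral>\<^sup>+p. (\<integral>\<^sup>+u. ennreal \<bar>H1 s (p, u)\<bar> \<partial>nX p) \<partial>?M) < \<infinity>" for s
 proof (rule le_less_trans[OF nn_integral_mono Z2fin])
  fix p
  show "(\<integral>\<^sup>+u. ennreal \<bar>H1 s (p, u)\<bar> \<partial>nX p) \<le> Z2 p"
   unfolding Z2_def n_def H1_def using ind01[of s p]
   by (intro nn_integral_mono ennreal_leI) (auto simp: abs_mult intro: mult_left_le_one_le)
 qed
 \<comment> \<open>The product is at most the sum of the squares, and the square of y is integrated
   against a measure of total mass at most \<open>rate_bound\<close>.\<close>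
 have H2fin: "(\<integral>\<^sup>+p. (\<integral>\<^sup>+u. ennreal \<bar>H2 s (p, u)\<bar> \<partial>nX p) \<partial>?M) < \<infinity>" for s
 proof -
  have "(\<integral>\<^sup>+p. (\<integral>\<^sup>+u. ennreal \<bar>H2 s (p, u)\<bar> \<partial>nX p) \<partial>?M) \<le>
    (\<integral>\<^sup>+p. ennreal rate_bound * sq (Y p) + Z2 p \<partial>?M)"
  proof (rule nn_integral_mono_AE)
   show "AE p in ?M. (\<integral>\<^sup>+u. ennreal \<bar>H2 s (p, u)\<bar> \<partial>nX p) \<le>
     ennreal rate_bound * sq (Y p) + Z2 p"
    using yl_AE AE_space
   proof eventually_elim
    case (elim p)
    have Zs[measurable]: "Z p \<in> borel_measurable (n p)" by (rule Zsec[OF elim(2)])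
    have "\<bar>H2 s (p, u)\<bar> \<le> (Y p)\<^sup>2 + (Z p u)\<^sup>2" for u
    proof -
     have "\<bar>H2 s (p, u)\<bar> \<le> \<bar>Y p * Z p u\<bar>"
      unfolding H2_def using ind01[of s p] elim(1) by (auto simp: abs_mult intro: mult_left_le_one_le)
     also have "\<dots> \<le> (Y p)\<^sup>2 + (Z p u)\<^sup>2"
     proof -
      have "0 \<le> (\<bar>Y p\<bar> - \<bar>Z p u\<bar>)\<^sup>2" "0 \<le> \<bar>Y p\<bar> * \<bar>Z p u\<bar>" by simp_all
      moreover from this(1) have "2 * (\<bar>Y p\<bar> * \<bar>Z p u\<bar>) \<le> (Y p)\<^sup>2 + (Z p u)\<^sup>2" by (simp add: power2_diff)
      ultimately show ?thesis unfolding abs_mult by linarith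
     qed
     finally show ?thesis .
    qed
    hence "(\<integral>\<^sup>+u. ennreal \<bar>H2 s (p, u)\<bar> \<partial>n p) \<le> (\<integral>\<^sup>+u. sq (Y p) + sq (Z p u) \<partial>n p)"
     by (intro nn_integral_mono) (simp add: ennreal_plus[symmetric] ennreal_leI del: ennreal_plus)
    also have "\<dots> = sq (Y p) * emeasure (n p) (space (n p)) + Z2 p"
     unfolding Z2_def by (subst nn_integral_add) auto
    also have "emeasure (n p) (space (n p)) \<le> ennreal rate_bound"
     using rate_le[OF dom(3,4)[OF elim(2)]] dom(3,4)[OF elim(2)] by (simp add: n_def space_rate)
    hence "sq (Y p) * emeasure (n p) (space (n p)) + Z2 p \<le> ennreal rate_bound * sq (Y p) + Z2 p"
     unfolding mult.commute[of "ennreal rate_bound"] by (intro add_right_mono mult_left_mono) auto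
    finally show ?case unfolding n_def .
   qed
  qed
  also have "\<dots> = ennreal rate_bound * (\<integral>\<^sup>+p. sq (Y p) \<partial>?M) + (\<integral>\<^sup>+p. Z2 p \<partial>?M)"
   by (subst nn_integral_add) (auto simp: nn_integral_cmult)
  also have "\<dots> < \<infinity>" using Yfin Z2fin by (simp add: ennreal_mult_less_top)
  finally show ?thesis .
 qed
 note c1 = compensator_integral[OF t H1m H1fin] and c2 = compensator_integral[OF t H2m H2fin]
 have H1_int: "(\<integral>u. H1 s (p, u) \<partial>nX p) = ind s p * zq p" if p: "p \<in> space ?M" for s p
 proof -
  have "(\<integral>u. H1 s (p, u) \<partial>n p) = ind s p * (\<integral>u. (Z p u)\<^sup>2 \<partial>n p)" by (simp add: H1_def)
  also have "(\<integral>u. (Z p u)\<^sup>2 \<partial>n p) = zq p"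
   using Zsec[OF p] unfolding zq_def Z2_def by (intro integral_eq_nn_integral) auto
  finally show ?thesis by (simp add: n_def)
 qed
 have H2_int: "(\<integral>u. H2 s (p, u) \<partial>nX p) = ind s p * (yl p * zi p)" for s p
  by (simp add: H2_def zi_def n_def)
 have Yzi_AE: "AE p in ?M. ind s p * (yl p * zi p) = ind s p * (Y p * zi p)" for s
  using yl_AE by eventually_elim simp
 have Yzi: "integrable ?M (\<lambda>p. ind s p * (Y p * zi p))" for s
 proof (rule integrable_cong_AE[THEN iffD1, OF _ _ Yzi_AE])
  show "integrable ?M (\<lambda>p. ind s p * (yl p * zi p))" using c2(2)[of s] unfolding H2_int .
 qed measurable
 define A where "A s w = (\<Sum>j\<in>jumps w t T. H1 s ((w, j), X j w))" for s w
 define Bs where "Bs s w = (\<Sum>j\<in>jumps w t T. H2 s ((w, j), X j w))" for s w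
 define F where "F s w = (\<integral>r. ind s (w, r) * (Y (w, r) * (h' (w, r) + zi (w, r))) \<partial>RS t)" for s w
 have indYh: "integrable ?M (\<lambda>p. ind s p * (Y p * h' p))" for s
 proof (rule Bochner_Integration.integrable_bound[OF Yh])
  show "AE p in ?M. norm (ind s p * (Y p * h' p)) \<le> norm (Y p * h' p)"
   using ind01 by (intro AE_I2) (auto simp: abs_mult intro: mult_left_le_one_le)
 qed measurable
 have FM: "integrable ?M (\<lambda>p. ind s p * (Y p * (h' p + zi p)))" for s
  using Bochner_Integration.integrable_add[OF indYh[of s] Yzi[of s]] by (simp add: distrib_left)
 have F_int: "integrable (P t x) (F s)" for s
  using integrable_fst'[OF FM[of s]] unfolding F_def[abs_def] .
 have F_val: "(\<integral>w. F s w \<partial>P t x) = (\<integral>p. ind s p * (Y p * h' p) \<partial>?M) + (\<integral>p. ind s p * (Y p * zi p) \<partial>?M)" for s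
  using integral_fst'[OF FM[of s]] Bochner_Integration.integral_add[OF indYh[of s] Yzi[of s]]
  unfolding F_def by (simp add: distrib_left)
 have A_val: "integrable (P t x) (A s)" "(\<integral>w. A s w \<partial>P t x) = (\<integral>p. ind s p * zq p \<partial>?M)" for s
 proof -
  show "integrable (P t x) (A s)" using c1(1)[of s] unfolding A_def[abs_def] .
  have "(\<integral>w. A s w \<partial>P t x) = (\<integral>p. (\<integral>u. H1 s (p, u) \<partial>nX p) \<partial>?M)"
   using c1(3)[of s] unfolding A_def .
  also have "\<dots> = (\<integral>p. ind s p * zq p \<partial>?M)" by (rule Bochner_Integration.integral_cong[OF refl H1_int])
  finally show "(\<integral>w. A s w \<partial>P t x) = (\<integral>p. ind s p * zq p \<partial>?M)" .
 qed
 have B_val: "integrable (P t x) (Bs s)" "(\<integral>w. Bs s w \<partial>P t x) = (\<integral>p. ind s p * (Y p * zi p) \<partial>?M)" for s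
 proof -
  show "integrable (P t x) (Bs s)" using c2(1)[of s] unfolding Bs_def[abs_def] .
  have "(\<integral>w. Bs s w \<partial>P t x) = (\<integral>p. ind s p * (yl p * zi p) \<partial>?M)"
   using c2(3)[of s] unfolding Bs_def H2_int .
  also have "\<dots> = (\<integral>p. ind s p * (Y p * zi p) \<partial>?M)"
   by (rule integral_cong_AE[OF _ _ Yzi_AE]) measurable
  finally show "(\<integral>w. Bs s w \<partial>P t x) = (\<integral>p. ind s p * (Y p * zi p) \<partial>?M)" .
 qed
 have path: "AE w in P t x. (y s w)\<^sup>2 = (\<xi> w)\<^sup>2 - A s w - 2 * Bs s w + 2 * F s w" if s: "s \<in> {t..T}" for s
  using AEgood
 proof eventually_elim
  case (elim w)
  hence w: "w \<in> \<Omega>" "good w" by auto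
  have Dint: "set_integrable lborel {s<..T} (D w)"
   using w(2) s by (auto simp: good_def intro: set_integrable_ioc_subset)
  have sT: "s \<le> T" using s by simp
  have sf: "(y T w)\<^sup>2 - (y s w)\<^sup>2 = (\<Sum>j\<in>jumps w s T. 2 * (y j w - c w j) * c w j + (c w j)\<^sup>2) -
    2 * ioc (\<lambda>r. y r w * D w r) s T"
   by (rule conjunct2[OF square_formula[OF sT Dint finite_jumps[OF w(1)]]]) (use incr[OF w] s in auto)
  have yT: "y T w = \<xi> w" using w(2) t by (simp add: good_def set_lebesgue_integral_def)
  have J: "(\<Sum>j\<in>jumps w t T. H ((w, j), X j w)) = (\<Sum>j\<in>jumps w s T. g j)"
   if "\<And>j. j \<in> jump_set X w ==> j \<in> {s<..T} ==> H ((w, j), X j w) = g j"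
    "\<And>j. j \<notin> {s<..T} ==> H ((w, j), X j w) = 0" for H :: "_ => real" and g
  proof (rule sum.mono_neutral_cong_right[OF finite_jumps[OF w(1)]])
   show "jumps w s T \<subseteq> jumps w t T" using s by auto
   show "\<forall>i\<in>jumps w t T - jumps w s T. H ((w, i), X i w) = 0"
    using that(2) by blast
   show "H ((w, i), X i w) = g i" if "i \<in> jumps w s T" for i
    using that \<open>\<And>j. j \<in> jump_set X w ==> j \<in> {s<..T} ==> H ((w, j), X j w) = g j\<close> by blast
  qed
  have A1: "A s w = (\<Sum>j\<in>jumps w s T. (c w j)\<^sup>2)"
   unfolding A_def by (rule J) (auto simp: H1_def ind_def Z_def c_def)
  have B1: "Bs s w = (\<Sum>j\<in>jumps w s T. (y j w - c w j) * c w j)"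
   unfolding Bs_def using yl_eq[OF w] s by (intro J) (auto simp: H2_def ind_def Z_def c_def)
  have F1: "F s w = ioc (\<lambda>r. y r w * D w r) s T"
   using s by (subst RSint) (auto simp: F_def ind_def Y_def D_def h'_def zi_def Z_def n_def)
  have "(\<Sum>j\<in>jumps w s T. 2 * (y j w - c w j) * c w j + (c w j)\<^sup>2) = 2 * Bs s w + A s w"
   unfolding A1 B1 sum_distrib_left sum.distrib[symmetric] by (intro sum.cong refl) (simp add: algebra_simps)
  thus ?case using sf yT F1 by simp
 qed
 have ysP[measurable]: "y s \<in> borel_measurable (P t x)" if "s \<in> {t..T}" for s
  using measurable_P[OF t(1,3) measurable_FA_mono[OF ys[OF that]]] by simp
 \<comment> \<open>The expectation of \<open>Bs\<close> is the integral of \<open>Y * zi\<close>,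
   and the same term occurs with opposite sign in F. After cancellation the compensator of z has
   disappeared; only the energy of z and the product \<open>Y * h'\<close> remain.\<close>
 have Ey: "integrable (P t x) (\<lambda>w. (y s w)\<^sup>2)"
  "(\<integral>w. (y s w)\<^sup>2 \<partial>P t x) = (\<integral>w. (\<xi> w)\<^sup>2 \<partial>P t x) - (\<integral>p. ind s p * zq p \<partial>?M) + 2 * (\<integral>p. ind s p * (Y p * h' p) \<partial>?M)"
  if s: "s \<in> {t..T}" for s
 proof -
  have R: "has_bochner_integral (P t x) (\<lambda>w. (\<xi> w)\<^sup>2 - A s w - 2 * Bs s w + 2 * F s w)
   ((\<integral>w. (\<xi> w)\<^sup>2 \<partial>P t x) - (\<integral>w. A s w \<partial>P t x) - 2 * (\<integral>w. Bs s w \<partial>P t x) + 2 * (\<integral>w. F s w \<partial>P t x))"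
   using xi2 A_val(1) B_val(1) F_int
   by (intro has_bochner_integral_add has_bochner_integral_diff has_bochner_integral_mult_right)
     (auto simp: has_bochner_integral_iff)
  have m: "(\<lambda>w. (y s w)\<^sup>2) \<in> borel_measurable (P t x)" using ysP[OF s] by measurable
  have "has_bochner_integral (P t x) (\<lambda>w. (y s w)\<^sup>2)
   ((\<integral>w. (\<xi> w)\<^sup>2 \<partial>P t x) - (\<integral>w. A s w \<partial>P t x) - 2 * (\<integral>w. Bs s w \<partial>P t x) + 2 * (\<integral>w. F s w \<partial>P t x))"
   by (rule has_bochner_integral_cong_AE[THEN iffD2, OF m _ path[OF s] R])
     (use R in \<open>auto simp: has_bochner_integral_iff\<close>)
  thus "integrable (P t x) (\<lambda>w. (y s w)\<^sup>2)"
   "(\<integral>w. (y s w)\<^sup>2 \<partial>P t x) = (\<integral>w. (\<xi> w)\<^sup>2 \<partial>P t x) - (\<integral>p. ind s p * zq p \<partial>?M) + 2 * (\<integral>p. ind s p * (Y p * h' p) \<partial>?M)"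
   by (auto simp: has_bochner_integral_iff A_val B_val F_val)
 qed
 define b where "b = (\<integral>w. (\<xi> w)\<^sup>2 \<partial>P t x) + (\<integral>p. (k' p)\<^sup>2 \<partial>?M)"
 have b0: "0 \<le> b" by (simp add: b_def)
 have Bb: "B = ennreal b"
  unfolding B_def b_def k'_def[symmetric] using xi2 k2
  by (simp add: nn_integral_eq_integral)
 have ind_int: "integrable ?M (\<lambda>p. ind s p * g p)" if g: "integrable ?M g" for s and g :: "_ => real"
 proof (rule Bochner_Integration.integrable_bound[OF g])
  show "AE p in ?M. norm (ind s p * g p) \<le> norm (g p)"
   using ind01[of s] by (intro AE_I2) (auto simp: abs_mult intro: mult_left_le_one_le)
 qed (use borel_measurable_integrable[OF g] in measurable)
 have iY: "integrable ?M (\<lambda>p. ind s p * (Y p)\<^sup>2)" and iz: "integrable ?M (\<lambda>p. ind s p * zq p)" and ik: "integrable ?M (\<lambda>p. ind s p * (k' p)\<^sup>2)" for s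
  by (rule ind_int[OF Y2], rule ind_int[OF zq_int], rule ind_int[OF k2])
 \<comment> \<open>Young's inequality absorbs half of the z-energy and leaves a bound in terms of
   the y-energy after s, which is the hypothesis of Gronwall's inequality.\<close>
 have main: "(\<integral>w. (y s w)\<^sup>2 \<partial>P t x) + (\<integral>p. ind s p * zq p \<partial>?M) / 2 \<le> b + C' * (\<integral>p. ind s p * (Y p)\<^sup>2 \<partial>?M)"
  if s: "s \<in> {t..T}" for s
 proof -
  have "2 * (\<integral>p. ind s p * (Y p * h' p) \<partial>?M) = (\<integral>p. 2 * (ind s p * (Y p * h' p)) \<partial>?M)" by simp
  also have "\<dots> \<le> (\<integral>p. C' * (ind s p * (Y p)\<^sup>2) + ind s p * zq p / 2 + ind s p * (k' p)\<^sup>2 \<partial>?M)"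
  proof (rule integral_mono_AE)
   show "AE p in ?M. 2 * (ind s p * (Y p * h' p)) \<le> C' * (ind s p * (Y p)\<^sup>2) + ind s p * zq p / 2 + ind s p * (k' p)\<^sup>2"
    using hb'
   proof eventually_elim
    case (elim p)
    have "Y p * h' p \<le> \<bar>Y p\<bar> * \<bar>h' p\<bar>" using abs_ge_self[of "Y p * h' p"] by (simp add: abs_mult)
    hence "2 * (Y p * h' p) \<le> C' * (Y p)\<^sup>2 + zq p / 2 + (k' p)\<^sup>2" using young[OF elim] by linarith
    hence "ind s p * (2 * (Y p * h' p)) \<le> ind s p * (C' * (Y p)\<^sup>2 + zq p / 2 + (k' p)\<^sup>2)"
     using ind01 by (intro mult_left_mono)
    thus ?case by (simp add: algebra_simps)
   qed
  qed (use indYh iY iz ik in auto)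
  also have "\<dots> = C' * (\<integral>p. ind s p * (Y p)\<^sup>2 \<partial>?M) + (\<integral>p. ind s p * zq p \<partial>?M) / 2 + (\<integral>p. ind s p * (k' p)\<^sup>2 \<partial>?M)"
   using iY iz ik by simp
  also have "(\<integral>p. ind s p * (k' p)\<^sup>2 \<partial>?M) \<le> (\<integral>p. (k' p)\<^sup>2 \<partial>?M)"
   using ik k2 ind01 by (intro integral_mono) (auto intro: mult_left_le_one_le)
  finally show ?thesis using Ey(2)[OF s] by (simp add: b_def)
 qed
 define \<phi> where "\<phi> r = (\<integral>\<^sup>+w. sq (y r w) \<partial>P t x) * indicator {t<..T} r" for r
 have \<phi>RS: "(\<lambda>r. \<integral>\<^sup>+w. sq (y r w) \<partial>P t x) \<in> borel_measurable (RS t)"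
 proof -
  have "(\<lambda>(r, w). sq (Y (w, r))) \<in> borel_measurable (RS t \<Otimes>\<^sub>M P t x)"
   using measurable_compose[OF measurable_pair_swap', of "\<lambda>p. sq (Y p)"] by (simp add: case_prod_beta')
  from sigma_finite_measure.borel_measurable_nn_integral[OF prob_space_imp_sigma_finite[OF prob[OF t(1,3)]] this] show ?thesis by (simp add: Y_def)
 qed
 have \<phi>m[measurable]: "\<phi> \<in> borel_measurable borel"
  using \<phi>RS unfolding \<phi>_def[abs_def] by (subst (asm) borel_measurable_restrict_space_iff_ennreal) auto
 have \<phi>int: "(\<integral>\<^sup>+r\<in>{s<..T}. \<phi> r \<partial>lborel) = ennreal (\<integral>p. ind s p * (Y p)\<^sup>2 \<partial>?M)" if s: "t \<le> s" for s
 proof -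
  have "(\<integral>\<^sup>+r\<in>{s<..T}. \<phi> r \<partial>lborel) = (\<integral>\<^sup>+r. (\<integral>\<^sup>+w. sq (y r w) \<partial>P t x) * indicator {s<..T} r \<partial>RS t)"
   unfolding RS_nn_integral \<phi>_def using s by (intro nn_integral_cong) (auto simp: indicator_def)
  also have "\<dots> = (\<integral>\<^sup>+r. (\<integral>\<^sup>+w. ennreal (ind s (w, r) * (Y (w, r))\<^sup>2) \<partial>P t x) \<partial>RS t)"
   by (intro nn_integral_cong) (auto simp: indicator_def ind_def Y_def)
  also have "\<dots> = (\<integral>\<^sup>+p. ennreal (ind s p * (Y p)\<^sup>2) \<partial>?M)"
   by (rule nn_integral_snd[of "\<lambda>p. ennreal (ind s p * (Y p)\<^sup>2)"]) measurable
  also have "\<dots> = ennreal (\<integral>p. ind s p * (Y p)\<^sup>2 \<partial>?M)"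
   using iY[of s] ind01 by (intro nn_integral_eq_integral) auto
  finally show ?thesis .
 qed
 define W where "W = 2 * (T - t) * exp (2 * C' * (T - t))"
 have W0: "0 \<le> W" using t by (simp add: W_def)
 have gr: "(\<integral>\<^sup>+r\<in>{t<..T}. \<phi> r \<partial>lborel) \<le> ennreal W * B"
  unfolding W_def
 proof (rule gronwall[OF t(2) C'0 \<phi>m])
  show "(\<integral>\<^sup>+r\<in>{t<..T}. \<phi> r \<partial>lborel) < \<infinity>" unfolding \<phi>int[OF order.refl] by simp
  fix r assume r: "r \<in> {t<..T}"
  hence r': "r \<in> {t..T}" "t \<le> r" by auto
  have "\<phi> r = ennreal (\<integral>w. (y r w)\<^sup>2 \<partial>P t x)"
   unfolding \<phi>_def using r Ey(1)[OF r'(1)] by (simp add: nn_integral_eq_integral)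
  also have "\<dots> \<le> ennreal (b + C' * (\<integral>p. ind r p * (Y p)\<^sup>2 \<partial>?M))"
  proof (rule ennreal_leI)
   have "0 \<le> (\<integral>p. ind r p * zq p \<partial>?M)" using ind01 zq0 by (intro integral_nonneg_AE AE_I2) auto
   thus "(\<integral>w. (y r w)\<^sup>2 \<partial>P t x) \<le> b + C' * (\<integral>p. ind r p * (Y p)\<^sup>2 \<partial>?M)" using main[OF r'(1)] by simp
  qed
  also have "\<dots> = B + ennreal C' * (\<integral>\<^sup>+q\<in>{r<..T}. \<phi> q \<partial>lborel)"
  proof -
   have "0 \<le> (\<integral>p. ind r p * (Y p)\<^sup>2 \<partial>?M)" using ind01 by (intro integral_nonneg_AE AE_I2) auto
   thus ?thesis unfolding Bb \<phi>int[OF r'(2)] using b0 C'0 by (simp add: ennreal_mult)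
  qed
  finally show "\<phi> r \<le> B + ennreal C' * (\<integral>\<^sup>+q\<in>{r<..T}. \<phi> q \<partial>lborel)" .
 qed
 have ind1: "ind t p = 1" if "p \<in> space ?M" for p using dom(2)[OF that] by (simp add: ind_def)
 have Yint_eq: "(\<integral>p. ind t p * (Y p)\<^sup>2 \<partial>?M) = (\<integral>p. (Y p)\<^sup>2 \<partial>?M)" "(\<integral>p. ind t p * zq p \<partial>?M) = (\<integral>p. zq p \<partial>?M)"
  by (intro Bochner_Integration.integral_cong; simp add: ind1)+
 define q where "q = (\<integral>p. (Y p)\<^sup>2 \<partial>?M)"
 have q0: "0 \<le> q" by (simp add: q_def)
 have "ennreal q \<le> ennreal (W * b)"
  using gr unfolding \<phi>int[OF order.refl] Yint_eq q_def[symmetric] Bb using W0 b0 by (simp add: ennreal_mult)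
 hence qW: "q \<le> W * b" using W0 b0 by (subst (asm) ennreal_le_iff) auto
 have "t \<in> {t..T}" using t by simp
 note main_t = main[OF this, unfolded Yint_eq q_def[symmetric]]
 define e where "e = (\<integral>w. (y t w)\<^sup>2 \<partial>P t x)"
 define zz where "zz = (\<integral>p. zq p \<partial>?M)"
 have ez0: "0 \<le> e" "0 \<le> zz" unfolding e_def zz_def using zq0 by (auto intro!: integral_nonneg_AE)
 have ec: "energy_const C t = W + 2 * (1 + C' * W)" by (simp add: energy_const_def Let_def C'_def W_def)
 have m2: "e + zz / 2 \<le> b * (1 + C' * W)"
 proof -
  have "C' * q \<le> C' * (W * b)" using qW C'0 by (intro mult_left_mono) auto
  thus ?thesis using main_t unfolding e_def[symmetric] zz_def[symmetric] by (simp add: algebra_simps)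
 qed
 have CW: "0 \<le> C' * W" "0 \<le> b * W" "0 \<le> b * (1 + C' * W)" using C'0 W0 b0 by auto
 have le: "e \<le> energy_const C t * b" "q \<le> energy_const C t * b" "zz \<le> energy_const C t * b"
  unfolding ec using m2 qW ez0 CW by (auto simp: algebra_simps)
 have ec0: "0 \<le> energy_const C t" unfolding ec using CW W0 by simp
 have EB: "ennreal (energy_const C t) * B = ennreal (energy_const C t * b)" unfolding Bb using ec0 b0 by (simp add: ennreal_mult)
 have "(\<integral>\<^sup>+w. sq (y t w) \<partial>P t x) = ennreal e"
  unfolding e_def using Ey(1)[of t] t by (intro nn_integral_eq_integral) auto
 thus ?g1 unfolding EB using le(1) by (simp add: ennreal_leI)
 have "(\<integral>\<^sup>+p. sq (Y p) \<partial>?M) = ennreal q"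
  unfolding q_def using Y2 by (intro nn_integral_eq_integral) auto
 thus ?g2 unfolding EB Y_def using le(2) by (simp add: ennreal_leI)
 have "(\<integral>\<^sup>+p. Z2 p \<partial>?M) = (\<integral>\<^sup>+p. ennreal (zq p) \<partial>?M)"
  using Z2AE by (intro nn_integral_cong_AE) (auto simp: zq_def less_top)
 also have "\<dots> = ennreal zz" unfolding zz_def using zq_int zq0 by (intro nn_integral_eq_integral) auto
 finally show ?g3 unfolding EB Z2_def Z_def n_def using le(3) by (simp add: ennreal_leI)
qed

end

text \<open>On (a, b] the function g is f plus a finite combination of indicators of points;
  measurability of g thus comes out of the proof.\<close>

lemma ioc_cong_finite:
 fixes f g :: "real => real"
 assumes f: "set_integrable lborel {a<..b} f" and S: "finite S"
  and eq: "\<And>r. r \<in> {a<..b} ==> r \<notin> S ==> g r = f r"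
 shows "set_integrable lborel {a<..b} g" and "ioc g a b = ioc f a b"
proof -
 define d where "d r = (\<Sum>j\<in>S. indicator {j} r * (indicator {a<..b} j * (g j - f j)))" for r
 have d: "d r = (if r \<in> S then indicator {a<..b} r * (g r - f r) else 0)" for r
 proof -
  have "d r = (\<Sum>j\<in>S. if r = j then indicator {a<..b} r * (g r - f r) else 0)"
   unfolding d_def by (intro sum.cong) (auto simp: indicator_def)
  thus ?thesis using S by (simp add: sum.delta)
 qed
 have gd: "(\<lambda>r. indicator {a<..b} r *\<^sub>R g r) = (\<lambda>r. indicator {a<..b} r *\<^sub>R f r + d r)"
  using eq by (auto simp: fun_eq_iff d indicator_def)
 have "has_bochner_integral lborel d (\<Sum>j\<in>S. 0)"
  unfolding d_def[abs_def]
 proof (rule has_bochner_integral_sum)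
  fix j
  have "integrable lborel (\<lambda>r. indicator {j} r * (indicator {a<..b} j * (g j - f j)))"
   by (intro integrable_mult_left integrable_real_indicator) auto
  thus "has_bochner_integral lborel (\<lambda>r. indicator {j} r * (indicator {a<..b} j * (g j - f j))) 0"
   by (simp add: has_bochner_integral_iff)
 qed
 moreover have "has_bochner_integral lborel (\<lambda>r. indicator {a<..b} r *\<^sub>R f r) (ioc f a b)"
  using f by (simp add: has_bochner_integral_iff set_integrable_def set_lebesgue_integral_def)
 ultimately have "has_bochner_integral lborel (\<lambda>r. indicator {a<..b} r *\<^sub>R f r + d r) (ioc f a b + (\<Sum>j\<in>S. 0))"
  by (intro has_bochner_integral_add)
 hence "has_bochner_integral lborel (\<lambda>r. indicator {a<..b} r *\<^sub>R g r) (ioc f a b)" unfolding gd by simp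
 thus "set_integrable lborel {a<..b} g" and "ioc g a b = ioc f a b"
  by (auto simp: has_bochner_integral_iff set_integrable_def set_lebesgue_integral_def)
qed

section \<open>Linear backward equations solved by functions of the state\<close>

context markov_jump_process
begin

text \<open>Induction on the number of jumps after s. Until the first jump j the state is constant,
  and the equation at that state gives the change in time; at j the value moves from
  \<open>u j x\<close> to \<open>u j (X j w)\<close>, the summand for j.\<close>

lemma kolmogorov_path:
 fixes u D :: "real => 'k => real"
 assumes w: "w \<in> \<Omega>"
  and D: "\<And>t x. t \<in> {0..T} ==> x \<in> space K ==> set_integrable lborel {t<..T} (\<lambda>s. D s x)"
  and u: "\<And>t x. t \<in> {0..T} ==> x \<in> space K ==> u t x = g x + ioc (\<lambda>s. D s x) t T"
  and s: "s \<in> {0..T}"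
 shows "set_integrable lborel {s<..T} (\<lambda>r. D r (X r w)) \<and> u s (X s w) = g (X T w) + ioc (\<lambda>r. D r (X r w)) s T -
  (\<Sum>j\<in>jumps w s T. u j (X j w) - u j (left_value X j w))"
 using s
proof (induction "card (jumps w s T)" arbitrary: s)
 case 0
 have J: "jumps w s T = {}" using 0(1) finite_jumps[OF w, of s T] by simp
 have const: "X r w = X s w" if "r \<in> {s..T}" for r
 proof (rule constant_without_jump[OF w])
  show "jumps w s r = {}" using J that by (force simp: disjoint_iff)
 qed (use that 0 in auto)
 have X: "X s w \<in> space K" using state w 0 by simp
 have D1: "set_integrable lborel {s<..T} (\<lambda>r. D r (X s w))" by (rule D[OF 0(2) X])
 have "D r (X r w) = D r (X s w)" if "r \<in> {s<..T}" for r using const[of r] that by simp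
 from ioc_cong_finite[OF D1 finite.emptyI this]
 have "set_integrable lborel {s<..T} (\<lambda>r. D r (X r w))" "ioc (\<lambda>r. D r (X r w)) s T = ioc (\<lambda>r. D r (X s w)) s T"
  by blast+
 moreover have "X T w = X s w" using const[of T] 0 by simp
 ultimately show ?case using u[OF 0(2) X] J by simp
next
 case (Suc n)
 define j where "j = Min (jumps w s T)"
 have fin: "finite (jumps w s T)" by (rule finite_jumps[OF w])
 have ne: "jumps w s T \<noteq> {}" using Suc(2) by auto
 have j: "j \<in> jump_set X w" "s < j" "j \<le> T" using Min_in[OF fin ne] by (auto simp: j_def)
 have min: "j \<le> r" if "r \<in> jump_set X w" "s < r" "r \<le> T" for r
  unfolding j_def using fin that by (intro Min_le) auto
 have J1: "jump_set X w \<inter> {s<..<j} = {}" using j min by fastforce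
 have J2: "jumps w s T = insert j (jumps w j T)" using j min by fastforce
 have fin2: "finite (jumps w j T)" by (rule finite_jumps[OF w])
 have card: "n = card (jumps w j T)" using Suc(2) fin2 by (simp add: J2)
 have j0: "j \<in> {0..T}" using j Suc.prems by simp
 note IH = Suc(1)[OF card j0]
 define x where "x = X s w"
 have x: "x \<in> space K" using state w Suc.prems by (simp add: x_def)
 have const: "X r w = x" if "r \<in> {s<..<j}" for r
  unfolding x_def
 proof (rule constant_without_jump[OF w])
  show "jumps w s r = {}" using J1 that by (force simp: disjoint_iff)
 qed (use that Suc.prems in auto)
 have lv: "left_value X j w = x" unfolding x_def by (rule left_value_eq) (use w j J1 Suc.prems in auto)
 have Dx: "set_integrable lborel {s<..T} (\<lambda>r. D r x)" by (rule D[OF Suc.prems x])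
 have Dx1: "set_integrable lborel {s<..j} (\<lambda>r. D r x)" by (rule set_integrable_ioc_subset[OF Dx]) (use j in auto)
 have "D r (X r w) = D r x" if "r \<in> {s<..j}" "r \<notin> {j}" for r using const[of r] that by simp
 hence D1: "set_integrable lborel {s<..j} (\<lambda>r. D r (X r w))" "ioc (\<lambda>r. D r (X r w)) s j = ioc (\<lambda>r. D r x) s j"
  using ioc_cong_finite[OF Dx1, of "{j}" "\<lambda>r. D r (X r w)"] by auto
 have un: "{s<..T} = {s<..j} \<union> {j<..T}" using j by auto
 have int: "set_integrable lborel {s<..T} (\<lambda>r. D r (X r w))"
  unfolding un using D1(1) IH by (intro set_integrable_Un) auto
 have sj: "s \<le> j" using j by simp
 have "u s x = u j x + ioc (\<lambda>r. D r x) s j"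
  using u[OF Suc.prems x] u[OF j0 x] ioc_split[OF Dx sj j(3)] by simp
 moreover have "ioc (\<lambda>r. D r (X r w)) s T = ioc (\<lambda>r. D r (X r w)) s j + ioc (\<lambda>r. D r (X r w)) j T"
  by (rule ioc_split[OF int sj j(3)])
 moreover have "(\<Sum>j\<in>jumps w s T. u j (X j w) - u j (left_value X j w)) =
   (u j (X j w) - u j x) + (\<Sum>j\<in>jumps w j T. u j (X j w) - u j (left_value X j w))"
  unfolding J2 using fin2 by (subst sum.insert) (auto simp: lv)
 ultimately show ?case using IH int D1(2) unfolding x_def by simp
qed

text \<open>The backward equation with the driver along the solution regarded as a given process h.
  The integral against the compensated measure is split into jump sum and compensator, and the
  latter is taken at X r rather than at the left limit.\<close>

definition linear_bsde :: "real => 'k => (real => 'w => real) => (real => 'w => 'k => real) =>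
  (real => 'w => real) => ('w => real) => bool" where
 "linear_bsde t x y z h \<xi> \<longleftrightarrow> (AE w in P t x.
  set_integrable lborel {t<..T} (\<lambda>r. h r w + (\<integral>u. z r w u \<partial>\<nu> r (X r w))) \<and>
  (\<forall>s\<in>{t..T}. y s w = \<xi> w + ioc (\<lambda>r. h r w + (\<integral>u. z r w u \<partial>\<nu> r (X r w))) s T -
    (\<Sum>j\<in>jumps w s T. z j w (X j w))))"

lemma X_minus_eq: "w \<in> \<Omega> ==> 0 \<le> t ==> t < s ==> s \<notin> jump_set X w ==> X_minus t s w = X s w"
 by (simp add: X_minus_def left_value_eq_self)

text \<open>H is compared with h away from jumps only, because the driver will be evaluated at the
  increments from \<open>X_minus\<close>, which at a jump is not the current state.\<close>

lemma kolmogorov_linear_bsde: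
 fixes u h :: "real => 'k => real"
 assumes D: "\<And>t x. t \<in> {0..T} ==> x \<in> space K ==> set_integrable lborel {t<..T} (\<lambda>s. h s x + generator \<nu> s (u s) x)"
  and u: "\<And>t x. t \<in> {0..T} ==> x \<in> space K ==> u t x = g x + ioc (\<lambda>s. h s x + generator \<nu> s (u s) x) t T"
  and t: "0 \<le> t" "t \<le> T" "x \<in> space K"
  and H: "\<And>r w. w \<in> \<Omega> ==> r \<in> {t<..T} ==> r \<notin> jump_set X w ==> H r w = h r (X r w)"
 shows "linear_bsde t x (\<lambda>s w. u s (X s w)) (\<lambda>s w y. u s y - u s (X_minus t s w)) H (\<lambda>w. g (X T w))"
 unfolding linear_bsde_def
proof (rule AE_I2)
 fix w assume "w \<in> space (P t x)"
 hence w: "w \<in> \<Omega>" using t by simp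
 define D where "D s y = h s y + generator \<nu> s (u s) y" for s y
 define E where "E r = H r w + (\<integral>y. u r y - u r (X_minus t r w) \<partial>\<nu> r (X r w))" for r
 have Ds: "t \<in> {0..T} ==> x \<in> space K ==> set_integrable lborel {t<..T} (\<lambda>s. D s x)"
  and us: "t \<in> {0..T} ==> x \<in> space K ==> u t x = g x + ioc (\<lambda>s. D s x) t T" for t x
  using assms(1,2)[of t x] unfolding D_def by auto
 have kp: "set_integrable lborel {s<..T} (\<lambda>r. D r (X r w)) \<and> u s (X s w) = g (X T w) + ioc (\<lambda>r. D r (X r w)) s T -
  (\<Sum>j\<in>jumps w s T. u j (X j w) - u j (left_value X j w))" if "s \<in> {0..T}" for s
  by (rule kolmogorov_path[OF w]) (use Ds us that in auto)
 have E: "set_integrable lborel {s<..T} E" "ioc E s T = ioc (\<lambda>r. D r (X r w)) s T" if s: "s \<in> {t..T}" for s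
 proof -
  have s0: "s \<in> {0..T}" using s t by simp
  have "E r = D r (X r w)" if r: "r \<in> {s<..T}" "r \<notin> jumps w s T" for r
  proof -
   have "X_minus t r w = X r w" using r s by (intro X_minus_eq w t(1)) auto
   thus ?thesis using H[OF w, of r] r s by (simp add: E_def D_def generator_def)
  qed
  from ioc_cong_finite[OF conjunct1[OF kp[OF s0]] finite_jumps[OF w] this]
  show "set_integrable lborel {s<..T} E" "ioc E s T = ioc (\<lambda>r. D r (X r w)) s T" by blast+
 qed
 have "u s (X s w) = g (X T w) + ioc E s T - (\<Sum>j\<in>jumps w s T. u j (X j w) - u j (X_minus t j w))"
  if s: "s \<in> {t..T}" for s
 proof -
  have s0: "s \<in> {0..T}" using s t by simp
  have "(\<Sum>j\<in>jumps w s T. u j (X j w) - u j (X_minus t j w)) =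
    (\<Sum>j\<in>jumps w s T. u j (X j w) - u j (left_value X j w))"
   using s by (intro sum.cong) (auto simp: X_minus_def)
  thus ?thesis using conjunct2[OF kp[OF s0]] E(2)[OF s] by simp
 qed
 thus "set_integrable lborel {t<..T} (\<lambda>r. H r w + (\<integral>y. u r y - u r (X_minus t r w) \<partial>\<nu> r (X r w))) \<and>
  (\<forall>s\<in>{t..T}. u s (X s w) = g (X T w) + ioc (\<lambda>r. H r w + (\<integral>y. u r y - u r (X_minus t r w) \<partial>\<nu> r (X r w))) s T -
    (\<Sum>j\<in>jumps w s T. u j (X j w) - u j (X_minus t j w)))"
  using E(1)[of t] t unfolding E_def[symmetric] by simp
qed

lemma product_nn_integral:
 assumes t: "0 \<le> t" "t \<le> T" "x \<in> space K" and m: "(\<lambda>p. H (fst p) (snd p)) \<in> borel_measurable (PR t x)"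
 shows "(\<integral>\<^sup>+w. (\<integral>\<^sup>+s\<in>{t<..T}. H w s \<partial>lborel) \<partial>P t x) = (\<integral>\<^sup>+p. H (fst p) (snd p) \<partial>PR t x)"
proof -
 interpret RI: finite_measure "RS t" by (rule finite_measure_RS[OF t(2)])
 show ?thesis using RI.nn_integral_fst[OF m] by (simp add: RS_nn_integral)
qed

lemma AE_product_fst:
 assumes t: "0 \<le> t" "t \<le> T" "x \<in> space K" and ae: "AE p in PR t x. Q (fst p) (snd p)"
 shows "AE w in P t x. AE r in lborel. r \<in> {t<..T} \<longrightarrow> Q w r"
proof -
 interpret prob_space "P t x" by (rule prob[OF t(1,3)])
 interpret RI: finite_measure "RS t" by (rule finite_measure_RS[OF t(2)])
 interpret pair_sigma_finite "P t x" "RS t" ..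
 from AE_pair[OF ae] show ?thesis by (simp add: AE_restrict_space_iff)
qed

lemma AE_product_integrable:
 fixes H :: "'w \<times> real => real"
 assumes t: "0 \<le> t" "t \<le> T" "x \<in> space K" and H: "integrable (PR t x) H"
 shows "AE w in P t x. set_integrable lborel {t<..T} (\<lambda>r. H (w, r))"
proof -
 interpret prob_space "P t x" by (rule prob[OF t(1,3)])
 interpret RI: finite_measure "RS t" by (rule finite_measure_RS[OF t(2)])
 interpret pair_sigma_finite "P t x" "RS t" ..
 from AE_integrable_fst'[OF H] show ?thesis
  by eventually_elim (simp add: integrable_restrict_space set_integrable_def)
qed

end

section \<open>Backward equations with a Lipschitz driver\<close>

context lipschitz_driver
begin

text \<open>The driver is only constrained on square integrable functions; hence the cut-off.\<close>

definition cut_driver :: "real => 'k => real => ('k => real) => real" where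
 "cut_driver s x r z = (if (\<integral>\<^sup>+y. sq (z y) \<partial>\<nu> s x) < \<infinity> then f s x r z else 0)"

lemma in_L2:
 assumes "s \<in> {0..T}" "x \<in> space K" "z \<in> borel_measurable K" "(\<integral>\<^sup>+y. sq (z y) \<partial>\<nu> s x) < \<infinity>"
 shows "z \<in> L2 (\<nu> s x)"
proof -
 have "z \<in> borel_measurable (\<nu> s x)" using assms by (simp add: measurable_rate_iff)
 thus ?thesis using assms(4) by (auto simp: L2_def intro!: integrableI_nonneg)
qed

lemma cut_driver_lipschitz:
 assumes sx: "s \<in> {0..T}" "x \<in> space K" and z: "z \<in> borel_measurable K" "z' \<in> borel_measurable K"
  and fin: "(\<integral>\<^sup>+y. sq (z y) \<partial>\<nu> s x) < \<infinity>" "(\<integral>\<^sup>+y. sq (z' y) \<partial>\<nu> s x) < \<infinity>"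
 shows "\<bar>cut_driver s x r z - cut_driver s x r' z'\<bar> \<le>
  L' * \<bar>r - r'\<bar> + L * sqrt (enn2real (\<integral>\<^sup>+y. sq (z y - z' y) \<partial>\<nu> s x))"
proof -
 have "z \<in> borel_measurable (\<nu> s x)" "z' \<in> borel_measurable (\<nu> s x)"
  using z sx by (simp_all add: measurable_rate_iff)
 hence "(LINT y | \<nu> s x. \<bar>z y - z' y\<bar>\<^sup>2) = enn2real (\<integral>\<^sup>+y. sq (z y - z' y) \<partial>\<nu> s x)"
  by (subst integral_eq_nn_integral) auto
 thus ?thesis
  using lipschitz[OF sx in_L2[OF sx z(1) fin(1)] in_L2[OF sx z(2) fin(2)], of r r'] fin
  by (simp add: cut_driver_def)
qed

text \<open>The Lipschitz condition compares with the argument (0, 0); squaring the three resulting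
  terms costs a factor 3. Beyond the cut-off the left side is 0.\<close>

lemma cut_driver_square:
 assumes sx: "s \<in> {0..T}" "x \<in> space K" and z: "z \<in> borel_measurable K"
 shows "sq (cut_driver s x r z) \<le> ennreal (3 * (1 + L'\<^sup>2 + L\<^sup>2)) *
  (sq (f s x 0 (\<lambda>_. 0)) + sq r + (\<integral>\<^sup>+y. sq (z y) \<partial>\<nu> s x))"
proof (cases "(\<integral>\<^sup>+y. sq (z y) \<partial>\<nu> s x) < \<infinity>")
 case True
 define q where "q = enn2real (\<integral>\<^sup>+y. sq (z y) \<partial>\<nu> s x)"
 define a where "a = f s x 0 (\<lambda>_. 0)"
 have q: "(\<integral>\<^sup>+y. sq (z y) \<partial>\<nu> s x) = ennreal q" "0 \<le> q"
  using True by (auto simp: q_def)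
 have "\<bar>cut_driver s x r z - a\<bar> \<le> L' * \<bar>r\<bar> + L * sqrt q"
  using cut_driver_lipschitz[OF sx z, of "\<lambda>_. 0" r 0] True unfolding a_def q_def by (simp add: cut_driver_def)
 hence "\<bar>cut_driver s x r z\<bar> \<le> \<bar>a\<bar> + L' * \<bar>r\<bar> + L * sqrt q" by linarith
 hence "(cut_driver s x r z)\<^sup>2 \<le> (\<bar>a\<bar> + L' * \<bar>r\<bar> + L * sqrt q)\<^sup>2"
  using L_nonneg q by (simp add: abs_le_square_iff[symmetric])
 also have "\<dots> \<le> 3 * (a\<^sup>2 + (L' * \<bar>r\<bar>)\<^sup>2 + (L * sqrt q)\<^sup>2)"
  using sum_squares_ge_zero[of "\<bar>a\<bar> - L' * \<bar>r\<bar>" "\<bar>a\<bar> - L * sqrt q"] zero_le_power2[of "L' * \<bar>r\<bar> - L * sqrt q"]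
  by (simp add: power2_eq_square algebra_simps)
 also have "\<dots> = 3 * (1 * a\<^sup>2 + L'\<^sup>2 * r\<^sup>2 + L\<^sup>2 * q)" using q by (simp add: power_mult_distrib)
 also have "\<dots> \<le> 3 * ((1 + L'\<^sup>2 + L\<^sup>2) * a\<^sup>2 + (1 + L'\<^sup>2 + L\<^sup>2) * r\<^sup>2 + (1 + L'\<^sup>2 + L\<^sup>2) * q)"
  using q by (intro mult_left_mono add_mono mult_right_mono) auto
 finally have "(cut_driver s x r z)\<^sup>2 \<le> 3 * (1 + L'\<^sup>2 + L\<^sup>2) * (a\<^sup>2 + r\<^sup>2 + q)" by (simp add: algebra_simps)
 hence "sq (cut_driver s x r z) \<le> ennreal (3 * (1 + L'\<^sup>2 + L\<^sup>2) * (a\<^sup>2 + r\<^sup>2 + q))"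
  by (rule ennreal_leI)
 thus ?thesis unfolding q(1) a_def[symmetric]
  using q by (subst (asm) ennreal_mult) (auto simp: ennreal_plus)
qed (simp add: cut_driver_def)

text \<open>Where z is not square integrable it is replaced by 0, which makes
  \<open>driver_composition_measurable\<close> applicable everywhere; the cut-off erases the effect
  of the replacement.\<close>

lemma cut_driver_measurable:
 assumes i: "i \<in> S \<rightarrow>\<^sub>M restrict_space borel {0..T}" and \<xi>: "\<xi> \<in> S \<rightarrow>\<^sub>M K"
  and r: "r \<in> borel_measurable S" and z: "(\<lambda>(w, y). z w y) \<in> borel_measurable (S \<Otimes>\<^sub>M K)"
 shows "(\<lambda>w. cut_driver (i w) (\<xi> w) (r w) (z w)) \<in> borel_measurable S"
proof -
 define q where "q w = (\<integral>\<^sup>+y. sq (z w y) \<partial>\<nu> (i w) (\<xi> w))" for w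
 have qm[measurable]: "q \<in> borel_measurable S"
  unfolding q_def[abs_def] by (rule kernel_nn_measurable[OF i \<xi>]) (use z in \<open>simp add: case_prod_beta'\<close>)
 define \<eta> where "\<eta> w = (if q w < \<infinity> then z w else (\<lambda>_. 0))" for w
 have "(\<lambda>w. f (i w) (\<xi> w) (r w) (\<eta> w)) \<in> borel_measurable S"
 proof (rule driver_composition_measurable[OF i \<xi> r])
  have "(\<lambda>(w, y). \<eta> w y) = (\<lambda>p. if q (fst p) < \<infinity> then (\<lambda>(w, y). z w y) p else 0)"
   by (auto simp: \<eta>_def fun_eq_iff)
  thus \<eta>: "(\<lambda>(w, y). \<eta> w y) \<in> borel_measurable (S \<Otimes>\<^sub>M K)" using z by simp
  fix w assume w: "w \<in> space S"
  have "i w \<in> {0..T}" "\<xi> w \<in> space K"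
   using measurable_space[OF i w] measurable_space[OF \<xi> w] by (auto simp: space_restrict_space)
  thus "\<eta> w \<in> L2 (\<nu> (i w) (\<xi> w))"
   by (intro in_L2 section_measurable[OF \<eta> w refl]) (auto simp: \<eta>_def q_def)
 qed
 hence "(\<lambda>w. if q w < \<infinity> then f (i w) (\<xi> w) (r w) (\<eta> w) else 0) \<in> borel_measurable S" by measurable
 thus ?thesis
  by (rule subst[where P="\<lambda>h. h \<in> borel_measurable S", rotated]) (auto simp: fun_eq_iff cut_driver_def q_def \<eta>_def)
qed

end

context markov_jump_process
begin

lemma product_domain:
 assumes "0 \<le> t" "x \<in> space K" "p \<in> space (PR t x)"
 shows "fst p \<in> \<Omega>" "snd p \<in> {t<..T}" "snd p \<in> {0..T}" "X (snd p) (fst p) \<in> space K"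
 using assms state by (auto simp: space_pair_measure)

lemma in_MD:
 assumes "inM t x Y Z"
 shows "(\<lambda>(w, s). Y s w) \<in> borel_measurable (GA t)"
  and "(\<lambda>((w, s), y). Z s w y) \<in> borel_measurable (PA t \<Otimes>\<^sub>M K)"
  and "M_norm t x Y Z < \<infinity>"
 using assms by (simp_all add: in_M_def)

lemma M_product:
 assumes t: "0 \<le> t" "t \<le> T" "x \<in> space K"
  and Yp: "(\<lambda>(w, s). Y s w) \<in> borel_measurable (GA t)"
  and Zp: "(\<lambda>((w, s), y). Z s w y) \<in> borel_measurable (PA t \<Otimes>\<^sub>M K)"
 shows "(\<lambda>p. Y (snd p) (fst p)) \<in> borel_measurable (PR t x)"
  and "(\<lambda>(p, u). Z (snd p) (fst p) u) \<in> borel_measurable ((PR t x) \<Otimes>\<^sub>M K)"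
  and "M_norm t x Y Z = (\<integral>\<^sup>+p. sq (Y (snd p) (fst p)) \<partial>PR t x) +
   (\<integral>\<^sup>+p. (\<integral>\<^sup>+u. sq (Z (snd p) (fst p) u) \<partial>nX p) \<partial>PR t x)"
  and "(\<lambda>p. \<integral>\<^sup>+u. sq (Z (snd p) (fst p) u) \<partial>nX p) \<in>
   borel_measurable (PR t x)"
proof -
 from product_progressive[OF t Yp]
 show Y: "(\<lambda>p. Y (snd p) (fst p)) \<in> borel_measurable (PR t x)"
  by (simp add: case_prod_beta')
 from product_predictable2[OF t Zp]
 show Z: "(\<lambda>(p, u). Z (snd p) (fst p) u) \<in> borel_measurable ((PR t x) \<Otimes>\<^sub>M K)"
  by (simp add: case_prod_beta')
 have "(\<lambda>p. X (snd p) (fst p)) \<in> PR t x \<rightarrow>\<^sub>M K"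
  using product_X[OF t] by (simp add: case_prod_beta')
 from kernel_nn_measurable[OF product_time[OF t] this, of "\<lambda>p u. sq (Z (snd p) (fst p) u)"] Z
 show Z2: "(\<lambda>p. \<integral>\<^sup>+u. sq (Z (snd p) (fst p) u) \<partial>nX p) \<in>
   borel_measurable (PR t x)"
  by (simp add: case_prod_beta')
 show "M_norm t x Y Z = (\<integral>\<^sup>+p. sq (Y (snd p) (fst p)) \<partial>PR t x) +
   (\<integral>\<^sup>+p. (\<integral>\<^sup>+u. sq (Z (snd p) (fst p) u) \<partial>nX p) \<partial>PR t x)"
  using product_nn_integral[OF t, of "\<lambda>w s. sq (Y s w)"] Y product_nn_integral[OF t Z2]
  by (simp add: M_norm_sq_def)
qed

lemmas in_M_product = M_product[OF _ _ _ in_MD(1) in_MD(2)]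

lemma square_integrable_product:
 assumes t: "0 \<le> t" "t \<le> T" "x \<in> space K" and [measurable]: "h \<in> borel_measurable (PR t x)"
  and fin: "(\<integral>\<^sup>+p. sq (h p) \<partial>PR t x) < \<infinity>"
 shows "integrable (PR t x) h"
proof -
 interpret prob_space "P t x" by (rule prob[OF t(1,3)])
 interpret RI: finite_measure "RS t" by (rule finite_measure_RS[OF t(2)])
 interpret F: finite_measure "PR t x" by (intro finite_measure_pair_measure finite_measure_axioms RI.finite_measure_axioms)
 show ?thesis
  by (rule F.square_integrable_imp_integrable) (use fin in \<open>auto intro!: integrableI_nonneg\<close>)
qed

text \<open>The bound \<open>\<bar>z\<bar> \<le> 1 + z\<^sup>2\<close> and the boundedness of the
  rates reduce integrability of Z to its finite energy.\<close>

lemma in_M_integral: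
 assumes t: "0 \<le> t" "t \<le> T" "x \<in> space K" and YZ: "inM t x Y Z"
 shows "AE w in P t x. set_integrable lborel {t<..T} (\<lambda>r. \<integral>u. Z r w u \<partial>\<nu> r (X r w))"
proof -
 let ?M = "PR t x"
 let ?I = "\<lambda>h. (\<integral>\<^sup>+p. (\<integral>\<^sup>+u. h (Z (snd p) (fst p) u) \<partial>nX p) \<partial>?M)"
 interpret prob_space "P t x" by (rule prob[OF t(1,3)])
 interpret RI: finite_measure "RS t" by (rule finite_measure_RS[OF t(2)])
 interpret F: finite_measure ?M by (intro finite_measure_pair_measure finite_measure_axioms RI.finite_measure_axioms)
 note iM = in_M_product[OF t YZ YZ]
 have "?I (\<lambda>z. ennreal \<bar>z\<bar>) \<le> (\<integral>\<^sup>+p. ennreal rate_bound +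
   (\<integral>\<^sup>+u. sq (Z (snd p) (fst p) u) \<partial>nX p) \<partial>?M)"
 proof (rule nn_integral_mono)
  fix p assume p: "p \<in> space ?M"
  note d = product_domain[OF t(1,3) p]
  have [measurable]: "Z (snd p) (fst p) \<in> borel_measurable (nX p)"
   using section_measurable[OF iM(2) p sets_rate] d by auto
  have le: "\<bar>z\<bar> \<le> 1 + z\<^sup>2" for z :: real
   using zero_le_power2[of "\<bar>z\<bar> - 1"] unfolding power2_diff by simp
  have "(\<integral>\<^sup>+u. ennreal \<bar>Z (snd p) (fst p) u\<bar> \<partial>nX p) \<le>
    (\<integral>\<^sup>+u. 1 + sq (Z (snd p) (fst p) u) \<partial>nX p)"
   using le by (intro nn_integral_mono) (simp flip: ennreal_1 ennreal_plus add: ennreal_leI)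
  also have "\<dots> = emeasure (nX p) (space K) +
    (\<integral>\<^sup>+u. sq (Z (snd p) (fst p) u) \<partial>nX p)"
   using d by (subst nn_integral_add) (auto simp: space_rate)
  finally show "(\<integral>\<^sup>+u. ennreal \<bar>Z (snd p) (fst p) u\<bar> \<partial>nX p) \<le> ennreal rate_bound +
    (\<integral>\<^sup>+u. sq (Z (snd p) (fst p) u) \<partial>nX p)"
   using rate_le[OF d(3,4)] by (meson add_right_mono order_trans)
 qed
 also have "\<dots> = ennreal rate_bound * emeasure ?M (space ?M) + ?I (\<lambda>z. sq z)"
  using iM(4) by (subst nn_integral_add) auto
 also have "\<dots> < \<infinity>"
  using in_MD(3)[OF YZ] F.emeasure_finite[of "space ?M"] unfolding iM(3) less_top by (auto simp: ennreal_mult_less_top)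
 finally have fin: "?I (\<lambda>z. ennreal \<bar>z\<bar>) < \<infinity>" .
 have "integrable ?M (\<lambda>p. \<integral>u. Z (snd p) (fst p) u \<partial>nX p)"
  using compensator_integral(2)[OF t, of "\<lambda>((w, s), y). Z s w y"] YZ fin by (simp add: in_M_def case_prod_beta')
 from AE_product_integrable[OF t this] show ?thesis by simp
qed

end

context lipschitz_driver
begin

lemma driver_process:
 assumes t: "0 \<le> t" "t \<le> T" "x \<in> space K" and YZ: "inM t x Y Z"
  and f0: "(\<integral>\<^sup>+w. (\<integral>\<^sup>+s\<in>{t<..T}. ennreal (\<bar>f s (X s w) 0 (\<lambda>_. 0)\<bar>\<^sup>2) \<partial>lborel) \<partial>P t x) < \<infinity>"
 shows "(\<lambda>p. cut_driver (snd p) (X (snd p) (fst p)) (Y (snd p) (fst p)) (Z (snd p) (fst p))) \<in>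
   borel_measurable (PR t x)" (is ?m)
  and "AE p in PR t x.
   (\<integral>\<^sup>+u. sq (Z (snd p) (fst p) u) \<partial>nX p) < \<infinity>" (is ?ae)
  and "AE w in P t x. set_integrable lborel {t<..T} (\<lambda>r. cut_driver r (X r w) (Y r w) (Z r w))" (is ?int)
proof -
 let ?M = "PR t x"
 note iM = in_M_product[OF t YZ YZ]
 have X'm: "(\<lambda>p. X (snd p) (fst p)) \<in> ?M \<rightarrow>\<^sub>M K" using product_X[OF t] by (simp add: case_prod_beta')
 show m: ?m by (rule cut_driver_measurable[OF product_time[OF t] X'm iM(1,2)])
 define a where "a p = f (snd p) (X (snd p) (fst p)) 0 (\<lambda>_. 0)" for p
 have "(\<lambda>p. cut_driver (snd p) (X (snd p) (fst p)) 0 (\<lambda>_. 0)) \<in> borel_measurable ?M"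
  by (rule cut_driver_measurable[OF product_time[OF t] X'm]) auto
 hence am[measurable]: "a \<in> borel_measurable ?M" by (simp add: cut_driver_def a_def[abs_def])
 have "(\<lambda>p. sq (a (fst p, snd p))) \<in> borel_measurable ?M" by simp
 from product_nn_integral[OF t this] f0 have afin: "(\<integral>\<^sup>+p. sq (a p) \<partial>?M) < \<infinity>" by (simp add: a_def)
 define Z2 where "Z2 p = (\<integral>\<^sup>+u. sq (Z (snd p) (fst p) u) \<partial>nX p)" for p
 have Z2m[measurable]: "Z2 \<in> borel_measurable ?M" using iM(4) by (simp add: Z2_def[abs_def])
 have fin: "(\<integral>\<^sup>+p. sq (Y (snd p) (fst p)) \<partial>?M) < \<infinity>" "(\<integral>\<^sup>+p. Z2 p \<partial>?M) < \<infinity>"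
  using in_MD(3)[OF YZ] unfolding iM(3) by (auto simp: Z2_def)
 hence "AE p in ?M. Z2 p \<noteq> \<infinity>" by (intro nn_integral_PInf_AE) auto
 thus ?ae by (simp add: Z2_def top.not_eq_extremum)
 have "(\<integral>\<^sup>+p. sq (cut_driver (snd p) (X (snd p) (fst p)) (Y (snd p) (fst p)) (Z (snd p) (fst p))) \<partial>?M) \<le>
   (\<integral>\<^sup>+p. ennreal (3 * (1 + L'\<^sup>2 + L\<^sup>2)) * (sq (a p) + sq (Y (snd p) (fst p)) + Z2 p) \<partial>?M)"
 proof (rule nn_integral_mono)
  fix p assume p: "p \<in> space ?M"
  note d = product_domain[OF t(1,3) p]
  show "sq (cut_driver (snd p) (X (snd p) (fst p)) (Y (snd p) (fst p)) (Z (snd p) (fst p))) \<le>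
   ennreal (3 * (1 + L'\<^sup>2 + L\<^sup>2)) * (sq (a p) + sq (Y (snd p) (fst p)) + Z2 p)"
   unfolding a_def Z2_def by (rule cut_driver_square[OF d(3,4) section_measurable[OF iM(2) p refl]])
 qed
 also have "\<dots> = ennreal (3 * (1 + L'\<^sup>2 + L\<^sup>2)) * ((\<integral>\<^sup>+p. sq (a p) \<partial>?M) +
   (\<integral>\<^sup>+p. sq (Y (snd p) (fst p)) \<partial>?M) + (\<integral>\<^sup>+p. Z2 p \<partial>?M))"
  using iM(1) by (subst nn_integral_cmult, simp, subst nn_integral_add, simp, simp, subst nn_integral_add) auto
 also have "\<dots> < \<infinity>" using afin fin by (auto simp: ennreal_mult_less_top)
 finally show ?int using AE_product_integrable[OF t square_integrable_product[OF t m]] by simp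
qed

text \<open>On almost every trajectory Z is square integrable for almost every time, so the driver
  agrees there with its cut-off. The left limit may be replaced by X r off the finitely many jumps,
  and the integral against the jump measure is a finite sum.\<close>

lemma bsde_iff_linear:
 assumes t: "0 \<le> t" "t \<le> T" "x \<in> space K" and YZ: "inM t x Y Z"
  and f0: "(\<integral>\<^sup>+w. (\<integral>\<^sup>+s\<in>{t<..T}. ennreal (\<bar>f s (X s w) 0 (\<lambda>_. 0)\<bar>\<^sup>2) \<partial>lborel) \<partial>P t x) < \<infinity>"
 shows "bsde g t x Y Z \<longleftrightarrow>
  linear_bsde t x Y Z (\<lambda>r w. cut_driver r (X r w) (Y r w) (Z r w)) (\<lambda>w. g (X T w))"
proof -
 define h where "h r w = cut_driver r (X r w) (Y r w) (Z r w)" for r w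
 define zi where "zi r w = (\<integral>u. Z r w u \<partial>\<nu> r (X r w))" for r w
 have "AE w in P t x. AE r in lborel. r \<in> {t<..T} \<longrightarrow> (\<integral>\<^sup>+u. sq (Z r w u) \<partial>\<nu> r (X r w)) < \<infinity>"
  by (rule AE_product_fst[OF t driver_process(2)[OF t YZ f0]])
 moreover have "AE w in P t x. set_integrable lborel {t<..T} (\<lambda>r. h r w)"
  using driver_process(3)[OF t YZ f0] by (simp add: h_def)
 moreover have "AE w in P t x. set_integrable lborel {t<..T} (\<lambda>r. zi r w)"
  using in_M_integral[OF t YZ] by (simp add: zi_def)
 moreover have "AE w in P t x. w \<in> \<Omega>" using t by (intro AE_I2) simp
 ultimately have "AE w in P t x.
  (\<forall>s\<in>{t..T}. Y s w + compensated_integral K \<nu> X t w s T (\<lambda>r. Z r w) =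
   g (X T w) + (LINT r : {s<..T} | lebesgue. f r (X r w) (Y r w) (Z r w))) \<longleftrightarrow>
  (set_integrable lborel {t<..T} (\<lambda>r. h r w + zi r w) \<and>
  (\<forall>s\<in>{t..T}. Y s w = g (X T w) + ioc (\<lambda>r. h r w + zi r w) s T - (\<Sum>j\<in>jumps w s T. Z j w (X j w))))"
 proof eventually_elim
  case (elim w)
  note w = elim(4)
  have int: "set_integrable lborel {s<..T} (\<lambda>r. h r w)" "set_integrable lborel {s<..T} (\<lambda>r. zi r w)" if "t \<le> s" for s
   by (rule set_integrable_ioc_subset[OF elim(2) that order_refl], rule set_integrable_ioc_subset[OF elim(3) that order_refl])
  have c: "compensated_integral K \<nu> X t w s T (\<lambda>r. Z r w) =
    (\<Sum>j\<in>jumps w s T. Z j w (X j w)) - ioc (\<lambda>r. zi r w) s T" if s: "s \<in> {t..T}" for s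
  proof (cases "s = T")
   case True
   thus ?thesis by (simp add: compensated_integral_def set_lebesgue_integral_def)
  next
   case False
   \<comment> \<open>\<open>jump_measure_integral\<close> requires a nondegenerate interval. For s =
     T all integrals in question are over empty sets.\<close>
   hence tT: "t < T" using s by simp
   have "w \<in> space (P t x)" using w t by simp
   hence "(\<lambda>(r, y). ((w, r), y)) \<in> restrict_space borel {t<..T} \<Otimes>\<^sub>M K \<rightarrow>\<^sub>M (PR t x) \<Otimes>\<^sub>M K"
    unfolding case_prod_beta'
    by (intro measurable_Pair measurable_const measurable_snd)
     (simp_all cong: measurable_cong_sets sets_pair_measure_cong sets_restrict_space_cong)
   from measurable_compose[OF this in_M_product(2)[OF t YZ YZ]]
   have "(\<lambda>(r, y). Z r w y) \<in> borel_measurable (restrict_space borel {t<..T} \<Otimes>\<^sub>M K)"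
    by (simp add: case_prod_beta')
   from jump_measure_integral[OF w t(1) _ _ order_refl tT this, of s] s
   have 1: "(LINT z : {s<..T} \<times> space K | jump_measure K X t w. Z (fst z) w (snd z)) =
    (\<Sum>j\<in>jumps w s T. Z j w (X j w))" by simp
   have "(LINT r : {s<..T} | lebesgue. LINT y | \<nu> r (left_value X r w). Z r w y) = ioc (\<lambda>r. zi r w) s T"
   proof (rule lebesgue_ioc_eq)
    show "set_borel_measurable lborel {s<..T} (\<lambda>r. zi r w)"
     using int(2)[of s] s by (auto simp: set_integrable_def set_borel_measurable_def)
    have "AE r in lborel. r \<notin> jumps w t T"
     by (rule AE_not_in[OF finite_imp_null_set_lborel[OF finite_jumps[OF w]]])
    thus "AE r in lborel. r \<in> {s<..T} \<longrightarrow> (LINT y | \<nu> r (left_value X r w). Z r w y) = zi r w"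
    proof eventually_elim
     case (elim r)
     show ?case
     proof
      assume "r \<in> {s<..T}"
      hence "left_value X r w = X r w" using elim s t by (intro left_value_eq_self w) auto
      thus "(LINT y | \<nu> r (left_value X r w). Z r w y) = zi r w" by (simp add: zi_def)
     qed
    qed
   qed
   with 1 show ?thesis by (simp add: compensated_integral_def)
  qed
  have f: "(LINT r : {s<..T} | lebesgue. f r (X r w) (Y r w) (Z r w)) = ioc (\<lambda>r. h r w) s T" if s: "s \<in> {t..T}" for s
  proof (rule lebesgue_ioc_eq)
   show "set_borel_measurable lborel {s<..T} (\<lambda>r. h r w)"
    using int(1)[of s] s by (auto simp: set_integrable_def set_borel_measurable_def)
   from elim(1) show "AE r in lborel. r \<in> {s<..T} \<longrightarrow> f r (X r w) (Y r w) (Z r w) = h r w"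
    by eventually_elim (use s in \<open>auto simp: h_def cut_driver_def\<close>)
  qed
  have "ioc (\<lambda>r. h r w + zi r w) s T = ioc (\<lambda>r. h r w) s T + ioc (\<lambda>r. zi r w) s T" if "s \<in> {t..T}" for s
   using int[of s] that by (intro set_integral_add) auto
  moreover have "set_integrable lborel {t<..T} (\<lambda>r. h r w + zi r w)" using elim by (intro set_integral_add) auto
  moreover have "Y s w + compensated_integral K \<nu> X t w s T (\<lambda>r. Z r w) =
    g (X T w) + (LINT r : {s<..T} | lebesgue. f r (X r w) (Y r w) (Z r w)) \<longleftrightarrow>
   Y s w = g (X T w) + (ioc (\<lambda>r. h r w) s T + ioc (\<lambda>r. zi r w) s T) -
    (\<Sum>j\<in>jumps w s T. Z j w (X j w))" if "s \<in> {t..T}" for s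
   unfolding c[OF that] f[OF that] by (simp add: algebra_simps)
  ultimately show ?case by simp
 qed
 thus ?thesis using YZ unfolding bsde_solution_def linear_bsde_def h_def[symmetric] zi_def[symmetric]
  by (auto elim: AE_mp)
qed

end

lemma square_diff_le:
 fixes a b :: real
 shows "sq (a - b) \<le> 2 * sq a + 2 * sq b"
proof -
 have "(a - b)\<^sup>2 \<le> 2 * a\<^sup>2 + 2 * b\<^sup>2" using zero_le_power2[of "a + b"] by (simp add: power2_eq_square algebra_simps)
 hence "sq (a - b) \<le> ennreal (2 * a\<^sup>2 + 2 * b\<^sup>2)" by (rule ennreal_leI)
 thus ?thesis by (simp add: ennreal_plus ennreal_mult)
qed

lemma nn_integral_square_diff_le:
 fixes f g :: "'a => real"
 assumes [measurable]: "f \<in> borel_measurable M" "g \<in> borel_measurable M"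
 shows "(\<integral>\<^sup>+x. sq (f x - g x) \<partial>M) \<le> 2 * (\<integral>\<^sup>+x. sq (f x) \<partial>M) + 2 * (\<integral>\<^sup>+x. sq (g x) \<partial>M)"
proof -
 have "(\<integral>\<^sup>+x. sq (f x - g x) \<partial>M) \<le> (\<integral>\<^sup>+x. 2 * sq (f x) + 2 * sq (g x) \<partial>M)"
  by (intro nn_integral_mono square_diff_le)
 thus ?thesis by (simp add: nn_integral_add nn_integral_cmult)
qed

context markov_jump_process
begin

lemma in_M_diff:
 assumes t: "0 \<le> t" "t \<le> T" "x \<in> space K"
  and YZ: "inM t x Y Z" "inM t x Y' Z'"
 shows "inM t x (\<lambda>s w. Y s w - Y' s w) (\<lambda>s w y. Z s w y - Z' s w y)"
proof -
 let ?M = "PR t x" and ?n = "\<lambda>p. nX p"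
 have Y: "(\<lambda>(w, s). Y s w - Y' s w) \<in> borel_measurable (GA t)"
  using borel_measurable_diff[OF in_MD(1)[OF YZ(1)] in_MD(1)[OF YZ(2)]] by (simp add: case_prod_beta')
 have Z: "(\<lambda>((w, s), y). Z s w y - Z' s w y) \<in> borel_measurable (PA t \<Otimes>\<^sub>M K)"
  using borel_measurable_diff[OF in_MD(2)[OF YZ(1)] in_MD(2)[OF YZ(2)]] by (simp add: case_prod_beta')
 note m = in_M_product[OF t YZ(1) YZ(1)] and m' = in_M_product[OF t YZ(2) YZ(2)]
 have "(\<integral>\<^sup>+p. (\<integral>\<^sup>+u. sq (Z (snd p) (fst p) u - Z' (snd p) (fst p) u) \<partial>?n p) \<partial>?M) \<le>
   (\<integral>\<^sup>+p. 2 * (\<integral>\<^sup>+u. sq (Z (snd p) (fst p) u) \<partial>?n p) + 2 * (\<integral>\<^sup>+u. sq (Z' (snd p) (fst p) u) \<partial>?n p) \<partial>?M)"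
 proof (intro nn_integral_mono nn_integral_square_diff_le)
  fix p assume p: "p \<in> space ?M"
  note d = product_domain[OF t(1,3) p]
  have s: "sets (?n p) = sets K" using d by (intro sets_rate) auto
  show "Z (snd p) (fst p) \<in> borel_measurable (?n p)" "Z' (snd p) (fst p) \<in> borel_measurable (?n p)"
   by (rule section_measurable[OF m(2) p s], rule section_measurable[OF m'(2) p s])
 qed
 also have "\<dots> = 2 * (\<integral>\<^sup>+p. (\<integral>\<^sup>+u. sq (Z (snd p) (fst p) u) \<partial>?n p) \<partial>?M) +
   2 * (\<integral>\<^sup>+p. (\<integral>\<^sup>+u. sq (Z' (snd p) (fst p) u) \<partial>?n p) \<partial>?M)"
  using m(4) m'(4) by (simp add: nn_integral_add nn_integral_cmult)
 also have "\<dots> < \<infinity>" using in_MD(3)[OF YZ(1)] in_MD(3)[OF YZ(2)] unfolding m(3) m'(3) by (auto simp: ennreal_mult_less_top)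
 finally have "M_norm t x (\<lambda>s w. Y s w - Y' s w) (\<lambda>s w y. Z s w y - Z' s w y) < \<infinity>"
  using nn_integral_square_diff_le[OF m(1) m'(1)] in_MD(3)[OF YZ(1)] in_MD(3)[OF YZ(2)]
  unfolding M_product(3)[OF t Y Z] m(3) m'(3) by (auto simp: ennreal_mult_less_top intro: le_less_trans)
 thus ?thesis using Y Z by (simp add: in_M_def)
qed

text \<open>Zero energy means that z vanishes almost everywhere for the rates along the path. The
  compensator identity for the absolute value of z transfers this to the jump measure, hence to
  every jump of almost every path.\<close>

lemma vanishing_integrand:
 assumes t: "0 \<le> t" "t \<le> T" "x \<in> space K"
  and z: "(\<lambda>((w, s), y). z s w y) \<in> borel_measurable (PA t \<Otimes>\<^sub>M K)"
  and z0: "(\<integral>\<^sup>+p. (\<integral>\<^sup>+u. sq (z (snd p) (fst p) u) \<partial>nX p) \<partial>PR t x) = 0"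
 shows "AE p in PR t x. (\<integral>u. z (snd p) (fst p) u \<partial>nX p) = 0"
  and "AE w in P t x. \<forall>j\<in>jumps w t T. z j w (X j w) = 0"
proof -
 let ?M = "PR t x" and ?n = "\<lambda>p. nX p"
 interpret RI: finite_measure "RS t" by (rule finite_measure_RS[OF t(2)])
 have ym: "(\<lambda>(w, s). 0 :: real) \<in> borel_measurable (GA t)" by simp
 note m = M_product[OF t ym z]
 have "AE p in ?M. (\<integral>\<^sup>+u. sq (z (snd p) (fst p) u) \<partial>?n p) = 0"
  using z0 m(4) by (subst (asm) nn_integral_0_iff_AE) auto
 hence ae: "AE p in ?M. AE u in ?n p. z (snd p) (fst p) u = 0"
 proof (rule AE_mp[OF _ AE_I2], intro impI)
  fix p assume p: "p \<in> space ?M" and 0: "(\<integral>\<^sup>+u. sq (z (snd p) (fst p) u) \<partial>?n p) = 0"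
  have [measurable]: "z (snd p) (fst p) \<in> borel_measurable (?n p)"
   using section_measurable[OF m(2) p sets_rate] product_domain[OF t(1,3) p] by auto
  show "AE u in ?n p. z (snd p) (fst p) u = 0" using 0 by (subst (asm) nn_integral_0_iff_AE) auto
 qed
 thus "AE p in ?M. (\<integral>u. z (snd p) (fst p) u \<partial>?n p) = 0"
  by eventually_elim (rule integral_eq_zero_AE)
 define H where "H = (\<lambda>((w, s), y). ennreal \<bar>z s w y\<bar>)"
 have Hm: "H \<in> borel_measurable (PA t \<Otimes>\<^sub>M K)"
  using z unfolding H_def by (simp add: case_prod_beta')
 have Hm': "(\<lambda>(w, r). \<integral>\<^sup>+y. H ((w, r), y) \<partial>\<nu> r (X r w)) \<in> borel_measurable ?M"
  by (rule product_rate_nn_integral[OF t Hm])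
 have "(\<integral>\<^sup>+p. (\<integral>\<^sup>+y. H (p, y) \<partial>?n p) \<partial>?M) = (\<integral>\<^sup>+p. 0 \<partial>?M)"
 proof (rule nn_integral_cong_AE, use ae in eventually_elim)
  fix p assume "AE u in ?n p. z (snd p) (fst p) u = 0"
  hence "(\<integral>\<^sup>+y. H (p, y) \<partial>?n p) = (\<integral>\<^sup>+y. 0 \<partial>?n p)"
   by (intro nn_integral_cong_AE) (auto simp: H_def case_prod_beta')
  thus "(\<integral>\<^sup>+y. H (p, y) \<partial>?n p) = 0" by simp
 qed
 hence "(\<integral>\<^sup>+w. (\<Sum>j\<in>jumps w t T. H ((w, j), X j w)) \<partial>P t x) = 0"
  using compensator[OF t Hm] RI.nn_integral_fst[OF Hm'] by (simp add: case_prod_beta')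
 hence "AE w in P t x. (\<Sum>j\<in>jumps w t T. H ((w, j), X j w)) = 0"
  using compensator[OF t Hm] by (subst (asm) nn_integral_0_iff_AE) auto
 moreover have "AE w in P t x. w \<in> \<Omega>" using t by (intro AE_I2) simp
 ultimately show "AE w in P t x. \<forall>j\<in>jumps w t T. z j w (X j w) = 0"
 proof eventually_elim
  case (elim w)
  hence "\<forall>j\<in>jumps w t T. H ((w, j), X j w) = 0"
   by (subst (asm) sum_eq_0_iff[OF finite_jumps]) auto
  thus ?case by (simp add: H_def)
 qed
qed

end

context lipschitz_driver
begin

text \<open>The difference of two solutions solves a linear backward equation with terminal value 0
  and no free term, whose driver is bounded through \<open>max L L'\<close>; the energy estimate
  makes its norm vanish. Equality at all times simultaneously is more than vanishing norm and is
  read off from the equation itself.\<close>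

theorem bsde_unique:
 assumes t: "0 \<le> t" "t \<le> T" "x \<in> space K"
  and f0: "(\<integral>\<^sup>+w. (\<integral>\<^sup>+s\<in>{t<..T}. ennreal (\<bar>f s (X s w) 0 (\<lambda>_. 0)\<bar>\<^sup>2) \<partial>lborel) \<partial>P t x) < \<infinity>"
  and sol: "bsde g t x Y Z" "bsde g t x Y' Z'"
 shows "M_norm t x (\<lambda>s w. Y s w - Y' s w) (\<lambda>s w y. Z s w y - Z' s w y) = 0"
  and "AE w in P t x. \<forall>s\<in>{t..T}. Y s w = Y' s w"
proof -
 let ?M = "PR t x" and ?n = "\<lambda>p. nX p"
 have M: "inM t x Y Z" "inM t x Y' Z'" using sol by (auto simp: bsde_solution_def)
 note D = in_M_diff[OF t M]
 note DP = in_M_product[OF t D D] and m = in_M_product[OF t M(1) M(1)] and m' = in_M_product[OF t M(2) M(2)]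
 define h where "h r w = cut_driver r (X r w) (Y r w) (Z r w)" for r w
 define h' where "h' r w = cut_driver r (X r w) (Y' r w) (Z' r w)" for r w
 define d where "d s w = Y s w - Y' s w" for s w
 define e where "e s w y = Z s w y - Z' s w y" for s w y
 define E where "E r w = h r w - h' r w + (\<integral>u. e r w u \<partial>\<nu> r (X r w))" for r w
 note hp = driver_process[OF t M(1) f0, folded h_def] and hp' = driver_process[OF t M(2) f0, folded h'_def]
 have lin: "linear_bsde t x Y Z h (\<lambda>w. g (X T w))" "linear_bsde t x Y' Z' h' (\<lambda>w. g (X T w))"
  using bsde_iff_linear[OF t M(1) f0, of g] bsde_iff_linear[OF t M(2) f0, of g] sol unfolding h_def h'_def by auto
 have fin: "AE p in ?M. (\<integral>\<^sup>+u. sq (Z (snd p) (fst p) u) \<partial>?n p) < \<infinity> \<and>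
   (\<integral>\<^sup>+u. sq (Z' (snd p) (fst p) u) \<partial>?n p) < \<infinity>" using hp(2) hp'(2) by auto
 have split: "AE p in ?M. (\<integral>u. e (snd p) (fst p) u \<partial>?n p) =
   (\<integral>u. Z (snd p) (fst p) u \<partial>?n p) - (\<integral>u. Z' (snd p) (fst p) u \<partial>?n p)"
  using fin
 proof (rule AE_mp, intro AE_I2 impI)
  fix p assume p: "p \<in> space ?M" and f: "(\<integral>\<^sup>+u. sq (Z (snd p) (fst p) u) \<partial>?n p) < \<infinity> \<and>
   (\<integral>\<^sup>+u. sq (Z' (snd p) (fst p) u) \<partial>?n p) < \<infinity>"
  note dm = product_domain[OF t(1,3) p]
  interpret finite_measure "?n p" by (rule finite_rate[OF dm(3,4)])
  have "sets (?n p) = sets K" using dm by (intro sets_rate) auto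
  hence [measurable]: "Z (snd p) (fst p) \<in> borel_measurable (?n p)" "Z' (snd p) (fst p) \<in> borel_measurable (?n p)"
   using section_measurable[OF m(2) p] section_measurable[OF m'(2) p] by auto
  have "integrable (?n p) (Z (snd p) (fst p))" "integrable (?n p) (Z' (snd p) (fst p))"
   by (rule square_integrable_imp_integrable[OF _ integrableI_nonneg]; use f in simp)+
  thus "(\<integral>u. e (snd p) (fst p) u \<partial>?n p) = (\<integral>u. Z (snd p) (fst p) u \<partial>?n p) - (\<integral>u. Z' (snd p) (fst p) u \<partial>?n p)"
   unfolding e_def by (rule Bochner_Integration.integral_diff)
 qed
 have eq: "AE w in P t x. set_integrable lborel {t<..T} (\<lambda>r. E r w) \<and>
   (\<forall>s\<in>{t..T}. d s w = ioc (\<lambda>r. E r w) s T - (\<Sum>j\<in>jumps w s T. e j w (X j w)))"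
  using lin[unfolded linear_bsde_def] in_M_integral[OF t D] hp(3) hp'(3) AE_product_fst[OF t split]
 proof eventually_elim
  case (elim w)
  define A where "A r = h r w + (\<integral>u. Z r w u \<partial>\<nu> r (X r w))" for r
  define A' where "A' r = h' r w + (\<integral>u. Z' r w u \<partial>\<nu> r (X r w))" for r
  have iE: "set_integrable lborel {t<..T} (\<lambda>r. E r w)" using elim(3-5) unfolding E_def e_def by (intro set_integral_add set_integral_diff)
  have iA: "set_integrable lborel {t<..T} A" "set_integrable lborel {t<..T} A'" using elim(1,2) unfolding A_def A'_def by auto
  have "ioc (\<lambda>r. E r w) s T = ioc A s T - ioc A' s T" if s: "s \<in> {t..T}" for s
  proof -
   have i: "set_integrable lborel {s<..T} A" "set_integrable lborel {s<..T} A'" "set_integrable lborel {s<..T} (\<lambda>r. E r w)"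
    using s by (auto intro: set_integrable_ioc_subset[OF iA(1)] set_integrable_ioc_subset[OF iA(2)] set_integrable_ioc_subset[OF iE])
   have "ioc (\<lambda>r. E r w) s T = ioc (\<lambda>r. A r - A' r) s T"
    unfolding set_lebesgue_integral_def
   proof (rule integral_cong_AE)
    from elim(6) show "AE r in lborel. indicator {s<..T} r *\<^sub>R E r w = indicator {s<..T} r *\<^sub>R (A r - A' r)"
     by eventually_elim (use s in \<open>auto simp: E_def A_def A'_def indicator_def\<close>)
   qed (use i(3) set_integral_diff(1)[OF i(1,2)] in \<open>auto simp: set_integrable_def\<close>)
   thus ?thesis using set_integral_diff(2)[OF i(1,2)] by simp
  qed
  thus ?case using elim(1,2) iE
   unfolding A_def[symmetric] A'_def[symmetric] d_def e_def by (simp add: sum_subtractf)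
 qed
 have hb: "AE p in ?M. \<bar>h (snd p) (fst p) - h' (snd p) (fst p)\<bar> \<le> max L L' * \<bar>d (snd p) (fst p)\<bar> +
   max L L' * sqrt (enn2real (\<integral>\<^sup>+u. sq (e (snd p) (fst p) u) \<partial>?n p)) + \<bar>0\<bar>"
  using fin
 proof (rule AE_mp, intro AE_I2 impI)
  fix p assume p: "p \<in> space ?M" and f: "(\<integral>\<^sup>+u. sq (Z (snd p) (fst p) u) \<partial>?n p) < \<infinity> \<and>
   (\<integral>\<^sup>+u. sq (Z' (snd p) (fst p) u) \<partial>?n p) < \<infinity>"
  note dm = product_domain[OF t(1,3) p]
  have "\<bar>h (snd p) (fst p) - h' (snd p) (fst p)\<bar> \<le> L' * \<bar>d (snd p) (fst p)\<bar> +
    L * sqrt (enn2real (\<integral>\<^sup>+u. sq (e (snd p) (fst p) u) \<partial>?n p))"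
   unfolding h_def h'_def d_def e_def
   by (rule cut_driver_lipschitz[OF dm(3,4) section_measurable[OF m(2) p refl] section_measurable[OF m'(2) p refl]])
    (use f in auto)
  also have "\<dots> \<le> max L L' * \<bar>d (snd p) (fst p)\<bar> +
    max L L' * sqrt (enn2real (\<integral>\<^sup>+u. sq (e (snd p) (fst p) u) \<partial>?n p))"
   by (intro add_mono mult_right_mono) auto
  finally show "\<bar>h (snd p) (fst p) - h' (snd p) (fst p)\<bar> \<le> max L L' * \<bar>d (snd p) (fst p)\<bar> +
    max L L' * sqrt (enn2real (\<integral>\<^sup>+u. sq (e (snd p) (fst p) u) \<partial>?n p)) + \<bar>0\<bar>" by simp
 qed
 note dp = D[folded d_def e_def]
 have C: "0 \<le> max L L'" using L_nonneg by simp
 have ys: "d s \<in> borel_measurable (FA {t..s})" if "s \<in> {t..T}" for s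
  using progressive_section[OF that in_MD(1)[OF dp]] by simp
 have hm: "(\<lambda>p. h (snd p) (fst p) - h' (snd p) (fst p)) \<in> borel_measurable ?M"
  using hp(1) hp'(1) unfolding h_def h'_def by simp
 note dpp = in_M_product[OF t dp dp]
 have fin': "(\<integral>\<^sup>+p. sq (d (snd p) (fst p)) \<partial>?M) < \<infinity>"
  "(\<integral>\<^sup>+p. (\<integral>\<^sup>+u. sq (e (snd p) (fst p) u) \<partial>?n p) \<partial>?M) < \<infinity>"
  using in_MD(3)[OF dp] unfolding dpp(3) by auto
 have eq': "AE w in P t x. set_integrable lborel {t<..T} (\<lambda>r. h r w - h' r w + (\<integral>u. e r w u \<partial>\<nu> r (X r w))) \<and>
   (\<forall>s\<in>{t..T}. d s w = 0 + ioc (\<lambda>r. h r w - h' r w + (\<integral>u. e r w u \<partial>\<nu> r (X r w))) s T -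
    (\<Sum>j\<in>jumps w s T. e j w (X j w)))"
  using eq by (simp add: E_def)
 have z: "(\<integral>\<^sup>+p. sq (d (snd p) (fst p)) \<partial>?M) = 0"
  "(\<integral>\<^sup>+p. (\<integral>\<^sup>+u. sq (e (snd p) (fst p) u) \<partial>?n p) \<partial>?M) = 0"
  using energy_estimate(2,3)[where y=d and z=e and h="\<lambda>r w. h r w - h' r w" and \<kappa>="\<lambda>_ _. 0" and \<xi>="\<lambda>_. 0",
   OF t C ys dpp(1) in_MD(2)[OF dp] hm borel_measurable_const borel_measurable_const fin' _ _ hb eq']
  by simp_all
 thus "M_norm t x (\<lambda>s w. Y s w - Y' s w) (\<lambda>s w y. Z s w y - Z' s w y) = 0"
  using dpp(3) by (simp add: d_def e_def)
 note v = vanishing_integrand[OF t in_MD(2)[OF dp] z(2)]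
 \<comment> \<open>With d and e of norm 0, the bound on the driver and
   \<open>vanishing_integrand\<close> make the integrand E vanish almost everywhere. As the jump
   terms vanish too, the equation leaves d = 0 at every time.\<close>
 have "AE p in ?M. d (snd p) (fst p) = 0 \<and> (\<integral>\<^sup>+u. sq (e (snd p) (fst p) u) \<partial>?n p) = 0"
  using z dpp(1,4) by (subst (asm) (1 2) nn_integral_0_iff_AE) auto
 hence "AE p in ?M. E (snd p) (fst p) = 0" using hb v(1) by eventually_elim (simp add: E_def)
 from eq v(2) AE_product_fst[OF t this]
 show "AE w in P t x. \<forall>s\<in>{t..T}. Y s w = Y' s w"
 proof eventually_elim
  case (elim w)
  show ?case
  proof
   fix s assume s: "s \<in> {t..T}"
   have "ioc (\<lambda>r. E r w) s T = 0"
    unfolding set_lebesgue_integral_def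
    by (rule integral_eq_zero_AE, use elim(3) in eventually_elim) (use s in \<open>auto simp: indicator_def\<close>)
   moreover have "(\<Sum>j\<in>jumps w s T. e j w (X j w)) = 0"
    using elim(2) s by (intro sum.neutral) auto
   ultimately show "Y s w = Y' s w" using bspec[OF conjunct2[OF elim(1)] s] by (simp add: d_def)
  qed
 qed
qed

end

section \<open>The Kolmogorov equation along trajectories\<close>

text \<open>Cauchy-Schwarz against the constant 1; a non-integrable h has integral 0 by
  default.\<close>

lemma integral_square_le:
 fixes h :: "'a => real"
 assumes [measurable]: "h \<in> borel_measurable M"
 shows "sq (\<integral>x. h x \<partial>M) \<le> (\<integral>\<^sup>+x. sq (h x) \<partial>M) * emeasure M (space M)"
proof (cases "integrable M h")
 case True
 have "sq (\<integral>x. h x \<partial>M) = (ennreal \<bar>\<integral>x. h x \<partial>M\<bar>)\<^sup>2" by (simp add: ennreal_power)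
 also have "\<dots> \<le> (\<integral>\<^sup>+x. ennreal \<bar>h x\<bar> * 1 \<partial>M)\<^sup>2"
  using integral_norm_bound_ennreal[OF True] by (intro power_mono) auto
 also have "\<dots> \<le> (\<integral>\<^sup>+x. (ennreal \<bar>h x\<bar>)\<^sup>2 \<partial>M) * (\<integral>\<^sup>+x. 1\<^sup>2 \<partial>M)"
  by (rule Cauchy_Schwarz_nn_integral) auto
 also have "\<dots> = (\<integral>\<^sup>+x. sq (h x) \<partial>M) * emeasure M (space M)" by (simp add: ennreal_power)
 finally show ?thesis .
qed (simp add: not_integrable_integral_eq)

context markov_jump_process
begin

abbreviation "TK \<equiv> restrict_space borel {0..T} \<Otimes>\<^sub>M K"
abbreviation TKm :: "(real \<Rightarrow> 'k \<Rightarrow> 'b :: topological_space) \<Rightarrow> bool" where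
 "TKm u \<equiv> (\<lambda>(s, y). u s y) \<in> borel_measurable TK"

abbreviation occ :: "real => 'k => (real => 'k => ennreal) => ennreal" where
 "occ t x h \<equiv> (\<integral>\<^sup>+w. (\<integral>\<^sup>+s\<in>{t<..T}. h s (X s w) \<partial>lborel) \<partial>P t x)"

definition jump_energy :: "(real => 'k => real) => real => 'k => ennreal" where
 "jump_energy v s x = (\<integral>\<^sup>+y. sq (v s y - v s x) \<partial>\<nu> s x)"

lemma measurable_increment:
 assumes v: "TKm v"
 shows "(\<lambda>(w, y). v (fst w) y - v (fst w) (snd w) :: real) \<in> borel_measurable (TK \<Otimes>\<^sub>M K)"
proof -
 have "(\<lambda>(w, y). (fst w, y)) \<in> TK \<Otimes>\<^sub>M K \<rightarrow>\<^sub>M TK" by measurable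
 from measurable_compose[OF this v] measurable_compose[OF measurable_fst v, of K]
 show ?thesis by (simp add: case_prod_beta')
qed

lemma jump_energy_measurable:
 assumes v: "TKm v"
 shows "(\<lambda>(s, x). jump_energy v s x) \<in> borel_measurable TK"
 using kernel_nn_measurable[OF measurable_fst measurable_snd, of "\<lambda>w y. sq (v (fst w) y - v (fst w) (snd w))"]
  measurable_increment[OF v] by (simp add: jump_energy_def case_prod_beta')

lemma generator_measurable:
 assumes v: "TKm v"
 shows "(\<lambda>(s, x). generator \<nu> s (v s) x) \<in> borel_measurable TK"
 using kernel_integral_measurable[OF measurable_fst measurable_snd measurable_increment[OF v]]
 by (simp add: generator_def case_prod_beta')

lemma TK_section:
 assumes "(\<lambda>(s, x). h s x) \<in> TK \<rightarrow>\<^sub>M N"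
 shows "x \<in> space K ==> (\<lambda>s. h s x) \<in> restrict_space borel {0..T} \<rightarrow>\<^sub>M N"
  and "s \<in> {0..T} ==> h s \<in> K \<rightarrow>\<^sub>M N"
 using measurable_compose[OF measurable_Pair2' assms, of x] measurable_compose[OF measurable_Pair1' assms, of s]
 by (simp_all add: space_restrict_space)

lemma TK_interval:
 assumes "(\<lambda>(s, x). h s x) \<in> TK \<rightarrow>\<^sub>M N" "x \<in> space K" "0 \<le> t"
 shows "(\<lambda>s. h s x) \<in> RS t \<rightarrow>\<^sub>M N"
proof -
 have "(\<lambda>s. h s x) \<in> restrict_space borel {t<..T} \<rightarrow>\<^sub>M N"
  by (rule measurable_restrict_mono[OF TK_section(1)[OF assms(1,2)]]) (use assms in auto)
 thus ?thesis by (simp cong: measurable_cong_sets sets_restrict_space_cong)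
qed

lemma TK_process:
 assumes h: "(\<lambda>(s, x). h s x) \<in> TK \<rightarrow>\<^sub>M N" and t: "0 \<le> t" "t \<le> T" "x \<in> space K"
 shows "(\<lambda>p. h (snd p) (X (snd p) (fst p))) \<in> PR t x \<rightarrow>\<^sub>M N"
 using measurable_compose[OF measurable_Pair[OF product_time[OF t] product_X[OF t]] h] by (simp add: case_prod_beta')

lemma occ_product:
 assumes h: "TKm h" and t: "0 \<le> t" "t \<le> T" "x \<in> space K"
 shows "occ t x h = (\<integral>\<^sup>+p. h (snd p) (X (snd p) (fst p)) \<partial>PR t x)"
 by (rule product_nn_integral[OF t TK_process[OF h t]])

lemma occ_add_cmult:
 assumes m: "TKm h" "TKm q"
  and t: "0 \<le> t" "t \<le> T" "x \<in> space K"
 shows "occ t x (\<lambda>s x. h s x + q s x) = occ t x h + occ t x q" and "occ t x (\<lambda>s x. c * h s x) = c * occ t x h"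
proof -
 have "(\<lambda>(s, x). h s x + q s x) \<in> borel_measurable TK" "(\<lambda>(s, x). c * h s x) \<in> borel_measurable TK"
  using m by (simp_all add: case_prod_beta')
 from this[THEN occ_product[OF _ t]] show "occ t x (\<lambda>s x. h s x + q s x) = occ t x h + occ t x q"
   "occ t x (\<lambda>s x. c * h s x) = c * occ t x h"
  using m[THEN TK_process[OF _ t]] m[THEN occ_product[OF _ t]] by (simp_all add: nn_integral_add nn_integral_cmult)
qed

lemma occ_mono:
 assumes "\<And>s y. s \<in> {0..T} ==> y \<in> space K ==> h s y \<le> q s y" "0 \<le> t" "x \<in> space K"
 shows "occ t x h \<le> occ t x q"
 using assms state by (intro nn_integral_mono) (auto simp: indicator_def intro!: nn_integral_mono)

lemma sojourn_cover_TK: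
 assumes t: "0 \<le> t" "t \<le> T" "x \<in> space K"
 obtains ts where "set ts \<subseteq> {t..T}" "\<And>h. TKm h ==>
   (\<integral>\<^sup>+s. h s x \<partial>RS t) \<le> (\<Sum>a\<leftarrow>ts. 2 * occ a x h)"
proof -
 obtain ts where ts: "set ts \<subseteq> {t..T}" "\<And>h :: real => 'k => ennreal. (\<lambda>s. h s x * indicator {0<..T} s) \<in> borel_measurable borel ==>
   (\<integral>\<^sup>+s\<in>{t<..T}. h s x \<partial>lborel) \<le> (\<Sum>a\<leftarrow>ts. 2 * occ a x h)"
  using sojourn_cover[OF t] by blast
 have "(\<integral>\<^sup>+s. h s x \<partial>RS t) \<le> (\<Sum>a\<leftarrow>ts. 2 * occ a x h)" if "TKm h" for h
  using ts(2)[of h] TK_interval[OF that t(3) order_refl]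
  by (simp add: RS_nn_integral borel_measurable_restrict_space_iff_ennreal)
 with ts(1) that show thesis by blast
qed

text \<open>\<open>X_minus\<close> makes the increments predictable. Integrated in time they have
  the same energy as the increments from X s, because the two states differ at finitely many times
  of each path.\<close>

lemma kolmogorov_pair:
 fixes v :: "real => 'k => real"
 assumes t: "0 \<le> t" "t \<le> T" "x \<in> space K" and v: "TKm v"
 shows "(\<lambda>(w, s). v s (X s w)) \<in> borel_measurable (GA t)"
  and "(\<lambda>((w, s), y). v s y - v s (X_minus t s w)) \<in> borel_measurable (PA t \<Otimes>\<^sub>M K)"
  and "M_norm t x (\<lambda>s w. v s (X s w)) (\<lambda>s w y. v s y - v s (X_minus t s w)) =
   occ t x (\<lambda>s y. sq (v s y)) + occ t x (jump_energy v)"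
  and "(\<integral>\<^sup>+p. (\<integral>\<^sup>+u. sq (v (snd p) u - v (snd p) (X_minus t (snd p) (fst p))) \<partial>nX p)
   \<partial>PR t x) = occ t x (jump_energy v)"
proof -
 show Y: "(\<lambda>(w, s). v s (X s w)) \<in> borel_measurable (GA t)"
  using measurable_compose[OF measurable_Pair[OF time_progressive X_progressive] v] t by (simp add: case_prod_beta')
 have m1: "(\<lambda>v'. (snd (fst v'), snd v')) \<in> PA t \<Otimes>\<^sub>M K \<rightarrow>\<^sub>M TK"
  by (intro measurable_Pair measurable_compose[OF measurable_fst time_predictable[OF t(1,2)]] measurable_snd)
 have m2: "(\<lambda>v'. (snd (fst v'), (\<lambda>(w, s). X_minus t s w) (fst v'))) \<in> PA t \<Otimes>\<^sub>M K \<rightarrow>\<^sub>M TK"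
  by (intro measurable_Pair measurable_compose[OF measurable_fst time_predictable[OF t(1,2)]]
    measurable_compose[OF measurable_fst X_minus_predictable[OF t(1,2)]])
 show Z: "(\<lambda>((w, s), y). v s y - v s (X_minus t s w)) \<in> borel_measurable (PA t \<Otimes>\<^sub>M K)"
  using borel_measurable_diff[OF measurable_compose[OF m1 v] measurable_compose[OF m2 v]] by (simp add: case_prod_beta')
 have "(\<integral>\<^sup>+w. (\<integral>\<^sup>+s\<in>{t<..T}. (\<integral>\<^sup>+y. sq (v s y - v s (X_minus t s w)) \<partial>\<nu> s (X s w)) \<partial>lborel) \<partial>P t x) =
   occ t x (jump_energy v)"
 proof (rule nn_integral_cong, rule nn_integral_cong_AE)
  fix w assume "w \<in> space (P t x)"
  hence w: "w \<in> \<Omega>" using t by simp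
  have "AE s in lborel. s \<notin> jumps w t T"
   by (rule AE_not_in[OF finite_imp_null_set_lborel[OF finite_jumps[OF w]]])
  thus "AE s in lborel. (\<integral>\<^sup>+y. sq (v s y - v s (X_minus t s w)) \<partial>\<nu> s (X s w)) * indicator {t<..T} s =
    jump_energy v s (X s w) * indicator {t<..T} s"
   by eventually_elim (auto simp: jump_energy_def X_minus_eq[OF w t(1)] indicator_def)
 qed
 with M_product(4)[OF t Y Z]
 show E: "(\<integral>\<^sup>+p. (\<integral>\<^sup>+u. sq (v (snd p) u - v (snd p) (X_minus t (snd p) (fst p))) \<partial>nX p)
   \<partial>PR t x) = occ t x (jump_energy v)"
  using product_nn_integral[OF t M_product(4)[OF t Y Z]] by simp
 have "(\<lambda>(s, y). sq (v s y)) \<in> borel_measurable TK" using v by (simp add: case_prod_beta')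
 from occ_product[OF this t]
 show "M_norm t x (\<lambda>s w. v s (X s w)) (\<lambda>s w y. v s y - v s (X_minus t s w)) =
   occ t x (\<lambda>s y. sq (v s y)) + occ t x (jump_energy v)"
  unfolding M_product(3)[OF t Y Z] E by simp
qed

text \<open>The energy estimate for y s = u s (X s). At the starting time the state is x almost
  surely, so the bound on the mean square becomes a bound on the single value \<open>u t x\<close>;
  this is what yields convergence at every point.\<close>

lemma kolmogorov_energy:
 fixes u h \<kappa> :: "real => 'k => real"
 assumes t: "0 \<le> t" "t \<le> T" "x \<in> space K" and C: "0 \<le> C"
  and um: "TKm u" and hm: "TKm h"
  and km: "TKm \<kappa>" and gm: "g \<in> borel_measurable K"
  and D: "\<And>t x. t \<in> {0..T} ==> x \<in> space K ==> set_integrable lborel {t<..T} (\<lambda>s. h s x + generator \<nu> s (u s) x)"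
  and u: "\<And>t x. t \<in> {0..T} ==> x \<in> space K ==> u t x = g x + ioc (\<lambda>s. h s x + generator \<nu> s (u s) x) t T"
  and hb: "\<And>s x. s \<in> {0..T} ==> x \<in> space K ==> jump_energy u s x < \<infinity> ==>
   \<bar>h s x\<bar> \<le> C * \<bar>u s x\<bar> + C * sqrt (enn2real (jump_energy u s x)) + \<bar>\<kappa> s x\<bar>"
  and fin: "occ t x (\<lambda>s y. sq (u s y)) < \<infinity>" "occ t x (jump_energy u) < \<infinity>"
   "occ t x (\<lambda>s y. sq (\<kappa> s y)) < \<infinity>" "(\<integral>\<^sup>+w. sq (g (X T w)) \<partial>P t x) < \<infinity>"
 defines "B \<equiv> ennreal (energy_const C t) *
  ((\<integral>\<^sup>+w. sq (g (X T w)) \<partial>P t x) + occ t x (\<lambda>s y. sq (\<kappa> s y)))"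
 shows "sq (u t x) \<le> B" and "occ t x (\<lambda>s y. sq (u s y)) \<le> B" and "occ t x (jump_energy u) \<le> B"
proof -
 let ?M = "PR t x" and ?n = "\<lambda>p. nX p"
 interpret prob_space "P t x" by (rule prob[OF t(1,3)])
 interpret RI: finite_measure "RS t" by (rule finite_measure_RS[OF t(2)])
 interpret pair_sigma_finite "P t x" "RS t" ..
 define y where "y s w = u s (X s w)" for s w
 define z where "z s w v = u s v - u s (X_minus t s w)" for s w v
 have sq: "occ t x (\<lambda>s y. sq (\<phi> s y)) = (\<integral>\<^sup>+p. sq (\<phi> (snd p) (X (snd p) (fst p))) \<partial>?M)"
  if "TKm \<phi>" for \<phi> :: "real => 'k => real"
  using that by (intro occ_product[OF _ t]) (simp add: case_prod_beta')
 note pair = kolmogorov_pair[OF t um, folded y_def z_def]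
 note Mp = M_product[OF t pair(1,2)]
 have zE: "(\<integral>\<^sup>+p. (\<integral>\<^sup>+v. sq (z (snd p) (fst p) v) \<partial>?n p) \<partial>?M) = occ t x (jump_energy u)"
  using pair(4) by (simp add: z_def)
 have ys: "y s \<in> borel_measurable (FA {t..s})" if "s \<in> {t..T}" for s
  using progressive_section[OF that pair(1)] by simp
 have hm': "(\<lambda>p. h (snd p) (X (snd p) (fst p))) \<in> borel_measurable ?M"
  and km': "(\<lambda>p. \<kappa> (snd p) (X (snd p) (fst p))) \<in> borel_measurable ?M"
  by (rule TK_process[OF hm t], rule TK_process[OF km t])
 have xm: "(\<lambda>w. g (X T w)) \<in> borel_measurable (P t x)"
  by (rule measurable_compose[OF _ gm]) (use t measurable_X[of T "{t..}"] in \<open>simp add: measurable_P\<close>)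
 define q where "q p = (\<integral>\<^sup>+v. sq (z (snd p) (fst p) v) \<partial>?n p)" for p
 have qm[measurable]: "q \<in> borel_measurable ?M" using Mp(4) by (simp add: q_def[abs_def])
 have "AE p in ?M. q (fst p, snd p) \<noteq> \<infinity>" using fin(2) zE Mp(4) by (intro nn_integral_PInf_AE) (auto simp: q_def)
 from AE_product_fst[OF t this] have qf: "AE w in P t x. AE r in lborel. r \<in> {t<..T} \<longrightarrow> q (w, r) \<noteq> \<infinity>"
  by simp
 have hb': "AE p in ?M. \<bar>h (snd p) (X (snd p) (fst p))\<bar> \<le> C * \<bar>y (snd p) (fst p)\<bar> + C * sqrt (enn2real (q p)) + \<bar>\<kappa> (snd p) (X (snd p) (fst p))\<bar>"
 proof (rule AE_pair_measure)
  show "{p \<in> space ?M. \<bar>h (snd p) (X (snd p) (fst p))\<bar> \<le> C * \<bar>y (snd p) (fst p)\<bar> + C * sqrt (enn2real (q p)) + \<bar>\<kappa> (snd p) (X (snd p) (fst p))\<bar>} \<in> sets ?M"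
   using hm' km' Mp(1) by measurable
  have "AE w in P t x. w \<in> \<Omega>" using t by (intro AE_I2) simp
  with qf show "AE w in P t x. AE r in RS t. \<bar>h (snd (w, r)) (X (snd (w, r)) (fst (w, r)))\<bar> \<le>
    C * \<bar>y (snd (w, r)) (fst (w, r))\<bar> + C * sqrt (enn2real (q (w, r))) + \<bar>\<kappa> (snd (w, r)) (X (snd (w, r)) (fst (w, r)))\<bar>"
  proof eventually_elim
   case (elim w)
   have "AE r in lborel. r \<notin> jumps w t T"
    by (rule AE_not_in[OF finite_imp_null_set_lborel[OF finite_jumps[OF elim(2)]]])
   with elim(1) have "AE r in lborel. r \<in> {t<..T} \<longrightarrow> \<bar>h r (X r w)\<bar> \<le>
     C * \<bar>y r w\<bar> + C * sqrt (enn2real (q (w, r))) + \<bar>\<kappa> r (X r w)\<bar>"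
   proof eventually_elim
    case (elim r)
    show ?case
    proof
     assume r: "r \<in> {t<..T}"
     have "X_minus t r w = X r w" using r elim by (intro X_minus_eq \<open>w \<in> \<Omega>\<close> t(1)) auto
     hence "q (w, r) = jump_energy u r (X r w)" by (simp add: q_def z_def jump_energy_def)
     thus "\<bar>h r (X r w)\<bar> \<le> C * \<bar>y r w\<bar> + C * sqrt (enn2real (q (w, r))) + \<bar>\<kappa> r (X r w)\<bar>"
      using hb[of r "X r w"] state[of r w] r t elim(1) \<open>w \<in> \<Omega>\<close> by (simp add: y_def less_top)
    qed
   qed
   thus ?case by (simp add: AE_restrict_space_iff)
  qed
 qed
 note lin = kolmogorov_linear_bsde[OF D u t refl, folded y_def z_def, unfolded linear_bsde_def]
 note ee = energy_estimate[where y=y and z=z and h="\<lambda>s w. h s (X s w)" and \<kappa>="\<lambda>s w. \<kappa> s (X s w)" and \<xi>="\<lambda>w. g (X T w)",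
   OF t C ys Mp(1) pair(2) hm' km' xm fin(1)[unfolded sq[OF um], folded y_def] fin(2)[folded zE]
    fin(3)[unfolded sq[OF km]] fin(4) hb'[unfolded q_def] lin, folded sq[OF km] B_def]
 have "AE w in P t x. sq (y t w) = sq (u t x)"
  using start_AE[OF t(1,3)] by eventually_elim (simp add: y_def)
 from nn_integral_cong_AE[OF this] show "sq (u t x) \<le> B"
  using ee(1) by (simp add: emeasure_space_1 B_def)
 show "occ t x (\<lambda>s y. sq (u s y)) \<le> B" using ee(2) unfolding sq[OF um] y_def B_def by simp
 show "occ t x (jump_energy u) \<le> B" using ee(3) unfolding zE B_def by simp
qed

lemma square_set_integrable:
 fixes h :: "real => 'k => real"
 assumes h: "TKm h" and t: "0 \<le> t" "t \<le> T" "x \<in> space K"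
 shows "(\<integral>\<^sup>+s. sq (h s x) \<partial>RS t) < \<infinity> ==> set_integrable lborel {t<..T} (\<lambda>s. h s x)"
  and "sq (ioc (\<lambda>s. h s x) t T) \<le> (\<integral>\<^sup>+s. sq (h s x) \<partial>RS t) * ennreal (T - t)"
proof -
 interpret finite_measure "RS t" by (rule finite_measure_RS[OF t(2)])
 note m[measurable] = TK_interval[OF h t(3,1)]
 show "set_integrable lborel {t<..T} (\<lambda>s. h s x)" if "(\<integral>\<^sup>+s. sq (h s x) \<partial>RS t) < \<infinity>"
 proof -
  have "integrable (RS t) (\<lambda>s. h s x)"
   by (rule square_integrable_imp_integrable[OF m integrableI_nonneg]) (use that in auto)
  thus ?thesis by (simp add: integrable_restrict_space set_integrable_def)
 qed
 have "ioc (\<lambda>s. h s x) t T = (\<integral>s. h s x \<partial>RS t)"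
  by (simp add: integral_restrict_space set_lebesgue_integral_def)
 moreover have "emeasure (RS t) (space (RS t)) = ennreal (T - t)"
  using t by (simp add: emeasure_restrict_space)
 ultimately show "sq (ioc (\<lambda>s. h s x) t T) \<le> (\<integral>\<^sup>+s. sq (h s x) \<partial>RS t) * ennreal (T - t)"
  using integral_square_le[OF m] by simp
qed

lemma generator_square:
 assumes v: "TKm v" and sx: "s \<in> {0..T}" "x \<in> space K"
 shows "sq (generator \<nu> s (v s) x) \<le> ennreal rate_bound * jump_energy v s x"
proof -
 have "(\<lambda>y. v s y - v s x) \<in> borel_measurable (\<nu> s x)"
  using TK_section(2)[OF v sx(1)] sx by (simp add: measurable_rate_iff)
 from integral_square_le[OF this]
 have "sq (generator \<nu> s (v s) x) \<le> jump_energy v s x * emeasure (\<nu> s x) (space (\<nu> s x))"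
  by (simp add: generator_def jump_energy_def)
 also have "\<dots> \<le> jump_energy v s x * ennreal rate_bound"
  using rate_le[OF sx] space_rate[of s x] sx by (intro mult_left_mono) auto
 finally show ?thesis by (simp add: mult.commute)
qed

text \<open>Measurability and the integrability conditions in the notion of a solution, separated
  from the equation itself.\<close>

definition finite_energy :: "(real => 'k => real) => bool" where
 "finite_energy v \<longleftrightarrow> TKm v \<and> (\<forall>t\<in>{0..T}. \<forall>x\<in>space K.
  occ t x (\<lambda>s y. sq (v s y)) < \<infinity> \<and> occ t x (jump_energy v) < \<infinity>)"

end

context lipschitz_driver
begin

definition drift :: "(real => 'k => real) => real => 'k => real" where
 "drift v s x = cut_driver s x (v s x) (\<lambda>y. v s y - v s x)"

abbreviation free_term :: "real => 'k => real" where
 "free_term s x \<equiv> f s x 0 (\<lambda>_. 0)"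

lemma free_term_measurable: "TKm free_term"
proof -
 have "(\<lambda>w. cut_driver (fst w) (snd w) 0 (\<lambda>_. 0)) \<in> borel_measurable TK"
  by (rule cut_driver_measurable[OF measurable_fst measurable_snd]) simp_all
 thus ?thesis by (simp add: cut_driver_def case_prod_beta')
qed

lemma drift_measurable:
 assumes v: "TKm v"
 shows "(\<lambda>(s, x). drift v s x) \<in> borel_measurable TK"
proof -
 have "(\<lambda>w. cut_driver (fst w) (snd w) (v (fst w) (snd w)) (\<lambda>y. v (fst w) y - v (fst w) (snd w))) \<in> borel_measurable TK"
  by (rule cut_driver_measurable[OF measurable_fst measurable_snd _ measurable_increment[OF v]])
   (use v in \<open>simp add: case_prod_beta'\<close>)
 thus ?thesis by (simp add: drift_def case_prod_beta')
qed

lemma drift_square: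
 assumes v: "TKm v" and sx: "s \<in> {0..T}" "x \<in> space K"
 shows "sq (drift v s x) \<le> ennreal (3 * (1 + L'\<^sup>2 + L\<^sup>2)) *
  (sq (free_term s x) + sq (v s x) + jump_energy v s x)"
 unfolding drift_def jump_energy_def
 by (rule cut_driver_square[OF sx]) (use TK_section(2)[OF v sx(1)] in simp)

end

locale square_integrable_driver = lipschitz_driver T K \<nu> \<Omega> X P f L L'
 for T :: real and K :: "'k measure" and \<nu> :: "real => 'k => 'k measure"
  and \<Omega> :: "'w set" and X :: "real => 'w => 'k" and P :: "real => 'k => 'w measure"
  and f :: "real => 'k => real => ('k => real) => real" and L L' :: real +
 assumes driver_square: "\<And>t x. t \<in> {0..T} ==> x \<in> space K ==>
   (\<integral>\<^sup>+ w. (\<integral>\<^sup>+ s \<in> {t<..T}. ennreal (\<bar>f s (X s w) 0 (\<lambda>_. 0)\<bar>\<^sup>2) \<partial>lborel) \<partial>P t x) < \<infinity>"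
begin

text \<open>The squares of drift and generator are dominated by constant multiples of \<phi>, whose
  mean along paths is finite from every starting time. The list of starting times from the sojourn
  estimate turns this into finiteness of the time integral at the fixed state x.\<close>

lemma finite_energy_integrable:
 assumes v: "finite_energy v" and t: "0 \<le> t" "t \<le> T" "x \<in> space K"
 shows "set_integrable lborel {t<..T} (\<lambda>s. drift v s x)"
  and "set_integrable lborel {t<..T} (\<lambda>s. generator \<nu> s (v s) x)"
  and "AE s in lborel. s \<in> {t<..T} \<longrightarrow> jump_energy v s x < \<infinity>"
proof -
 have vm: "TKm v" using v by (simp add: finite_energy_def)
 define \<phi> where "\<phi> s y = sq (free_term s y) + sq (v s y) + jump_energy v s y" for s y
 have m: "(\<lambda>(s, y). sq (free_term s y)) \<in> borel_measurable TK"
  "(\<lambda>(s, y). sq (v s y)) \<in> borel_measurable TK"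
  "(\<lambda>(s, y). jump_energy v s y) \<in> borel_measurable TK"
  using free_term_measurable vm jump_energy_measurable[OF vm] by (simp_all add: case_prod_beta')
 have m2: "(\<lambda>(s, y). sq (free_term s y) + sq (v s y)) \<in> borel_measurable TK"
  using m(1,2) by (simp add: case_prod_beta')
 have \<phi>m: "TKm \<phi>" using m by (simp add: \<phi>_def case_prod_beta')
 have occ: "occ a x \<phi> < \<infinity>" if a: "a \<in> {t..T}" for a
 proof -
  have a': "0 \<le> a" "a \<le> T" "a \<in> {0..T}" using a t by auto
  show ?thesis
   using occ_add_cmult(1)[OF m2 m(3) a'(1,2) t(3)] occ_add_cmult(1)[OF m(1,2) a'(1,2) t(3)]
    driver_square[OF a'(3) t(3)] v a' t unfolding \<phi>_def[abs_def] by (simp add: finite_energy_def)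
 qed
 obtain ts where ts: "set ts \<subseteq> {t..T}" "(\<integral>\<^sup>+s. \<phi> s x \<partial>RS t) \<le> (\<Sum>a\<leftarrow>ts. 2 * occ a x \<phi>)"
  by (rule sojourn_cover_TK[OF t], rule that) (use \<phi>m in blast)+
 have "(\<Sum>a\<leftarrow>ts. 2 * occ a x \<phi>) < \<infinity>"
  using ts(1) occ by (induction ts) (auto simp: ennreal_mult_less_top)
 hence fin: "(\<integral>\<^sup>+s. \<phi> s x \<partial>RS t) < \<infinity>" using ts(2) by simp
 note \<phi>x[measurable] = TK_interval[OF \<phi>m t(3,1)]
 have dom: "s \<in> {0..T}" if "s \<in> space (RS t)" for s using that t by auto
 have le: "(\<integral>\<^sup>+s. h s \<partial>RS t) < \<infinity>" if "\<And>s. s \<in> {0..T} ==> h s \<le> ennreal c * \<phi> s x" for h c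
 proof -
  have "(\<integral>\<^sup>+s. h s \<partial>RS t) \<le> (\<integral>\<^sup>+s. ennreal c * \<phi> s x \<partial>RS t)" by (intro nn_integral_mono that dom)
  also have "\<dots> < \<infinity>" using fin by (simp add: nn_integral_cmult ennreal_mult_less_top)
  finally show ?thesis .
 qed
 show "set_integrable lborel {t<..T} (\<lambda>s. drift v s x)"
  by (rule square_set_integrable(1)[OF drift_measurable[OF vm] t le[OF drift_square[OF vm _ t(3), folded \<phi>_def]]])
 show "set_integrable lborel {t<..T} (\<lambda>s. generator \<nu> s (v s) x)"
 proof (rule square_set_integrable(1)[OF generator_measurable[OF vm] t le])
  fix s assume "s \<in> {0..T}"
  from generator_square[OF vm this t(3)]
  show "sq (generator \<nu> s (v s) x) \<le> ennreal rate_bound * \<phi> s x"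
   by (rule order_trans) (auto simp: \<phi>_def intro!: mult_left_mono)
 qed
 have "AE s in RS t. \<phi> s x \<noteq> \<infinity>" by (rule nn_integral_PInf_AE) (use fin in auto)
 thus "AE s in lborel. s \<in> {t<..T} \<longrightarrow> jump_energy v s x < \<infinity>"
  by (auto simp: AE_restrict_space_iff \<phi>_def less_top elim!: eventually_mono)
qed

text \<open>Finite energy makes the increments square integrable at x for almost every time, so the
  two integrals over \<open>lebesgue\<close> combine into one Borel integral with the cut-off
  driver.\<close>

lemma kolmogorov_solution_iff:
 "kolmogorov g v \<longleftrightarrow> finite_energy v \<and> (\<forall>t\<in>{0..T}. \<forall>x\<in>space K.
  v t x = g x + ioc (\<lambda>s. drift v s x + generator \<nu> s (v s) x) t T)"
proof -
 have eq: "g x + (LINT s : {t<..T} | lebesgue. generator \<nu> s (v s) x) +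
   (LINT s : {t<..T} | lebesgue. f s x (v s x) (\<lambda>y. v s y - v s x)) =
   g x + ioc (\<lambda>s. drift v s x + generator \<nu> s (v s) x) t T"
  if v: "finite_energy v" and t: "t \<in> {0..T}" "x \<in> space K" for t x
 proof -
  have t': "0 \<le> t" "t \<le> T" using t by auto
  note fi = finite_energy_integrable[OF v t' t(2)]
  have "(LINT s : {t<..T} | lebesgue. generator \<nu> s (v s) x) = ioc (\<lambda>s. generator \<nu> s (v s) x) t T"
   by (rule lebesgue_ioc_eq) (use fi(2) in \<open>auto simp: set_integrable_def set_borel_measurable_def\<close>)
  moreover have "(LINT s : {t<..T} | lebesgue. f s x (v s x) (\<lambda>y. v s y - v s x)) = ioc (\<lambda>s. drift v s x) t T"
  proof (rule lebesgue_ioc_eq)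
   show "AE s in lborel. s \<in> {t<..T} \<longrightarrow> f s x (v s x) (\<lambda>y. v s y - v s x) = drift v s x"
    using fi(3) by eventually_elim (simp add: drift_def cut_driver_def jump_energy_def)
  qed (use fi(1) in \<open>auto simp: set_integrable_def set_borel_measurable_def\<close>)
  ultimately show ?thesis using set_integral_add(2)[OF fi(1,2)] by simp
 qed
 have "kolmogorov g v \<longleftrightarrow> finite_energy v \<and> (\<forall>t\<in>{0..T}. \<forall>x\<in>space K.
  v t x = g x + (LINT s : {t<..T} | lebesgue. generator \<nu> s (v s) x) +
   (LINT s : {t<..T} | lebesgue. f s x (v s x) (\<lambda>y. v s y - v s x)))"
  unfolding kolmogorov_solution_def finite_energy_def jump_energy_def power2_abs by blast
 thus ?thesis by (simp only: eq cong: conj_cong ball_cong)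
qed

text \<open>The Kolmogorov equation followed along the path is the linear backward equation, whose
  driver differs from the drift at the current state at jumps only.\<close>

lemma kolmogorov_bsde:
 assumes v: "kolmogorov g v" and t: "0 \<le> t" "t \<le> T" "x \<in> space K"
 shows "bsde g t x (\<lambda>s w. v s (X s w)) (\<lambda>s w y. v s y - v s (X_minus t s w))"
proof -
 from v have fe: "finite_energy v" and eq: "\<And>t x. t \<in> {0..T} ==> x \<in> space K ==>
   v t x = g x + ioc (\<lambda>s. drift v s x + generator \<nu> s (v s) x) t T"
  by (auto simp: kolmogorov_solution_iff)
 have vm: "TKm v" using fe by (simp add: finite_energy_def)
 have M: "inM t x (\<lambda>s w. v s (X s w)) (\<lambda>s w y. v s y - v s (X_minus t s w))"
  using kolmogorov_pair[OF t vm] fe t by (simp add: in_M_def finite_energy_def)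
 have f0: "(\<integral>\<^sup>+ w. (\<integral>\<^sup>+ s \<in> {t<..T}. ennreal (\<bar>f s (X s w) 0 (\<lambda>_. 0)\<bar>\<^sup>2) \<partial>lborel) \<partial>P t x) < \<infinity>"
  using driver_square t by simp
 have int: "set_integrable lborel {t<..T} (\<lambda>s. drift v s x + generator \<nu> s (v s) x)"
  if "t \<in> {0..T}" "x \<in> space K" for t x
  using finite_energy_integrable(1,2)[OF fe _ _ that(2), of t] that by (intro set_integral_add) auto
 have "linear_bsde t x (\<lambda>s w. v s (X s w)) (\<lambda>s w y. v s y - v s (X_minus t s w))
   (\<lambda>r w. cut_driver r (X r w) (v r (X r w)) (\<lambda>y. v r y - v r (X_minus t r w))) (\<lambda>w. g (X T w))"
  by (rule kolmogorov_linear_bsde[where h="drift v", OF int eq t]) (auto simp: drift_def X_minus_eq t)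
 thus ?thesis using bsde_iff_linear[OF t M f0] by blast
qed

text \<open>Any solution of the BSDE is compared, by uniqueness, with the one built from v. The
  vanishing norm is formed with X s and \<open>X_minus\<close>; passing to left limits changes the
  integrand at finitely many times of each path.\<close>

theorem kolmogorov_representation:
 assumes v: "kolmogorov g v" and t: "0 \<le> t" "t \<le> T" "x \<in> space K"
  and sol: "bsde g t x Y Z"
 shows "AE w in P t x. \<forall>s\<in>{t..T}. Y s w = v s (X s w)" and "AE w in P t x. Y t w = v t x"
  and "(\<integral>\<^sup>+ w. (\<integral>\<^sup>+ s \<in> {t<..T}. (\<integral>\<^sup>+ y. ennreal (\<bar>Z s w y - v s y + v s (left_value X s w)\<bar>\<^sup>2)
      \<partial>\<nu> s (left_value X s w)) \<partial>lborel) \<partial>P t x) = 0"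
proof -
 have f0: "(\<integral>\<^sup>+ w. (\<integral>\<^sup>+ s \<in> {t<..T}. ennreal (\<bar>f s (X s w) 0 (\<lambda>_. 0)\<bar>\<^sup>2) \<partial>lborel) \<partial>P t x) < \<infinity>"
  using driver_square t by simp
 note un = bsde_unique[OF t f0 sol kolmogorov_bsde[OF v t]]
 show "AE w in P t x. \<forall>s\<in>{t..T}. Y s w = v s (X s w)" by (rule un(2))
 thus "AE w in P t x. Y t w = v t x" using start_AE[OF t(1,3)] by eventually_elim (use t in auto)
 have "(\<integral>\<^sup>+ w. (\<integral>\<^sup>+ s \<in> {t<..T}. (\<integral>\<^sup>+ y. ennreal (\<bar>Z s w y - v s y + v s (left_value X s w)\<bar>\<^sup>2)
      \<partial>\<nu> s (left_value X s w)) \<partial>lborel) \<partial>P t x) =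
  (\<integral>\<^sup>+ w. (\<integral>\<^sup>+ s \<in> {t<..T}. (\<integral>\<^sup>+ y. ennreal (\<bar>Z s w y - (v s y - v s (X_minus t s w))\<bar>\<^sup>2)
      \<partial>\<nu> s (X s w)) \<partial>lborel) \<partial>P t x)"
 proof (rule nn_integral_cong, rule nn_integral_cong_AE)
  fix w assume "w \<in> space (P t x)"
  hence w: "w \<in> \<Omega>" using t by simp
  have "AE s in lborel. s \<notin> jumps w t T"
   by (rule AE_not_in[OF finite_imp_null_set_lborel[OF finite_jumps[OF w]]])
  thus "AE s in lborel. (\<integral>\<^sup>+ y. ennreal (\<bar>Z s w y - v s y + v s (left_value X s w)\<bar>\<^sup>2)
      \<partial>\<nu> s (left_value X s w)) * indicator {t<..T} s =
    (\<integral>\<^sup>+ y. ennreal (\<bar>Z s w y - (v s y - v s (X_minus t s w))\<bar>\<^sup>2) \<partial>\<nu> s (X s w)) * indicator {t<..T} s"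
  proof eventually_elim
   case (elim s)
   show ?case
   proof (cases "s \<in> {t<..T}")
    case True
    hence s: "0 < s" "t < s" "s \<notin> jump_set X w" using t elim by auto
    show ?thesis using left_value_eq_self[OF w s(1,3)] X_minus_eq[OF w t(1) s(2,3)] by (simp add: diff_add_eq diff_diff_eq2)
   qed simp
  qed
 qed
 thus "(\<integral>\<^sup>+ w. (\<integral>\<^sup>+ s \<in> {t<..T}. (\<integral>\<^sup>+ y. ennreal (\<bar>Z s w y - v s y + v s (left_value X s w)\<bar>\<^sup>2)
      \<partial>\<nu> s (left_value X s w)) \<partial>lborel) \<partial>P t x) = 0"
  using un(1) by (simp add: M_norm_sq_def)
qed

text \<open>The BSDE solution built from v' is represented by v. At time t, where the state is x,
  this is an almost sure equality between two numbers, hence an equality.\<close>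

lemma kolmogorov_unique:
 assumes v: "kolmogorov g v" "kolmogorov g v'"
  and t: "0 \<le> t" "t \<le> T" "x \<in> space K"
 shows "v' t x = v t x"
proof -
 interpret prob_space "P t x" by (rule prob[OF t(1,3)])
 have "AE w in P t x. v' t x = v t x"
  using kolmogorov_representation(2)[OF v(1) t kolmogorov_bsde[OF v(2) t]] start_AE[OF t(1,3)] by eventually_elim auto
 thus ?thesis by simp
qed

end

section \<open>Existence for bounded data\<close>

lemma cauchy_limit:
 fixes a :: "nat => real"
 assumes a: "\<And>n m. n \<le> m ==> \<bar>a m - a n\<bar> \<le> e n" and e: "e \<longlonglongrightarrow> 0"
 shows "a \<longlonglongrightarrow> lim a" and "\<bar>lim a - a n\<bar> \<le> e n"
proof -
 have "Cauchy a"
  unfolding Cauchy_altdef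
 proof (intro allI impI)
  fix \<epsilon> :: real assume "0 < \<epsilon>"
  with e obtain N where "e N < \<epsilon>" using order_tendstoD(2)[OF e, of \<epsilon>] by (auto simp: eventually_sequentially)
  thus "\<exists>M. \<forall>m\<ge>M. \<forall>n>m. dist (a m) (a n) < \<epsilon>"
   using order_tendstoD(2)[OF e \<open>0 < \<epsilon>\<close>] a
   unfolding eventually_sequentially dist_real_def by (metis abs_minus_commute le_less_trans less_imp_le)
 qed
 thus lim: "a \<longlonglongrightarrow> lim a" by (simp add: Cauchy_convergent_iff convergent_LIMSEQ_iff)
 have "(\<lambda>m. \<bar>a m - a n\<bar>) \<longlonglongrightarrow> \<bar>lim a - a n\<bar>" by (intro tendsto_intros lim)
 thus "\<bar>lim a - a n\<bar> \<le> e n" by (rule LIMSEQ_le_const2) (use a in blast)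
qed

lemma ioc_bound:
 fixes h e :: "real => real"
 assumes "set_integrable lborel {a<..b} h" "set_integrable lborel {a<..b} e" "\<And>s. s \<in> {a<..b} ==> \<bar>h s\<bar> \<le> e s"
 shows "\<bar>ioc h a b\<bar> \<le> ioc e a b"
 using assms unfolding set_lebesgue_integral_def set_integrable_def
 by (intro integral_abs_bound[THEN order_trans] integral_mono) (auto simp: indicator_def intro: integrable_abs)

context markov_jump_process
begin

lemma bounded_square:
 assumes sx: "s \<in> {0..T}" "x \<in> space K" and c: "\<And>y. y \<in> space K ==> \<bar>h y\<bar> \<le> c"
 shows "(\<integral>\<^sup>+y. sq (h y) \<partial>\<nu> s x) \<le> ennreal (c\<^sup>2 * rate_bound)"
proof -
 have sp: "space (\<nu> s x) = space K" using space_rate sx by simp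
 have "(\<integral>\<^sup>+y. sq (h y) \<partial>\<nu> s x) \<le> (\<integral>\<^sup>+y. sq c \<partial>\<nu> s x)"
  using c by (intro nn_integral_mono ennreal_leI) (auto simp: sp abs_le_square_iff[symmetric] intro: order_trans[OF _ abs_ge_self])
 also have "\<dots> \<le> sq c * ennreal rate_bound" using rate_le[OF sx] by (simp add: sp mult_left_mono)
 finally show ?thesis using rate_bound_pos by (simp add: ennreal_mult)
qed

lemma occ_bounded:
 assumes "\<And>s y. s \<in> {0..T} ==> y \<in> space K ==> h s y \<le> ennreal c" "0 \<le> t" "t \<le> T" "x \<in> space K"
 shows "occ t x h < \<infinity>"
proof -
 have "occ t x h \<le> occ t x (\<lambda>_ _. ennreal c)" using assms by (intro occ_mono) auto
 also have "\<dots> < \<infinity>"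
  using prob_space.emeasure_space_1[OF prob] assms by (simp add: nn_integral_cmult ennreal_mult_less_top)
 finally show ?thesis .
qed

lemma bounded_finite_energy:
 assumes v: "TKm v" and B: "\<And>s x. s \<in> {0..T} ==> x \<in> space K ==> \<bar>v s x\<bar> \<le> B"
 shows "finite_energy v" and "s \<in> {0..T} ==> x \<in> space K ==> jump_energy v s x < \<infinity>"
proof -
 have je: "jump_energy v s x \<le> ennreal ((2 * B)\<^sup>2 * rate_bound)" if "s \<in> {0..T}" "x \<in> space K" for s x
  unfolding jump_energy_def
 proof (rule bounded_square[OF that])
  fix y assume "y \<in> space K"
  thus "\<bar>v s y - v s x\<bar> \<le> 2 * B" using B[OF that(1), of y] B[OF that] by linarith
 qed
 have sq: "sq (v s x) \<le> sq B" if "s \<in> {0..T}" "x \<in> space K" for s x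
  using B[OF that] by (intro ennreal_leI) (simp add: abs_le_square_iff[symmetric])
 show "finite_energy v" using v occ_bounded[OF je] occ_bounded[OF sq] by (auto simp: finite_energy_def)
 show "s \<in> {0..T} ==> x \<in> space K ==> jump_energy v s x < \<infinity>"
  by (rule le_less_trans[OF je]) auto
qed

lemma generator_diff:
 assumes v: "TKm v" and w: "TKm w"
  and sx: "s \<in> {0..T}" "x \<in> space K" and fin: "jump_energy v s x < \<infinity>" "jump_energy w s x < \<infinity>"
 shows "generator \<nu> s (\<lambda>y. v s y - w s y) x = generator \<nu> s (v s) x - generator \<nu> s (w s) x"
proof -
 interpret finite_measure "\<nu> s x" by (rule finite_rate[OF sx])
 have m: "v s \<in> borel_measurable (\<nu> s x)" "w s \<in> borel_measurable (\<nu> s x)"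
  using TK_section(2)[OF v sx(1)] TK_section(2)[OF w sx(1)] sx by (simp_all add: measurable_rate_iff)
 have "integrable (\<nu> s x) (\<lambda>y. v s y - v s x)" "integrable (\<nu> s x) (\<lambda>y. w s y - w s x)"
  by (rule square_integrable_imp_integrable[OF _ integrableI_nonneg]; use m fin in \<open>simp add: jump_energy_def\<close>)+
 from Bochner_Integration.integral_diff[OF this] show ?thesis by (simp add: generator_def algebra_simps)
qed

text \<open>The moving end point is put into the integrand, so that the integral is over one fixed
  finite measure.\<close>

lemma ioc_measurable:
 fixes h :: "real => 'k => real"
 assumes h: "TKm h"
 shows "(\<lambda>(t, x). ioc (\<lambda>s. h s x) t T) \<in> borel_measurable TK"
proof -
 interpret finite_measure "RS 0" by (rule finite_measure_RS) (use T_pos in simp)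
 have s: "snd \<in> TK \<Otimes>\<^sub>M RS 0 \<rightarrow>\<^sub>M restrict_space borel {0..T}"
  by (rule measurable_compose[OF measurable_snd], rule measurable_restrict_space2)
   (auto simp: measurable_restrict_space1)
 have m: "(\<lambda>p. h (snd p) (snd (fst p))) \<in> borel_measurable (TK \<Otimes>\<^sub>M RS 0)"
  using measurable_compose[OF measurable_Pair[OF s measurable_compose[OF measurable_fst measurable_snd]] h]
  by (simp add: case_prod_beta')
 have b: "fst \<in> borel_measurable TK" "(\<lambda>p. fst (fst p)) \<in> borel_measurable (TK \<Otimes>\<^sub>M RS 0)" "snd \<in> borel_measurable (TK \<Otimes>\<^sub>M RS 0)"
  using measurable_compose[OF measurable_fst measurable_restrict_space1[OF measurable_ident]]
   measurable_compose[OF measurable_compose[OF measurable_fst measurable_fst] measurable_restrict_space1[OF measurable_ident]]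
   measurable_compose[OF s measurable_restrict_space1[OF measurable_ident]] by (simp_all add: id_def)
 have "(\<lambda>(w, s). if fst w < s then h s (snd w) else 0) \<in> borel_measurable (TK \<Otimes>\<^sub>M RS 0)"
  unfolding case_prod_beta' using m b(2,3) by measurable
 from borel_measurable_lebesgue_integral[OF this]
 have I: "(\<lambda>w. \<integral>s. (if fst w < s then h s (snd w) else 0) \<partial>RS 0) \<in> borel_measurable TK" by simp
 have "(\<integral>s. (if t < s then h s x else 0) \<partial>RS 0) = ioc (\<lambda>s. h s x) t T" if "0 \<le> t" for t x
  using that unfolding set_lebesgue_integral_def
  by (subst integral_restrict_space) (auto simp: indicator_def intro!: Bochner_Integration.integral_cong)
 hence "(\<lambda>(t, x). ioc (\<lambda>s. h s x) t T) \<in> borel_measurable TK \<longleftrightarrow>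
   (\<lambda>w. \<integral>s. (if fst w < s then h s (snd w) else 0) \<partial>RS 0) \<in> borel_measurable TK"
  by (intro measurable_cong) (auto simp: space_pair_measure space_restrict_space)
 with I show ?thesis by blast
qed

end

context lipschitz_driver
begin

definition rhs :: "(real => 'k => real) => real => 'k => real" where
 "rhs v s x = drift v s x + generator \<nu> s (v s) x"

lemma rhs_measurable:
 "TKm v ==> (\<lambda>(s, x). rhs v s x) \<in> borel_measurable TK"
 using borel_measurable_add[OF drift_measurable generator_measurable] by (simp add: rhs_def case_prod_beta')

lemma drift_diff:
 assumes v: "TKm v" and w: "TKm w"
  and sx: "s \<in> {0..T}" "x \<in> space K" and fin: "jump_energy v s x < \<infinity>" "jump_energy w s x < \<infinity>"
 shows "\<bar>drift v s x - drift w s x\<bar> \<le> L' * \<bar>v s x - w s x\<bar> + L * sqrt (enn2real (jump_energy (\<lambda>s y. v s y - w s y) s x))"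
proof -
 have "v s \<in> borel_measurable K" "w s \<in> borel_measurable K"
  using TK_section(2)[OF v sx(1)] TK_section(2)[OF w sx(1)] by auto
 thus ?thesis
  using cut_driver_lipschitz[OF sx, of "\<lambda>y. v s y - v s x" "\<lambda>y. w s y - w s x" "v s x" "w s x"] fin
  by (simp add: drift_def jump_energy_def algebra_simps)
qed

text \<open>The three terms under the constant come from the two Lipschitz constants and from the
  generator, whose square costs a factor \<open>rate_bound\<close>; the factor 3 is from squaring a
  sum of three terms.\<close>

lemma rhs_diff:
 assumes v: "TKm v" and w: "TKm w"
  and sx: "s \<in> {0..T}" "x \<in> space K" and fin: "jump_energy v s x < \<infinity>" "jump_energy w s x < \<infinity>"
 shows "sq (rhs v s x - rhs w s x) \<le> ennreal (3 * (L'\<^sup>2 + L\<^sup>2 + rate_bound)) *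
  (sq (v s x - w s x) + jump_energy (\<lambda>s y. v s y - w s y) s x)"
proof -
 define u where "u s y = v s y - w s y" for s y
 have um: "TKm u"
  using borel_measurable_diff[OF v w] by (simp add: u_def case_prod_beta')
 have "jump_energy u s x \<le> 2 * jump_energy v s x + 2 * jump_energy w s x"
 proof -
  have "(\<lambda>y. v s y - v s x) \<in> borel_measurable (\<nu> s x)" "(\<lambda>y. w s y - w s x) \<in> borel_measurable (\<nu> s x)"
   using TK_section(2)[OF v sx(1)] TK_section(2)[OF w sx(1)] sx by (simp_all add: measurable_rate_iff)
  from nn_integral_square_diff_le[OF this] show ?thesis by (simp add: jump_energy_def u_def algebra_simps)
 qed
 also have "\<dots> < \<infinity>" using fin by (simp add: ennreal_mult_less_top)
 finally obtain q where q: "jump_energy u s x = ennreal q" "0 \<le> q" by (cases "jump_energy u s x") auto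
 define b where "b = u s x"
 have "sq (generator \<nu> s (u s) x) \<le> ennreal (rate_bound * q)"
  using generator_square[OF um sx] rate_bound_pos by (simp add: q ennreal_mult)
 hence g: "(generator \<nu> s (u s) x)\<^sup>2 \<le> rate_bound * q" using q rate_bound_pos by simp
 have d: "\<bar>drift v s x - drift w s x\<bar> \<le> L' * \<bar>b\<bar> + L * sqrt q"
  using drift_diff[OF assms] q unfolding b_def u_def[abs_def] by simp
 have "rhs v s x - rhs w s x = (drift v s x - drift w s x) + generator \<nu> s (u s) x"
  using generator_diff[OF assms] unfolding rhs_def u_def[abs_def] by simp
 hence "\<bar>rhs v s x - rhs w s x\<bar> \<le> L' * \<bar>b\<bar> + L * sqrt q + \<bar>generator \<nu> s (u s) x\<bar>"
  using d by linarith
 hence "(rhs v s x - rhs w s x)\<^sup>2 \<le> (L' * \<bar>b\<bar> + L * sqrt q + \<bar>generator \<nu> s (u s) x\<bar>)\<^sup>2"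
  using L_nonneg q by (simp add: abs_le_square_iff[symmetric])
 also have "\<dots> \<le> 3 * ((L' * \<bar>b\<bar>)\<^sup>2 + (L * sqrt q)\<^sup>2 + \<bar>generator \<nu> s (u s) x\<bar>\<^sup>2)"
  using sum_squares_ge_zero[of "L' * \<bar>b\<bar> - L * sqrt q" "L' * \<bar>b\<bar> - \<bar>generator \<nu> s (u s) x\<bar>"]
   zero_le_power2[of "L * sqrt q - \<bar>generator \<nu> s (u s) x\<bar>"]
  by (simp add: power2_eq_square algebra_simps)
 also have "\<dots> \<le> 3 * (L'\<^sup>2 * b\<^sup>2 + L\<^sup>2 * q + rate_bound * q)" using q g by (simp add: power_mult_distrib)
 also have "\<dots> \<le> 3 * (L'\<^sup>2 + L\<^sup>2 + rate_bound) * (b\<^sup>2 + q)"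
  using q rate_bound_pos by (simp add: algebra_simps mult_nonneg_nonneg)
 finally have "sq (rhs v s x - rhs w s x) \<le> ennreal (3 * (L'\<^sup>2 + L\<^sup>2 + rate_bound) * (b\<^sup>2 + q))"
  by (rule ennreal_leI)
 also have "\<dots> = ennreal (3 * (L'\<^sup>2 + L\<^sup>2 + rate_bound)) * (sq b + ennreal q)"
  using q rate_bound_pos by (subst ennreal_mult) (auto simp: ennreal_plus)
 finally show ?thesis using q(1) by (simp add: b_def u_def[abs_def])
qed

text \<open>Picard iteration. The increments are measured with the weight \<open>exp (\<beta> (T - t))\<close>, for which each step halves them.\<close>

lemma bounded_existence:
 assumes gm: "g \<in> borel_measurable K" and g: "\<And>x. x \<in> space K ==> \<bar>g x\<bar> \<le> G"
  and f0: "\<And>s x. s \<in> {0..T} ==> x \<in> space K ==> \<bar>free_term s x\<bar> \<le> G"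
 shows "\<exists>v B. TKm v \<and> (\<forall>s\<in>{0..T}. \<forall>x\<in>space K. \<bar>v s x\<bar> \<le> B) \<and>
  (\<forall>t\<in>{0..T}. \<forall>x\<in>space K. set_integrable lborel {t<..T} (\<lambda>s. rhs v s x) \<and>
   v t x = g x + ioc (\<lambda>s. rhs v s x) t T)"
proof -
 define good where "good v \<longleftrightarrow> TKm v \<and>
  (\<exists>B. \<forall>s\<in>{0..T}. \<forall>x\<in>space K. \<bar>v s x\<bar> \<le> B)" for v :: "real => 'k => real"
 have goodI: "good v" if "TKm v" "\<And>s x. s \<in> {0..T} ==> x \<in> space K ==> \<bar>v s x\<bar> \<le> B" for v B
  unfolding good_def using that by blast
 have goodD: "TKm v"
  "\<exists>B. \<forall>s x. s \<in> {0..T} \<longrightarrow> x \<in> space K \<longrightarrow> \<bar>v s x\<bar> \<le> B" if "good v" for v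
  using that unfolding good_def by blast+
 define \<Phi> where "\<Phi> v t x = g x + ioc (\<lambda>s. rhs v s x) t T" for v t x
 \<comment> \<open>If two functions differ by at most b everywhere, the increments of the difference
   are at most 2 b, so its jump energy is at most \<open>4 * rate_bound\<close> times b^2. With
   \<open>rhs_diff\<close> this makes C a Lipschitz constant of the right-hand side in the supremum
   norm.\<close>
 define C where "C = sqrt (3 * (L'\<^sup>2 + L\<^sup>2 + rate_bound) * (1 + 4 * rate_bound))"
 have C0: "0 \<le> C" using rate_bound_pos by (simp add: C_def)
 have lip: "\<bar>rhs v s x - rhs w s x\<bar> \<le> C * b"
  if v: "good v" and w: "good w" and sx: "s \<in> {0..T}" "x \<in> space K" and b: "\<And>y. y \<in> space K ==> \<bar>v s y - w s y\<bar> \<le> b"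
  for v w s x b
 proof -
  have b0: "0 \<le> b" using b[OF sx(2)] by simp
  note m = goodD(1)[OF v] goodD(1)[OF w]
  have fin: "jump_energy v s x < \<infinity>" "jump_energy w s x < \<infinity>"
   using goodD(2)[OF v] bounded_finite_energy(2)[OF m(1) _ sx] goodD(2)[OF w] bounded_finite_energy(2)[OF m(2) _ sx] by blast+
  have "jump_energy (\<lambda>s y. v s y - w s y) s x \<le> ennreal ((2 * b)\<^sup>2 * rate_bound)"
   unfolding jump_energy_def
  proof (rule bounded_square[OF sx])
   fix y assume "y \<in> space K"
   thus "\<bar>v s y - w s y - (v s x - w s x)\<bar> \<le> 2 * b" using b[of y] b[OF sx(2)] by linarith
  qed
  moreover have "sq (v s x - w s x) \<le> sq b"
   using b[OF sx(2)] by (intro ennreal_leI) (simp add: abs_le_square_iff[symmetric])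
  ultimately have "sq (rhs v s x - rhs w s x) \<le>
    ennreal (3 * (L'\<^sup>2 + L\<^sup>2 + rate_bound)) * (sq b + ennreal ((2 * b)\<^sup>2 * rate_bound))"
   by (intro order_trans[OF rhs_diff[OF m sx fin]] mult_left_mono add_mono) auto
  also have "\<dots> = sq (C * b)"
   using rate_bound_pos b0 by (simp add: C_def power_mult_distrib algebra_simps flip: ennreal_plus ennreal_mult)
  finally have "(rhs v s x - rhs w s x)\<^sup>2 \<le> (C * b)\<^sup>2" by simp
  thus ?thesis using C0 b0 by (simp add: abs_le_square_iff[symmetric])
 qed
 have good0: "good (\<lambda>_ _. 0)" by (auto simp: good_def)
 \<comment> \<open>At the zero function the right-hand side is the free term, bounded by G by
   assumption; the Lipschitz bound covers every other bounded function.\<close>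
 have rhs_bound: "\<exists>B. \<forall>s\<in>{0..T}. \<forall>x\<in>space K. \<bar>rhs v s x\<bar> \<le> B" if v: "good v" for v
 proof -
  from v obtain B where B: "\<And>s x. s \<in> {0..T} ==> x \<in> space K ==> \<bar>v s x\<bar> \<le> B" using goodD(2) by blast
  have "\<bar>rhs v s x\<bar> \<le> G + C * B" if sx: "s \<in> {0..T}" "x \<in> space K" for s x
   using lip[OF v good0 sx, of B] B[OF sx(1)] f0[OF sx]
   by (simp add: rhs_def drift_def generator_def cut_driver_def)
  thus ?thesis by blast
 qed
 have int: "set_integrable lborel {t<..T} (\<lambda>s. rhs v s x)"
  if v: "good v" and t: "t \<in> {0..T}" "x \<in> space K" for v t x
 proof -
  obtain B where "\<And>s x. s \<in> {0..T} ==> x \<in> space K ==> \<bar>rhs v s x\<bar> \<le> B" using rhs_bound[OF v] by blast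
  moreover have "(\<lambda>(s, x). rhs v s x) \<in> borel_measurable TK"
   using v by (intro rhs_measurable) (simp add: good_def)
  from TK_interval[OF this t(2)] t have "(\<lambda>s. rhs v s x) \<in> borel_measurable (RS t)" by simp
  ultimately have "integrable (RS t) (\<lambda>s. rhs v s x)"
   using t by (intro finite_measure.integrable_const_bound[OF finite_measure_RS, where B=B] AE_I2) auto
  thus ?thesis by (simp add: integrable_restrict_space set_integrable_def)
 qed
 have const: "set_integrable lborel {t<..T} (\<lambda>_. c)" for t c :: real
  unfolding set_integrable_def by (cases "t \<le> T") (auto intro!: integrable_scaleR_left integrable_real_indicator)
 have goodS: "good (\<Phi> v)" if v: "good v" for v
 proof -
  obtain B where B: "\<And>s x. s \<in> {0..T} ==> x \<in> space K ==> \<bar>rhs v s x\<bar> \<le> B" using rhs_bound[OF v] by blast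
  have "\<bar>\<Phi> v t x\<bar> \<le> G + \<bar>B\<bar> * T" if t: "t \<in> {0..T}" "x \<in> space K" for t x
  proof -
   have "\<bar>ioc (\<lambda>s. rhs v s x) t T\<bar> \<le> ioc (\<lambda>_. \<bar>B\<bar>) t T"
    using B t by (intro ioc_bound int v t const) (auto intro: order_trans[OF _ abs_ge_self])
   also have "\<dots> \<le> \<bar>B\<bar> * T" using t mult_left_mono[of "T - t" T "\<bar>B\<bar>"]
    by (simp add: set_lebesgue_integral_def mult.commute)
   finally show ?thesis using g[OF t(2)] by (simp add: \<Phi>_def)
  qed
  moreover have "(\<lambda>(t, x). \<Phi> v t x) \<in> borel_measurable TK"
   using ioc_measurable[OF rhs_measurable, of v] v measurable_compose[OF measurable_snd gm, of "restrict_space borel {0..T}"]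
   by (simp add: \<Phi>_def good_def case_prod_beta')
  ultimately show ?thesis by (intro goodI)
 qed
 define V where "V n = (\<Phi> ^^ n) (\<lambda>_ _. 0)" for n
 have V: "V (Suc n) = \<Phi> (V n)" for n by (simp add: V_def)
 have gV: "good (V n)" for n by (induction n) (simp add: V_def good0, simp add: V goodS)
 obtain A where A: "\<And>s x. s \<in> {0..T} ==> x \<in> space K ==> \<bar>V 1 s x\<bar> \<le> A" using goodD(2)[OF gV] by blast
 define A' where "A' = \<bar>A\<bar>"
 \<comment> \<open>Integrating the weight from t to T produces the factor
   \<open>C / \<beta>\<close>, which has to be at most 1 / 2; the added 1 keeps \<beta> positive
   when C = 0.\<close>
 define \<beta> where "\<beta> = 2 * C + 1"
 have \<beta>0: "0 < \<beta>" using C0 by (simp add: \<beta>_def)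
 hence \<beta>: "0 < \<beta>" "C / \<beta> \<le> 1 / 2" by (simp_all add: pos_divide_le_eq) (simp add: \<beta>_def)
 have step: "\<bar>V (Suc n) t x - V n t x\<bar> \<le> A' * (1 / 2) ^ n * exp (\<beta> * (T - t))" if t: "t \<in> {0..T}" "x \<in> space K" for n t x
  using t
 proof (induction n arbitrary: t x)
  case 0
  have "A' * 1 \<le> A' * exp (\<beta> * (T - t))" using 0 \<beta> by (intro mult_left_mono) (auto simp: A'_def)
  thus ?case using A[OF 0] by (simp add: V_def A'_def)
 next
  case (Suc n)
  let ?c = "C * (A' * (1 / 2) ^ n) * exp (\<beta> * T)"
  have ex: "exp (\<beta> * (T - s)) = exp (\<beta> * T) * exp (- \<beta> * s)" for s
   by (simp add: exp_add[symmetric] right_diff_distrib)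
  have e: "C * (A' * (1 / 2) ^ n * exp (\<beta> * (T - s))) = ?c * exp (- \<beta> * s)" for s
   by (simp only: ex mult.assoc)
  have alg: "c * q * w * ((a - b) / (- \<beta>)) = (c / \<beta>) * (q * (w * b - w * a))" for a b c q w :: real
   using \<beta> by (simp add: field_simps)
  have tT: "t \<le> T" "- \<beta> \<noteq> 0" using Suc.prems \<beta> by auto
  have d: "V (Suc (Suc n)) t x - V (Suc n) t x = ioc (\<lambda>s. rhs (V (Suc n)) s x - rhs (V n) s x) t T"
   using set_integral_diff(2)[OF int[OF gV Suc.prems] int[OF gV Suc.prems], of "Suc n" n] by (simp add: V \<Phi>_def)
  have "\<bar>V (Suc (Suc n)) t x - V (Suc n) t x\<bar> \<le> ioc (\<lambda>s. ?c * exp (- \<beta> * s)) t T"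
   unfolding d
  proof (rule ioc_bound)
   show "set_integrable lborel {t<..T} (\<lambda>s. rhs (V (Suc n)) s x - rhs (V n) s x)"
    by (intro set_integral_diff(1) int gV Suc.prems)
   show "set_integrable lborel {t<..T} (\<lambda>s. ?c * exp (- \<beta> * s))" using ioc_exp(1)[OF tT] by simp
   fix s assume s: "s \<in> {t<..T}"
   hence s0: "s \<in> {0..T}" using Suc.prems by auto
   show "\<bar>rhs (V (Suc n)) s x - rhs (V n) s x\<bar> \<le> ?c * exp (- \<beta> * s)"
    unfolding e[symmetric] by (rule lip[OF gV gV s0 Suc.prems(2) Suc.IH[OF s0]])
  qed
  also have "\<dots> = ?c * ((exp (- \<beta> * T) - exp (- \<beta> * t)) / (- \<beta>))" 
   by (simp only: set_integral_mult_right ioc_exp(2)[OF tT])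
  also have "\<dots> = (C / \<beta>) * (A' * (1 / 2) ^ n * (exp (\<beta> * (T - t)) - exp (\<beta> * (T - T))))"
   unfolding alg ex ..
  also have "\<dots> \<le> (1 / 2) * (A' * (1 / 2) ^ n * exp (\<beta> * (T - t)))"
   using \<beta> C0 Suc.prems by (intro mult_mono) (auto simp: A'_def)
  finally show ?case by simp
 qed
 \<comment> \<open>The geometric series of the increments sums to 2, and the weight is at most its
   value at t = 0.\<close>
 define E where "E = 2 * A' * exp (\<beta> * T)"
 have E0: "0 \<le> E" by (simp add: E_def A'_def)
 have diff: "\<bar>V m t x - V n t x\<bar> \<le> E * (1 / 2) ^ n" if t: "t \<in> {0..T}" "x \<in> space K" and nm: "n \<le> m" for n m t x
 proof -
  have st: "\<bar>V (Suc k) t x - V k t x\<bar> \<le> E * (1 / 2) ^ k / 2" for k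
  proof -
   have "A' * (1 / 2) ^ k * exp (\<beta> * (T - t)) \<le> A' * (1 / 2) ^ k * exp (\<beta> * T)"
    using t \<beta> by (intro mult_left_mono) (auto simp: A'_def)
   moreover have "A' * (1 / 2) ^ k * exp (\<beta> * T) = E * (1 / 2) ^ k / 2" by (simp add: E_def)
   ultimately show ?thesis using step[OF t, of k] by linarith
  qed
  have "\<bar>V m t x - V n t x\<bar> \<le> E * (1 / 2) ^ n - E * (1 / 2) ^ m" using nm
  proof (induction m rule: dec_induct)
   case (step k)
   have "E * (1 / 2) ^ Suc k = E * (1 / 2) ^ k / 2" by simp
   thus ?case using st[of k] step.IH by linarith
  qed simp
  also have "\<dots> \<le> E * (1 / 2) ^ n" using E0 by simp
  finally show ?thesis .
 qed
 have e0: "(\<lambda>n. E * (1 / 2 :: real) ^ n) \<longlonglongrightarrow> 0" by (intro tendsto_mult_right_zero LIMSEQ_power_zero) simp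
 define v where "v t x = lim (\<lambda>n. V n t x)" for t x
 have v: "(\<lambda>n. V n t x) \<longlonglongrightarrow> v t x" "\<bar>v t x - V n t x\<bar> \<le> E * (1 / 2) ^ n" if t: "t \<in> {0..T}" "x \<in> space K" for t x n
  unfolding v_def using cauchy_limit[OF diff[OF t] e0] by blast+
 have vb: "\<bar>v t x\<bar> \<le> E" if t: "t \<in> {0..T}" "x \<in> space K" for t x using v(2)[OF t, of 0] by (simp add: V_def)
 have "TKm v"
 proof (rule borel_measurable_LIMSEQ_real)
  show "TKm (V n)" for n using gV by (simp add: good_def)
  fix w assume "w \<in> space TK"
  thus "(\<lambda>n. case w of (s, x) => V n s x) \<longlonglongrightarrow> (case w of (s, x) => v s x)"
   using v(1) by (auto simp: space_pair_measure space_restrict_space)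
 qed
 hence gv: "good v" using vb by (intro goodI)
 have "v t x = g x + ioc (\<lambda>s. rhs v s x) t T" if t: "t \<in> {0..T}" "x \<in> space K" for t x
 proof -
  have "\<bar>V (Suc n) t x - (g x + ioc (\<lambda>s. rhs v s x) t T)\<bar> \<le> (C * T) * (E * (1 / 2) ^ n)" for n
  proof -
   have d: "V (Suc n) t x - (g x + ioc (\<lambda>s. rhs v s x) t T) =
     ioc (\<lambda>s. rhs (V n) s x - rhs v s x) t T"
    using set_integral_diff(2)[OF int[OF gV t] int[OF gv t], of n] by (simp add: V \<Phi>_def)
   have "\<bar>V (Suc n) t x - (g x + ioc (\<lambda>s. rhs v s x) t T)\<bar> \<le> ioc (\<lambda>_. C * (E * (1 / 2) ^ n)) t T"
    unfolding d
   proof (rule ioc_bound)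
    show "set_integrable lborel {t<..T} (\<lambda>s. rhs (V n) s x - rhs v s x)"
     by (intro set_integral_diff(1) int gV gv t)
    fix s assume s: "s \<in> {t<..T}"
    hence s0: "s \<in> {0..T}" using t by auto
    show "\<bar>rhs (V n) s x - rhs v s x\<bar> \<le> C * (E * (1 / 2) ^ n)"
     by (rule lip[OF gV gv s0 t(2)]) (use v(2)[OF s0, of _ n] in \<open>simp add: abs_minus_commute\<close>)
   qed (rule const)
   also have "\<dots> = (T - t) * (C * (E * (1 / 2) ^ n))" using t by (simp add: set_lebesgue_integral_def)
   also have "\<dots> \<le> T * (C * (E * (1 / 2) ^ n))" using t C0 E0 by (intro mult_right_mono) auto
   finally show ?thesis by (simp add: mult_ac)
  qed
  hence "(\<lambda>n. V (Suc n) t x) \<longlonglongrightarrow> g x + ioc (\<lambda>s. rhs v s x) t T"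
   by (intro LIM_zero_cancel[OF Lim_null_comparison[OF _ tendsto_mult_right_zero[OF e0, of "C * T"]]]) auto
  thus ?thesis using LIMSEQ_unique[OF LIMSEQ_Suc[OF v(1)[OF t]]] by simp
 qed
 thus ?thesis using gv int[OF gv] vb by (intro exI[of _ v] exI[of _ E]) (auto simp: good_def)
qed

end

section \<open>Existence in general\<close>

definition truncate :: "nat => real => real" where
 "truncate n r = max (- real n) (min (real n) r)"

lemma truncate_bounds:
 "\<bar>truncate n r\<bar> \<le> real n" "\<bar>truncate n r - r\<bar> \<le> \<bar>r\<bar>"
 "n \<le> m ==> \<bar>truncate n r - truncate m r\<bar> \<le> \<bar>truncate n r - r\<bar>"
 by (auto simp: truncate_def max_def min_def)

lemma truncate_measurable[measurable]: "truncate n \<in> borel_measurable borel"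
 unfolding truncate_def[abs_def] by measurable

lemma truncate_tendsto: "(\<lambda>n. truncate n r) \<longlonglongrightarrow> r"
proof (rule tendsto_eventually)
 obtain N where N: "\<bar>r\<bar> \<le> real N" using real_arch_simple by blast
 show "\<forall>\<^sub>F n in sequentially. truncate n r = r"
  using eventually_ge_at_top[of N] by eventually_elim (use N in \<open>auto simp: truncate_def max_def min_def\<close>)
qed

lemma square_le: "\<bar>a\<bar> \<le> \<bar>b :: real\<bar> ==> sq a \<le> sq b"
 by (intro ennreal_leI) (simp add: abs_le_square_iff)

lemma truncate_square_integral:
 assumes [measurable]: "h \<in> borel_measurable M" and fin: "(\<integral>\<^sup>+x. sq (h x) \<partial>M) < \<infinity>"
 shows "(\<lambda>n. \<integral>\<^sup>+x. sq (truncate n (h x) - h x) \<partial>M) \<longlonglongrightarrow> 0"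
proof -
 have "(\<lambda>n. \<integral>\<^sup>+x. sq (truncate n (h x) - h x) \<partial>M) \<longlonglongrightarrow> (\<integral>\<^sup>+x. 0 \<partial>M)"
 proof (rule nn_integral_dominated_convergence[where w="\<lambda>x. sq (h x)"])
  show "AE x in M. sq (truncate n (h x) - h x) \<le> sq (h x)" for n
   by (intro AE_I2 square_le truncate_bounds)
  have "(\<lambda>n. sq (truncate n r - r)) \<longlonglongrightarrow> sq (r - r)" for r
   by (intro tendsto_intros truncate_tendsto)
  thus "AE x in M. (\<lambda>n. sq (truncate n (h x) - h x)) \<longlonglongrightarrow> 0" by simp
 qed (use fin in auto)
 thus ?thesis by simp
qed

context markov_jump_process
begin

text \<open>Bounds from an index N on are enough; for N = n they concern the differences of the n-th
  approximation from later ones.\<close>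

lemma occ_fatou:
 fixes h :: "nat => real => 'k => ennreal"
 assumes t: "0 \<le> t" "t \<le> T" "x \<in> space K" and m: "\<And>n. TKm (h n)"
  and le: "\<And>s y. s \<in> {0..T} ==> y \<in> space K ==> q s y \<le> liminf (\<lambda>n. h n s y)"
  and c: "\<And>n. N \<le> n ==> occ t x (h n) \<le> c"
 shows "occ t x q \<le> c"
proof -
 have L: "(\<lambda>(s, y). liminf (\<lambda>n. h n s y)) \<in> borel_measurable TK"
  using m by (simp add: case_prod_beta')
 have "occ t x q \<le> occ t x (\<lambda>s y. liminf (\<lambda>n. h n s y))" by (rule occ_mono[OF le t(1,3)])
 also have "\<dots> = (\<integral>\<^sup>+p. liminf (\<lambda>n. h n (snd p) (X (snd p) (fst p))) \<partial>PR t x)" by (rule occ_product[OF L t])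
 also have "\<dots> \<le> liminf (\<lambda>n. \<integral>\<^sup>+p. h n (snd p) (X (snd p) (fst p)) \<partial>PR t x)"
  by (rule nn_integral_liminf[OF TK_process[OF m t]])
 also have "\<dots> \<le> liminf (\<lambda>n. c)"
  using c by (intro Liminf_mono) (auto simp: eventually_sequentially occ_product[OF m t])
 finally show ?thesis by (simp add: Liminf_const)
qed

end

context lipschitz_driver
begin

text \<open>A bounded solution for the driver f + \<kappa>, with \<kappa> kept outside the driver so
  that solutions for different perturbations are compared through one and the same right-hand
  side.\<close>

definition perturbed_solution :: "(real => 'k => real) => ('k => real) => (real => 'k => real) => bool" where
 "perturbed_solution \<kappa> g v \<longleftrightarrow> TKm v \<and>
  (\<exists>B. \<forall>s x. s \<in> {0..T} \<longrightarrow> x \<in> space K \<longrightarrow> \<bar>v s x\<bar> \<le> B) \<and>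
  (\<forall>t\<in>{0..T}. \<forall>x\<in>space K. set_integrable lborel {t<..T} (\<lambda>s. rhs v s x + \<kappa> s x) \<and>
   v t x = g x + ioc (\<lambda>s. rhs v s x + \<kappa> s x) t T)"

lemma perturbed_solutionD:
 assumes "perturbed_solution \<kappa> g v"
 shows "TKm v" and "finite_energy v"
  and "\<And>s x. s \<in> {0..T} ==> x \<in> space K ==> jump_energy v s x < \<infinity>"
  and "\<And>t x. t \<in> {0..T} ==> x \<in> space K ==> set_integrable lborel {t<..T} (\<lambda>s. rhs v s x + \<kappa> s x)"
  and "\<And>t x. t \<in> {0..T} ==> x \<in> space K ==> v t x = g x + ioc (\<lambda>s. rhs v s x + \<kappa> s x) t T"
  and "\<exists>B. \<forall>s x. s \<in> {0..T} \<longrightarrow> x \<in> space K \<longrightarrow> \<bar>v s x\<bar> \<le> B"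
proof -
 show vm: "TKm v"
  and B: "\<exists>B. \<forall>s x. s \<in> {0..T} \<longrightarrow> x \<in> space K \<longrightarrow> \<bar>v s x\<bar> \<le> B"
  using assms unfolding perturbed_solution_def by blast+
 show "\<And>t x. t \<in> {0..T} ==> x \<in> space K ==> set_integrable lborel {t<..T} (\<lambda>s. rhs v s x + \<kappa> s x)"
  "\<And>t x. t \<in> {0..T} ==> x \<in> space K ==> v t x = g x + ioc (\<lambda>s. rhs v s x + \<kappa> s x) t T"
  using assms unfolding perturbed_solution_def by blast+
 show "finite_energy v" "\<And>s x. s \<in> {0..T} ==> x \<in> space K ==> jump_energy v s x < \<infinity>"
  using B bounded_finite_energy[OF vm] by blast+
qed

text \<open>Adding a function of (s, x) alone leaves both Lipschitz constants as they are, so the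
  bounded existence result applies to the perturbed driver.\<close>

lemma perturbed_existence:
 assumes \<kappa>: "TKm \<kappa>" and gm: "g \<in> borel_measurable K"
  and g: "\<And>x. x \<in> space K ==> \<bar>g x\<bar> \<le> G"
  and f0: "\<And>s x. s \<in> {0..T} ==> x \<in> space K ==> \<bar>free_term s x + \<kappa> s x\<bar> \<le> G"
 shows "\<exists>v. perturbed_solution \<kappa> g v"
proof -
 interpret n: lipschitz_driver T K \<nu> \<Omega> X P "\<lambda>s x r z. f s x r z + \<kappa> s x" L L'
 proof
  fix z :: "'k => real" and C
  assume z: "z \<in> borel_measurable K" "\<And>y. y \<in> space K ==> \<bar>z y\<bar> \<le> C"
  have "(\<lambda>p. (fst p, fst (snd p))) \<in> restrict_space borel {0..T} \<Otimes>\<^sub>M K \<Otimes>\<^sub>M (borel :: real measure) \<rightarrow>\<^sub>M TK"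
   by measurable
  from borel_measurable_add[OF driver_measurable[OF z] measurable_compose[OF this \<kappa>]]
  show "(\<lambda>(s, x, r). f s x r z + \<kappa> s x) \<in> borel_measurable (restrict_space borel {0..T} \<Otimes>\<^sub>M K \<Otimes>\<^sub>M borel)"
   by (simp add: case_prod_beta')
 next
  fix s x r r' and z z' :: "'k => real"
  assume "s \<in> {0..T}" "x \<in> space K" "z \<in> L2 (\<nu> s x)" "z' \<in> L2 (\<nu> s x)"
  from lipschitz[OF this] show "\<bar>f s x r z + \<kappa> s x - (f s x r' z' + \<kappa> s x)\<bar> \<le>
    L' * \<bar>r - r'\<bar> + L * sqrt (LINT y | \<nu> s x. \<bar>z y - z' y\<bar>\<^sup>2)" by simp
 qed (use L_nonneg in auto)
 obtain v B where vm: "TKm v"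
  and B: "\<forall>s\<in>{0..T}. \<forall>x\<in>space K. \<bar>v s x\<bar> \<le> B"
  and v: "\<forall>t\<in>{0..T}. \<forall>x\<in>space K. set_integrable lborel {t<..T} (\<lambda>s. n.rhs v s x) \<and>
   v t x = g x + ioc (\<lambda>s. n.rhs v s x) t T"
  using n.bounded_existence[OF gm g f0] by blast
 have je: "jump_energy v s x < \<infinity>" if "s \<in> {0..T}" "x \<in> space K" for s x
  using bounded_finite_energy(2)[OF vm _ that, of B] B by blast
 \<comment> \<open>Beyond the cut-off the perturbed driver would lose \<kappa> as well; a bounded v
   has finite jump energy, so this case does not arise.\<close>
 have eq: "n.rhs v s x = rhs v s x + \<kappa> s x" if "s \<in> {0..T}" "x \<in> space K" for s x
  using je[OF that] unfolding n.rhs_def rhs_def n.drift_def drift_def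
   n.cut_driver_def cut_driver_def jump_energy_def by simp
 have "set_integrable lborel {t<..T} (\<lambda>s. rhs v s x + \<kappa> s x) \<and>
   v t x = g x + ioc (\<lambda>s. rhs v s x + \<kappa> s x) t T" if t: "t \<in> {0..T}" "x \<in> space K" for t x
 proof -
  have e: "n.rhs v s x = rhs v s x + \<kappa> s x" if "s \<in> {t<..T}" for s using eq t that by simp
  have i: "set_integrable lborel {t<..T} (\<lambda>s. n.rhs v s x)" using v t by blast
  have "v t x = g x + ioc (\<lambda>s. n.rhs v s x) t T" using v t by blast
  with ioc_cong_finite[OF i finite.emptyI e[symmetric]] show ?thesis by simp
 qed
 thus ?thesis using vm B unfolding perturbed_solution_def by blast
qed

text \<open>The difference solves a linear equation to which \<open>kolmogorov_energy\<close>
  applies with constant \<open>max L L'\<close>. Boundedness of v and v' serves for finiteness only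
  and does not enter the estimate, which is therefore uniform over truncation levels.\<close>

lemma perturbed_difference:
 assumes v: "perturbed_solution \<kappa> g v" and v': "perturbed_solution \<kappa>' g' v'"
  and km: "TKm \<kappa>" "TKm \<kappa>'"
   "TKm \<kappa>0" and gm: "g \<in> borel_measurable K" "g' \<in> borel_measurable K"
  and k0: "\<And>s x. \<bar>\<kappa> s x - \<kappa>' s x\<bar> \<le> \<bar>\<kappa>0 s x\<bar>" and g0: "\<And>x. \<bar>g x - g' x\<bar> \<le> \<bar>g0 x\<bar>"
  and t: "0 \<le> t" "t \<le> T" "x \<in> space K"
  and fin: "(\<integral>\<^sup>+w. sq (g0 (X T w)) \<partial>P t x) < \<infinity>" "occ t x (\<lambda>s y. sq (\<kappa>0 s y)) < \<infinity>"
 defines "B \<equiv> ennreal (energy_const (max L L') t) *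
  ((\<integral>\<^sup>+w. sq (g0 (X T w)) \<partial>P t x) + occ t x (\<lambda>s y. sq (\<kappa>0 s y)))"
 shows "sq (v t x - v' t x) \<le> B" and "occ t x (\<lambda>s y. sq (v s y - v' s y)) \<le> B"
  and "occ t x (jump_energy (\<lambda>s y. v s y - v' s y)) \<le> B"
proof -
 note vD = perturbed_solutionD[OF v] and wD = perturbed_solutionD[OF v']
 define u where "u s y = v s y - v' s y" for s y
 define h where "h s y = drift v s y + \<kappa> s y - (drift v' s y + \<kappa>' s y)" for s y
 have um: "TKm u"
  using borel_measurable_diff[OF vD(1) wD(1)] by (simp add: u_def case_prod_beta')
 have hm: "TKm h"
  using drift_measurable[OF vD(1)] drift_measurable[OF wD(1)] km by (simp add: h_def case_prod_beta')
 obtain B1 B2 where B: "\<And>s x. s \<in> {0..T} ==> x \<in> space K ==> \<bar>v s x\<bar> \<le> B1" "\<And>s x. s \<in> {0..T} ==> x \<in> space K ==> \<bar>v' s x\<bar> \<le> B2"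
  using vD(6) wD(6) by blast
 have ub: "\<bar>u s x\<bar> \<le> B1 + B2" if "s \<in> {0..T}" "x \<in> space K" for s x using B[OF that] unfolding u_def by linarith
 have gen: "h s x + generator \<nu> s (u s) x = (rhs v s x + \<kappa> s x) - (rhs v' s x + \<kappa>' s x)"
  if "s \<in> {0..T}" "x \<in> space K" for s x
  using generator_diff[OF vD(1) wD(1) that vD(3)[OF that] wD(3)[OF that]]
  by (simp add: h_def rhs_def u_def[abs_def])
 have D: "set_integrable lborel {t<..T} (\<lambda>s. h s x + generator \<nu> s (u s) x)"
  and ueq: "u t x = (g x - g' x) + ioc (\<lambda>s. h s x + generator \<nu> s (u s) x) t T" if t: "t \<in> {0..T}" "x \<in> space K" for t x
 proof -
  note d = set_integral_diff[OF vD(4)[OF t] wD(4)[OF t]]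
  have e: "h s x + generator \<nu> s (u s) x = (rhs v s x + \<kappa> s x) - (rhs v' s x + \<kappa>' s x)"
   if "s \<in> {t<..T}" for s using gen[of s x] that t by simp
  note c = ioc_cong_finite[OF d(1) finite.emptyI e]
  show "set_integrable lborel {t<..T} (\<lambda>s. h s x + generator \<nu> s (u s) x)" by (rule c(1))
  show "u t x = (g x - g' x) + ioc (\<lambda>s. h s x + generator \<nu> s (u s) x) t T"
   using c(2) d(2) vD(5)[OF t] wD(5)[OF t] unfolding u_def by simp
 qed
 have C: "0 \<le> max L L'" using L_nonneg by simp
 have hb: "\<bar>h s x\<bar> \<le> max L L' * \<bar>u s x\<bar> + max L L' * sqrt (enn2real (jump_energy u s x)) + \<bar>\<kappa>0 s x\<bar>"
  if sx: "s \<in> {0..T}" "x \<in> space K" for s x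
 proof -
  have "\<bar>h s x\<bar> \<le> \<bar>drift v s x - drift v' s x\<bar> + \<bar>\<kappa> s x - \<kappa>' s x\<bar>" unfolding h_def by linarith
  also have "\<dots> \<le> (L' * \<bar>u s x\<bar> + L * sqrt (enn2real (jump_energy u s x))) + \<bar>\<kappa>0 s x\<bar>"
   unfolding u_def[abs_def] by (intro add_mono drift_diff[OF vD(1) wD(1) sx vD(3)[OF sx] wD(3)[OF sx]] k0)
  also have "\<dots> \<le> max L L' * \<bar>u s x\<bar> + max L L' * sqrt (enn2real (jump_energy u s x)) + \<bar>\<kappa>0 s x\<bar>"
   by (intro add_mono mult_right_mono) auto
  finally show ?thesis .
 qed
 have ufe: "finite_energy u" by (rule bounded_finite_energy(1)[OF um ub])
 have ufin: "occ t x (\<lambda>s y. sq (u s y)) < \<infinity>" "occ t x (jump_energy u) < \<infinity>"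
  using ufe t unfolding finite_energy_def by auto
 have gle: "(\<integral>\<^sup>+w. sq (g (X T w) - g' (X T w)) \<partial>P t x) \<le> (\<integral>\<^sup>+w. sq (g0 (X T w)) \<partial>P t x)"
  by (intro nn_integral_mono square_le g0)
 have gm': "(\<lambda>x. g x - g' x) \<in> borel_measurable K" using gm by simp
 note ke = kolmogorov_energy[where u=u and h=h and \<kappa>=\<kappa>0 and g="\<lambda>x. g x - g' x",
   OF t C um hm km(3) gm' D ueq hb ufin fin(2) le_less_trans[OF gle fin(1)]]
 have le: "ennreal (energy_const (max L L') t) * ((\<integral>\<^sup>+w. sq (g (X T w) - g' (X T w)) \<partial>P t x) +
   occ t x (\<lambda>s y. sq (\<kappa>0 s y))) \<le> B"
  unfolding B_def using gle by (intro mult_left_mono add_mono) auto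
 show "sq (v t x - v' t x) \<le> B" using order_trans[OF ke(1) le] by (simp add: u_def)
 show "occ t x (\<lambda>s y. sq (v s y - v' s y)) \<le> B" using order_trans[OF ke(2) le] by (simp add: u_def)
 show "occ t x (jump_energy (\<lambda>s y. v s y - v' s y)) \<le> B" using order_trans[OF ke(3) le] by (simp add: u_def[abs_def])
qed

end

context square_integrable_driver
begin

text \<open>The quantities \<open>en n t x\<close> bound the distance of the n-th approximation from
  all later ones, at the point and in energy, and tend to 0 for every starting point. Passing to the
  limit in the equation at fixed x requires convergence of the right-hand sides in mean square in
  time, which the sojourn estimate deduces from convergence in energy at finitely many starting
  times.\<close>

lemma existence:
 assumes gm: "g \<in> borel_measurable K"
  and g2: "\<And>t x. t \<in> {0..T} ==> x \<in> space K ==> (\<integral>\<^sup>+w. sq (g (X T w)) \<partial>P t x) < \<infinity>"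
 shows "\<exists>v. kolmogorov g v"
proof -
 \<comment> \<open>The perturbation replaces the free term by its truncation and leaves the
   dependence on the solution alone.\<close>
 define \<kappa> where "\<kappa> n s x = truncate n (free_term s x) - free_term s x" for n s x
 define gn where "gn n x = truncate n (g x)" for n x
 have km: "TKm (\<kappa> n)" for n
  using free_term_measurable by (simp add: \<kappa>_def case_prod_beta')
 have gnm: "gn n \<in> borel_measurable K" for n using gm unfolding gn_def[abs_def] by measurable
 have ex: "\<exists>v. perturbed_solution (\<kappa> n) (gn n) v" for n
  by (rule perturbed_existence[OF km gnm]) (use truncate_bounds(1) in \<open>auto simp: gn_def \<kappa>_def\<close>)
 define v where "v n = (SOME v. perturbed_solution (\<kappa> n) (gn n) v)" for n
 have v: "perturbed_solution (\<kappa> n) (gn n) (v n)" for n unfolding v_def by (rule someI_ex[OF ex])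
 note vD = perturbed_solutionD[OF v]
 define kn where "kn n t x = occ t x (\<lambda>s y. sq (\<kappa> n s y))" for n t x
 \<comment> \<open>No later index occurs here: two truncations differ by no more than the coarser
   one differs from the untruncated value.\<close>
 define en where "en n t x = ennreal (energy_const (max L L') t) *
   ((\<integral>\<^sup>+w. sq (gn n (X T w) - g (X T w)) \<partial>P t x) + kn n t x)" for n t x
 have sq: "(\<lambda>(s, y). sq (h s y)) \<in> borel_measurable TK" if "TKm h"
  for h :: "real => 'k => real" using that by (simp add: case_prod_beta')
 have lims: "(\<lambda>n. kn n t x) \<longlonglongrightarrow> 0" "(\<lambda>n. en n t x) \<longlonglongrightarrow> 0" "en n t x < \<infinity>" "kn n t x < \<infinity>"
  "(\<integral>\<^sup>+w. sq (gn n (X T w) - g (X T w)) \<partial>P t x) < \<infinity>"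
  if t: "t \<in> {0..T}" "x \<in> space K" for t x n
 proof -
  have t': "0 \<le> t" "t \<le> T" "x \<in> space K" using t by auto
  have fm: "(\<lambda>p. free_term (snd p) (X (snd p) (fst p))) \<in> borel_measurable (PR t x)"
   by (rule TK_process[OF free_term_measurable t'])
  have ffin: "(\<integral>\<^sup>+p. sq (free_term (snd p) (X (snd p) (fst p))) \<partial>PR t x) < \<infinity>"
   using driver_square[OF t] occ_product[OF sq[OF free_term_measurable] t'] by simp
  have kp: "kn n t x = (\<integral>\<^sup>+p. sq (truncate n (free_term (snd p) (X (snd p) (fst p))) - free_term (snd p) (X (snd p) (fst p)))
    \<partial>PR t x)" for n
   unfolding kn_def occ_product[OF sq[OF km] t'] by (simp add: \<kappa>_def)
  show k: "(\<lambda>n. kn n t x) \<longlonglongrightarrow> 0" unfolding kp by (rule truncate_square_integral[OF fm ffin])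
  have "kn n t x \<le> (\<integral>\<^sup>+p. sq (free_term (snd p) (X (snd p) (fst p))) \<partial>PR t x)"
   unfolding kp by (intro nn_integral_mono square_le truncate_bounds)
  thus kf: "kn n t x < \<infinity>" using ffin by (rule le_less_trans)
  have gXm: "(\<lambda>w. g (X T w)) \<in> borel_measurable (P t x)"
   by (rule measurable_compose[OF _ gm]) (use t' measurable_X[of T "{t..}"] in \<open>simp add: measurable_P\<close>)
  have gl: "(\<lambda>n. \<integral>\<^sup>+w. sq (gn n (X T w) - g (X T w)) \<partial>P t x) \<longlonglongrightarrow> 0"
   unfolding gn_def by (rule truncate_square_integral[OF gXm g2[OF t]])
  have "(\<integral>\<^sup>+w. sq (gn n (X T w) - g (X T w)) \<partial>P t x) \<le> (\<integral>\<^sup>+w. sq (g (X T w)) \<partial>P t x)"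
   unfolding gn_def by (intro nn_integral_mono square_le truncate_bounds)
  thus gf: "(\<integral>\<^sup>+w. sq (gn n (X T w) - g (X T w)) \<partial>P t x) < \<infinity>" using g2[OF t] by (rule le_less_trans)
  show "en n t x < \<infinity>" using kf gf by (simp add: en_def ennreal_mult_less_top)
  have "(\<lambda>n. en n t x) \<longlonglongrightarrow> ennreal (energy_const (max L L') t) * (0 + 0)"
   unfolding en_def by (intro ennreal_tendsto_cmult tendsto_add gl k) simp
  thus "(\<lambda>n. en n t x) \<longlonglongrightarrow> 0" by simp
 qed
 have diff: "sq (v n t x - v m t x) \<le> en n t x"
  "occ t x (\<lambda>s y. sq (v n s y - v m s y)) \<le> en n t x"
  "occ t x (jump_energy (\<lambda>s y. v n s y - v m s y)) \<le> en n t x"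
  if nm: "n \<le> m" and t: "t \<in> {0..T}" "x \<in> space K" for n m t x
 proof -
  have t': "0 \<le> t" "t \<le> T" "x \<in> space K" using t by auto
  have k0: "\<bar>\<kappa> n s x - \<kappa> m s x\<bar> \<le> \<bar>\<kappa> n s x\<bar>" and g0: "\<bar>gn n x - gn m x\<bar> \<le> \<bar>gn n x - g x\<bar>" for s x
   using truncate_bounds(3)[OF nm] by (auto simp: \<kappa>_def gn_def)
  show "sq (v n t x - v m t x) \<le> en n t x"
   "occ t x (\<lambda>s y. sq (v n s y - v m s y)) \<le> en n t x"
   "occ t x (jump_energy (\<lambda>s y. v n s y - v m s y)) \<le> en n t x"
   unfolding en_def kn_def
   by (rule perturbed_difference[OF v v km km km gnm gnm k0 g0 t' lims(5)[OF t] lims(4)[OF t, unfolded kn_def]])+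
 qed
 have e0: "(\<lambda>n. sqrt (enn2real (en n t x))) \<longlonglongrightarrow> 0" if t: "t \<in> {0..T}" "x \<in> space K" for t x
  using tendsto_real_sqrt[OF tendsto_enn2real[of _ 0, OF lims(2)[OF t, folded ennreal_0]]] by simp
 have vdiff: "\<bar>v m t x - v n t x\<bar> \<le> sqrt (enn2real (en n t x))" if nm: "n \<le> m" and t: "t \<in> {0..T}" "x \<in> space K" for n m t x
 proof -
  have "(v n t x - v m t x)\<^sup>2 \<le> enn2real (en n t x)"
   using enn2real_mono[OF diff(1)[OF nm t]] lims(3)[OF t] by simp
  from real_sqrt_le_mono[OF this] show ?thesis by simp
 qed
 define v' where "v' t x = lim (\<lambda>n. v n t x)" for t x
 have v': "(\<lambda>n. v n t x) \<longlonglongrightarrow> v' t x" if t: "t \<in> {0..T}" "x \<in> space K" for t x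
  unfolding v'_def by (rule cauchy_limit(1)[OF vdiff[OF _ t] e0[OF t]])
 have wm: "TKm v'"
 proof (rule borel_measurable_LIMSEQ_real)
  show "TKm (v n)" for n by (rule vD(1))
  fix p assume "p \<in> space TK"
  thus "(\<lambda>n. case p of (s, x) => v n s x) \<longlonglongrightarrow> (case p of (s, x) => v' s x)"
   using v' by (auto simp: space_pair_measure)
 qed
 have dm: "(\<lambda>(s, x). v n s x - v m s x) \<in> borel_measurable TK" "(\<lambda>(s, x). v n s x - v' s x) \<in> borel_measurable TK" for n m
  using borel_measurable_diff[OF vD(1) vD(1), of n m] borel_measurable_diff[OF vD(1) wm, of n] by (simp_all add: case_prod_beta')
 have fat: "occ t x (\<lambda>s y. sq (v n s y - v' s y)) \<le> en n t x"
  "occ t x (jump_energy (\<lambda>s y. v n s y - v' s y)) \<le> en n t x"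
  if t: "t \<in> {0..T}" "x \<in> space K" for n t x
 proof -
  have t': "0 \<le> t" "t \<le> T" "x \<in> space K" using t by auto
  show "occ t x (\<lambda>s y. sq (v n s y - v' s y)) \<le> en n t x"
  proof (rule occ_fatou[OF t' sq[OF dm(1)] _ diff(2)[OF _ t]])
   fix s y assume "s \<in> {0..T}" "y \<in> space K"
   hence "(\<lambda>m. sq (v n s y - v m s y)) \<longlonglongrightarrow> sq (v n s y - v' s y)"
    by (intro tendsto_intros v')
   from lim_imp_Liminf[OF _ this] show "sq (v n s y - v' s y) \<le> liminf (\<lambda>m. sq (v n s y - v m s y))" by simp
  qed
  show "occ t x (jump_energy (\<lambda>s y. v n s y - v' s y)) \<le> en n t x"
  proof (rule occ_fatou[OF t' jump_energy_measurable[OF dm(1)] _ diff(3)[OF _ t]])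
   fix s y assume sy: "s \<in> {0..T}" "y \<in> space K"
   have sp: "space (\<nu> s y) = space K" using space_rate sy by simp
   \<comment> \<open>The increments converge for every state z, so Fatou's lemma for the rates, and
     then for the law of the path, moves the energy bound from later approximations to the
     limit.\<close>
   have "sq (v n s z - v' s z - (v n s y - v' s y)) =
     liminf (\<lambda>m. sq (v n s z - v m s z - (v n s y - v m s y)))" if "z \<in> space (\<nu> s y)" for z
    by (rule lim_imp_Liminf[symmetric]) (use sy that in \<open>auto intro!: tendsto_intros v' simp: sp\<close>)
   hence "jump_energy (\<lambda>s y. v n s y - v' s y) s y =
     (\<integral>\<^sup>+z. liminf (\<lambda>m. sq (v n s z - v m s z - (v n s y - v m s y))) \<partial>\<nu> s y)"
    unfolding jump_energy_def by (rule nn_integral_cong)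
   also have "\<dots> \<le> liminf (\<lambda>m. \<integral>\<^sup>+z. sq (v n s z - v m s z - (v n s y - v m s y)) \<partial>\<nu> s y)"
   proof (rule nn_integral_liminf)
    have [measurable]: "v m s \<in> borel_measurable (\<nu> s y)" for m
     using TK_section(2)[OF vD(1) sy(1)] sy by (simp add: measurable_rate_iff)
    show "(\<lambda>z. sq (v n s z - v m s z - (v n s y - v m s y))) \<in> borel_measurable (\<nu> s y)" for m by measurable
   qed
   finally show "jump_energy (\<lambda>s y. v n s y - v' s y) s y \<le> liminf (\<lambda>m. jump_energy (\<lambda>s y. v n s y - v m s y) s y)"
    by (simp add: jump_energy_def)
  qed
 qed
 have fe: "finite_energy v'"
  unfolding finite_energy_def
 proof (intro conjI ballI wm)
  fix t x assume t: "t \<in> {0..T}" "x \<in> space K"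
  have t': "0 \<le> t" "t \<le> T" "x \<in> space K" using t by auto
  \<comment> \<open>The limit is written as v 0 minus the difference of v 0 and the limit. Index 0
    is one approximation of finite energy among others.\<close>
  note fin = vD(2)[of 0, unfolded finite_energy_def, THEN conjunct2, rule_format, OF t]
  have add: "occ t x q < \<infinity>" if m: "TKm h" "TKm h'"
   and f: "occ t x h < \<infinity>" "occ t x h' \<le> en 0 t x" and le: "\<And>s y. s \<in> {0..T} ==> y \<in> space K ==> q s y \<le> 2 * h s y + 2 * h' s y"
   for q h h' :: "real => 'k => ennreal"
  proof -
   have m2: "(\<lambda>(s, y). 2 * h s y) \<in> borel_measurable TK" "(\<lambda>(s, y). 2 * h' s y) \<in> borel_measurable TK"
    using m by (simp_all add: case_prod_beta')
   have "occ t x q \<le> occ t x (\<lambda>s y. 2 * h s y + 2 * h' s y)" by (rule occ_mono[OF le t'(1,3)])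
   also have "\<dots> = 2 * occ t x h + 2 * occ t x h'"
    unfolding occ_add_cmult(1)[OF m2 t'] occ_add_cmult(2)[OF m(1) m(1) t'] occ_add_cmult(2)[OF m(2) m(2) t'] ..
   also have "\<dots> < \<infinity>" using f le_less_trans[OF f(2) lims(3)[OF t]] by (simp add: ennreal_mult_less_top)
   finally show ?thesis .
  qed
  show "occ t x (\<lambda>s y. sq (v' s y)) < \<infinity>"
  proof (rule add[OF sq[OF vD(1)] sq[OF dm(2)] fin[THEN conjunct1] fat(1)[OF t]])
   show "sq (v' s y) \<le> 2 * sq (v 0 s y) + 2 * sq (v 0 s y - v' s y)" for s y
    using square_diff_le[of "v 0 s y" "v 0 s y - v' s y"] by simp
  qed
  show "occ t x (jump_energy v') < \<infinity>"
  proof (rule add[OF jump_energy_measurable[OF vD(1)] jump_energy_measurable[OF dm(2)] fin[THEN conjunct2] fat(2)[OF t]])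
   fix s y assume sy: "s \<in> {0..T}" "y \<in> space K"
   have m: "v 0 s \<in> borel_measurable (\<nu> s y)" "v' s \<in> borel_measurable (\<nu> s y)"
    using TK_section(2)[OF vD(1) sy(1)] TK_section(2)[OF wm sy(1)] sy by (simp_all add: measurable_rate_iff)
   have "v' s z - v' s y = (v 0 s z - v 0 s y) - (v 0 s z - v' s z - (v 0 s y - v' s y))" for z by simp
   thus "jump_energy v' s y \<le> 2 * jump_energy (v 0) s y + 2 * jump_energy (\<lambda>s y. v 0 s y - v' s y) s y"
    unfolding jump_energy_def by (simp only:) (rule nn_integral_square_diff_le; use m in measurable)
  qed
 qed
 have "v' t x = g x + ioc (\<lambda>s. drift v' s x + generator \<nu> s (v' s) x) t T" if t: "t \<in> {0..T}" "x \<in> space K" for t x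
 proof -
  have t': "0 \<le> t" "t \<le> T" "x \<in> space K" using t by auto
  define c where "c = 3 * (L'\<^sup>2 + L\<^sup>2 + rate_bound)"
  have c0: "0 \<le> c" using rate_bound_pos by (simp add: c_def)
  define d where "d n s x = (rhs (v n) s x + \<kappa> n s x) - rhs v' s x" for n s x
  \<comment> \<open>A bound for the square of \<open>d n\<close>: one factor 2 separates the
    perturbation from the difference of right-hand sides, and c is the constant of
    \<open>rhs_diff\<close>.\<close>
  define h where "h n s y = ennreal (2 * c) * (sq (v n s y - v' s y) + jump_energy (\<lambda>s y. v n s y - v' s y) s y) +
    2 * sq (\<kappa> n s y)" for n s y
  have dmeas: "TKm (d n)" for n
   using rhs_measurable[OF vD(1), of n] rhs_measurable[OF wm] km[of n]
   by (simp add: d_def case_prod_beta')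
  have m1: "(\<lambda>(s, y). sq (v n s y - v' s y) + jump_energy (\<lambda>s y. v n s y - v' s y) s y) \<in> borel_measurable TK" for n
   using sq[OF dm(2), of n] jump_energy_measurable[OF dm(2), of n] by (simp add: case_prod_beta')
  have m2: "(\<lambda>(s, y). ennreal (2 * c) * (sq (v n s y - v' s y) + jump_energy (\<lambda>s y. v n s y - v' s y) s y)) \<in> borel_measurable TK"
   "(\<lambda>(s, y). 2 * sq (\<kappa> n s y)) \<in> borel_measurable TK" for n
   using m1[of n] sq[OF km, of n] by (simp_all add: case_prod_beta')
  have hm: "TKm (h n)" for n
   using m2[of n] by (simp add: h_def case_prod_beta')
  have occh: "occ a x (h n) \<le> ennreal (2 * c) * (en n a x + en n a x) + 2 * kn n a x" if a: "a \<in> {0..T}" for n a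
  proof -
   have a': "0 \<le> a" "a \<le> T" "x \<in> space K" using a t by auto
   show ?thesis
    unfolding h_def[abs_def] kn_def occ_add_cmult(1)[OF m2 a'] occ_add_cmult(2)[OF m1 m1 a']
     occ_add_cmult(2)[OF sq[OF km] sq[OF km] a'] occ_add_cmult(1)[OF sq[OF dm(2)] jump_energy_measurable[OF dm(2)] a']
    by (intro add_mono mult_left_mono fat a t) auto
  qed
  \<comment> \<open>The starting times are fixed before n varies, so the finitely many energies at
    these times tend to 0 together.\<close>
  obtain ts where ts: "set ts \<subseteq> {t..T}" and cov: "\<And>h. TKm h ==>
    (\<integral>\<^sup>+s. h s x \<partial>RS t) \<le> (\<Sum>a\<leftarrow>ts. 2 * occ a x h)"
   by (rule sojourn_cover_TK[OF t'], rule that)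
  have sum0: "(\<lambda>n. \<Sum>a\<leftarrow>ts. 2 * (ennreal (2 * c) * (en n a x + en n a x) + 2 * kn n a x)) \<longlonglongrightarrow> 0"
   using ts
  proof (induction ts)
   case (Cons a ts)
   hence a: "a \<in> {0..T}" using t by auto
   have "(\<lambda>n. 2 * (ennreal (2 * c) * (en n a x + en n a x) + 2 * kn n a x)) \<longlonglongrightarrow> 2 * (ennreal (2 * c) * (0 + 0) + 2 * 0)"
    by (intro ennreal_tendsto_cmult tendsto_add lims a t) auto
   from tendsto_add[OF this Cons.IH] Cons.prems show ?case by simp
  qed simp
  have bnd: "sq (ioc (\<lambda>s. d n s x) t T) \<le>
    ennreal (T - t) * (\<Sum>a\<leftarrow>ts. 2 * (ennreal (2 * c) * (en n a x + en n a x) + 2 * kn n a x))" for n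
  proof -
   have "(\<integral>\<^sup>+s. sq (d n s x) \<partial>RS t) \<le> (\<integral>\<^sup>+s. h n s x \<partial>RS t)"
   proof (rule nn_integral_mono_AE)
    \<comment> \<open>The limit need not be bounded. Its jump energy at x is finite for almost every
      time only, which suffices under the integral.\<close>
    have "AE s in RS t. jump_energy v' s x < \<infinity> \<and> s \<in> {0..T}"
     using finite_energy_integrable(3)[OF fe t'] t by (auto simp: AE_restrict_space_iff)
    thus "AE s in RS t. sq (d n s x) \<le> h n s x"
    proof eventually_elim
     case (elim s)
     have "sq (d n s x) \<le> 2 * sq (rhs (v n) s x - rhs v' s x) + 2 * sq (\<kappa> n s x)"
      using square_diff_le[of "rhs (v n) s x - rhs v' s x" "- \<kappa> n s x"] by (simp add: d_def algebra_simps)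
     also have "\<dots> \<le> 2 * (ennreal c * (sq (v n s x - v' s x) + jump_energy (\<lambda>s y. v n s y - v' s y) s x)) +
       2 * sq (\<kappa> n s x)"
      unfolding c_def using elim t by (intro add_mono mult_left_mono rhs_diff vD(1,3) wm) auto
     also have "\<dots> = h n s x"
      using c0 by (simp add: h_def ennreal_mult mult.assoc)
     finally show ?case .
    qed
   qed
   also have "\<dots> \<le> (\<Sum>a\<leftarrow>ts. 2 * occ a x (h n))" by (rule cov[OF hm])
   also have "\<dots> \<le> (\<Sum>a\<leftarrow>ts. 2 * (ennreal (2 * c) * (en n a x + en n a x) + 2 * kn n a x))"
    using ts t by (intro sum_list_mono mult_left_mono occh) auto
   finally have le: "(\<integral>\<^sup>+s. sq (d n s x) \<partial>RS t) \<le>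
     (\<Sum>a\<leftarrow>ts. 2 * (ennreal (2 * c) * (en n a x + en n a x) + 2 * kn n a x))" .
   show ?thesis
    by (rule order_trans[OF square_set_integrable(2)[OF dmeas t']], subst mult.commute, rule mult_left_mono[OF le]) simp
  qed
  have "(\<lambda>n. ennreal (T - t) * (\<Sum>a\<leftarrow>ts. 2 * (ennreal (2 * c) * (en n a x + en n a x) + 2 * kn n a x))) \<longlonglongrightarrow> ennreal (T - t) * 0"
   by (intro ennreal_tendsto_cmult sum0) simp
  from tendsto_sandwich[OF _ _ tendsto_const this[unfolded mult_zero_right]]
  have "(\<lambda>n. sq (ioc (\<lambda>s. d n s x) t T)) \<longlonglongrightarrow> 0"
   by (simp only: bnd zero_le eventually_True)
  hence "(\<lambda>n. (ioc (\<lambda>s. d n s x) t T)\<^sup>2) \<longlonglongrightarrow> 0" by (simp add: ennreal_tendsto_0_iff)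
  hence "(\<lambda>n. ioc (\<lambda>s. d n s x) t T) \<longlonglongrightarrow> 0" by simp
  moreover have "ioc (\<lambda>s. d n s x) t T = v n t x - gn n x - ioc (\<lambda>s. rhs v' s x) t T" for n
  proof -
   have "set_integrable lborel {t<..T} (\<lambda>s. rhs v' s x)"
    unfolding rhs_def by (intro set_integral_add(1) finite_energy_integrable[OF fe t'])
   from set_integral_diff(2)[OF vD(4)[OF t] this, of n] show ?thesis using vD(5)[OF t, of n] by (simp add: d_def)
  qed
  ultimately have "(\<lambda>n. v n t x - gn n x - ioc (\<lambda>s. rhs v' s x) t T) \<longlonglongrightarrow> 0" by simp
  moreover have "(\<lambda>n. v n t x - gn n x - ioc (\<lambda>s. rhs v' s x) t T) \<longlonglongrightarrow>
    v' t x - g x - ioc (\<lambda>s. rhs v' s x) t T"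
   unfolding gn_def by (intro tendsto_intros v' t truncate_tendsto)
  ultimately have "0 = v' t x - g x - ioc (\<lambda>s. rhs v' s x) t T" by (rule LIMSEQ_unique)
  thus ?thesis by (simp add: rhs_def)
 qed
 thus ?thesis using fe by (auto simp: kolmogorov_solution_iff)
qed

end

theorem theorem4p4:
 fixes T :: real and K :: "'k measure" and \<nu> :: "real \<Rightarrow> 'k \<Rightarrow> 'k measure"
  and \<Omega> :: "'w set" and X :: "real \<Rightarrow> 'w \<Rightarrow> 'k" and P :: "real \<Rightarrow> 'k \<Rightarrow> 'w measure"
  and f :: "real \<Rightarrow> 'k \<Rightarrow> real \<Rightarrow> ('k \<Rightarrow> real) \<Rightarrow> real" and g :: "'k \<Rightarrow> real"
 assumes process: "markov_jump_process T K \<nu> \<Omega> X P"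
  and g_measurable: "g \<in> borel_measurable K"
  and g_square: "\<And>t x. t \<in> {0..T} \<Longrightarrow> x \<in> space K \<Longrightarrow>
   (\<integral>\<^sup>+ \<omega>. ennreal (\<bar>g (X T \<omega>)\<bar>\<^sup>2) \<partial>P t x) < \<infinity>"
  and f_measurable: "\<And>z C. z \<in> borel_measurable K \<Longrightarrow> (\<And>y. y \<in> space K \<Longrightarrow> \<bar>z y\<bar> \<le> C) \<Longrightarrow>
   (\<lambda>(s, x, r). f s x r z) \<in>
    borel_measurable (restrict_space borel {0..T} \<Otimes>\<^sub>M K \<Otimes>\<^sub>M (borel :: real measure))"
  and f_lipschitz: "\<exists>L L'. 0 \<le> L \<and> 0 \<le> L' \<and>
   (\<forall>s\<in>{0..T}. \<forall>x\<in>space K. \<forall>r r'. \<forall>z\<in>L2 (\<nu> s x). \<forall>z'\<in>L2 (\<nu> s x).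
    \<bar>f s x r z - f s x r' z'\<bar> \<le>
     L' * \<bar>r - r'\<bar> + L * sqrt (LINT y | \<nu> s x. \<bar>z y - z' y\<bar>\<^sup>2))"
  and f_square: "\<And>t x. t \<in> {0..T} \<Longrightarrow> x \<in> space K \<Longrightarrow>
   (\<integral>\<^sup>+ \<omega>. (\<integral>\<^sup>+ s \<in> {t<..T}. ennreal (\<bar>f s (X s \<omega>) 0 (\<lambda>_. 0)\<bar>\<^sup>2) \<partial>lborel) \<partial>P t x) < \<infinity>"
 shows "\<exists>v. kolmogorov_solution T K \<nu> X P f g v \<and>
  (\<forall>v'. kolmogorov_solution T K \<nu> X P f g v' \<longrightarrow> (\<forall>t\<in>{0..T}. \<forall>x\<in>space K. v' t x = v t x)) \<and>
  (\<forall>t\<in>{0..T}. \<forall>x\<in>space K.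
   (\<exists>Y Z. bsde_solution T K \<nu> \<Omega> X P f g t x Y Z \<and>
    (\<forall>Y' Z'. bsde_solution T K \<nu> \<Omega> X P f g t x Y' Z' \<longrightarrow>
     M_norm_sq T \<nu> X P t x (\<lambda>s \<omega>. Y' s \<omega> - Y s \<omega>) (\<lambda>s \<omega> y. Z' s \<omega> y - Z s \<omega> y) = 0)) \<and>
   (\<forall>Y Z. bsde_solution T K \<nu> \<Omega> X P f g t x Y Z \<longrightarrow>
    (AE \<omega> in P t x. \<forall>s\<in>{t..T}. Y s \<omega> = v s (X s \<omega>)) \<and>
    (\<integral>\<^sup>+ \<omega>. (\<integral>\<^sup>+ s \<in> {t<..T}.
     (\<integral>\<^sup>+ y. ennreal (\<bar>Z s \<omega> y - v s y + v s (left_value X s \<omega>)\<bar>\<^sup>2)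
      \<partial>\<nu> s (left_value X s \<omega>)) \<partial>lborel) \<partial>P t x) = 0 \<and>
    (AE \<omega> in P t x. Y t \<omega> = v t x)))"
proof -
 obtain L L' where L: "0 \<le> L" "0 \<le> L'" and lip: "\<forall>s\<in>{0..T}. \<forall>x\<in>space K. \<forall>r r'. \<forall>z\<in>L2 (\<nu> s x). \<forall>z'\<in>L2 (\<nu> s x).
    \<bar>f s x r z - f s x r' z'\<bar> \<le> L' * \<bar>r - r'\<bar> + L * sqrt (LINT y | \<nu> s x. \<bar>z y - z' y\<bar>\<^sup>2)"
  using f_lipschitz by blast
 interpret markov_jump_process T K \<nu> \<Omega> X P by (rule process)
 interpret square_integrable_driver T K \<nu> \<Omega> X P f L L'
 proof
  show "(\<lambda>(s, x, r). f s x r z) \<in> borel_measurable (restrict_space borel {0..T} \<Otimes>\<^sub>M K \<Otimes>\<^sub>M (borel :: real measure))"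
   if "z \<in> borel_measurable K" "\<And>y. y \<in> space K \<Longrightarrow> \<bar>z y\<bar> \<le> C" for z C
   by (rule f_measurable[OF that])
  show "\<bar>f s x r z - f s x r' z'\<bar> \<le> L' * \<bar>r - r'\<bar> + L * sqrt (LINT y | \<nu> s x. \<bar>z y - z' y\<bar>\<^sup>2)"
   if "s \<in> {0..T}" "x \<in> space K" "z \<in> L2 (\<nu> s x)" "z' \<in> L2 (\<nu> s x)" for s x r r' z z'
   using lip that by blast
 qed (fact L f_square)+
 obtain v where v: "kolmogorov_solution T K \<nu> X P f g v"
  using existence[OF g_measurable] g_square by auto
 show ?thesis
 proof (intro exI[of _ v] conjI v allI impI ballI)
  fix v' t x assume v': "kolmogorov_solution T K \<nu> X P f g v'" and t: "t \<in> {0..T}" "x \<in> space K"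
  show "v' t x = v t x" by (rule kolmogorov_unique[OF v v']) (use t in auto)
 next
  fix t x assume t: "t \<in> {0..T}" "x \<in> space K"
  then have t': "0 \<le> t" "t \<le> T" "x \<in> space K" by auto
  show "\<exists>Y Z. bsde_solution T K \<nu> \<Omega> X P f g t x Y Z \<and>
    (\<forall>Y' Z'. bsde_solution T K \<nu> \<Omega> X P f g t x Y' Z' \<longrightarrow>
     M_norm_sq T \<nu> X P t x (\<lambda>s \<omega>. Y' s \<omega> - Y s \<omega>) (\<lambda>s \<omega> y. Z' s \<omega> y - Z s \<omega> y) = 0)"
   \<comment> \<open>Solvability of the BSDE is obtained from v itself; uniqueness of the pair in
     norm is independent of v.\<close>
   using kolmogorov_bsde[OF v t'] bsde_unique(1)[OF t' f_square[OF t]] by blast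
  fix Y Z assume "bsde_solution T K \<nu> \<Omega> X P f g t x Y Z"
  note rep = kolmogorov_representation[OF v t' this]
  show "AE \<omega> in P t x. \<forall>s\<in>{t..T}. Y s \<omega> = v s (X s \<omega>)" "AE \<omega> in P t x. Y t \<omega> = v t x"
   "(\<integral>\<^sup>+ \<omega>. (\<integral>\<^sup>+ s \<in> {t<..T}. (\<integral>\<^sup>+ y. ennreal (\<bar>Z s \<omega> y - v s y + v s (left_value X s \<omega>)\<bar>\<^sup>2)
      \<partial>\<nu> s (left_value X s \<omega>)) \<partial>lborel) \<partial>P t x) = 0"
   by (rule rep)+
 qed
qed

end
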